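(* Let $N\ge1$, $s\in(0,1)$, $\beta>-1$. Let $f:(0,\infty)\times\mathbb{R}^N\times\mathbb{R}\to\mathbb{R}$ be a Carathéodory function with $f(t,x,r)r\ge0$ for all $(t,x,r)$, with $f(t,x,0)=0$ and $$0\le f(t,x,r)\le t^\beta g(r)\qquad\text{for all }(t,x,r)\in(0,\infty)\times\mathbb{R}^N\times[0,\infty),$$ where $g$ is continuous and nondecreasing. Assume that $$\int_1^\infty g(\sigma)\sigma^{-1-p_\beta^*}d\sigma<+\infty,\quad p_\beta^*=1+\frac{2s(1+\beta)}{N},\qquad\text{if }-1<\beta\le0,$$ $$\int_1^\infty g(\sigma)\sigma^{-2-\frac{2s}{N}}d\sigma<+\infty\qquad\text{if }\beta>0.$$ Let $u$ be a nonnegative classical solution of $\partial_tu+(-\Delta)^su+f(t,x,u)=0$ in $Q_\infty=(0,\infty)\times\mathbb{R}^N$ with initial trace $(\mathcal S_u,\nu_u)$. If $\mathcal S_u\ne\emptyset$ and $z\in\mathcal S_u$, then $$\lim_{t\to0}\int_{B_\rho(z)}u(t,x)\,dx=+\infty\quad\text{for any }\rho>0.$$ More precisely, $u\ge u_{z,\infty}$, where $u_{z,\infty}=\lim_{k\to\infty}u_{k\delta_z}$ and $u_{k\delta_z}$ is the (weak) solution of $$\partial_tv+(-\Delta)^sv+t^\beta g(v)=0\ \text{ in }Q_\infty,\qquad v(0,\cdot)=k\delta_z .$$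
   Context: The fractional Laplacian is $(-\Delta)^s\phi=\lim_{\varepsilon\to0^+}(-\Delta)^s_\varepsilon\phi$, where $(-\Delta)^s_\varepsilon\phi(x)=a_{N,s}\int_{|y-x|>\varepsilon}\frac{\phi(x)-\phi(y)}{|y-x|^{N+2s}}dy$ and $a_{N,s}=\frac{\Gamma(\frac N2+s)}{\pi^{N/2}\Gamma(2-s)}s(1-s)$. $\mathcal L^s(\mathbb{R}^N)$ is the space of $\phi\in L^1_{loc}(\mathbb{R}^N)$ with $\int_{\mathbb{R}^N}\frac{|\phi(x)|}{1+|x|^{N+2s}}dx<+\infty$. Solutions $u$ of the equation with $f$ are classical, and it is always assumed that $u(t,\cdot)\in\mathcal L^s(\mathbb{R}^N)$ for every $t>0$. $B_\rho(z)$ is the open ball of center $z$ and radius $\rho$; $Q_T=(0,T)\times\mathbb{R}^N$; $\delta_z$ is the Dirac mass at $z$. The singular set of $u$ is $\mathcal S_u=\{z\in\mathbb{R}^N:\limsup_{t\to0}\int_{B_\rho(z)}u(t,x)dx=+\infty\ \text{for any }\rho>0\}$. The measure $\nu_u$ is the nonnegative Radon measure on the regular set $\mathcal R_u=\{z\in\mathbb{R}^N:\exists\rho>0,\ \int_0^1\int_{B_\rho(z)}f(t,x,u)dxdt<\infty\}$ such that $\lim_{t\to0}\int_{\mathcal R_u} u(t,x)\zeta(x)dx=\int_{\mathcal R_u}\zeta\, d\nu_u$ for all $C^2$ functions $\zeta$ with compact support in $\mathcal R_u$ (such a measure always exists). The initial trace of $u$ is the couple $(\mathcal S_u,\nu_u)$.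 For a bounded nonnegative Radon measure $\mu$, a weak solution of $\partial_tv+(-\Delta)^sv+t^\beta g(v)=0$ in $Q_\infty$, $v(0,\cdot)=\mu$, is a (here nonnegative) function $v$ such that for all $T>0$, $v\in L^1(Q_T)$, $t^\beta g(v)\in L^1(Q_T)$ and $$\int_0^T\!\!\int_{\mathbb{R}^N}\big[(-\partial_t\xi+(-\Delta)^s\xi)v+t^\beta g(v)\xi\big]dxdt=\int_{\mathbb{R}^N}\xi(0,x)d\mu(x)\quad\forall\xi\in\mathbb Y_{s,T},$$ where $\mathbb Y_{s,T}$ is the space of functions $\xi$ on $Q_\infty$ with $\|\xi\|_{L^1(Q_T)}+\|\xi\|_{L^\infty(Q_T)}+\|\partial_t\xi\|_{L^\infty(Q_T)}+\|(-\Delta)^s\xi\|_{L^\infty(Q_T)}<\infty$, $\xi(T,\cdot)=0$, and such that for $0<t<T$ there exist $M>0$, $\varepsilon_0>0$ with $\|(-\Delta)^s_\varepsilon\xi(t,\cdot)\|_{L^\infty(\mathbb{R}^N)}\le M$ for $0<\varepsilon\le\varepsilon_0$. The existence and uniqueness of $u_{k\delta_z}$ are taken from a known theorem of Chen, Véron and Wang on this initial value problem with bounded measure data. *)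

theory Defs
  imports "HOL-Probability.Probability"
begin

text \<open>The space \<open>\<real>\<^sup>N\<close> is an arbitrary Euclidean space \<open>'a\<close> with \<open>N = DIM('a)\<close>. Functions
  on the half space \<open>(0,\<infinity>) \<times> \<real>\<^sup>N\<close> are curried; their values at times \<open>t \<le> 0\<close> play no role.\<close>

definition cylinder :: "real \<Rightarrow> (real \<times> 'a::euclidean_space) set" where
  "cylinder T = {0<..<T} \<times> UNIV"

definition half_space :: "(real \<times> 'a::euclidean_space) set" where
  "half_space = {0<..} \<times> UNIV"

definition frac_lap_const :: "'a::euclidean_space itself \<Rightarrow> real \<Rightarrow> real" where
  "frac_lap_const _ s =
     Gamma (real DIM('a) / 2 + s) / (pi powr (real DIM('a) / 2) * Gamma (2 - s)) * s * (1 - s)"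

definition frac_lap_trunc :: "real \<Rightarrow> real \<Rightarrow> ('a::euclidean_space \<Rightarrow> real) \<Rightarrow> 'a \<Rightarrow> real" where
  "frac_lap_trunc s \<epsilon> \<phi> x =
     frac_lap_const TYPE('a) s *
       (LINT y:{y. norm (y - x) > \<epsilon>}|lebesgue. (\<phi> x - \<phi> y) / norm (y - x) powr (real DIM('a) + 2 * s))"

definition has_frac_lap :: "real \<Rightarrow> ('a::euclidean_space \<Rightarrow> real) \<Rightarrow> 'a \<Rightarrow> real \<Rightarrow> bool" where
  "has_frac_lap s \<phi> x L \<longleftrightarrow> ((\<lambda>\<epsilon>. frac_lap_trunc s \<epsilon> \<phi> x) \<longlongrightarrow> L) (at_right 0)"

definition frac_lap :: "real \<Rightarrow> ('a::euclidean_space \<Rightarrow> real) \<Rightarrow> 'a \<Rightarrow> real" where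
  "frac_lap s \<phi> x = Lim (at_right 0) (\<lambda>\<epsilon>. frac_lap_trunc s \<epsilon> \<phi> x)"

definition Ls_space :: "real \<Rightarrow> ('a::euclidean_space \<Rightarrow> real) set" where
  "Ls_space s =
     {\<phi>. (\<forall>K. compact K \<longrightarrow> \<phi> absolutely_integrable_on K) \<and>
         integrable lebesgue (\<lambda>x. \<bar>\<phi> x\<bar> / (1 + norm x powr (real DIM('a) + 2 * s)))}"

definition caratheodory :: "(real \<Rightarrow> 'a::euclidean_space \<Rightarrow> real \<Rightarrow> real) \<Rightarrow> bool" where
  "caratheodory f \<longleftrightarrow>
     (\<forall>r. (\<lambda>(t, x). f t x r) \<in> borel_measurable (lebesgue_on half_space)) \<and>
     (AE (t, x) in lebesgue_on half_space. continuous_on UNIV (f t x))"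

text \<open>Classical solutions of \<open>\<partial>\<^sub>t u + (-\<Delta>)\<^sup>s u + f(t,x,u) = 0\<close>. Since \<open>f\<close> need not be continuous in
  \<open>(t,x)\<close>, the derivatives are required to exist at every point but not to be continuous.\<close>

definition classical_solution ::
    "real \<Rightarrow> (real \<Rightarrow> 'a::euclidean_space \<Rightarrow> real \<Rightarrow> real) \<Rightarrow> (real \<Rightarrow> 'a \<Rightarrow> real) \<Rightarrow> bool" where
  "classical_solution s f u \<longleftrightarrow>
     continuous_on half_space (\<lambda>(t, x). u t x) \<and>
     (\<forall>t>0. u t \<in> Ls_space s) \<and>
     (\<forall>t>0. \<forall>x. \<exists>D L.
        ((\<lambda>\<tau>. u \<tau> x) has_real_derivative D) (at t) \<and>
        has_frac_lap s (u t) x L \<and>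
        D + L + f t x (u t x) = 0)"

definition singular_set :: "(real \<Rightarrow> 'a::euclidean_space \<Rightarrow> real) \<Rightarrow> 'a set" where
  "singular_set u =
     {z. \<forall>\<rho>>0. Limsup (at_right 0) (\<lambda>t. ereal (LINT x:ball z \<rho>|lebesgue. u t x)) = \<infinity>}"

text \<open>Only used when \<open>f(t,x,u(t,x)) \<ge> 0\<close>, so that passing to \<open>ennreal\<close> loses nothing.\<close>

definition regular_set ::
    "(real \<Rightarrow> 'a::euclidean_space \<Rightarrow> real \<Rightarrow> real) \<Rightarrow> (real \<Rightarrow> 'a \<Rightarrow> real) \<Rightarrow> 'a set" where
  "regular_set f u =
     {z. \<exists>\<rho>>0. (\<integral>\<^sup>+(t, x)\<in>{0<..<1} \<times> ball z \<rho>. ennreal (f t x (u t x)) \<partial>lebesgue) < \<infinity>}"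

text \<open>On an open subset of a Euclidean space, a Borel measure that is finite on compact sets is
  automatically regular, hence Radon.\<close>

definition radon_measure_on :: "'a::euclidean_space set \<Rightarrow> 'a measure \<Rightarrow> bool" where
  "radon_measure_on U \<nu> \<longleftrightarrow>
     sets \<nu> = sets (restrict_space borel U) \<and>
     (\<forall>K. compact K \<and> K \<subseteq> U \<longrightarrow> emeasure \<nu> K < \<infinity>)"

definition C2_function :: "('a::euclidean_space \<Rightarrow> real) \<Rightarrow> bool" where
  "C2_function \<zeta> \<longleftrightarrow>
     (\<exists>(D :: 'a \<Rightarrow> 'a \<Rightarrow>\<^sub>L real) (H :: 'a \<Rightarrow> 'a \<Rightarrow>\<^sub>L ('a \<Rightarrow>\<^sub>L real)).
        (\<forall>x. (\<zeta> has_derivative blinfun_apply (D x)) (at x)) \<and>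
        (\<forall>x. (D has_derivative blinfun_apply (H x)) (at x)) \<and>
        continuous_on UNIV H)"

definition initial_trace ::
    "(real \<Rightarrow> 'a::euclidean_space \<Rightarrow> real \<Rightarrow> real) \<Rightarrow> (real \<Rightarrow> 'a \<Rightarrow> real) \<Rightarrow>
     'a set \<Rightarrow> 'a measure \<Rightarrow> bool" where
  "initial_trace f u S \<nu> \<longleftrightarrow>
     S = singular_set u \<and>
     radon_measure_on (regular_set f u) \<nu> \<and>
     (\<forall>\<zeta>. C2_function \<zeta> \<and> compact (closure {x. \<zeta> x \<noteq> 0}) \<and>
           closure {x. \<zeta> x \<noteq> 0} \<subseteq> regular_set f u \<longrightarrow>
        ((\<lambda>t. LINT x:regular_set f u|lebesgue. u t x * \<zeta> x) \<longlongrightarrow> (\<integral>x. \<zeta> x \<partial>\<nu>)) (at_right 0))"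

definition ess_bounded_on :: "'b::euclidean_space set \<Rightarrow> ('b \<Rightarrow> real) \<Rightarrow> bool" where
  "ess_bounded_on A h \<longleftrightarrow> (\<exists>C. AE p in lebesgue_on A. \<bar>h p\<bar> \<le> C)"

text \<open>The test functions. The values \<open>\<xi>(0,x)\<close> are integrated against a measure that may charge
  points, so they must be determined by \<open>\<xi>\<close> on the open cylinder: the bounds on \<open>\<partial>\<^sub>t \<xi>\<close> and on the
  truncated fractional Laplacians give a representative that is continuous up to \<open>t = 0\<close>, and
  \<open>\<xi>\<close> is taken to be that representative.\<close>

definition test_space :: "real \<Rightarrow> real \<Rightarrow> (real \<Rightarrow> 'a::euclidean_space \<Rightarrow> real) set" where
  "test_space s T =
     {\<xi>. continuous_on ({0..T} \<times> UNIV) (\<lambda>(t, x). \<xi> t x) \<and>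
         (\<forall>t\<in>{0<..<T}. \<forall>x. (\<lambda>\<tau>. \<xi> \<tau> x) differentiable (at t)) \<and>
         (\<forall>t\<in>{0<..<T}. \<forall>x. \<exists>L. has_frac_lap s (\<xi> t) x L) \<and>
         set_integrable lebesgue (cylinder T) (\<lambda>(t, x). \<xi> t x) \<and>
         ess_bounded_on (cylinder T) (\<lambda>(t, x). \<xi> t x) \<and>
         ess_bounded_on (cylinder T) (\<lambda>(t, x). deriv (\<lambda>\<tau>. \<xi> \<tau> x) t) \<and>
         ess_bounded_on (cylinder T) (\<lambda>(t, x). frac_lap s (\<xi> t) x) \<and>
         (\<forall>x. \<xi> T x = 0) \<and>
         (\<forall>t\<in>{0<..<T}. \<exists>M>0. \<exists>\<epsilon>\<^sub>0>0. \<forall>\<epsilon>\<in>{0<..\<epsilon>\<^sub>0}.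
            AE x in lebesgue. \<bar>frac_lap_trunc s \<epsilon> (\<xi> t) x\<bar> \<le> M)}"

text \<open>Nonnegative weak solutions of \<open>\<partial>\<^sub>t v + (-\<Delta>)\<^sup>s v + t\<^sup>\<beta> g(v) = 0\<close>, \<open>v(0,\<cdot>) = \<mu>\<close>, for a finite Borel
  measure \<open>\<mu>\<close>. They are determined only up to null sets.\<close>

definition weak_solution ::
    "real \<Rightarrow> real \<Rightarrow> (real \<Rightarrow> real) \<Rightarrow> 'a::euclidean_space measure \<Rightarrow> (real \<Rightarrow> 'a \<Rightarrow> real) \<Rightarrow> bool" where
  "weak_solution s \<beta> g \<mu> v \<longleftrightarrow>
     (AE (t, x) in lebesgue_on half_space. 0 \<le> v t x) \<and>
     (\<forall>T>0.
        set_integrable lebesgue (cylinder T) (\<lambda>(t, x). v t x) \<and>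
        set_integrable lebesgue (cylinder T) (\<lambda>(t, x). t powr \<beta> * g (v t x)) \<and>
        (\<forall>\<xi>\<in>test_space s T.
           (LINT p:cylinder T|lebesgue.
              (case p of (t, x) \<Rightarrow>
                 (- deriv (\<lambda>\<tau>. \<xi> \<tau> x) t + frac_lap s (\<xi> t) x) * v t x
                 + t powr \<beta> * g (v t x) * \<xi> t x))
           = (\<integral>x. \<xi> 0 x \<partial>\<mu>)))"

end

theory Submission
  imports Defs
begin

text \<open>Replace \<open>(-\<Delta>)\<^sup>s\<close> by the bounded operators \<open>(-\<Delta>)\<^sup>s\<^sub>\<epsilon>\<close>, which generate jump processes with finite rate: their semilinear
  equations are solved by a fixed point, and all estimates follow from the maximum principle, uniformly in \<open>\<epsilon>\<close>.
  At a time \<open>t\<^sub>0\<close> at which \<open>u\<close> has mass more than \<open>k\<close> in a small ball around the singular point \<open>z\<close>, a piece of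
  \<open>u(t\<^sub>0)\<close> of mass \<open>k\<close> is the initial value of a solution \<open>w\<close> of such an equation, and \<open>w\<close> stays below \<open>u\<close> up to a small error.
  Mass conservation and the bound \<open>w \<le> C k t\<^bsup>-N/2s\<^esup>\<close> make the absorbed mass small for small \<open>t\<close>, uniformly in \<open>t\<^sub>0\<close>, by
  subcriticality of \<open>g\<close>; so \<open>u\<close> keeps a mass close to \<open>k\<close> near \<open>z\<close>, which is the first assertion. For the second one, \<open>w\<close> is compared with the
  weak solution \<open>v\<close> by duality: the solution \<open>\<xi>\<close> of the linearised backward problem is a test function for both
  equations, and its equicontinuity near \<open>t = 0\<close> turns \<open>w(t\<^sub>0) \<approx> k \<delta>\<^sub>z\<close> into \<open>v \<le> w\<close> up to small errors, hence \<open>v \<le> u\<close>.\<close>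

text \<open>Neither of the functions to be compared is regular. About \<open>u\<close> nothing is
  known beyond pointwise derivatives and membership in \<open>Ls_space\<close>, so it can only be
  touched from below by a function whose fractional Laplacian converges absolutely. This is why
  \<open>w\<close> must have bounded second differences, why \<open>g\<close> is replaced by a
  smooth \<open>G\<close> with \<open>g (r - th) <= G r <= g r\<close>, and why the bounds on
  \<open>w\<close> must not depend on the truncation: its length is chosen after them, so as to
  leave an error of at most \<open>th\<close>. The weak solution \<open>v\<close> is merely
  integrable and is compared with \<open>w\<close> through integrals only. The coefficient of the
  dual problem has no uniform bound, so regularity of \<open>xi\<close> that depends on it is
  useless at \<open>t = 0\<close>, where the datum of \<open>w\<close> is almost a point mass. The
  way out is a coefficient that vanishes for \<open>t <= tau\<close>: there \<open>xi\<close> solves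
  the free equation, whose Hoelder modulus depends on the sup norm alone. The price is the mass that
  \<open>w\<close> absorbs before \<open>tau\<close>, which is small. Thus \<open>t0\<close> can be
  fixed before the coefficient is.\<close>

abbreviation nn_lborel :: "('a::euclidean_space => ennreal) => ennreal" (binder "NN " 10) where
 "nn_lborel f == integral\<^sup>N lborel f"

abbreviation borel_funs :: "('a::topological_space => 'b::topological_space) set" where
 "borel_funs == borel_measurable borel"

abbreviation Leb1 :: "('a::euclidean_space => real) => bool" where
 "Leb1 f == integrable lborel f"

subsection \<open>The maximum principle and bounded second differences\<close>

text \<open>After the last time before \<open>t\<close> with \<open>q <= 0\<close> the function
  would be positive, hence nonincreasing, which is a contradiction. The derivative has to be
  controlled only where \<open>q\<close> is positive; this is what lets absorption terms be dropped
  in the comparison arguments.\<close>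

lemma nonpos_of_deriv_nonpos:
 fixes q :: "real => real"
 assumes cont: "continuous_on {0..T} q" and init: "q 0 <= 0"
  and der: "!!t. 0 < t ==> t < T ==> 0 < q t ==> \<exists>D. (q has_real_derivative D) (at t) & D <= 0"
  and t: "0 <= t" "t <= T"
 shows "q t <= 0"
proof (rule ccontr)
 assume "~ q t <= 0"
 then have qt: "0 < q t" by simp
 define Z where "Z = {r\<in>{0..t}. q r <= 0}"
 have "closed Z"
  unfolding Z_def
  by (intro continuous_on_closed_Collect_le)
   (use t in "auto intro!: continuous_intros continuous_on_subset[OF cont]")
 then have cz: "compact Z"
  by (auto simp: compact_eq_bounded_closed Z_def intro!: bounded_subset[OF bounded_closed_interval[of 0 t]])
 have "0 : Z" using init t by (auto simp: Z_def)
 then obtain r where r: "r : Z" "!!r'. r' : Z ==> r' <= r"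
  using compact_attains_sup[OF cz] by blast
 have rt: "r < t" using r(1) qt by (cases "r = t") (auto simp: Z_def)
 have "q t <= q r"
 proof (rule DERIV_nonpos_imp_decreasing_open[of r t q])
  show "r <= t" using rt by simp
  show "\<exists>y. DERIV q x :> y & y <= 0" if "r < x" "x < t" for x
  proof -
   have "0 <= r" using r(1) by (simp add: Z_def)
   moreover have "x \<notin> Z" using r(2)[of x] that by auto
   ultimately show ?thesis using der[of x] that t by (auto simp: Z_def not_le)
  qed
  show "continuous_on {r..t} q"
   using r(1) t by (auto intro!: continuous_on_subset[OF cont] simp: Z_def)
 qed
 then show False using r(1) qt by (simp add: Z_def)
qed

text \<open>No maximum need be attained, since \<open>p\<close> runs over a set without structure.
  Let \<open>M\<close> be the supremum over all times and all \<open>p\<close>: integrating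
  \<open>psi' <= lam (M - psi)\<close> gives \<open>psi <= M (1 - exp (- lam T))\<close>, and taking
  the supremum again forces \<open>M <= 0\<close>. The set of all \<open>p\<close> is later also a
  set of pairs, for the doubling of variables.\<close>

lemma jump_maximum_principle:
 fixes psi :: "real => 'p => real"
 assumes T: "0 <= T" and lam: "0 <= lam"
  and cont: "!!p. continuous_on {0..T} (%t. psi t p)"
  and init: "!!p. psi 0 p <= 0"
  and bdd: "!!t p. 0 <= t ==> t <= T ==> psi t p <= M0"
  and der: "!!t p M. 0 < t ==> t < T ==> 0 < psi t p ==> 0 <= M ==> (!!q. psi t q <= M) ==>
    \<exists>D. ((%tau. psi tau p) has_real_derivative D) (at t) & D <= lam * (M - psi t p)"
  and t: "0 <= t" "t <= T"
 shows "psi t p <= 0"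
proof -
 \<comment> \<open>Inserting 0 makes the supremum nonnegative, as \<open>der\<close> requires of its
   bounds \<open>M\<close>.\<close>
 define A where "A = insert 0 ((%(t, p). psi t p) ` ({0..T} \<times> UNIV))"
 have bA: "bdd_above A"
  unfolding A_def bdd_above_def using bdd by (intro exI[of _ "max 0 M0"]) (fastforce simp: max_def)
 define M where "M = Sup A"
 have M0: "0 <= M" unfolding M_def by (rule cSup_upper[OF _ bA]) (simp add: A_def)
 have M: "psi t p <= M" if "0 <= t" "t <= T" for t p
  unfolding M_def by (rule cSup_upper[OF _ bA]) (use that in "auto simp: A_def")
 have key: "psi t p <= M * (1 - exp (- lam * T))" if t: "0 <= t" "t <= T" for t p
 proof -
  \<comment> \<open>With the integrating factor the differential inequality becomes monotonicity
    wherever \<open>?q\<close> is positive; there \<open>psi\<close> is positive too, so that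
    \<open>der\<close> applies.\<close>
  let ?q = "%t. exp (lam * t) * psi t p - M * (exp (lam * t) - 1)"
  have "?q t <= 0"
  proof (rule nonpos_of_deriv_nonpos[where T = T and q = ?q])
   show "continuous_on {0..T} ?q" by (intro continuous_intros cont)
   show "?q 0 <= 0" using init by simp
  next
   fix r assume r: "0 < r" "r < T" "0 < ?q r"
   have "0 <= M * (exp (lam * r) - 1)" using M0 lam r by auto
   then have "0 < exp (lam * r) * psi r p" using r by linarith
   then have pos: "0 < psi r p" by (simp add: zero_less_mult_iff)
   obtain D where D: "((%tau. psi tau p) has_real_derivative D) (at r)" "D <= lam * (M - psi r p)"
    using der[OF r(1,2) pos M0] M r by (meson less_imp_le)
   have d: "(?q has_real_derivative (lam * exp (lam * r) * psi r p + D * exp (lam * r) - M * (lam * exp (lam * r)))) (at r)"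
    by (auto intro!: derivative_eq_intros D)
   have eq: "lam * exp (lam * r) * psi r p + D * exp (lam * r) - M * (lam * exp (lam * r))
     = exp (lam * r) * (D - lam * (M - psi r p))" by (simp add: algebra_simps)
   have "exp (lam * r) * (D - lam * (M - psi r p)) <= 0" using D(2) by (simp add: mult_le_0_iff)
   with d show "\<exists>D. (?q has_real_derivative D) (at r) & D <= 0" unfolding eq by blast
  qed (use t in auto)
  then have "exp (lam * t) * psi t p <= exp (lam * t) * (M * (1 - exp (- lam * t)))"
   by (simp add: algebra_simps exp_minus)
  then have "psi t p <= M * (1 - exp (- lam * t))" by simp
  also have "... <= M * (1 - exp (- lam * T))"
   using M0 lam t by (intro mult_left_mono) (auto intro: mult_left_mono)
  finally show ?thesis .
 qed
 have "Sup A <= M * (1 - exp (- lam * T))"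
 proof (rule cSup_least)
  show "A \<noteq> {}" by (simp add: A_def)
  show "x <= M * (1 - exp (- lam * T))" if "x : A" for x
   using that key M0 lam T by (auto simp: A_def)
 qed
 then have "M * exp (- lam * T) <= 0" by (simp add: algebra_simps M_def[symmetric])
 then have "M <= 0" by (simp add: mult_le_0_iff not_le)
 then show ?thesis using M[OF t, of p] by linarith
qed

text \<open>Bounded second differences replace \<open>C\<^sup>2\<close> regularity: the class is stable under uniform
  approximation, and all the estimates below are second difference estimates.\<close>

definition c11_bound :: "real => real => real => ('b::euclidean_space => real) => bool" where
 "c11_bound M B D phi \<longleftrightarrow> (\<forall>x. \<bar>phi x\<bar> <= M) & (\<forall>x h. \<bar>phi (x + h) - phi x\<bar> <= B * norm h) \<and>
  (\<forall>x h. \<bar>phi (x + h) + phi (x - h) - 2 * phi x\<bar> <= D * (norm h)^2)"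

definition c11 :: "('b::euclidean_space => real) => bool" where
 "c11 phi \<longleftrightarrow> (\<exists>M B D. c11_bound M B D phi)"

lemma c11_boundD:
 assumes "c11_bound M B D phi"
 shows "\<bar>phi x\<bar> <= M" "\<bar>phi (x + h) - phi x\<bar> <= B * norm h"
  "\<bar>phi (x + h) + phi (x - h) - 2 * phi x\<bar> <= D * (norm h)^2"
 using assms unfolding c11_bound_def by blast+

lemma c11_bound_lipschitz: "c11_bound M B D phi ==> \<bar>phi x - phi y\<bar> <= B * norm (x - y)"
 using c11_boundD(2)[of M B D phi y "x - y"] by simp

lemma c11_bound_nonneg:
 assumes "c11_bound M B D (phi :: 'b::euclidean_space => real)"
 shows "0 <= M" "0 <= B" "0 <= D"
proof -
 obtain b :: 'b where "b : Basis" using nonempty_Basis by blast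
 then have b: "norm b = 1" by simp
 show "0 <= M" using c11_boundD(1)[OF assms] abs_ge_zero order_trans by blast
 show "0 <= B" using order_trans[OF abs_ge_zero c11_boundD(2)[OF assms, of 0 b]] b by simp
 show "0 <= D" using order_trans[OF abs_ge_zero c11_boundD(3)[OF assms, of 0 b]] b by simp
qed

lemma c11_continuous: "c11 phi ==> continuous_on UNIV phi"
proof -
 assume "c11 phi"
 then obtain M B D where b: "c11_bound M B D phi" by (auto simp: c11_def)
 have "B-lipschitz_on UNIV phi"
  using c11_bound_lipschitz[OF b] c11_bound_nonneg[OF b]
  by (auto simp: lipschitz_on_def dist_norm)
 then show ?thesis by (rule lipschitz_on_continuous_on)
qed

lemma c11_borel: "c11 phi ==> phi : borel_funs"
 using c11_continuous borel_measurable_continuous_onI by blast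

lemma c11_const: "c11 (%_. a)"
 unfolding c11_def c11_bound_def by (intro exI[of _ "\<bar>a\<bar>"] exI[of _ 0]) auto

lemma c11_add: assumes "c11 phi" "c11 psi" shows "c11 (%x. phi x + psi x)"
proof -
 obtain M B D M' B' D' where b: "c11_bound M B D phi" "c11_bound M' B' D' psi"
  using assms by (auto simp: c11_def)
 have "c11_bound (M + M') (B + B') (D + D') (%x. phi x + psi x)"
  unfolding c11_bound_def
 proof (intro conjI allI)
  fix x h
  note b1 = c11_boundD[OF b(1), of x] and b2 = c11_boundD[OF b(2), of x]
  show "\<bar>phi x + psi x\<bar> <= M + M'" using b1(1) b2(1) by linarith
  show "\<bar>phi (x + h) + psi (x + h) - (phi x + psi x)\<bar> <= (B + B') * norm h"
   using b1(2)[of h] b2(2)[of h] unfolding distrib_right by linarith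
  show "\<bar>phi (x + h) + psi (x + h) + (phi (x - h) + psi (x - h)) - 2 * (phi x + psi x)\<bar> <= (D + D') * (norm h)^2"
   using order_trans[OF abs_triangle_ineq add_mono[OF b1(3)[of h] b2(3)[of h]]]
   by (simp add: algebra_simps)
 qed
 then show ?thesis by (auto simp: c11_def)
qed

lemma c11_cmult: assumes "c11 phi" shows "c11 (%x. a * phi x)"
proof -
 obtain M B D where b: "c11_bound M B D phi" using assms by (auto simp: c11_def)
 have "c11_bound (\<bar>a\<bar> * M) (\<bar>a\<bar> * B) (\<bar>a\<bar> * D) (%x. a * phi x)"
  unfolding c11_bound_def
 proof (intro conjI allI)
  fix x h
  note b1 = c11_boundD[OF b, of x]
  show "\<bar>a * phi x\<bar> <= \<bar>a\<bar> * M" using b1(1) by (simp add: abs_mult mult_left_mono)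
  have "\<bar>a * phi (x + h) - a * phi x\<bar> = \<bar>a\<bar> * \<bar>phi (x + h) - phi x\<bar>"
   by (simp add: abs_mult[symmetric] algebra_simps)
  then show "\<bar>a * phi (x + h) - a * phi x\<bar> <= \<bar>a\<bar> * B * norm h"
   using mult_left_mono[OF b1(2)[of h], of "\<bar>a\<bar>"] by (simp add: mult.assoc)
  have "\<bar>a * phi (x + h) + a * phi (x - h) - 2 * (a * phi x)\<bar> = \<bar>a\<bar> * \<bar>phi (x + h) + phi (x - h) - 2 * phi x\<bar>"
   by (simp add: abs_mult[symmetric] algebra_simps)
  then show "\<bar>a * phi (x + h) + a * phi (x - h) - 2 * (a * phi x)\<bar> <= \<bar>a\<bar> * D * (norm h)^2"
   using mult_left_mono[OF b1(3)[of h], of "\<bar>a\<bar>"] by (simp add: mult.assoc)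
 qed
 then show ?thesis by (auto simp: c11_def)
qed

lemma c11_sum: "finite I ==> (!!i. i : I ==> c11 (phi i)) ==> c11 (%x. \<Sum>i\<in>I. phi i x)"
 by (induction I rule: finite_induct) (auto intro: c11_add c11_const)

text \<open>The values at \<open>a\<close> and \<open>b\<close> are compared with the value at their
  midpoint, and that one with the value at \<open>c\<close> by the Lipschitz bound. The set
  \<open>I\<close> matters for the squared positive part, which is Lipschitz only on half lines
  bounded above.\<close>

lemma second_difference_compose:
 fixes q :: "real => real"
 assumes lip: "!!r r'. r : I ==> r' : I ==> \<bar>q r - q r'\<bar> <= L * \<bar>r - r'\<bar>"
  and sec: "!!r r'. r : I ==> r' : I ==> \<bar>q r + q r' - 2 * q ((r + r') / 2)\<bar> <= C * (r - r')^2"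
  and I: "convex I" "a : I" "b : I" "c : I"
 shows "\<bar>q a + q b - 2 * q c\<bar> <= C * (a - b)^2 + L * \<bar>a + b - 2 * c\<bar>"
proof -
 have mid: "(a + b) / 2 : I"
  using convexD[OF I(1,2,3), of "1/2" "1/2"] by (simp add: add_divide_distrib)
 have "\<bar>2 * q ((a + b) / 2) - 2 * q c\<bar> <= 2 * (L * \<bar>(a + b) / 2 - c\<bar>)"
  using lip[OF mid I(4)] by linarith
 also have "... = L * \<bar>a + b - 2 * c\<bar>" by (simp add: abs_if field_simps)
 finally show ?thesis using sec[OF I(2,3)] by linarith
qed

lemma c11_compose:
 fixes q :: "real => real"
 assumes phi: "c11 phi"
  and bdd: "!!r. \<bar>q r\<bar> <= Mq"
  and lip: "!!r r'. \<bar>q r - q r'\<bar> <= L * \<bar>r - r'\<bar>"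
  and sec: "!!r r'. \<bar>q r + q r' - 2 * q ((r + r') / 2)\<bar> <= C * (r - r')^2"
 shows "c11 (%x. q (phi x))"
proof -
 obtain M B D where b: "c11_bound M B D phi" using phi by (auto simp: c11_def)
 note nn = c11_bound_nonneg[OF b]
 have L: "0 <= L" using order_trans[OF abs_ge_zero lip[of 1 0]] by simp
 have C: "0 <= C" using order_trans[OF abs_ge_zero sec[of 1 0]] by simp
 have "c11_bound Mq (L * B) (C * (2 * B)^2 + L * D) (%x. q (phi x))"
  unfolding c11_bound_def
 proof (intro conjI allI)
  fix x h
  show "\<bar>q (phi x)\<bar> <= Mq" by (rule bdd)
  show "\<bar>q (phi (x + h)) - q (phi x)\<bar> <= L * B * norm h"
   using order_trans[OF lip mult_left_mono[OF c11_boundD(2)[OF b] L]] by (simp add: mult.assoc)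
  have "\<bar>phi (x + h) - phi (x - h)\<bar> <= 2 * B * norm h"
   using c11_boundD(2)[OF b, of x h] c11_boundD(2)[OF b, of x "-h"] by simp
  then have "(phi (x + h) - phi (x - h))^2 <= (2 * B * norm h)^2"
   by (metis abs_ge_zero power2_abs power_mono)
  then have 1: "C * (phi (x + h) - phi (x - h))^2 <= C * (2 * B * norm h)^2"
   using C by (rule mult_left_mono)
  have 2: "L * \<bar>phi (x + h) + phi (x - h) - 2 * phi x\<bar> <= L * (D * (norm h)^2)"
   using c11_boundD(3)[OF b] L by (rule mult_left_mono)
  have "\<bar>q (phi (x + h)) + q (phi (x - h)) - 2 * q (phi x)\<bar>
    <= C * (phi (x + h) - phi (x - h))^2 + L * \<bar>phi (x + h) + phi (x - h) - 2 * phi x\<bar>"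
   by (rule second_difference_compose[where I = UNIV]) (auto intro: lip sec)
  also have "... <= C * (2 * B * norm h)^2 + L * (D * (norm h)^2)" using 1 2 by linarith
  finally show "\<bar>q (phi (x + h)) + q (phi (x - h)) - 2 * q (phi x)\<bar> <= (C * (2 * B)^2 + L * D) * (norm h)^2"
   by (simp add: algebra_simps power_mult_distrib)
 qed
 then show ?thesis by (auto simp: c11_def)
qed

lemma c11_slice: fixes phi :: "'b::euclidean_space \<times> 'c::euclidean_space => real"
 assumes "c11_bound M B D phi" shows "c11_bound M B D (%x. phi (t, x))"
 using c11_boundD[OF assms, of "(t, _)"] c11_boundD(2,3)[OF assms, of "(t, _)" "(0, _)"]
 unfolding c11_bound_def by (auto simp: norm_Pair)

section \<open>A compactly supported bump with bounded second differences\<close>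

definition bump :: "'b::euclidean_space => real" where
 "bump x = (max 0 (1 - (norm x)^2))^2"

lemma bump_bounds: "0 <= bump x" "bump x <= 1"
 by (auto simp: bump_def max_def intro!: power_le_one)

lemma bump_eq_0_iff: "bump x = 0 \<longleftrightarrow> 1 <= norm x"
proof -
 have "1 <= (norm x)^2 \<longleftrightarrow> 1 <= norm x" using abs_le_square_iff[of 1 "norm x"] by simp
 moreover have "bump x = 0 \<longleftrightarrow> 1 <= (norm x)^2" by (simp add: bump_def max_def)
 ultimately show ?thesis by simp
qed

lemma pos_square_props:
 fixes r r' :: real
 assumes "r <= 1" "r' <= 1"
 shows "\<bar>(max 0 r)^2 - (max 0 r')^2\<bar> <= 2 * \<bar>r - r'\<bar>"
proof -
 have "\<bar>(max 0 r)^2 - (max 0 r')^2\<bar> = (max 0 r + max 0 r') * \<bar>max 0 r - max 0 r'\<bar>"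
  by (simp add: power2_eq_square square_diff_square_factored abs_mult)
 also have "... <= 2 * \<bar>r - r'\<bar>" using assms by (intro mult_mono) (auto simp: max_def)
 finally show ?thesis .
qed

lemma pos_square_second:
 fixes r r' :: real
 shows "\<bar>(max 0 r)^2 + (max 0 r')^2 - 2 * (max 0 ((r + r') / 2))^2\<bar> <= (r - r')^2"
proof -
 have *: "\<bar>(max 0 r)^2 + (max 0 r')^2 - 2 * (max 0 ((r + r') / 2))^2\<bar> <= (r - r')^2" if "r' <= r" for r r' :: real
 proof (cases "r' \<ge> 0")
  case True
  have "r^2 + r'^2 - 2 * ((r + r') / 2)^2 = (r - r')^2 / 2" by (simp add: power2_eq_square field_simps)
  moreover have "0 <= (r - r')^2" by simp
  ultimately have "\<bar>r^2 + r'^2 - 2 * ((r + r') / 2)^2\<bar> <= (r - r')^2" by linarith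
  then show ?thesis using True that by simp
 next
  case r': False
  show ?thesis
  proof (cases "r \<ge> 0")
   case True
   define m where "m = max 0 ((r + r') / 2)"
   have m: "0 <= m" "m <= r / 2" using r' True by (auto simp: m_def max_def)
   have "m^2 <= (r/2)^2" using m by (intro power_mono) auto
   moreover have "r^2 <= (r - r')^2" using True r' by (intro power_mono) auto
   moreover have "(r/2)^2 = r^2 / 4" by (simp add: power2_eq_square)
   ultimately have "\<bar>r^2 - 2 * m^2\<bar> <= (r - r')^2" using zero_le_power2[of m] zero_le_power2[of r] unfolding abs_le_iff by linarith
   then show ?thesis using True r' by (simp add: m_def)
  qed (use r' that in auto)
 qed
 show ?thesis using *[of r r'] *[of r' r] by (cases "r' <= r") (auto simp: add.commute power2_commute)
qed

lemma norm_sum_diff: "(norm (x + h))^2 + (norm (x - h))^2 = 2 * (norm x)^2 + 2 * (norm (h::'b::real_inner))^2"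
 by (simp add: power2_norm_eq_inner inner_add inner_diff algebra_simps inner_commute)

lemma norm_diff_diff: "(norm (x + h))^2 - (norm (x - h))^2 = 4 * (x \<bullet> (h::'b::real_inner))"
 by (simp add: power2_norm_eq_inner inner_add inner_diff algebra_simps inner_commute)

lemma c11_bump: "c11 (bump :: 'b::euclidean_space => real)"
proof -
 \<comment> \<open>Increments with \<open>norm h >= 1\<close> are covered by the sup bound, and for
   \<open>norm x >= 2\<close>, \<open>norm h < 1\<close> all values vanish. In the remaining case 12
   is 2, the Lipschitz constant of the squared positive part on \<open>{..1}\<close>, times 6, a
   bound for \<open>norm (x + h) + norm x\<close>; and 70 exceeds 16 * 4 + 4.\<close>
 have "c11_bound 1 12 70 (bump :: 'b => real)"
  unfolding c11_bound_def
 proof (intro conjI allI)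
  fix x h :: 'b
  show "\<bar>bump x\<bar> <= 1" using bump_bounds[of x] by simp
  have big: "\<bar>bump (x + h) - bump x\<bar> <= 1" using bump_bounds[of x] bump_bounds[of "x + h"] by linarith
  show "\<bar>bump (x + h) - bump x\<bar> <= 12 * norm h"
  proof (cases "norm h \<ge> 1")
   case True then show ?thesis using big by linarith
  next
   case h: False
   show ?thesis
   proof (cases "norm x \<ge> 2")
    case True
    then have "norm (x + h) \<ge> 1" using h norm_triangle_ineq4[of "x + h" h] by simp
    then show ?thesis using True by (simp add: bump_eq_0_iff[THEN iffD2])
   next
    case False
    have "\<bar>bump (x + h) - bump x\<bar> <= 2 * \<bar>(1 - (norm (x + h))^2) - (1 - (norm x)^2)\<bar>"
     unfolding bump_def by (rule pos_square_props) auto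
    also have "(1 - (norm (x + h))^2) - (1 - (norm x)^2) = - ((norm (x + h) + norm x) * (norm (x + h) - norm x))"
     by (simp add: power2_eq_square algebra_simps)
    also have "2 * \<bar>...\<bar> = 2 * ((norm (x + h) + norm x) * \<bar>norm (x + h) - norm x\<bar>)"
     by (simp add: abs_mult)
    also have "... <= 2 * (6 * norm h)"
    proof (intro mult_left_mono mult_mono)
     show "norm (x + h) + norm x <= 6" using h False norm_triangle_ineq[of x h] by linarith
     show "\<bar>norm (x + h) - norm x\<bar> <= norm h" using norm_triangle_ineq3[of "x + h" x] by simp
    qed auto
    finally show ?thesis by simp
   qed
  qed
  show "\<bar>bump (x + h) + bump (x - h) - 2 * bump x\<bar> <= 70 * (norm h)^2"
  proof (cases "norm h \<ge> 1")
   case True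
   have "\<bar>bump (x + h) + bump (x - h) - 2 * bump x\<bar> <= 2"
    using bump_bounds[of x] bump_bounds[of "x + h"] bump_bounds[of "x - h"] by linarith
   moreover have "1 <= (norm h)^2" using True by simp
   ultimately show ?thesis by linarith
  next
   case h: False
   show ?thesis
   proof (cases "norm x \<ge> 2")
    case True
    then have "norm (x + h) \<ge> 1" "norm (x - h) \<ge> 1"
     using h norm_triangle_ineq4[of "x + h" h] norm_triangle_ineq[of "x - h" h] by simp_all
    then show ?thesis using True by (simp add: bump_eq_0_iff[THEN iffD2])
   next
    case False
    let ?p = "%x::'b. 1 - (norm x)^2"
    have "\<bar>bump (x + h) + bump (x - h) - 2 * bump x\<bar>
     <= 1 * (?p (x + h) - ?p (x - h))^2 + 2 * \<bar>?p (x + h) + ?p (x - h) - 2 * ?p x\<bar>"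
     unfolding bump_def
     by (rule second_difference_compose[where I = "{..1}"])
      (auto intro: pos_square_props pos_square_second)
    also have "?p (x + h) - ?p (x - h) = - (4 * (x \<bullet> h))" using norm_diff_diff[of x h] by linarith
    also have "?p (x + h) + ?p (x - h) - 2 * ?p x = - (2 * (norm h)^2)" using norm_sum_diff[of x h] by (simp add: algebra_simps)
    also have "1 * (- (4 * (x \<bullet> h)))^2 + 2 * \<bar>- (2 * (norm h)^2)\<bar> = 16 * (x \<bullet> h)^2 + 4 * (norm h)^2"
     by (simp add: power_mult_distrib)
    also have "(x \<bullet> h)^2 <= (norm x * norm h)^2"
     by (metis Cauchy_Schwarz_ineq2 abs_ge_zero power2_abs power_mono)
    also have "(norm x * norm h)^2 <= 4 * (norm h)^2"
     using False power_mono[of "norm x" 2 2] by (simp add: power_mult_distrib mult_right_mono)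
    finally show ?thesis by (simp add: mult_left_mono)
   qed
  qed
 qed
 then show ?thesis by (auto simp: c11_def)
qed

lemma c11_affine:
 assumes "c11_bound M B D phi" "r \<noteq> 0"
 shows "c11_bound M (B * \<bar>r\<bar>) (D * r^2) (%x. phi (r *\<^sub>R (x - p)))"
 unfolding c11_bound_def
proof (intro conjI allI)
 fix x h
 note b = c11_boundD[OF assms(1), of "r *\<^sub>R (x - p)"]
 show "\<bar>phi (r *\<^sub>R (x - p))\<bar> <= M" by (rule b)
 show "\<bar>phi (r *\<^sub>R (x + h - p)) - phi (r *\<^sub>R (x - p))\<bar> <= B * \<bar>r\<bar> * norm h"
  using b(2)[of "r *\<^sub>R h"] by (simp add: algebra_simps)
 show "\<bar>phi (r *\<^sub>R (x + h - p)) + phi (r *\<^sub>R (x - h - p)) - 2 * phi (r *\<^sub>R (x - p))\<bar> <= D * r^2 * (norm h)^2"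
  using b(3)[of "r *\<^sub>R h"] by (simp add: algebra_simps power_mult_distrib)
qed

definition bump_at :: "'b::euclidean_space => real => 'b => real" where
 "bump_at p r x = bump ((1 / r) *\<^sub>R (x - p))"

lemma bump_at_bounds: "0 <= bump_at p r x" "bump_at p r x <= 1"
 by (simp_all add: bump_at_def bump_bounds)

lemma bump_at_eq_0_iff: "r > 0 ==> bump_at p r x = 0 \<longleftrightarrow> r <= norm (x - p)"
 by (simp add: bump_at_def bump_eq_0_iff le_divide_eq del: scaleR_right_diff_distrib)

lemma bump_at_center: "bump_at p r p = 1"
 by (simp add: bump_at_def bump_def)

lemma c11_bump_at: "r > 0 ==> c11 (bump_at p r)"
 using c11_affine[of _ _ _ bump "1/r" p] c11_bump unfolding c11_def bump_at_def[abs_def] by fastforce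

subsection \<open>Jump operators and the fractional Laplacian\<close>

definition jump :: "'a::euclidean_space measure => ('a => real) => 'a => real" where
 "jump kappa phi x = (\<integral>y. phi (x + y) - phi x \<partial>kappa)"

lemma continuous_on_param_integral:
 fixes F :: "'p::metric_space => 'd => real"
 assumes fin: "finite_measure M" and meas: "!!p. p : S ==> F p : borel_measurable M"
  and bdd: "!!p y. p : S ==> \<bar>F p y\<bar> <= B"
  and cont: "!!y. continuous_on S (%p. F p y)"
 shows "continuous_on S (%p. \<integral>y. F p y \<partial>M)"
 unfolding continuous_on_sequentially o_def
proof (intro allI ballI impI)
 fix X a assume a: "a : S" and X: "(\<forall>n. X n : S) & X \<longlonglongrightarrow> a"
 show "(%n. \<integral>y. F (X n) y \<partial>M) \<longlonglongrightarrow> (\<integral>y. F a y \<partial>M)"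
 proof (rule integral_dominated_convergence[where w = "%_. B"])
  show "integrable M (%_. B)" using fin by (rule finite_measure.integrable_const)
  show "AE y in M. (%n. F (X n) y) \<longlonglongrightarrow> F a y"
   using cont a X unfolding continuous_on_sequentially o_def by auto
 qed (use meas bdd a X in auto)
qed

lemma lborel_distr_uminus_euclidean: "distr lborel borel uminus = (lborel :: 'a::euclidean_space measure)"
 by (subst (2) lborel_affine[of "-1" 0]) (simp_all add: density_1 one_ennreal_def[symmetric])

lemma lborel_integral_shift:
 fixes f :: "'a::euclidean_space => real"
 assumes "f : borel_funs"
 shows "(LBINT x. f (c + x)) = (LBINT x. f x)"
 using assms by (subst (2) lborel_distr_plus[of c, symmetric], subst integral_distr) auto

lemma lborel_integral_reflect:
 fixes f :: "'a::euclidean_space => real"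
 assumes "f : borel_funs"
 shows "(LBINT x. f (- x)) = (LBINT x. f x)"
 using assms by (subst (2) lborel_distr_uminus_euclidean[symmetric], subst integral_distr) auto

text \<open>Finite mass makes \<open>jump\<close> a bounded operator on bounded functions; symmetry
  makes it self-adjoint and turns first differences into second differences.\<close>

locale symmetric_jumps = finite_measure kappa for kappa :: "'a::euclidean_space measure" +
 assumes sets_jumps [measurable_cong, simp]: "sets kappa = sets borel"
  and sym: "distr kappa borel uminus = kappa"
begin

lemma space_jumps [simp]: "space kappa = UNIV"
 using sets_eq_imp_space_eq[OF sets_jumps] by simp

abbreviation rate where "rate \<equiv> measure kappa UNIV"

lemma integrable_bounded:
 fixes phi :: "'a => real"
 assumes [measurable]: "phi : borel_funs" and bdd: "!!x. \<bar>phi x\<bar> <= M"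
 shows "integrable kappa phi"
 by (rule integrable_const_bound[of _ M]) (use bdd in auto)

lemma integrable_shift:
 fixes phi :: "'a => real"
 assumes [measurable]: "phi : borel_funs" and "!!x. \<bar>phi x\<bar> <= M"
 shows "integrable kappa (%y. phi (x + y))"
 using assms(2) by (intro integrable_bounded[where M = M]) measurable

lemma jump_eq:
 assumes "phi : borel_funs" "!!x. \<bar>phi x\<bar> <= M"
 shows "jump kappa phi x = (\<integral>y. phi (x + y) \<partial>kappa) - rate * phi x"
 unfolding jump_def using integrable_shift[OF assms]
 by (subst Bochner_Integration.integral_diff) auto

lemma jump_bound:
 assumes "phi : borel_funs" "!!x. \<bar>phi x\<bar> <= M"
 shows "\<bar>jump kappa phi x\<bar> <= 2 * M * rate"
proof -
 have "\<bar>\<integral>y. phi (x + y) - phi x \<partial>kappa\<bar> <= (\<integral>y. \<bar>phi (x + y) - phi x\<bar> \<partial>kappa)" by (rule integral_abs_bound)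
 also have "... <= (\<integral>y. 2 * M \<partial>kappa)"
 proof (rule integral_mono)
  show "\<bar>phi (x + y) - phi x\<bar> <= 2 * M" for y using assms(2)[of x] assms(2)[of "x + y"] by linarith
 qed (use integrable_shift[OF assms] in auto)
 finally show ?thesis by (simp add: jump_def mult_ac)
qed

lemma jump_add:
 assumes "phi : borel_funs" "!!x. \<bar>phi x\<bar> <= M" "psi : borel_funs" "!!x. \<bar>psi x\<bar> <= M'"
 shows "jump kappa (%x. phi x + psi x) x = jump kappa phi x + jump kappa psi x"
proof -
 have i: "integrable kappa (%y. phi (x + y) - phi x)" "integrable kappa (%y. psi (x + y) - psi x)"
  using integrable_shift[OF assms(1,2)] integrable_shift[OF assms(3,4)] by auto
 show ?thesis
  unfolding jump_def Bochner_Integration.integral_add[OF i, symmetric]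
  by (rule Bochner_Integration.integral_cong) auto
qed

lemma jump_cmult: "jump kappa (%x. a * phi x) x = a * jump kappa phi x"
 unfolding jump_def by (simp add: right_diff_distrib[symmetric])

lemma jump_shift: "jump kappa (%x. phi (x + h)) x = jump kappa phi (x + h)"
 unfolding jump_def by (simp add: algebra_simps)

lemma jump_uminus_measure:
 fixes phi :: "'a => real"
 assumes [measurable]: "phi : borel_funs"
 shows "(\<integral>y. phi (- y) \<partial>kappa) = (\<integral>y. phi y \<partial>kappa)"
 by (subst (2) sym[symmetric], subst integral_distr) auto

lemma jump_second_difference:
 assumes [measurable]: "phi : borel_funs" and "!!x. \<bar>phi x\<bar> <= M"
 shows "2 * jump kappa phi x = (\<integral>y. phi (x + y) + phi (x - y) - 2 * phi x \<partial>kappa)"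
proof -
 have i1: "integrable kappa (%y. phi (x + y) - phi x)" using integrable_shift[OF assms] by auto
 have i2: "integrable kappa (%y. phi (x - y) - phi x)"
 proof (rule integrable_bounded[where M = "2 * M"])
  show "\<bar>phi (x - y) - phi x\<bar> <= 2 * M" for y using assms(2)[of x] assms(2)[of "x - y"] by linarith
 qed measurable
 have "(\<integral>y. phi (x - y) - phi x \<partial>kappa) = jump kappa phi x"
  unfolding jump_def by (subst jump_uminus_measure[symmetric]) auto
 moreover have "(\<integral>y. phi (x + y) + phi (x - y) - 2 * phi x \<partial>kappa)
   = (\<integral>y. (phi (x + y) - phi x) + (phi (x - y) - phi x) \<partial>kappa)"
  by (rule Bochner_Integration.integral_cong) auto
 ultimately show ?thesis unfolding Bochner_Integration.integral_add[OF i1 i2] by (simp add: jump_def)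
qed

text \<open>This is the one-sided bound that \<open>jump_maximum_principle\<close> asks for: no jump
  from \<open>x\<close> gains more than \<open>M - phi x\<close>.\<close>

lemma jump_le_max:
 assumes "phi : borel_funs" "!!x. \<bar>phi x\<bar> <= M0" "!!x. phi x <= M"
 shows "jump kappa phi x <= rate * (M - phi x)"
proof -
 have "jump kappa phi x <= (\<integral>y. M - phi x \<partial>kappa)"
  unfolding jump_def using integrable_shift[OF assms(1,2)] assms(3) by (intro integral_mono) auto
 then show ?thesis by simp
qed

lemma nn_integral_shift:
 assumes [measurable]: "phi : borel_funs"
 shows "(\<integral>\<^sup>+x. (\<integral>\<^sup>+y. phi (x + y) \<partial>kappa) \<partial>lborel) = emeasure kappa UNIV * (NN x. phi x)"
proof -
 interpret P: pair_sigma_finite lborel kappa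
  by (intro pair_sigma_finite.intro sigma_finite_lborel sigma_finite_measure)
 have "(\<integral>\<^sup>+x. (\<integral>\<^sup>+y. phi (x + y) \<partial>kappa) \<partial>lborel) = (\<integral>\<^sup>+y. (NN x. phi (x + y)) \<partial>kappa)"
  by (rule P.Fubini'[symmetric]) measurable
 also have "... = (\<integral>\<^sup>+y. (NN x. phi x) \<partial>kappa)"
 proof (rule nn_integral_cong)
  fix y
  have "(NN x. phi x) = (\<integral>\<^sup>+x. phi x \<partial>distr lborel borel ((+) y))"
   by (simp add: lborel_distr_plus)
  also have "... = (NN x. phi (y + x))" by (subst nn_integral_distr) auto
  finally show "(NN x. phi (x + y)) = (NN x. phi x)" by (simp add: add.commute)
 qed
 finally show ?thesis by (simp add: mult.commute)
qed

lemma borel_measurable_shift_integral [measurable]: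
 assumes [measurable]: "phi : borel_funs"
 shows "(%x. \<integral>y. phi (x + y) \<partial>kappa :: real) : borel_funs"
proof (rule borel_measurable_lebesgue_integral)
 have "(%(x, y). phi (x + y)) : borel_measurable (borel \<Otimes>\<^sub>M borel)" by measurable
 then show "(%(x, y). phi (x + y)) : borel_measurable (borel \<Otimes>\<^sub>M kappa)"
  by (simp cong: measurable_cong_sets sets_pair_measure_cong)
qed

lemma borel_measurable_jump [measurable]:
 assumes [measurable]: "phi : borel_funs"
 shows "jump kappa phi : borel_funs"
 unfolding jump_def[abs_def] by measurable

text \<open>Fubini, a translation in \<open>x\<close> and the reflection of \<open>kappa\<close>
  move the jump from \<open>phi\<close> to \<open>psi\<close>. Only \<open>phi\<close> has to be
  integrable; a merely bounded \<open>psi\<close> is what allows the constant 1 as a test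
  function.\<close>

lemma jump_dual:
 assumes [measurable]: "phi : borel_funs" "psi : borel_funs"
  and phi: "Leb1 phi" "!!x. \<bar>phi x\<bar> <= M" and psi: "!!x. \<bar>psi x\<bar> <= M'"
 shows "Leb1 (%x. psi x * jump kappa phi x)" (is ?i1)
  "Leb1 (%x. phi x * jump kappa psi x)" (is ?i2)
  "(LBINT x. psi x * jump kappa phi x) = (LBINT x. phi x * jump kappa psi x)" (is ?eq)
proof -
 interpret P: pair_sigma_finite lborel kappa
  by (intro pair_sigma_finite.intro sigma_finite_lborel sigma_finite_measure)
 have M': "0 <= M'" using psi abs_ge_zero order_trans by blast
 have fin: "emeasure kappa UNIV < \<top>" by (simp add: less_top[symmetric])
 have I: "integrable (lborel \<Otimes>\<^sub>M kappa) (%(x, y). psi x * phi (x + y))"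
 proof (rule integrableI_bounded)
  have "(\<integral>\<^sup>+p. ennreal (norm (case p of (x, y) => psi x * phi (x + y))) \<partial>(lborel \<Otimes>\<^sub>M kappa))
   = (\<integral>\<^sup>+x. \<integral>\<^sup>+y. ennreal \<bar>psi x * phi (x + y)\<bar> \<partial>kappa \<partial>lborel)"
   by (subst nn_integral_fst[symmetric]) auto
  also have "... <= (\<integral>\<^sup>+x. \<integral>\<^sup>+y. ennreal M' * ennreal \<bar>phi (x + y)\<bar> \<partial>kappa \<partial>lborel)"
   using psi M' by (intro nn_integral_mono) (auto simp: abs_mult ennreal_mult[symmetric] intro!: ennreal_leI mult_right_mono)
  also have "... = ennreal M' * (emeasure kappa UNIV * (NN x. ennreal \<bar>phi x\<bar>))"
   by (subst nn_integral_shift[symmetric]) (auto simp: nn_integral_cmult)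
  also have "... < \<infinity>"
   using phi(1) fin unfolding integrable_iff_bounded by (simp add: ennreal_mult_less_top)
  finally show "(\<integral>\<^sup>+p. ennreal (norm (case p of (x, y) => psi x * phi (x + y))) \<partial>(lborel \<Otimes>\<^sub>M kappa)) < \<infinity>" .
 qed auto
 have J1: "psi x * jump kappa phi x = (\<integral>y. psi x * phi (x + y) \<partial>kappa) - rate * (psi x * phi x)" for x
  unfolding jump_eq[OF assms(1) phi(2)] by (simp add: right_diff_distrib)
 have J2: "phi x * jump kappa psi x = (\<integral>y. phi x * psi (x + y) \<partial>kappa) - rate * (psi x * phi x)" for x
  unfolding jump_eq[OF assms(2) psi] by (simp add: right_diff_distrib)
 have ipp: "Leb1 (%x. psi x * phi x)"
  by (rule Bochner_Integration.integrable_bound[OF integrable_mult_right[OF phi(1), of M']])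
   (use psi M' in "auto simp: abs_mult intro!: mult_right_mono")
 have I1: "Leb1 (%x. \<integral>y. psi x * phi (x + y) \<partial>kappa)" using P.integrable_fst'[OF I] by simp
 show i1: ?i1 unfolding J1 using I1 ipp by auto
 have b2: "\<bar>phi x * jump kappa psi x\<bar> <= \<bar>(2 * M' * rate) * phi x\<bar>" for x
  using jump_bound[OF assms(2) psi, of x] M' mult_right_mono[of "\<bar>jump kappa psi x\<bar>" "2 * M' * rate" "\<bar>phi x\<bar>"]
  by (simp add: abs_mult mult.commute)
 show i2: ?i2
  by (rule Bochner_Integration.integrable_bound[OF integrable_mult_right[OF phi(1), of "2 * M' * rate"]])
   (use b2 in auto)
 then have I2: "Leb1 (%x. \<integral>y. phi x * psi (x + y) \<partial>kappa)"
  using Bochner_Integration.integrable_add[OF i2 integrable_mult_right[OF ipp, of rate]] unfolding J2 by simp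
 have "(\<integral>x. \<integral>y. psi x * phi (x + y) \<partial>kappa \<partial>lborel) = (\<integral>y. (LBINT x. psi x * phi (x + y)) \<partial>kappa)"
  using P.Fubini_integral[OF I] by simp
 also have "... = (\<integral>y. (LBINT x. psi (x - y) * phi x) \<partial>kappa)"
  
 proof (rule Bochner_Integration.integral_cong)
  show "(LBINT x. psi x * phi (x + y)) = (LBINT x. psi (x - y) * phi x)" for y
   using lborel_integral_shift[of "%x. psi (x - y) * phi x" y] by (simp add: add.commute)
 qed simp
 also have "... = (\<integral>y. (LBINT x. psi (x + y) * phi x) \<partial>kappa)"
  by (subst jump_uminus_measure[symmetric]) auto
 also have "... = (\<integral>x. \<integral>y. psi (x + y) * phi x \<partial>kappa \<partial>lborel)"
 proof (rule P.Fubini_integral)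
  show "integrable (lborel \<Otimes>\<^sub>M kappa) (%(x, y). psi (x + y) * phi x)"
  proof (rule Bochner_Integration.integrable_bound)
   show "integrable (lborel \<Otimes>\<^sub>M kappa) (%p. M' * phi (fst p))"
   proof (intro integrable_mult_right integrableI_bounded)
    show "(\<integral>\<^sup>+p. ennreal (norm (phi (fst p))) \<partial>(lborel \<Otimes>\<^sub>M kappa)) < \<infinity>"
     using phi(1) fin unfolding integrable_iff_bounded
     by (subst nn_integral_fst[symmetric]) (auto simp: nn_integral_multc ennreal_mult_less_top)
   qed auto
  qed (use psi M' in "auto simp: abs_mult intro!: AE_I2 mult_right_mono")
 qed
 also have "... = (\<integral>x. \<integral>y. phi x * psi (x + y) \<partial>kappa \<partial>lborel)" by (simp add: mult.commute)
 finally show ?eq unfolding J1 J2 using I1 I2 ipp by simp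
qed

end

section \<open>Moments of the kernel of the fractional Laplacian\<close>

definition kern :: "real => 'a::euclidean_space => real" where
 "kern s y = frac_lap_const TYPE('a) s * norm y powr - (real DIM('a) + 2 * s)"

definition jump_kernel :: "real => real => 'a::euclidean_space measure" where
 "jump_kernel s eps = density lborel (%y. ennreal (indicator {y. eps < norm y} y * kern s y))"

definition shell_integral :: "real => 'a::euclidean_space itself => real => ennreal" where
 "shell_integral p _ a = (NN y. ennreal (indicator {y::'a. a < norm y & norm y <= 2 * a} y * norm y powr p))"

lemma shell_integral_le:
 assumes a: "0 < a"
 shows "shell_integral p TYPE('a::euclidean_space) a
  <= ennreal (2 powr \<bar>p\<bar> * unit_ball_vol DIM('a) * 2 ^ DIM('a) * a powr (p + DIM('a)))"
proof -
 have pw: "r powr p <= 2 powr \<bar>p\<bar> * a powr p" if "a < r" "r <= 2 * a" for r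
 proof (cases "p \<ge> 0")
  case True
  have "r powr p <= (2 * a) powr p" using that a True by (intro powr_mono2) auto
  then show ?thesis using True a by (simp add: powr_mult)
 next
  case False
  have "r powr p <= a powr p" using that a False by (intro powr_mono2') auto
  also have "... <= 2 powr \<bar>p\<bar> * a powr p" using ge_one_powr_ge_zero[of 2 "\<bar>p\<bar>"] mult_right_mono[of 1 "2 powr \<bar>p\<bar>" "a powr p"] by simp
  finally show ?thesis .
 qed
 have "shell_integral p TYPE('a) a
   <= (NN y. ennreal (2 powr \<bar>p\<bar> * a powr p) * indicator (cball (0::'a) (2 * a)) y)"
  unfolding shell_integral_def
  by (intro nn_integral_mono) (auto split: split_indicator intro!: ennreal_leI pw)
 also have "... = ennreal (2 powr \<bar>p\<bar> * a powr p) * emeasure lborel (cball (0::'a) (2 * a))"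
  by (rule nn_integral_cmult_indicator) simp
 also have "... = ennreal (2 powr \<bar>p\<bar> * a powr p * (unit_ball_vol DIM('a) * (2 * a) ^ DIM('a)))"
  using a by (subst emeasure_cball) (auto simp: ennreal_mult[symmetric])
 also have "2 powr \<bar>p\<bar> * a powr p * (unit_ball_vol DIM('a) * (2 * a) ^ DIM('a))
  = 2 powr \<bar>p\<bar> * unit_ball_vol DIM('a) * 2 ^ DIM('a) * a powr (p + DIM('a))"
  using a by (simp add: powr_add powr_realpow power_mult_distrib)
 finally show ?thesis .
qed

lemma ennreal_le_suminf: fixes f :: "nat => ennreal" shows "f j <= (\<Sum>j. f j)"
 using sum_le_suminf[of f "{j}"] by simp

text \<open>Dyadic shells do the work of polar coordinates: on each shell the power is constant up
  to a factor \<open>2 powr |p|\<close>, so the shells contribute a geometric series.\<close>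

lemma nn_integral_shells_finite:
 fixes a :: "nat => real" and p :: real
 assumes a: "!!j. 0 < a j" and q: "!!j. a j powr (p + DIM('a::euclidean_space)) <= K * q ^ j" "0 <= q" "q < 1"
  and cov: "!!y::'a. y : S ==> \<exists>j. a j < norm y & norm y <= 2 * a j"
 shows "(NN y. ennreal (indicator S (y::'a) * norm y powr p)) < \<infinity>"
proof -
 have K: "0 <= K" using order_trans[OF powr_ge_zero q(1)[of 0]] by simp
 let ?f = "%j y. ennreal (indicator {y::'a. a j < norm y & norm y <= 2 * a j} y * norm y powr p)"
 let ?C = "2 powr \<bar>p\<bar> * unit_ball_vol DIM('a) * 2 ^ DIM('a)"
 have "(NN y. ennreal (indicator S (y::'a) * norm y powr p)) <= (NN y. (\<Sum>j. ?f j y))"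
 proof (rule nn_integral_mono)
  fix y :: 'a
  show "ennreal (indicator S y * norm y powr p) <= (\<Sum>j. ?f j y)"
  proof (cases "y : S")
   case True
   then obtain j where "a j < norm y" "norm y <= 2 * a j" using cov by blast
   then have "ennreal (indicator S y * norm y powr p) = ?f j y" using True by simp
   also have "... <= (\<Sum>j. ?f j y)" by (rule ennreal_le_suminf)
   finally show ?thesis .
  qed simp
 qed
 also have "... = (\<Sum>j. shell_integral p TYPE('a) (a j))"
  unfolding shell_integral_def by (rule nn_integral_suminf) measurable
 also have "... <= (\<Sum>j. ennreal (?C * K * q ^ j))"
 proof (rule suminf_le)
  fix j
  have "?C * a j powr (p + DIM('a)) <= ?C * (K * q ^ j)" using q(1) by (intro mult_left_mono) auto
  then show "shell_integral p TYPE('a) (a j) <= ennreal (?C * K * q ^ j)"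
   using order_trans[OF shell_integral_le[OF a, where 'a = 'a] ennreal_leI] by (simp add: mult.assoc)
 qed auto
 also have "... < \<infinity>"
 proof -
  have "summable (%j. ?C * K * q ^ j)" using q by (intro summable_mult summable_geometric) auto
  then show ?thesis using K q
   by (subst suminf_ennreal2) (auto intro!: mult_nonneg_nonneg)
 qed
 finally show ?thesis .
qed

lemma nn_integral_powr_inner:
 fixes p :: real assumes "p + DIM('a::euclidean_space) > 0"
 shows "(NN y. ennreal (indicator (cball 0 1) (y::'a) * norm y powr p)) < \<infinity>"
proof -
 \<comment> \<open>The origin lies in no shell. It is restored at the end at no cost, since
   \<open>0 powr p = 0\<close>.\<close>
 have "(NN y. ennreal (indicator (cball 0 1 - {0}) (y::'a) * norm y powr p)) < \<infinity>"
 proof (rule nn_integral_shells_finite[where a = "%j. (1/2) ^ Suc j" and K = 1 and q = "(1/2) powr (p + DIM('a))"])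
  show "((1/2) ^ Suc j) powr (p + DIM('a)) <= 1 * ((1/2) powr (p + DIM('a))) ^ j" for j
  proof -
   have "((1/2) ^ Suc j) powr (p + DIM('a)) <= ((1/2) ^ j) powr (p + DIM('a))"
    using assms by (intro powr_mono2) auto
   also have "... = ((1/2) powr (p + DIM('a))) ^ j"
    by (simp add: powr_powr powr_realpow[symmetric] mult.commute)
   finally show ?thesis by simp
  qed
  show "(1/2) powr (p + DIM('a)) < 1" using assms powr_less_mono2[of "p + DIM('a)" "1/2" 1] by simp
  fix y :: 'a assume y: "y : cball 0 1 - {0}"
  then obtain n where "(1/2) ^ n < norm y" using real_arch_pow_inv[of "norm y" "1/2"] by auto
  moreover have "(1/2) ^ Suc n <= (1/2::real) ^ n" by simp
  ultimately have "\<exists>j. (1/2) ^ Suc j < norm y" by (meson le_less_trans)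
  then have ex: "\<exists>j. (1/2) ^ Suc j < norm y" .
  define j where "j = (LEAST j. (1/2) ^ Suc j < norm y)"
  have 1: "(1/2) ^ Suc j < norm y" unfolding j_def using ex by (rule LeastI_ex)
  have "norm y <= (1/2) ^ j"
  proof (cases j)
   case (Suc i)
   then have "~ (1/2) ^ Suc i < norm y" using not_less_Least[of i "%j. (1/2) ^ Suc j < norm y"] j_def by auto
   then show ?thesis using Suc by simp
  qed (use y in simp)
  then show "\<exists>j. (1/2) ^ Suc j < norm y & norm y <= 2 * (1/2) ^ Suc j" using 1 by auto
 qed auto
 also have "(NN y. ennreal (indicator (cball 0 1 - {0}) (y::'a) * norm y powr p))
   = (NN y. ennreal (indicator (cball 0 1) (y::'a) * norm y powr p))"
  by (intro nn_integral_cong) (auto split: split_indicator)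
 finally show ?thesis .
qed

lemma nn_integral_powr_outer:
 fixes p :: real assumes "p + DIM('a::euclidean_space) < 0"
 shows "(NN y. ennreal (indicator {y. 1 < norm y} (y::'a) * norm y powr p)) < \<infinity>"
proof (rule nn_integral_shells_finite[where a = "%j. 2 ^ j" and K = 1 and q = "2 powr (p + DIM('a))"])
 show "(2 ^ j) powr (p + DIM('a)) <= 1 * (2 powr (p + DIM('a))) ^ j" for j
  by (simp add: powr_powr powr_realpow[symmetric] mult.commute)
 show "2 powr (p + DIM('a)) < 1" using assms powr_less_mono[of "p + DIM('a)" 0 2] by simp
 fix y :: 'a assume y: "y : {y. 1 < norm y}"
 have ex: "\<exists>j. norm y <= 2 * 2 ^ j"
 proof -
  obtain n where n: "norm y < 2 ^ n" using real_arch_pow[of 2 "norm y"] by auto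
  moreover have "(2::real) ^ n <= 2 * 2 ^ n" by simp
  ultimately have "norm y <= 2 * 2 ^ n" by linarith
  then show ?thesis ..
 qed
 define j where "j = (LEAST j. norm y <= 2 * 2 ^ j)"
 have 1: "norm y <= 2 * 2 ^ j" unfolding j_def using ex by (rule LeastI_ex)
 have "2 ^ j < norm y"
 proof (cases j)
  case (Suc i)
  then have "~ norm y <= 2 * 2 ^ i" using not_less_Least[of i "%j. norm y <= 2 * 2 ^ j"] j_def by auto
  then show ?thesis using Suc by simp
 qed (use y in simp)
 then show "\<exists>j. 2 ^ j < norm y & norm y <= 2 * 2 ^ j" using 1 by auto
qed auto

lemma c11I: "c11_bound M B D phi ==> c11 phi"
 unfolding c11_def by blast

lemmas c11_bound_borel = c11_borel[OF c11I]

lemma frac_lap_const_pos: "0 < s ==> s < 1 ==> 0 < frac_lap_const TYPE('a::euclidean_space) s"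
 unfolding frac_lap_const_def
 by (intro mult_pos_pos divide_pos_pos Gamma_real_pos) auto

lemma kern_measurable [measurable]: "kern s : borel_funs"
 unfolding kern_def[abs_def] by measurable

lemma kern_inverse:
 "kern s (y::'a::euclidean_space) = frac_lap_const TYPE('a) s * inverse (norm y powr (real DIM('a) + 2 * s))"
 by (simp only: kern_def powr_minus)

lemma cball_borel [measurable]: "cball (x::'a::euclidean_space) r : sets borel"
 by (simp add: borel_closed)

lemma kern_minus: "kern s (- y) = kern s y"
 by (simp add: kern_def)

lemma kern_nonneg: "0 < s ==> s < 1 ==> 0 <= kern s (y::'a::euclidean_space)"
 using frac_lap_const_pos[where 'a = 'a] by (simp add: kern_def less_imp_le)

text \<open>The second moment of the jumps of length at most \<open>r\<close>. It measures what is
  lost by removing them when the operator acts on a function with bounded second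
  differences.\<close>

definition m2 :: "'a::euclidean_space itself => real => real => real" where
 "m2 _ s r = (LBINT y. indicator (cball 0 r) y * ((norm y)^2 * kern s (y::'a)))"

context
 fixes s :: real and ty :: "'a::euclidean_space itself"
 assumes s: "0 < s" "s < 1"
begin

lemma integrable_kern_outer_1: "Leb1 (%y::'a. indicator {y. 1 < norm y} y * kern s y)"
proof (rule integrableI_nonneg)
 have "(NN y. ennreal (indicator {y. 1 < norm y} y * kern s (y::'a)))
  = ennreal (frac_lap_const TYPE('a) s) *
   (NN y. ennreal (indicator {y. 1 < norm y} (y::'a) * norm y powr (- (real DIM('a) + 2 * s))))"
  using frac_lap_const_pos[OF s, where 'a = 'a]
  by (subst nn_integral_cmult[symmetric]) (auto simp: kern_def ennreal_mult[symmetric] mult_ac)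
 also have "... < \<infinity>"
  using nn_integral_powr_outer[of "- (real DIM('a) + 2 * s)", where 'a = 'a] s
  by (auto simp: ennreal_mult_less_top)
 finally show "(NN y. ennreal (indicator {y. 1 < norm y} y * kern s (y::'a))) < \<infinity>" .
qed (auto intro!: AE_I2 kern_nonneg s mult_nonneg_nonneg)

lemma integrable_kern_inner_1: "Leb1 (%y::'a. indicator (cball 0 1) y * ((norm y)^2 * kern s y))"
proof (rule integrableI_nonneg)
 have e: "(norm y)^2 * norm y powr (- (real DIM('a) + 2 * s)) = norm y powr (2 - (real DIM('a) + 2 * s))" for y :: 'a
  by (cases "y = 0") (simp_all add: powr_diff powr_minus powr_add powr_numeral divide_inverse)
 have "(NN y. ennreal (indicator (cball 0 1) y * ((norm y)^2 * kern s (y::'a))))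
  = ennreal (frac_lap_const TYPE('a) s) *
   (NN y. ennreal (indicator (cball 0 1) (y::'a) * norm y powr (2 - (real DIM('a) + 2 * s))))"
  unfolding e[symmetric] using frac_lap_const_pos[OF s, where 'a = 'a]
  by (subst nn_integral_cmult[symmetric]) (auto simp: kern_def ennreal_mult[symmetric] mult_ac)
 also have "... < \<infinity>"
  using nn_integral_powr_inner[of "2 - (real DIM('a) + 2 * s)", where 'a = 'a] s
  by (auto simp: ennreal_mult_less_top)
 finally show "(NN y. ennreal (indicator (cball 0 1) y * ((norm y)^2 * kern s (y::'a)))) < \<infinity>" .
qed (auto intro!: AE_I2 kern_nonneg s mult_nonneg_nonneg)

lemma integrable_kern_outer:
 assumes e: "0 < eps" shows "Leb1 (%y::'a. indicator {y. eps < norm y} y * kern s y)"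
proof (rule Bochner_Integration.integrable_bound)
 show "Leb1 (%y::'a. indicator {y. 1 < norm y} y * kern s y
   + (1 / eps^2) * (indicator (cball 0 1) y * ((norm y)^2 * kern s y)))"
  by (intro Bochner_Integration.integrable_add integrable_mult_right integrable_kern_outer_1 integrable_kern_inner_1)
 have "\<bar>indicator {y. eps < norm y} y * kern s y\<bar> <= \<bar>indicator {y. 1 < norm y} y * kern s y
   + (1 / eps^2) * (indicator (cball 0 1) y * ((norm y)^2 * kern s y))\<bar>" for y :: 'a
 proof (cases "eps < norm y & norm y <= 1")
  case True
  then have "1 <= (norm y)^2 / eps^2" using e power_mono[of eps "norm y" 2] by simp
  then have "1 * kern s y <= (norm y)^2 / eps^2 * kern s y" by (rule mult_right_mono) (rule kern_nonneg[OF s])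
  then show ?thesis using True kern_nonneg[OF s, of y] by (simp add: abs_mult)
 qed (use kern_nonneg[OF s] in "auto split: split_indicator")
 then show "AE y in lborel. norm (indicator {y. eps < norm y} y * kern s y) <= norm (indicator {y. 1 < norm y} y * kern s y
   + (1 / eps^2) * (indicator (cball 0 1) y * ((norm y)^2 * kern s (y::'a))))" by auto
qed measurable

lemma integrable_kern_inner:
 "Leb1 (%y::'a. indicator (cball 0 r) y * ((norm y)^2 * kern s y))"
proof (rule Bochner_Integration.integrable_bound)
 show "Leb1 (%y::'a. r^2 * (indicator {y. 1 < norm y} y * kern s y)
   + (indicator (cball 0 1) y * ((norm y)^2 * kern s y)))"
  by (intro Bochner_Integration.integrable_add integrable_mult_right integrable_kern_outer_1 integrable_kern_inner_1)
 have "\<bar>indicator (cball 0 r) y * ((norm y)^2 * kern s y)\<bar> <= \<bar>r^2 * (indicator {y. 1 < norm y} y * kern s y)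
   + (indicator (cball 0 1) y * ((norm y)^2 * kern s y))\<bar>" for y :: 'a
 proof (cases "1 < norm y & norm y <= r")
  case True
  then have "(norm y)^2 * kern s y <= r^2 * kern s y" by (intro mult_right_mono power_mono kern_nonneg s) auto
  then show ?thesis using True kern_nonneg[OF s, of y] by (simp add: abs_mult)
 qed (use kern_nonneg[OF s] in "auto split: split_indicator")
 then show "AE y in lborel. norm (indicator (cball 0 r) y * ((norm y)^2 * kern s y)) <= norm (r^2 * (indicator {y. 1 < norm y} y * kern s y)
   + (indicator (cball 0 1) y * ((norm y)^2 * kern s (y::'a))))" by auto
qed auto

lemma m2_nonneg: "0 <= m2 TYPE('a) s r"
 unfolding m2_def by (intro Bochner_Integration.integral_nonneg mult_nonneg_nonneg kern_nonneg s) auto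

lemma m2_mono: "r <= r' ==> m2 TYPE('a) s r <= m2 TYPE('a) s r'"
 unfolding m2_def
 by (intro Bochner_Integration.integral_mono integrable_kern_inner) (auto intro!: kern_nonneg s mult_nonneg_nonneg split: split_indicator)

lemma m2_small: assumes "0 < \<delta>" shows "\<exists>r>0. \<forall>eps\<le>r. m2 TYPE('a) s eps <= \<delta>"
proof -
 let ?f = "%n::nat. %y::'a. indicator (cball 0 (1 / real (Suc n))) y * ((norm y)^2 * kern s y)"
 have "(%n. (LBINT y. ?f n y)) \<longlonglongrightarrow> (\<integral>y. (0::real) \<partial>(lborel :: 'a measure))"
 proof (rule integral_dominated_convergence[where w = "%y. indicator (cball 0 1) y * ((norm y)^2 * kern s y)"])
  show "AE y in lborel. (%n. ?f n y) \<longlonglongrightarrow> 0"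
  proof (rule AE_I2)
   fix y :: 'a
   have "eventually (%n. ?f n y = 0) sequentially"
   proof (cases "y = 0")
    case False
    then obtain N where N: "1 / real (Suc N) < norm y" using nat_approx_posE[of "norm y"] by auto
    show ?thesis
    proof (rule eventually_sequentiallyI)
     fix n assume "N <= n"
     then have "1 / real (Suc n) <= 1 / real (Suc N)" by (intro divide_left_mono) auto
     then show "?f n y = 0" using N by auto
    qed
   qed auto
   then show "(%n. ?f n y) \<longlonglongrightarrow> 0" by (rule tendsto_eventually)
  qed
  show "AE y in lborel. norm (?f n y) <= indicator (cball 0 1) y * ((norm y)^2 * kern s y)" for n
  proof (rule AE_I2)
   fix y :: 'a
   have n: "1 / real (Suc n) <= 1" by simp
   have "norm y <= 1" if "norm y <= 1 / real (Suc n)" using that n by (rule order_trans)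
   then show "norm (?f n y) <= indicator (cball 0 1) y * ((norm y)^2 * kern s y)"
    using kern_nonneg[OF s, of y] by (simp add: indicator_def)
  qed
 qed (use integrable_kern_inner_1 in auto)
 then have "eventually (%n. (LBINT y. ?f n y) < \<delta>) sequentially"
  using assms by (intro order_tendstoD) auto
 then obtain n where n: "m2 TYPE('a) s (1 / real (Suc n)) < \<delta>"
  unfolding m2_def by (meson eventually_sequentially order_refl)
 show ?thesis using m2_mono[of _ "1 / real (Suc n)"] n by (intro exI[of _ "1 / real (Suc n)"]) fastforce
qed

lemma sets_jump_kernel [simp]: "sets (jump_kernel s eps :: 'a measure) = sets borel"
 by (simp add: jump_kernel_def)

lemma symmetric_jumps_jump_kernel:
 assumes e: "0 < eps" shows "symmetric_jumps (jump_kernel s eps :: 'a measure)"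
proof (intro symmetric_jumps.intro finite_measureI symmetric_jumps_axioms.intro)
 have "emeasure (jump_kernel s eps :: 'a measure) (space (jump_kernel s eps)) = (NN y. ennreal (indicator {y. eps < norm y} y * kern s (y::'a)))"
  unfolding jump_kernel_def by (subst emeasure_density) (auto intro!: nn_integral_cong)
 also have "... < \<infinity>" using integrable_kern_outer[OF e]
  by (subst nn_integral_eq_integral) (auto intro!: AE_I2 kern_nonneg s mult_nonneg_nonneg)
 finally show "emeasure (jump_kernel s eps :: 'a measure) (space (jump_kernel s eps)) \<noteq> \<infinity>" by simp
 have "density lborel (%y::'a. ennreal (indicator {y. eps < norm y} y * kern s y))
  = density (distr lborel borel uminus) (%y::'a. ennreal (indicator {y. eps < norm y} y * kern s y))"
  by (simp add: lborel_distr_uminus_euclidean)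
 also have "... = distr (density lborel (%y::'a. ennreal (indicator {y. eps < norm y} (- y) * kern s (- y)))) borel uminus"
  by (subst density_distr) auto
 also have "(%y::'a. ennreal (indicator {y. eps < norm y} (- y) * kern s (- y))) = (%y. ennreal (indicator {y. eps < norm y} y * kern s y))"
  by (auto simp: kern_minus split: split_indicator)
 finally show "distr (jump_kernel s eps :: 'a measure) borel uminus = jump_kernel s eps"
  by (simp add: jump_kernel_def)
qed simp

lemma integral_jump_kernel:
 fixes phi :: "'a => real"
 assumes [measurable]: "phi : borel_funs"
 shows "(\<integral>y. phi y \<partial>jump_kernel s eps) = (LBINT y. indicator {y. eps < norm y} y * kern s y * phi y)"
 unfolding jump_kernel_def by (subst integral_density) (auto intro!: AE_I2 kern_nonneg s mult_nonneg_nonneg)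

lemma integrable_jump_kernel:
 fixes phi :: "'a => real"
 assumes [measurable]: "phi : borel_funs"
 shows "integrable (jump_kernel s eps) phi \<longleftrightarrow> Leb1 (%y. indicator {y. eps < norm y} y * kern s y * phi y)"
 unfolding jump_kernel_def by (subst integrable_density) (auto intro!: AE_I2 kern_nonneg s mult_nonneg_nonneg)

lemma measure_jump_kernel:
 fixes A :: "'a set" assumes [measurable]: "A : sets borel" and e: "0 < eps"
 shows "measure (jump_kernel s eps) A = (LBINT y. indicator {y. eps < norm y} y * kern s y * indicator A y)"
proof -
 interpret symmetric_jumps "jump_kernel s eps :: 'a measure" by (rule symmetric_jumps_jump_kernel[OF e])
 have "measure (jump_kernel s eps) A = (\<integral>y. indicator A y \<partial>jump_kernel s eps)" by simp
 also have "... = (LBINT y. indicator {y. eps < norm y} y * kern s y * indicator A y)"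
  by (rule integral_jump_kernel) measurable
 finally show ?thesis .
qed

lemma rate_small: assumes "0 < \<delta>" shows "\<exists>R>0. measure (jump_kernel s R :: 'a measure) UNIV <= \<delta>"
proof -
 let ?f = "%n::nat. %y::'a. indicator {y. real (Suc n) < norm y} y * kern s y * indicator UNIV y"
 have "(%n. (LBINT y. ?f n y)) \<longlonglongrightarrow> (\<integral>y. (0::real) \<partial>(lborel :: 'a measure))"
 proof (rule integral_dominated_convergence[where w = "%y. indicator {y. 1 < norm y} y * kern s y"])
  show "AE y in lborel. (%n. ?f n y) \<longlonglongrightarrow> 0"
  proof (rule AE_I2)
   fix y :: 'a
   obtain N where N: "norm y < real N" using reals_Archimedean2 by blast
   have "eventually (%n. ?f n y = 0) sequentially"
    by (rule eventually_sequentiallyI[of N]) (use N in auto)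
   then show "(%n. ?f n y) \<longlonglongrightarrow> 0" by (rule tendsto_eventually)
  qed
  show "AE y in lborel. norm (?f n y) <= indicator {y. 1 < norm y} y * kern s y" for n
   using kern_nonneg[OF s] by (intro AE_I2) (auto split: split_indicator)
 qed (use integrable_kern_outer_1 in auto)
 then have "eventually (%n. (LBINT y. ?f n y) < \<delta>) sequentially"
  using assms by (intro order_tendstoD) auto
 then obtain n where "(LBINT y. ?f n y) < \<delta>"
  by (meson eventually_sequentially order_refl)
 then show ?thesis
  using measure_jump_kernel[of UNIV "real (Suc n)"] by (intro exI[of _ "real (Suc n)"]) auto
qed

text \<open>Both sides are the same Lebesgue integral after a translation, so the identity holds
  even if that integral does not exist, when both are 0. Hence measurability of \<open>phi\<close>
  suffices.\<close>

lemma frac_lap_trunc_eq_jump: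
 assumes [measurable]: "phi : borel_funs"
 shows "frac_lap_trunc s eps phi (x::'a) = - jump (jump_kernel s eps) phi x"
proof -
 let ?h = "%y. indicator {y. eps < norm (y - x)} y *\<^sub>R ((phi x - phi y) / norm (y - x) powr (real DIM('a) + 2 * s))"
 have "frac_lap_trunc s eps phi x = frac_lap_const TYPE('a) s * (LBINT y. ?h y)"
  unfolding frac_lap_trunc_def set_lebesgue_integral_def by (subst integral_completion) auto
 also have "(LBINT y. ?h y) = (LBINT y. ?h (x + y))" by (rule lborel_integral_shift[symmetric]) measurable
 also have "frac_lap_const TYPE('a) s * ... = (LBINT y. - (indicator {y. eps < norm y} y * kern s y * (phi (x + y) - phi x)))"
  unfolding integral_mult_right_zero[symmetric]
  by (intro Bochner_Integration.integral_cong)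
   (auto simp: kern_inverse divide_inverse algebra_simps split: split_indicator)
 also have "... = - jump (jump_kernel s eps) phi x"
  unfolding jump_def by (subst integral_jump_kernel) auto
 finally show ?thesis .
qed

lemma integrable_second_difference:
 assumes b: "c11_bound M B D (phi :: 'a => real)" and [measurable]: "A : sets borel"
 shows "Leb1 (%y. indicator A y * kern s y * (phi (x + y) + phi (x - y) - 2 * phi x))"
proof (rule Bochner_Integration.integrable_bound)
 have [measurable]: "phi : borel_funs" by (rule c11_bound_borel[OF b])
 show "(%y. indicator A y * kern s y * (phi (x + y) + phi (x - y) - 2 * phi x)) : borel_measurable lborel"
  by measurable
 show "Leb1 (%y::'a. (4 * M) * (indicator {y. 1 < norm y} y * kern s y) + D * (indicator (cball 0 1) y * ((norm y)^2 * kern s y)))"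
  by (intro Bochner_Integration.integrable_add integrable_mult_right integrable_kern_outer_1 integrable_kern_inner_1)
 note nn = c11_bound_nonneg[OF b]
 have "\<bar>indicator A y * kern s y * (phi (x + y) + phi (x - y) - 2 * phi x)\<bar> <=
   \<bar>(4 * M) * (indicator {y. 1 < norm y} y * kern s y) + D * (indicator (cball 0 1) y * ((norm y)^2 * kern s y))\<bar>" for y :: 'a
 proof -
  have k: "0 <= kern s y" by (rule kern_nonneg[OF s])
  have "\<bar>indicator A y * kern s y * (phi (x + y) + phi (x - y) - 2 * phi x)\<bar> <= kern s y * \<bar>phi (x + y) + phi (x - y) - 2 * phi x\<bar>"
   using k by (auto simp: abs_mult split: split_indicator)
  also have "... <= (4 * M) * (indicator {y. 1 < norm y} y * kern s y) + D * (indicator (cball 0 1) y * ((norm y)^2 * kern s y))"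
  proof (cases "1 < norm y")
   case True
   have "\<bar>phi (x + y) + phi (x - y) - 2 * phi x\<bar> <= 4 * M"
    using c11_boundD(1)[OF b, of "x + y"] c11_boundD(1)[OF b, of "x - y"] c11_boundD(1)[OF b, of x] by linarith
   from mult_left_mono[OF this k] show ?thesis using True by (simp add: mult_ac)
  next
   case False
   then show ?thesis using mult_left_mono[OF c11_boundD(3)[OF b, of x y] k] by (simp add: mult_ac)
  qed
  finally show ?thesis by linarith
 qed
 then show "AE y in lborel. norm (indicator A y * kern s y * (phi (x + y) + phi (x - y) - 2 * phi x)) <=
   norm ((4 * M) * (indicator {y. 1 < norm y} y * kern s y) + D * (indicator (cball 0 1) y * ((norm y)^2 * kern s y)))"
  by auto
qed

text \<open>The fractional Laplacian without principal value: symmetrised in \<open>y\<close>, the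
  integral converges absolutely for functions with bounded second differences.\<close>

definition full_lap :: "('a => real) => 'a => real" where
 "full_lap phi x = - (LBINT y. kern s y * (phi (x + y) + phi (x - y) - 2 * phi x)) / 2"

lemma jump_eq_second_difference:
 assumes b: "c11_bound M B D (phi :: 'a => real)" and e: "0 < eps"
 shows "jump (jump_kernel s eps) phi x = (LBINT y. indicator {y. eps < norm y} y * kern s y * (phi (x + y) + phi (x - y) - 2 * phi x)) / 2"
proof -
 interpret symmetric_jumps "jump_kernel s eps :: 'a measure" by (rule symmetric_jumps_jump_kernel[OF e])
 have [measurable]: "phi : borel_funs" by (rule c11_bound_borel[OF b])
 have "2 * jump (jump_kernel s eps) phi x = (\<integral>y. phi (x + y) + phi (x - y) - 2 * phi x \<partial>jump_kernel s eps)"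
  using c11_boundD(1)[OF b] by (intro jump_second_difference) auto
 then show ?thesis by (subst (asm) integral_jump_kernel) auto
qed

lemma second_difference_integral_le:
 assumes b: "c11_bound M B D (phi :: 'a => real)" and A: "A : sets borel" "A \<subseteq> cball 0 r"
 shows "\<bar>(LBINT y. indicator A y * kern s y * (phi (x + y) + phi (x - y) - 2 * phi x))\<bar> <= D * m2 TYPE('a) s r"
proof -
 have "\<bar>(LBINT y. indicator A y * kern s y * (phi (x + y) + phi (x - y) - 2 * phi x))\<bar>
  <= (LBINT y. \<bar>indicator A y * kern s y * (phi (x + y) + phi (x - y) - 2 * phi x)\<bar>)"
  by (rule integral_abs_bound)
 also have "... <= (LBINT y. D * (indicator (cball (0::'a) r) y * ((norm y)^2 * kern s y)))"
 proof (rule Bochner_Integration.integral_mono)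
  show "Leb1 (%y. \<bar>indicator A y * kern s y * (phi (x + y) + phi (x - y) - 2 * phi x)\<bar>)"
   using integrable_second_difference[OF b A(1)] by auto
  show "Leb1 (%y::'a. D * (indicator (cball 0 r) y * ((norm y)^2 * kern s y)))"
   by (intro integrable_mult_right integrable_kern_inner)
  fix y :: 'a
  have k: "0 <= kern s y" by (rule kern_nonneg[OF s])
  show "\<bar>indicator A y * kern s y * (phi (x + y) + phi (x - y) - 2 * phi x)\<bar> <= D * (indicator (cball 0 r) y * ((norm y)^2 * kern s y))"
  proof (cases "y : A")
   case True
   then show ?thesis using mult_left_mono[OF c11_boundD(3)[OF b, of x y] k] A k by (simp add: abs_mult mult_ac subset_iff)
  qed (use k c11_bound_nonneg[OF b] in auto)
 qed
 finally show ?thesis by (simp add: m2_def)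
qed

text \<open>The two operators differ by the jumps of length at most \<open>eps\<close>, on which the
  second difference is at most \<open>D |y|^2\<close>. The bound is uniform in \<open>x\<close>, so
  it can be inserted in maximum principle arguments, and it requires a \<open>D\<close> that is
  known before \<open>eps\<close>.\<close>

lemma jump_kernel_error:
 assumes b: "c11_bound M B D (phi :: 'a => real)" and e: "0 < eps"
 shows "\<bar>full_lap phi x + jump (jump_kernel s eps) phi x\<bar> <= D * m2 TYPE('a) s eps"
proof -
 let ?d = "%y. phi (x + y) + phi (x - y) - 2 * phi x"
 have "- full_lap phi x - jump (jump_kernel s eps) phi x
  = ((LBINT y. indicator UNIV y * kern s y * ?d y) - (LBINT y. indicator {y. eps < norm y} y * kern s y * ?d y)) / 2"
  unfolding full_lap_def jump_eq_second_difference[OF b e] by (simp add: field_simps)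
 also have "... = (LBINT y. indicator UNIV y * kern s y * ?d y - indicator {y. eps < norm y} y * kern s y * ?d y) / 2"
  using Bochner_Integration.integral_diff[OF integrable_second_difference[OF b, of UNIV x] integrable_second_difference[OF b, of "{y. eps < norm y}" x]]
  by simp
 also have "... = (LBINT y. indicator (cball 0 eps) y * kern s y * ?d y) / 2"
  by (intro arg_cong[where f = "%x. x / 2"] Bochner_Integration.integral_cong) (auto split: split_indicator)
 finally have "full_lap phi x + jump (jump_kernel s eps) phi x = - ((LBINT y. indicator (cball 0 eps) y * kern s y * ?d y) / 2)"
  by linarith
 then show ?thesis using second_difference_integral_le[OF b, of "cball 0 eps" eps x]
  mult_nonneg_nonneg[OF c11_bound_nonneg(3)[OF b] m2_nonneg[of eps]] by (simp add: abs_divide)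
qed

lemma c11_has_frac_lap:
 assumes b: "c11_bound M B D (phi :: 'a => real)"
 shows "has_frac_lap s phi x (full_lap phi x)" "frac_lap s phi x = full_lap phi x"
proof -
 have [measurable]: "phi : borel_funs" by (rule c11_bound_borel[OF b])
 show *: "has_frac_lap s phi x (full_lap phi x)"
  unfolding has_frac_lap_def
 proof (rule tendstoI)
  fix \<delta> :: real assume d: "0 < \<delta>"
  have D: "0 <= D" by (rule c11_bound_nonneg[OF b])
  obtain r where r: "r > 0" "!!eps. eps <= r ==> m2 TYPE('a) s eps <= \<delta> / (D + 1)"
   using m2_small[of "\<delta> / (D + 1)"] d D by auto
  have "dist (frac_lap_trunc s eps phi x) (full_lap phi x) < \<delta>" if "0 < eps" "eps < r" for eps
  proof -
   have "D * m2 TYPE('a) s eps <= D * (\<delta> / (D + 1))" using that r D by (intro mult_left_mono) auto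
   also have "... < \<delta>" using d D by (simp add: field_simps)
   finally show ?thesis using jump_kernel_error[OF b that(1), of x]
    by (simp add: frac_lap_trunc_eq_jump dist_real_def abs_minus_commute)
  qed
  then show "eventually (%eps. dist (frac_lap_trunc s eps phi x) (full_lap phi x) < \<delta>) (at_right 0)"
   using r(1) unfolding eventually_at_right_field by blast
 qed
 then show "frac_lap s phi x = full_lap phi x"
  unfolding frac_lap_def has_frac_lap_def by (intro tendsto_Lim) auto
qed

text \<open>Jumps shorter than \<open>r\<close> are estimated by second differences, longer ones by
  the sup norm. The bound does not depend on \<open>eps\<close>, and the free radius
  \<open>r\<close> allows the two terms to be balanced.\<close>

lemma jump_kernel_bound:
 assumes b: "c11_bound M B D (phi :: 'a => real)" and e: "0 < eps" and r: "0 < r"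
 shows "\<bar>jump (jump_kernel s eps) phi x\<bar> <= D * m2 TYPE('a) s r + 2 * M * measure (jump_kernel s r :: 'a measure) UNIV"
proof -
 let ?d = "%y. phi (x + y) + phi (x - y) - 2 * phi x"
 note nn = c11_bound_nonneg[OF b]
 let ?A = "{y::'a. eps < norm y} \<inter> cball 0 r" and ?B = "{y::'a. eps < norm y} \<inter> {y. r < norm y}"
 have "2 * jump (jump_kernel s eps) phi x
  = (LBINT y. indicator ?A y * kern s y * ?d y + indicator ?B y * kern s y * ?d y)"
  unfolding jump_eq_second_difference[OF b e]
  by (simp, intro Bochner_Integration.integral_cong) (auto split: split_indicator)
 also have "... = (LBINT y. indicator ?A y * kern s y * ?d y) + (LBINT y. indicator ?B y * kern s y * ?d y)"
  by (rule Bochner_Integration.integral_add) (auto intro!: integrable_second_difference[OF b])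
 finally have 1: "2 * jump (jump_kernel s eps) phi x = ..." .
 have 2: "\<bar>(LBINT y. indicator ?A y * kern s y * ?d y)\<bar> <= D * m2 TYPE('a) s r"
  by (rule second_difference_integral_le[OF b]) auto
 have "\<bar>(LBINT y. indicator ?B y * kern s y * ?d y)\<bar> <= (LBINT y. \<bar>indicator ?B y * kern s y * ?d y\<bar>)"
  by (rule integral_abs_bound)
 also have "... <= (LBINT y. (4 * M) * (indicator {y::'a. r < norm y} y * kern s y))"
 proof (rule Bochner_Integration.integral_mono)
  show "Leb1 (%y. \<bar>indicator ?B y * kern s y * ?d y\<bar>)"
   by (rule integrable_abs) (rule integrable_second_difference[OF b], measurable)
  show "Leb1 (%y::'a. (4 * M) * (indicator {y. r < norm y} y * kern s y))"
   by (intro integrable_mult_right integrable_kern_outer r)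
  fix y :: 'a
  have k: "0 <= kern s y" by (rule kern_nonneg[OF s])
  have "\<bar>?d y\<bar> <= 4 * M"
   using c11_boundD(1)[OF b, of "x + y"] c11_boundD(1)[OF b, of "x - y"] c11_boundD(1)[OF b, of x] by linarith
  then show "\<bar>indicator ?B y * kern s y * ?d y\<bar> <= (4 * M) * (indicator {y. r < norm y} y * kern s y)"
   using mult_left_mono[of "\<bar>?d y\<bar>" "4 * M", OF _ k] k nn by (auto simp: abs_mult mult.commute split: split_indicator)
 qed
 also have "... = 4 * M * measure (jump_kernel s r :: 'a measure) UNIV"
  by (simp add: measure_jump_kernel[OF _ r])
 finally have 3: "\<bar>(LBINT y. indicator ?B y * kern s y * ?d y)\<bar> <= 4 * M * measure (jump_kernel s r :: 'a measure) UNIV" .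
 have "2 * \<bar>jump (jump_kernel s eps) phi x\<bar> <= D * m2 TYPE('a) s r + 4 * M * measure (jump_kernel s r :: 'a measure) UNIV"
  using 1 2 3 by linarith
 then show ?thesis using mult_nonneg_nonneg[OF nn(3) m2_nonneg[of r]] by linarith
qed

end

subsection \<open>Semilinear jump equations\<close>

text \<open>Meant for the Duhamel integral over \<open>{0..t}\<close>, whose integrand is
  discontinuous in \<open>t\<close> at the single point \<open>sig = t\<close>.\<close>

lemma continuous_on_param_integral_AE:
 fixes F :: "'p::metric_space => 'd => real"
 assumes fin: "finite_measure M" and meas: "!!p. p : S ==> F p : borel_measurable M"
  and bdd: "!!p y. p : S ==> \<bar>F p y\<bar> <= B"
  and cont: "!!p. p : S ==> AE y in M. continuous (at p within S) (%p. F p y)"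
 shows "continuous_on S (%p. \<integral>y. F p y \<partial>M)"
 unfolding continuous_on_sequentially o_def
proof (intro allI ballI impI)
 fix X a assume a: "a : S" and X: "(\<forall>n. X n : S) & X \<longlonglongrightarrow> a"
 show "(%n. \<integral>y. F (X n) y \<partial>M) \<longlonglongrightarrow> (\<integral>y. F a y \<partial>M)"
 proof (rule integral_dominated_convergence[where w = "%_. B"])
  show "integrable M (%_. B)" using fin by (rule finite_measure.integrable_const)
  show "AE y in M. (%n. F (X n) y) \<longlonglongrightarrow> F a y"
   using cont[OF a] by eventually_elim (use X in "auto simp: continuous_within_sequentially o_def")
 qed (use meas bdd a X in auto)
qed

text \<open>Continuity and boundedness are required for all real times although the equation is only
  posed on \<open>{0<..<T}\<close>. This keeps restrictions out of the measurability arguments;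
  solutions are constructed with time frozen outside \<open>{0..T}\<close>, by
  \<open>tclamp\<close>.\<close>

definition jump_solution :: "'a::euclidean_space measure => (real => 'a => real => real) => real => (real => 'a => real) => bool" where
 "jump_solution kappa b T w \<longleftrightarrow> continuous_on UNIV (%(t, x). w t x) & (\<exists>C. \<forall>t x. \<bar>w t x\<bar> <= C) \<and>
  (\<forall>t\<in>{0<..<T}. \<forall>x. ((%tau. w tau x) has_real_derivative jump kappa (w t) x - b t x (w t x)) (at t))"

lemma integral_exp_lborel:
 fixes f F :: "real => real"
 assumes t: "0 <= t" and der: "!!x. (F has_real_derivative f x) (at x)" and cont: "continuous_on UNIV f"
 shows "(LBINT x. indicator {0..t} x * f x) = F t - F 0" "Leb1 (%x. indicator {0..t} x * f x)"
proof -
 have "(LBINT x. indicator {0..t} x *\<^sub>R f x) = F t - F 0"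
 proof (rule integral_FTC_atLeastAtMost[OF t])
  show "(F has_vector_derivative f x) (at x within {0..t})" for x
   using has_field_derivative_at_within[OF der] unfolding has_real_derivative_iff_has_vector_derivative .
  show "continuous_on {0..t} f" using cont by (rule continuous_on_subset) simp
 qed
 then show "(LBINT x. indicator {0..t} x * f x) = F t - F 0" by simp
 have "set_integrable lborel {0..t} f"
  unfolding set_integrable_def by (rule borel_integrable_compact) (use cont in "auto intro: continuous_on_subset")
 then show "Leb1 (%x. indicator {0..t} x * f x)" by (simp add: set_integrable_def)
qed

section \<open>Existence for semilinear jump equations through the mild formulation\<close>

locale jump_equation = symmetric_jumps kappa for kappa :: "'a::euclidean_space measure" +
 fixes b :: "real => 'a => real => real" and K T N N1 W B0 :: real and w0 :: "'a => real"
 assumes T: "0 < T" and K: "0 <= K"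
  and b_cont: "continuous_on UNIV (%(t, x, r). b t x r)"
  and b_mono: "!!t x r r'. r <= r' ==> b t x r <= b t x r'"
  and b_lip: "!!t x r r'. r <= r' ==> b t x r' - b t x r <= K * (r' - r)"
  and b_bdd: "!!t x. \<bar>b t x 0\<bar> <= N"
  and b_int: "!!t. (NN x. ennreal \<bar>b t x 0\<bar>) <= ennreal N1" and N1: "0 <= N1"
  and w0_cont: "continuous_on UNIV w0" and w0_bdd: "!!x. \<bar>w0 x\<bar> <= W"
  and w0_int: "(NN x. ennreal \<bar>w0 x\<bar>) <= ennreal B0" and B0: "0 <= B0"
begin

text \<open>The equation is read as \<open>w' + Lam w = src\<close>: the whole loss term
  \<open>rate w\<close>, and \<open>K w\<close> added on both sides, go to the left. Then
  \<open>src\<close> is Lipschitz in \<open>psi\<close> with the same constant \<open>Lam\<close>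
  that damps on the left.\<close>

definition "Lam = rate + K"

lemma Lam: "0 <= Lam" using K by (simp add: Lam_def)

definition "src psi sig x = (\<integral>y. psi (sig, x + y) \<partial>kappa) + K * psi (sig, x) - b sig x (psi (sig, x))"

definition "tclamp t = max 0 (min T t)"

lemma tclamp: "0 <= tclamp t" "tclamp t <= T" "0 <= t ==> t <= T ==> tclamp t = t"
 using T by (auto simp: tclamp_def)

definition "mild psi p = exp (- Lam * tclamp (fst p)) * w0 (snd p) +
 (LBINT sig. indicator {0..tclamp (fst p)} sig * (exp (- Lam * (tclamp (fst p) - sig)) * src psi sig (snd p)))"

lemma absorb_bound: "\<bar>K * r - b t x r\<bar> <= K * \<bar>r\<bar> + \<bar>b t x 0\<bar>"
 using b_mono[of 0 r t x] b_mono[of r 0 t x] b_lip[of 0 r t x] b_lip[of r 0 t x] K by (cases "r \<ge> 0") auto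

text \<open>The increments of \<open>b\<close> in \<open>r\<close> lie between 0 and
  \<open>K\<close> times those of \<open>r\<close>, hence so do the increments of
  \<open>K r - b\<close>. No factor 2 is lost, and this is what makes the fixed point map a
  contraction.\<close>

lemma absorb_lip: "\<bar>(K * r - b t x r) - (K * r' - b t x r')\<bar> <= K * \<bar>r - r'\<bar>"
 using b_mono[of r' r t x] b_mono[of r r' t x] b_lip[of r' r t x] b_lip[of r r' t x]
 by (cases "r' <= r") (auto simp: algebra_simps)

lemma b_continuous_on:
 assumes "continuous_on S f" "continuous_on S g" "continuous_on S h"
 shows "continuous_on S (%p. b (f p) (g p) (h p))"
 using continuous_on_compose2[OF b_cont continuous_on_Pair[OF assms(1) continuous_on_Pair[OF assms(2,3)]]]
 by simp

context
 fixes psi :: "real \<times> 'a => real" and C :: real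
 assumes psi_cont: "continuous_on UNIV psi" and psi_bdd: "!!p. \<bar>psi p\<bar> <= C"
begin

lemma psi_comp: "continuous_on S f ==> continuous_on S (%p. psi (f p))"
 using continuous_on_compose2[OF psi_cont] by auto

lemma src_cont: "continuous_on UNIV (%p. src psi (fst p) (snd p))"
proof -
 have "continuous_on UNIV (%p. \<integral>y. psi (fst p, snd p + y) \<partial>kappa)"
 proof (rule continuous_on_param_integral[where B = C])
  show "finite_measure kappa" by unfold_locales
  show "(%y. psi (fst p, snd p + y)) : borel_measurable kappa" for p
  proof -
   have "(%y. psi (fst p, snd p + y)) : borel_funs"
    by (intro borel_measurable_continuous_onI psi_comp continuous_intros)
   then show ?thesis by simp
  qed
  show "continuous_on UNIV (%p. psi (fst p, snd p + y))" for y
   by (intro psi_comp continuous_intros)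
 qed (rule psi_bdd)
 then show ?thesis unfolding src_def by (intro continuous_intros psi_comp b_continuous_on)
qed

lemma src_comp: "continuous_on S f ==> continuous_on S g ==> continuous_on S (%p. src psi (f p) (g p))"
 using continuous_on_compose2[OF src_cont, of S "%p. (f p, g p)"] by (auto intro!: continuous_intros)

lemma integrable_psi: "integrable kappa (%y. psi (sig, x + y))"
proof (rule integrable_bounded[of _ C])
 show "(%y. psi (sig, x + y)) : borel_funs"
  by (intro borel_measurable_continuous_onI psi_comp continuous_intros)
qed (rule psi_bdd)

lemma src_bound: "\<bar>src psi sig x\<bar> <= Lam * C + N"
proof -
 have "\<bar>\<integral>y. psi (sig, x + y) \<partial>kappa\<bar> <= (\<integral>y. \<bar>psi (sig, x + y)\<bar> \<partial>kappa)" by (rule integral_abs_bound)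
 also have "... <= (\<integral>y. C \<partial>kappa)"
  using integrable_psi psi_bdd by (intro Bochner_Integration.integral_mono) auto
 finally have 1: "\<bar>\<integral>y. psi (sig, x + y) \<partial>kappa\<bar> <= rate * C" by simp
 have "K * \<bar>psi (sig, x)\<bar> <= K * C" using psi_bdd K by (intro mult_left_mono)
 then have 2: "\<bar>K * psi (sig, x) - b sig x (psi (sig, x))\<bar> <= K * C + N"
  using absorb_bound[of "psi (sig, x)" sig x] b_bdd[of sig x] by linarith
 have "\<bar>src psi sig x\<bar> <= \<bar>\<integral>y. psi (sig, x + y) \<partial>kappa\<bar> + \<bar>K * psi (sig, x) - b sig x (psi (sig, x))\<bar>"
  unfolding src_def by linarith
 also have "... <= rate * C + (K * C + N)" using 1 2 by (rule add_mono)
 finally show ?thesis by (simp add: Lam_def algebra_simps)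
qed

lemma src_borel: "(%sig. src psi sig x) : borel_funs"
 by (intro borel_measurable_continuous_onI src_comp continuous_intros)

lemma mild_cont: "continuous_on UNIV (mild psi)"
proof -
 let ?M = "density lborel (indicator {0..T}) :: real measure"
 let ?F = "%p sig. indicator {0..tclamp (fst p)} sig * (exp (- Lam * (tclamp (fst p) - sig)) * src psi sig (snd p))"
 have tclamp_cont: "continuous_on S (%p. tclamp (f p))" if "continuous_on S f" for S :: "('b::topological_space) set" and f
  unfolding tclamp_def by (intro continuous_intros that)
 have N: "0 <= Lam * C + N" using src_bound abs_ge_zero order_trans by blast
 \<comment> \<open>The integral is rewritten over one fixed finite measure, so that dominated
   convergence with a constant majorant applies. For given \<open>p\<close>, continuity of the
   integrand can fail only at \<open>sig = tclamp (fst p)\<close>.\<close>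
 have eq: "(LBINT sig. ?F p sig) = (\<integral>sig. ?F p sig * indicator {0..T} sig \<partial>?M)" for p
 proof -
  have [measurable]: "(%sig. src psi sig x) : borel_funs" for x by (rule src_borel)
  have "(\<integral>sig. ?F p sig * indicator {0..T} sig \<partial>?M) = (LBINT sig. indicator {0..T} sig *\<^sub>R (?F p sig * indicator {0..T} sig))"
   unfolding ennreal_indicator[symmetric] by (rule integral_density) auto
  also have "... = (LBINT sig. ?F p sig)"
   using tclamp(1,2)[of "fst p"] by (intro Bochner_Integration.integral_cong) (auto simp: indicator_def)
  finally show ?thesis ..
 qed
 have "continuous_on UNIV (%p. \<integral>sig. ?F p sig * indicator {0..T} sig \<partial>?M)"
 proof (rule continuous_on_param_integral_AE[where B = "Lam * C + N"])
  show "finite_measure ?M" using T by (intro finite_measureI) (simp add: emeasure_density)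
  show "(%sig. ?F p sig * indicator {0..T} sig) : borel_measurable ?M" for p
   using src_borel by measurable
  show "\<bar>?F p sig * indicator {0..T} sig\<bar> <= Lam * C + N" for p sig
  proof (cases "sig : {0..tclamp (fst p)} & sig : {0..T}")
   case True
   have "exp (- Lam * (tclamp (fst p) - sig)) <= 1" using True Lam by (simp add: mult_nonneg_nonneg)
   then have "\<bar>exp (- Lam * (tclamp (fst p) - sig)) * src psi sig (snd p)\<bar> <= 1 * (Lam * C + N)"
    unfolding abs_mult using src_bound by (intro mult_mono) auto
   then show ?thesis using True by simp
  qed (use N in auto)
  show "AE sig in ?M. continuous (at p within UNIV) (%p. ?F p sig * indicator {0..T} sig)" for p
  proof -
   have "AE sig in lborel. sig \<noteq> tclamp (fst p)" by (rule AE_lborel_singleton)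
   then have "AE sig in lborel. (0::ennreal) < indicator {0..T} sig --> continuous (at p within UNIV) (%p. ?F p sig * indicator {0..T} sig)"
   proof eventually_elim
    case (elim sig)
    let ?G = "%p. exp (- Lam * (tclamp (fst p) - sig)) * src psi sig (snd p)"
    have G: "continuous_on UNIV ?G" by (intro continuous_intros tclamp_cont src_comp)
    have cc: "continuous_on UNIV (%p::real \<times> 'a. tclamp (fst p))" by (intro tclamp_cont continuous_intros)
    show ?case
    proof
     assume "(0::ennreal) < indicator {0..T} sig"
     then have s: "0 <= sig" "sig <= T" by (auto split: split_indicator_asm)
     consider "tclamp (fst p) < sig" | "sig < tclamp (fst p)" using elim by linarith
     then show "continuous (at p within UNIV) (%p. ?F p sig * indicator {0..T} sig)"
     proof cases
      case 1
      have op: "open {p::real \<times> 'a. tclamp (fst p) < sig}" by (intro open_Collect_less cc continuous_intros)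
      have "continuous_on {p::real \<times> 'a. tclamp (fst p) < sig} (%p. ?F p sig * indicator {0..T} sig)"
       by (rule continuous_on_cong[THEN iffD2, OF refl _ continuous_on_const[of _ 0]]) auto
      from bspec[OF continuous_on_eq_continuous_at[OF op, THEN iffD1, OF this], of p] 1 show ?thesis by simp
     next
      case 2
      have op: "open {p::real \<times> 'a. sig < tclamp (fst p)}" by (intro open_Collect_less cc continuous_intros)
      have "continuous_on {p::real \<times> 'a. sig < tclamp (fst p)} (%p. ?F p sig * indicator {0..T} sig)"
       by (rule continuous_on_cong[THEN iffD2, OF refl _ continuous_on_subset[OF G]]) (use s in auto)
      from bspec[OF continuous_on_eq_continuous_at[OF op, THEN iffD1, OF this], of p] 2 show ?thesis by simp
     qed
    qed
   qed
   then show ?thesis by (subst AE_density) auto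
  qed
 qed
 then have "continuous_on UNIV (%p. (LBINT sig. ?F p sig))" unfolding eq .
 moreover have "continuous_on UNIV (%p. w0 (snd p))"
  using continuous_on_compose2[OF w0_cont continuous_on_snd[OF continuous_on_id]] by simp
 ultimately show ?thesis unfolding mild_def[abs_def] by (intro continuous_intros tclamp_cont)
qed

lemma mild_integrand_integrable:
 fixes x :: 'a
 shows "Leb1 (%sig. indicator {0..t} sig * (exp (- Lam * (t - sig)) * src psi sig x))"
proof -
 have "set_integrable lborel {0..t} (%sig. exp (- Lam * (t - sig)) * src psi sig x)"
  unfolding set_integrable_def by (rule borel_integrable_compact) (auto intro!: continuous_intros src_comp)
 then show ?thesis by (simp add: set_integrable_def)
qed

lemma exp_weight:
 assumes "0 <= t"
 shows "(LBINT sig. indicator {0..t} sig * (exp (- Lam * (t - sig)) * Lam)) = 1 - exp (- Lam * t)"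
  "Leb1 (%sig. indicator {0..t} sig * (exp (- Lam * (t - sig)) * Lam))"
proof -
 have 1: "((%sig. exp (- Lam * (t - sig))) has_real_derivative exp (- Lam * (t - x)) * Lam) (at x)" for x
  by (auto intro!: derivative_eq_intros)
 have 2: "continuous_on UNIV (%sig. exp (- Lam * (t - sig)) * Lam)" by (intro continuous_intros)
 show "(LBINT sig. indicator {0..t} sig * (exp (- Lam * (t - sig)) * Lam)) = 1 - exp (- Lam * t)"
  using integral_exp_lborel(1)[OF assms 1 2] by simp
 show "Leb1 (%sig. indicator {0..t} sig * (exp (- Lam * (t - sig)) * Lam))"
  by (rule integral_exp_lborel(2)[OF assms 1 2])
qed

lemma mild_bdd: "\<exists>C'. \<forall>p. \<bar>mild psi p\<bar> <= C'"
proof (intro exI allI)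
 fix p :: "real \<times> 'a"
 let ?t = "tclamp (fst p)"
 have N: "0 <= Lam * C + N" using src_bound abs_ge_zero order_trans by blast
 have "\<bar>(LBINT sig. indicator {0..?t} sig * (exp (- Lam * (?t - sig)) * src psi sig (snd p)))\<bar>
   <= (LBINT sig. \<bar>indicator {0..?t} sig * (exp (- Lam * (?t - sig)) * src psi sig (snd p))\<bar>)"
  by (rule integral_abs_bound)
 also have "... <= (LBINT sig. indicator {0..T} sig * (Lam * C + N))"
 proof (rule Bochner_Integration.integral_mono)
  show "Leb1 (%sig. \<bar>indicator {0..?t} sig * (exp (- Lam * (?t - sig)) * src psi sig (snd p))\<bar>)"
   by (rule integrable_abs[OF mild_integrand_integrable])
  fix sig
  have "exp (- Lam * (?t - sig)) * \<bar>src psi sig (snd p)\<bar> <= 1 * (Lam * C + N)" if "sig <= ?t"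
   using that src_bound Lam by (intro mult_mono) (auto simp: mult_nonneg_nonneg)
  then show "\<bar>indicator {0..?t} sig * (exp (- Lam * (?t - sig)) * src psi sig (snd p))\<bar> <= indicator {0..T} sig * (Lam * C + N)"
   using tclamp(1,2)[of "fst p"] N by (auto simp: indicator_def abs_mult)
  show "Leb1 (%sig. indicator {0..T} sig * (Lam * C + N))"
   using T by (intro integrable_mult_left) (simp add: integrable_indicator_iff)
 qed
 also have "... = T * (Lam * C + N)" using T by simp
 finally have 1: "\<bar>(LBINT sig. indicator {0..?t} sig * (exp (- Lam * (?t - sig)) * src psi sig (snd p)))\<bar> <= T * (Lam * C + N)" .
 have "exp (- Lam * ?t) * \<bar>w0 (snd p)\<bar> <= 1 * W"
  using w0_bdd tclamp(1) Lam by (intro mult_mono) (auto simp: mult_nonneg_nonneg)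
 then have "\<bar>exp (- Lam * ?t) * w0 (snd p)\<bar> <= W" by (simp add: abs_mult)
 with 1 show "\<bar>mild psi p\<bar> <= W + T * (Lam * C + N)" unfolding mild_def by linarith
qed

end

lemma src_lip:
 assumes p1: "continuous_on UNIV psi1" "!!p. \<bar>psi1 p\<bar> <= C1" and p2: "continuous_on UNIV psi2" "!!p. \<bar>psi2 p\<bar> <= C2"
  and d: "!!p. \<bar>psi1 p - psi2 p\<bar> <= d"
 shows "\<bar>src psi1 sig x - src psi2 sig x\<bar> <= Lam * d"
proof -
 note i1 = integrable_psi[OF p1] and i2 = integrable_psi[OF p2]
 have "\<bar>(\<integral>y. psi1 (sig, x + y) \<partial>kappa) - (\<integral>y. psi2 (sig, x + y) \<partial>kappa)\<bar> = \<bar>\<integral>y. psi1 (sig, x + y) - psi2 (sig, x + y) \<partial>kappa\<bar>"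
  by (subst Bochner_Integration.integral_diff[OF i1 i2]) simp
 also have "... <= (\<integral>y. \<bar>psi1 (sig, x + y) - psi2 (sig, x + y)\<bar> \<partial>kappa)" by (rule integral_abs_bound)
 also have "... <= (\<integral>y. d \<partial>kappa)"
  using i1 i2 d by (intro Bochner_Integration.integral_mono) auto
 finally have 1: "\<bar>(\<integral>y. psi1 (sig, x + y) \<partial>kappa) - (\<integral>y. psi2 (sig, x + y) \<partial>kappa)\<bar> <= rate * d" by simp
 have "K * \<bar>psi1 (sig, x) - psi2 (sig, x)\<bar> <= K * d" using d K by (intro mult_left_mono)
 with 1 absorb_lip[of "psi1 (sig, x)" sig x "psi2 (sig, x)"]
 have "\<bar>src psi1 sig x - src psi2 sig x\<bar> <= rate * d + K * d" unfolding src_def by linarith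
 then show ?thesis by (simp add: Lam_def algebra_simps)
qed

text \<open>The weight \<open>Lam exp (- Lam (t - sig))\<close> has integral
  \<open>1 - exp (- Lam t)\<close>. The factor is below 1 for every \<open>T\<close>, so the fixed
  point is found on the whole interval at once.\<close>

lemma mild_lip:
 assumes p1: "continuous_on UNIV psi1" "!!p. \<bar>psi1 p\<bar> <= C1" and p2: "continuous_on UNIV psi2" "!!p. \<bar>psi2 p\<bar> <= C2"
  and d: "!!p. \<bar>psi1 p - psi2 p\<bar> <= d"
 shows "\<bar>mild psi1 p - mild psi2 p\<bar> <= (1 - exp (- Lam * T)) * d"
proof -
 let ?t = "tclamp (fst p)" and ?x = "snd p"
 have d0: "0 <= d" using d abs_ge_zero order_trans by blast
 note i = mild_integrand_integrable[OF p1, of ?t ?x] mild_integrand_integrable[OF p2, of ?t ?x]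
 have "\<bar>mild psi1 p - mild psi2 p\<bar> = \<bar>(LBINT sig. indicator {0..?t} sig * (exp (- Lam * (?t - sig)) * src psi1 sig ?x)
   - indicator {0..?t} sig * (exp (- Lam * (?t - sig)) * src psi2 sig ?x))\<bar>"
  unfolding mild_def Bochner_Integration.integral_diff[OF i] by simp
 also have "... <= (LBINT sig. \<bar>indicator {0..?t} sig * (exp (- Lam * (?t - sig)) * src psi1 sig ?x)
   - indicator {0..?t} sig * (exp (- Lam * (?t - sig)) * src psi2 sig ?x)\<bar>)"
  by (rule integral_abs_bound)
 also have "... <= (LBINT sig. d * (indicator {0..?t} sig * (exp (- Lam * (?t - sig)) * Lam)))"
 proof (rule Bochner_Integration.integral_mono)
  show "Leb1 (%sig. d * (indicator {0..?t} sig * (exp (- Lam * (?t - sig)) * Lam)))"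
   using exp_weight(2)[OF p1 tclamp(1)] by (rule integrable_mult_right)
  fix sig
  have "\<bar>indicator {0..?t} sig * (exp (- Lam * (?t - sig)) * src psi1 sig ?x)
   - indicator {0..?t} sig * (exp (- Lam * (?t - sig)) * src psi2 sig ?x)\<bar>
   = indicator {0..?t} sig * (exp (- Lam * (?t - sig)) * \<bar>src psi1 sig ?x - src psi2 sig ?x\<bar>)"
   by (simp add: indicator_def abs_mult right_diff_distrib[symmetric])
  also have "... <= indicator {0..?t} sig * (exp (- Lam * (?t - sig)) * (Lam * d))"
   by (intro mult_left_mono src_lip[OF p1 p2 d]) auto
  finally show "\<bar>indicator {0..?t} sig * (exp (- Lam * (?t - sig)) * src psi1 sig ?x)
   - indicator {0..?t} sig * (exp (- Lam * (?t - sig)) * src psi2 sig ?x)\<bar> <= d * (indicator {0..?t} sig * (exp (- Lam * (?t - sig)) * Lam))"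
   by (simp add: mult_ac)
 qed (use i in auto)
 also have "... = d * (1 - exp (- Lam * ?t))" using exp_weight(1)[OF p1 tclamp(1)] by simp
 also have "... <= d * (1 - exp (- Lam * T))"
  using d0 Lam tclamp(2)[of "fst p"] by (intro mult_left_mono) (auto intro: mult_left_mono)
 finally show ?thesis by (simp add: mult.commute)
qed

text \<open>The bound is reproduced exactly because
  \<open>exp (- Lam (t - sig)) (B0 + N1 sig)\<close> is a primitive of the majorant of the source.
  So the functions that satisfy it form an invariant set, and with \<open>N1 = 0\<close> the
  solution never exceeds its initial mass.\<close>

lemma mild_L1:
 assumes p: "continuous_on UNIV psi" "!!p. \<bar>psi p\<bar> <= C"
  and L1: "!!t. 0 <= t ==> t <= T ==> (NN x. ennreal \<bar>psi (t, x)\<bar>) <= ennreal (B0 + N1 * t)"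
  and t: "0 <= t" "t <= T"
 shows "(NN x. ennreal \<bar>mild psi (t, x)\<bar>) <= ennreal (B0 + N1 * t)"
proof -
 have ct: "tclamp t = t" using t by (rule tclamp)
 have [measurable]: "psi : borel_funs" "w0 : borel_funs"
  using p(1) w0_cont by (auto intro: borel_measurable_continuous_onI)
 have [measurable]: "(%x. src psi sig x) : borel_funs" for sig
  by (intro borel_measurable_continuous_onI src_comp[OF p] continuous_intros)
 have "(%p. src psi (snd p) (fst p)) : borel_funs"
  by (intro borel_measurable_continuous_onI src_comp[OF p] continuous_intros)
 then have [measurable]: "(%p. src psi (snd p) (fst p)) : borel_measurable (borel \<Otimes>\<^sub>M borel)" by (simp add: borel_prod)
 have [measurable]: "(%x. b sig x 0) : borel_funs" for sig
  by (intro borel_measurable_continuous_onI b_continuous_on continuous_intros)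
 have [measurable]: "(%x. psi (sig, x)) : borel_funs" for sig
  by (intro borel_measurable_continuous_onI psi_comp[OF p] continuous_intros)
 let ?e = "%sig. exp (- Lam * (t - sig))"
 have rate: "emeasure kappa UNIV = ennreal rate" by (simp add: emeasure_eq_measure)
 have src1: "(NN x. ennreal \<bar>src psi sig x\<bar>) <= ennreal (Lam * (B0 + N1 * sig) + N1)" if s: "0 <= sig" "sig <= T" for sig
 proof -
  have "ennreal \<bar>src psi sig x\<bar> <= (\<integral>\<^sup>+y. ennreal \<bar>psi (sig, x + y)\<bar> \<partial>kappa) + (ennreal K * ennreal \<bar>psi (sig, x)\<bar> + ennreal \<bar>b sig x 0\<bar>)" for x
  proof -
   have "\<bar>src psi sig x\<bar> <= \<bar>\<integral>y. psi (sig, x + y) \<partial>kappa\<bar> + (K * \<bar>psi (sig, x)\<bar> + \<bar>b sig x 0\<bar>)"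
    unfolding src_def using absorb_bound[of "psi (sig, x)" sig x] by linarith
   then have "ennreal \<bar>src psi sig x\<bar> <= ennreal \<bar>\<integral>y. psi (sig, x + y) \<partial>kappa\<bar> + (ennreal K * ennreal \<bar>psi (sig, x)\<bar> + ennreal \<bar>b sig x 0\<bar>)"
    using K by (simp add: ennreal_mult[symmetric] ennreal_plus[symmetric] ennreal_leI del: ennreal_plus)
   moreover have "ennreal \<bar>\<integral>y. psi (sig, x + y) \<partial>kappa\<bar> <= (\<integral>\<^sup>+y. ennreal \<bar>psi (sig, x + y)\<bar> \<partial>kappa)"
    using integral_norm_bound_ennreal[OF integrable_psi[OF p]] by simp
   ultimately show ?thesis by (meson add_right_mono order_trans)
  qed
  then have "(NN x. ennreal \<bar>src psi sig x\<bar>) <= (\<integral>\<^sup>+x. (\<integral>\<^sup>+y. ennreal \<bar>psi (sig, x + y)\<bar> \<partial>kappa) + (ennreal K * ennreal \<bar>psi (sig, x)\<bar> + ennreal \<bar>b sig x 0\<bar>) \<partial>lborel)"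
   by (intro nn_integral_mono) auto
  also have "... = (\<integral>\<^sup>+x. (\<integral>\<^sup>+y. ennreal \<bar>psi (sig, x + y)\<bar> \<partial>kappa) \<partial>lborel) + (ennreal K * (NN x. ennreal \<bar>psi (sig, x)\<bar>) + (NN x. ennreal \<bar>b sig x 0\<bar>))"
  proof -
   have m: "(%x. \<integral>\<^sup>+y. ennreal \<bar>psi (sig, x + y)\<bar> \<partial>kappa) : borel_measurable lborel"
   proof (rule borel_measurable_nn_integral)
    have "(%(x, y). ennreal \<bar>psi (sig, x + y)\<bar>) : borel_measurable (borel \<Otimes>\<^sub>M borel)" by measurable
    then show "(%(x, y). ennreal \<bar>psi (sig, x + y)\<bar>) : borel_measurable (lborel \<Otimes>\<^sub>M kappa)"
     by (simp cong: measurable_cong_sets sets_pair_measure_cong)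
   qed
   show ?thesis using m by (simp add: nn_integral_add nn_integral_cmult)
  qed
  also have "... = ennreal rate * (NN x. ennreal \<bar>psi (sig, x)\<bar>) + (ennreal K * (NN x. ennreal \<bar>psi (sig, x)\<bar>) + (NN x. ennreal \<bar>b sig x 0\<bar>))"
   by (subst nn_integral_shift[of "%x. ennreal \<bar>psi (sig, x)\<bar>"]) (auto simp: rate)
  also have "... <= ennreal rate * ennreal (B0 + N1 * sig) + (ennreal K * ennreal (B0 + N1 * sig) + ennreal N1)"
   using L1[OF s] b_int by (intro add_mono mult_left_mono) auto
  also have "... = ennreal (rate * (B0 + N1 * sig) + (K * (B0 + N1 * sig) + N1))"
   using B0 N1 K s by (simp add: ennreal_mult[symmetric] ennreal_plus[symmetric] del: ennreal_plus)
  finally show ?thesis by (simp add: Lam_def algebra_simps)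
 qed
 have "ennreal \<bar>mild psi (t, x)\<bar> <= ennreal (exp (- Lam * t)) * ennreal \<bar>w0 x\<bar>
   + (NN sig. ennreal (indicator {0..t} sig * ?e sig) * ennreal \<bar>src psi sig x\<bar>)" for x
 proof -
  let ?I = "(LBINT sig. indicator {0..t} sig * (?e sig * src psi sig x))"
  have "\<bar>mild psi (t, x)\<bar> <= exp (- Lam * t) * \<bar>w0 x\<bar> + \<bar>?I\<bar>"
   using abs_triangle_ineq[of "exp (- Lam * t) * w0 x" ?I] unfolding mild_def by (simp add: ct abs_mult)
  then have "ennreal \<bar>mild psi (t, x)\<bar> <= ennreal (exp (- Lam * t)) * ennreal \<bar>w0 x\<bar> + ennreal \<bar>?I\<bar>"
   by (simp add: ennreal_mult[symmetric] ennreal_plus[symmetric] ennreal_leI del: ennreal_plus)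
  also have "ennreal \<bar>?I\<bar> <= (NN sig. ennreal \<bar>indicator {0..t} sig * (?e sig * src psi sig x)\<bar>)"
   using integral_norm_bound_ennreal[OF mild_integrand_integrable[OF p]] by simp
  also have "... = (NN sig. ennreal (indicator {0..t} sig * ?e sig) * ennreal \<bar>src psi sig x\<bar>)"
   by (intro nn_integral_cong) (auto simp: ennreal_mult[symmetric] abs_mult indicator_def)
  finally show ?thesis by (simp add: add_left_mono)
 qed
 then have "(NN x. ennreal \<bar>mild psi (t, x)\<bar>) <= (NN x. ennreal (exp (- Lam * t)) * ennreal \<bar>w0 x\<bar>
   + (NN sig. ennreal (indicator {0..t} sig * ?e sig) * ennreal \<bar>src psi sig x\<bar>))"
  by (intro nn_integral_mono) auto
 also have "... = ennreal (exp (- Lam * t)) * (NN x. ennreal \<bar>w0 x\<bar>)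
   + (NN x. (NN sig. ennreal (indicator {0..t} sig * ?e sig) * ennreal \<bar>src psi sig x\<bar>))"
 proof -
  have "(%x. (NN sig. ennreal (indicator {0..t} sig * ?e sig) * ennreal \<bar>src psi sig x\<bar>)) : borel_measurable lborel"
   by (rule lborel.borel_measurable_nn_integral) (simp add: case_prod_beta, measurable)
  then show ?thesis by (subst nn_integral_add) (auto simp: nn_integral_cmult)
 qed
 also have "(NN x. (NN sig. ennreal (indicator {0..t} sig * ?e sig) * ennreal \<bar>src psi sig x\<bar>))
   = (NN sig. (NN x. ennreal (indicator {0..t} sig * ?e sig) * ennreal \<bar>src psi sig x\<bar>))"
  by (rule lborel_pair.Fubini'[symmetric]) (simp add: case_prod_beta, measurable)
 also have "... <= (NN sig. ennreal (indicator {0..t} sig * (?e sig * (Lam * (B0 + N1 * sig) + N1))))"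
 proof (rule nn_integral_mono)
  fix sig
  show "(NN x. ennreal (indicator {0..t} sig * ?e sig) * ennreal \<bar>src psi sig x\<bar>)
    <= ennreal (indicator {0..t} sig * (?e sig * (Lam * (B0 + N1 * sig) + N1)))"
  proof (cases "sig : {0..t}")
   case True
   have "(NN x. ennreal (indicator {0..t} sig * ?e sig) * ennreal \<bar>src psi sig x\<bar>)
    = ennreal (?e sig) * (NN x. ennreal \<bar>src psi sig x\<bar>)"
    using True by (subst nn_integral_cmult[symmetric]) auto
   also have "... <= ennreal (?e sig) * ennreal (Lam * (B0 + N1 * sig) + N1)"
    using True t by (intro mult_left_mono src1) auto
   also have "... = ennreal (?e sig * (Lam * (B0 + N1 * sig) + N1))"
    using True Lam B0 N1 by (intro ennreal_mult[symmetric]) auto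
   finally show ?thesis using True by simp
  qed simp
 qed
 also have "... = ennreal (LBINT sig. indicator {0..t} sig * (?e sig * (Lam * (B0 + N1 * sig) + N1)))"
 proof (rule nn_integral_eq_integral)
  show "Leb1 (%sig. indicator {0..t} sig * (?e sig * (Lam * (B0 + N1 * sig) + N1)))"
   by (rule integral_exp_lborel(2)[OF t(1), where F = "%sig. ?e sig * (B0 + N1 * sig)"])
    (auto intro!: derivative_eq_intros continuous_intros simp: algebra_simps)
 qed (use Lam B0 N1 in "auto simp: indicator_def")
 also have "(LBINT sig. indicator {0..t} sig * (?e sig * (Lam * (B0 + N1 * sig) + N1))) = B0 + N1 * t - exp (- Lam * t) * B0"
  by (subst integral_exp_lborel(1)[OF t(1), where F = "%sig. ?e sig * (B0 + N1 * sig)"])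
   (auto intro!: derivative_eq_intros continuous_intros simp: algebra_simps)
 also have "ennreal (exp (- Lam * t)) * (NN x. ennreal \<bar>w0 x\<bar>) <= ennreal (exp (- Lam * t)) * ennreal B0"
  by (intro mult_left_mono w0_int) auto
 also have "ennreal (exp (- Lam * t)) * ennreal B0 + ennreal (B0 + N1 * t - exp (- Lam * t) * B0) = ennreal (B0 + N1 * t)"
 proof -
  have "exp (- Lam * t) * B0 <= 1 * B0" using Lam t B0 by (intro mult_right_mono) auto
  moreover have "0 <= N1 * t" using N1 t by simp
  ultimately show ?thesis using B0
   by (simp add: ennreal_mult[symmetric] ennreal_plus[symmetric] del: ennreal_plus)
 qed
 finally show ?thesis by (simp add: add_right_mono)
qed

theorem solution_exists:
 obtains w where "jump_solution kappa b T w" "!!x. w 0 x = w0 x"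
  "!!t. 0 <= t ==> t <= T ==> (NN x. ennreal \<bar>w t x\<bar>) <= ennreal (B0 + N1 * t)"
proof -
 let ?ok = "%f::(real \<times> 'a) \<Rightarrow>\<^sub>C real. \<forall>t. 0 <= t & t <= T --> (NN x. ennreal \<bar>apply_bcontfun f (t, x)\<bar>) <= ennreal (B0 + N1 * t)"
 let ?S = "{f. ?ok f}"
 have bc: "\<exists>C. \<forall>p. \<bar>apply_bcontfun f p\<bar> <= C" for f :: "(real \<times> 'a) \<Rightarrow>\<^sub>C real"
  using norm_bounded[of f] by auto
 define \<Phi> where "\<Phi> f = Bcontfun (mild (apply_bcontfun f))" for f
 have app: "apply_bcontfun (\<Phi> f) = mild (apply_bcontfun f)" for f
 proof -
  obtain C where C: "!!p. \<bar>apply_bcontfun f p\<bar> <= C" using bc by blast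
  obtain C' where "!!p. \<bar>mild (apply_bcontfun f) p\<bar> <= C'"
   using mild_bdd[OF continuous_on_apply_bcontfun C] by blast
  then have "mild (apply_bcontfun f) : bcontfun"
   using mild_cont[OF continuous_on_apply_bcontfun C] by (intro bcontfun_normI[of _ C']) auto
  then show ?thesis by (simp add: \<Phi>_def Bcontfun_inverse)
 qed
 \<comment> \<open>The bound on the mass survives uniform limits by Fatou's lemma.\<close>
 have cl: "closed ?S"
  unfolding closed_sequential_limits
 proof (intro allI impI, elim conjE)
  fix F f assume F: "\<forall>n. F n : ?S" and lim: "F \<longlonglongrightarrow> f"
  show "f : ?S"
  proof (intro CollectI allI impI)
   fix t assume t: "0 <= t & t <= T"
   have pt: "(%n. apply_bcontfun (F n) p) \<longlonglongrightarrow> apply_bcontfun f p" for p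
   proof (rule tendstoI)
    fix e :: real assume "0 < e"
    then have "eventually (%n. dist (F n) f < e) sequentially" using lim by (rule tendstoD[rotated])
    then show "eventually (%n. dist (apply_bcontfun (F n) p) (apply_bcontfun f p) < e) sequentially"
     by eventually_elim (rule dist_fun_lt_imp_dist_val_lt)
   qed
   have m: "(%x. apply_bcontfun g (t, x)) : borel_funs" for g :: "(real \<times> 'a) \<Rightarrow>\<^sub>C real"
    by (intro borel_measurable_continuous_onI continuous_on_compose2[OF continuous_on_apply_bcontfun[of UNIV g]] continuous_intros) auto
   have "(NN x. ennreal \<bar>apply_bcontfun f (t, x)\<bar>) = (NN x. liminf (%n. ennreal \<bar>apply_bcontfun (F n) (t, x)\<bar>))"
   proof (rule nn_integral_cong)
    fix x
    have "(%n. ennreal \<bar>apply_bcontfun (F n) (t, x)\<bar>) \<longlonglongrightarrow> ennreal \<bar>apply_bcontfun f (t, x)\<bar>"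
     by (intro tendsto_ennrealI tendsto_rabs pt)
    then show "ennreal \<bar>apply_bcontfun f (t, x)\<bar> = liminf (%n. ennreal \<bar>apply_bcontfun (F n) (t, x)\<bar>)"
     using lim_imp_Liminf[OF sequentially_bot] by metis
   qed
   also have "... <= liminf (%n. (NN x. ennreal \<bar>apply_bcontfun (F n) (t, x)\<bar>))"
    using m by (intro nn_integral_liminf) auto
   also have "... <= ennreal (B0 + N1 * t)"
    using F t by (intro Liminf_le) (auto intro: always_eventually)
   finally show "(NN x. ennreal \<bar>apply_bcontfun f (t, x)\<bar>) <= ennreal (B0 + N1 * t)" .
  qed
 qed
 have "\<exists>!f\<in>?S. \<Phi> f = f"
 proof (rule Banach_fix[OF complete_eq_closed[THEN iffD2, OF cl], where c = "1 - exp (- Lam * T)"])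
  have "0 : ?S" by simp
  then show "?S \<noteq> {}" by blast
  show "0 <= 1 - exp (- Lam * T)" "1 - exp (- Lam * T) < 1" using Lam T by auto
  show "\<Phi> ` ?S \<subseteq> ?S"
  proof (intro subsetI, elim imageE, simp only: mem_Collect_eq, intro allI impI)
   fix g f t assume f: "g = \<Phi> f" "?ok f" and t: "0 <= t & t <= T"
   obtain C where C: "!!p. \<bar>apply_bcontfun f p\<bar> <= C" using bc by blast
   show "(NN x. ennreal \<bar>apply_bcontfun (\<Phi> f) (t, x)\<bar>) <= ennreal (B0 + N1 * t)"
    unfolding app using f t by (intro mild_L1[OF continuous_on_apply_bcontfun C]) auto
  qed
  fix f g
  show "dist (\<Phi> f) (\<Phi> g) <= (1 - exp (- Lam * T)) * dist f g"
  proof (rule dist_bound)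
   fix p
   obtain C where C: "!!p. \<bar>apply_bcontfun f p\<bar> <= C" using bc by blast
   obtain C' where C': "!!p. \<bar>apply_bcontfun g p\<bar> <= C'" using bc by blast
   show "dist (apply_bcontfun (\<Phi> f) p) (apply_bcontfun (\<Phi> g) p) <= (1 - exp (- Lam * T)) * dist f g"
    unfolding app dist_real_def
    by (rule mild_lip[OF continuous_on_apply_bcontfun C continuous_on_apply_bcontfun C'])
     (use dist_bounded[of f _ g] in "simp add: dist_real_def")
  qed
 qed
 then obtain f where f: "?ok f" "\<Phi> f = f" by blast
 define psi where "psi = apply_bcontfun f"
 have pc: "continuous_on UNIV psi" unfolding psi_def by simp
 obtain C where pb: "!!p. \<bar>psi p\<bar> <= C" using bc psi_def by blast
 have fix': "mild psi = psi" using app[of f] f(2) by (simp add: psi_def)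
 define w where "w t x = psi (t, x)" for t x
 have form: "w t x = exp (- Lam * t) * (w0 x + integral {0..t} (%sig. exp (Lam * sig) * src psi sig x))" if t: "0 <= t" "t <= T" for t x
 proof -
  have c: "continuous_on {0..t} (%sig. exp (- Lam * (t - sig)) * src psi sig x)"
   by (intro continuous_intros src_comp[OF pc pb])
  have si: "set_integrable lborel {0..t} (%sig. exp (- Lam * (t - sig)) * src psi sig x)"
   unfolding set_integrable_def by (rule borel_integrable_compact[OF _ c]) simp
  have "w t x = exp (- Lam * t) * w0 x + (LBINT sig. indicator {0..t} sig * (exp (- Lam * (t - sig)) * src psi sig x))"
   unfolding w_def by (subst fix'[symmetric]) (simp add: mild_def tclamp(3)[OF t])
  also have "(LBINT sig. indicator {0..t} sig * (exp (- Lam * (t - sig)) * src psi sig x)) = integral {0..t} (%sig. exp (- Lam * (t - sig)) * src psi sig x)"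
   using set_borel_integral_eq_integral(2)[OF si] by (simp add: set_lebesgue_integral_def)
  also have "... = integral {0..t} (%sig. exp (- Lam * t) * (exp (Lam * sig) * src psi sig x))"
   by (intro Henstock_Kurzweil_Integration.integral_cong) (simp add: exp_add[symmetric] mult.assoc[symmetric] algebra_simps)
  also have "... = exp (- Lam * t) * integral {0..t} (%sig. exp (Lam * sig) * src psi sig x)"
   by (rule Henstock_Kurzweil_Integration.integral_mult_right)
  finally show ?thesis by (simp add: distrib_left)
 qed
 show ?thesis
 proof (rule that[of w])
  show "w 0 x = w0 x" for x using form[of 0 x] T by simp
  show "(NN x. ennreal \<bar>w t x\<bar>) <= ennreal (B0 + N1 * t)" if "0 <= t" "t <= T" for t
   using f(1) that by (simp add: w_def psi_def)
  show "jump_solution kappa b T w"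
   unfolding jump_solution_def
  proof (intro conjI ballI allI)
   show "continuous_on UNIV (%(t, x). w t x)" using pc by (simp add: w_def)
   show "\<exists>C. \<forall>t x. \<bar>w t x\<bar> <= C" using pb by (auto simp: w_def)
   fix t x assume t: "t : {0<..<T}"
   let ?g = "%sig. exp (Lam * sig) * src psi sig x"
   have g: "continuous_on {0..T} ?g" by (intro continuous_intros src_comp[OF pc pb])
   have "((%t. integral {0..t} ?g) has_real_derivative ?g t) (at t within {0..T})"
    using t by (intro integral_has_real_derivative[OF g]) auto
   then have I: "((%t. integral {0..t} ?g) has_real_derivative ?g t) (at t)"
    using t at_within_Icc_at[of 0 t T] by simp
   have "((%t. exp (- Lam * t) * (w0 x + integral {0..t} ?g)) has_real_derivative
     - Lam * exp (- Lam * t) * (w0 x + integral {0..t} ?g) + ?g t * exp (- Lam * t)) (at t)"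
    by (auto intro!: derivative_eq_intros I)
   moreover have "- Lam * exp (- Lam * t) * (w0 x + integral {0..t} ?g) = - Lam * w t x"
    using form[of t x] t by simp
   moreover have "?g t * exp (- Lam * t) = src psi t x" by (simp add: exp_minus)
   moreover have "- Lam * w t x + src psi t x = jump kappa (w t) x - b t x (w t x)"
   proof -
    have "jump kappa (w t) x = (\<integral>y. w t (x + y) \<partial>kappa) - rate * w t x"
     by (rule jump_eq[of _ C])
      (auto simp: w_def[abs_def] pb intro!: borel_measurable_continuous_onI psi_comp[OF pc pb] continuous_intros)
    then show ?thesis by (simp add: src_def w_def Lam_def algebra_simps)
   qed
   ultimately have "((%t. exp (- Lam * t) * (w0 x + integral {0..t} ?g)) has_real_derivative jump kappa (w t) x - b t x (w t x)) (at t)"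
    by (simp only:)
   then show "((%tau. w tau x) has_real_derivative jump kappa (w t) x - b t x (w t x)) (at t)"
   proof (rule has_field_derivative_transform_within_open)
    show "open {0<..<T}" by simp
    show "t : {0<..<T}" by (rule t)
    show "exp (- Lam * r) * (w0 x + integral {0..r} ?g) = w r x" if "r : {0<..<T}" for r
     using form[of r x] that by simp
   qed
  qed
 qed
qed

end

lemma jump_solution_continuous:
 assumes "jump_solution kappa b T w"
 shows "continuous_on S (%(t, x). w t x)" "continuous_on I (%t. w t x)" "continuous_on A (w t)"
proof -
 have c: "continuous_on UNIV (%(t, x). w t x)" using assms by (simp add: jump_solution_def)
 then show "continuous_on S (%(t, x). w t x)" by (rule continuous_on_subset) simp
 show "continuous_on I (%t. w t x)"
  using continuous_on_compose2[OF c continuous_on_Pair[OF continuous_on_id continuous_on_const]] by simp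
 show "continuous_on A (w t)"
  using continuous_on_compose2[OF c continuous_on_Pair[OF continuous_on_const continuous_on_id]] by simp
qed

lemma jump_solution_borel:
 assumes "jump_solution kappa b T w"
 shows "w t : borel_funs" "(%(t, x). w t x) : borel_funs"
 using jump_solution_continuous[OF assms] by (auto intro: borel_measurable_continuous_onI)

lemma jump_solution_bounded:
 assumes "jump_solution kappa b T w" obtains C where "!!t x. \<bar>w t x\<bar> <= C"
 using assms unfolding jump_solution_def by blast

lemma jump_solution_deriv:
 assumes "jump_solution kappa b T w" "0 < t" "t < T"
 shows "((%tau. w tau x) has_real_derivative jump kappa (w t) x - b t x (w t x)) (at t)"
 using assms unfolding jump_solution_def by simp

section \<open>Comparison with super- and subsolutions\<close>

context symmetric_jumps
begin

text \<open>Where \<open>w\<close> exceeds \<open>B\<close>, monotonicity of \<open>b\<close> gives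
  the absorption the favourable sign, and what remains is the jump operator applied to
  \<open>w - B\<close>. The differential inequality for \<open>B\<close> is therefore required only
  at such points.\<close>

lemma comparison_above:
 assumes w: "jump_solution kappa b T w" and T: "0 <= T"
  and mono: "!!t x r r'. r <= r' ==> b t x r <= b t x r'"
  and B: "!!t. B t : borel_funs" "!!t x. 0 <= t ==> t <= T ==> \<bar>B t x\<bar> <= C" "!!x. continuous_on {0..T} (%t. B t x)"
  and init: "!!x. w 0 x <= B 0 x"
  and super: "!!t x. 0 < t ==> t < T ==> B t x < w t x ==>
    \<exists>D. ((%tau. B tau x) has_real_derivative D) (at t) & jump kappa (B t) x - b t x (B t x) <= D"
  and t: "0 <= t" "t <= T"
 shows "w t x <= B t x"
proof -
 obtain Cw where Cw: "!!t x. \<bar>w t x\<bar> <= Cw" using jump_solution_bounded[OF w] by blast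
 have "w t x - B t x <= 0"
 proof (rule jump_maximum_principle[where psi = "%t x. w t x - B t x" and T = T and lam = rate and ?M0.0 = "Cw + C"])
  show "continuous_on {0..T} (%t. w t p - B t p)" for p
   by (intro continuous_intros jump_solution_continuous[OF w] B)
  show "w 0 p - B 0 p <= 0" for p using init by simp
  show "w t p - B t p <= Cw + C" if "0 <= t" "t <= T" for t p
   using Cw[of t p] B(2)[OF that, of p] by linarith
 next
  fix t x M assume t: "0 < t" "t < T" and pos: "0 < w t x - B t x" and M: "0 <= M" "!!q. w t q - B t q <= M"
  obtain D where D: "((%tau. B tau x) has_real_derivative D) (at t)" "jump kappa (B t) x - b t x (B t x) <= D"
   using super[OF t] pos by auto
  have Bb: "\<bar>B t y\<bar> <= C" for y using B(2) t by simp
  have "jump kappa (w t) x - jump kappa (B t) x = jump kappa (%y. w t y + (-1) * B t y) x"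
   using jump_add[OF jump_solution_borel(1)[OF w, of t] Cw, of "%y. (-1) * B t y" C x] jump_cmult[of "-1" "B t" x] B(1) Bb by simp
  also have "... <= rate * (M - (w t x + (-1) * B t x))"
  proof (rule jump_le_max)
   show "(%y. w t y + (-1) * B t y) : borel_funs" using jump_solution_borel(1)[OF w] B(1) by measurable
   show "\<bar>w t y + (-1) * B t y\<bar> <= Cw + C" for y using Cw[of t y] Bb[of y] by linarith
   show "w t y + (-1) * B t y <= M" for y using M(2)[of y] by simp
  qed
  finally have j: "jump kappa (w t) x - jump kappa (B t) x <= rate * (M - (w t x - B t x))" by simp
  have "b t x (B t x) <= b t x (w t x)" using pos by (intro mono) simp
  then have "(jump kappa (w t) x - b t x (w t x)) - D <= rate * (M - (w t x - B t x))" using j D(2) by linarith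
  then show "\<exists>D. ((%tau. w tau x - B tau x) has_real_derivative D) (at t) & D <= rate * (M - (w t x - B t x))"
   using DERIV_diff[OF jump_solution_deriv[OF w t] D(1)] by blast
 qed (use T t in auto)
 then show ?thesis by simp
qed

lemma jump_solution_uminus:
 assumes "jump_solution kappa b T w"
 shows "jump_solution kappa (%t x r. - b t x (- r)) T (%t x. - w t x)"
 unfolding jump_solution_def
proof (intro conjI ballI allI)
 show "continuous_on UNIV (%(t, x). - w t x)"
  using jump_solution_continuous(1)[OF assms] by (auto simp: case_prod_unfold intro!: continuous_intros)
 show "\<exists>C. \<forall>t x. \<bar>- w t x\<bar> <= C" using assms by (simp add: jump_solution_def)
 fix t x assume "t : {0<..<T}"
 then show "((%tau. - w tau x) has_real_derivative jump kappa (%x. - w t x) x - - b t x (- (- w t x))) (at t)"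
  using DERIV_minus[OF jump_solution_deriv[OF assms, of t x]] jump_cmult[of "-1" "w t" x] by simp
qed

lemma comparison_below:
 assumes w: "jump_solution kappa b T w" and T: "0 <= T"
  and mono: "!!t x r r'. r <= r' ==> b t x r <= b t x r'"
  and B: "!!t. B t : borel_funs" "!!t x. 0 <= t ==> t <= T ==> \<bar>B t x\<bar> <= C" "!!x. continuous_on {0..T} (%t. B t x)"
  and init: "!!x. B 0 x <= w 0 x"
  and sub: "!!t x. 0 < t ==> t < T ==> w t x < B t x ==>
    \<exists>D. ((%tau. B tau x) has_real_derivative D) (at t) & D <= jump kappa (B t) x - b t x (B t x)"
  and t: "0 <= t" "t <= T"
 shows "B t x <= w t x"
proof -
 have "- w t x <= - B t x"
 proof (rule comparison_above[OF jump_solution_uminus[OF w] T, where C = C])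
  fix t x assume "0 < t" "t < T" "- B t x < - w t x"
  then obtain D where D: "((%tau. B tau x) has_real_derivative D) (at t)" "D <= jump kappa (B t) x - b t x (B t x)"
   using sub[of t x] by auto
  then show "\<exists>D. ((%tau. - B tau x) has_real_derivative D) (at t) \<and>
    jump kappa (%y. - B t y) x - - b t x (- (- B t x)) <= D"
   using jump_cmult[of "-1" "B t" x] by (intro exI[of _ "- D"]) (auto intro: DERIV_minus)
 qed (use mono B init t in "auto intro!: continuous_intros")
 then show ?thesis by simp
qed

end

text \<open>Second differences of \<open>b\<close> along \<open>(h, q)\<close>; the constants are those that enter the
  \<open>x\<close>-regularity of solutions, which does not depend on the jump measure.\<close>

definition absorption_bounds :: "real => real => real => (real => 'a::euclidean_space => real => real) => bool" where
 "absorption_bounds M B1 C2 b \<longleftrightarrow>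
  (\<forall>t x r r'. r <= r' --> b t x r <= b t x r') \<and>
  (\<forall>t x h r. \<bar>r\<bar> <= M --> \<bar>b t (x + h) r - b t x r\<bar> <= B1 * norm h) \<and>
  (\<forall>t x h r q. \<bar>r\<bar> <= M --> \<bar>b t (x + h) (r + q) + b t (x - h) (r - q) - 2 * b t x r\<bar> <= C2 * (norm h + \<bar>q\<bar>)^2)"

lemma absorption_bounds_nonneg:
 assumes b: "absorption_bounds M B1 C2 (b :: real => 'a::euclidean_space => real => real)" and M: "0 <= M"
 shows "0 <= B1" "0 <= C2"
proof -
 obtain e :: 'a where "e : Basis" using nonempty_Basis by blast
 then have ne: "norm e = 1" by simp
 have M0: "\<bar>0::real\<bar> <= M" using M by simp
 have "\<bar>b 0 (0 + e) 0 - b 0 0 0\<bar> <= B1 * norm e" using b M0 unfolding absorption_bounds_def by blast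
 then show "0 <= B1" using ne abs_ge_zero order_trans by fastforce
 have "\<bar>b 0 (0 + e) (0 + 0) + b 0 (0 - e) (0 - 0) - 2 * b 0 0 0\<bar> <= C2 * (norm e + \<bar>0\<bar>)^2"
  using b M0 unfolding absorption_bounds_def by blast
 then show "0 <= C2" using ne abs_ge_zero order_trans by fastforce
qed

lemma absorption_bounds_uminus:
 assumes "absorption_bounds M B1 C2 b"
 shows "absorption_bounds M B1 C2 (%t x r. - b t x (- r))"
proof -
 have 1: "b t x r <= b t x r'" if "r <= r'" for t x r r' using assms that by (simp add: absorption_bounds_def)
 have 2: "\<bar>b t (x + h) r - b t x r\<bar> <= B1 * norm h" if "\<bar>r\<bar> <= M" for t x h r
  using assms that by (simp add: absorption_bounds_def)
 have 3: "\<bar>b t (x + h) (r + q) + b t (x - h) (r - q) - 2 * b t x r\<bar> <= C2 * (norm h + \<bar>q\<bar>)^2" if "\<bar>r\<bar> <= M" for t x h r q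
  using assms that by (simp add: absorption_bounds_def)
 show ?thesis
  unfolding absorption_bounds_def
 proof (intro conjI allI impI)
  show "- b t x (- r) <= - b t x (- r')" if "r <= r'" for t x r r' using 1[of "-r'" "-r"] that by simp
  show "\<bar>- b t (x + h) (- r) - - b t x (- r)\<bar> <= B1 * norm h" if "\<bar>r\<bar> <= M" for t x h r
   using 2[of "- r" t x h] that by (simp add: abs_minus_commute)
  show "\<bar>- b t (x + h) (- (r + q)) + - b t (x - h) (- (r - q)) - 2 * - b t x (- r)\<bar> <= C2 * (norm h + \<bar>q\<bar>)^2"
   if "\<bar>r\<bar> <= M" for t x h r q
   using 3[of "- r" t x h "- q"] that unfolding abs_le_iff by (simp add: algebra_simps)
 qed
qed

context symmetric_jumps
begin

context
 fixes w b T M B1 C2 L0 D0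
 assumes w: "jump_solution kappa b T w" and T: "0 <= T" and b: "absorption_bounds M B1 C2 b"
  and bdd: "!!t x. 0 <= t ==> t <= T ==> \<bar>w t x\<bar> <= M"
  and init: "c11_bound M L0 D0 (w 0)"
begin

text \<open>A translate of \<open>w\<close> solves the same equation up to a change of
  \<open>b\<close> by at most \<open>B1 |h|\<close>, and where the increment is positive the
  monotonicity of \<open>b\<close> helps. The jump operator commutes with translations, so
  \<open>kappa\<close> does not enter the bound.\<close>

lemma increment_upper:
 assumes t: "0 <= t" "t <= T"
 shows "w t (x + h) - w t x <= (L0 + B1 * t) * norm h"
proof -
 obtain Cw where Cw: "!!t x. \<bar>w t x\<bar> <= Cw" using jump_solution_bounded[OF w] by blast
 have [measurable]: "w t : borel_funs" for t by (rule jump_solution_borel[OF w])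
 have M: "0 <= M" using bdd[OF order_refl T] abs_ge_zero order_trans by blast
 note B1 = absorption_bounds_nonneg(1)[OF b M]
 have L0: "0 <= L0" by (rule c11_bound_nonneg[OF init])
 have "(w t (x + h) - w t x) - (L0 + B1 * t) * norm h <= 0"
 proof (rule jump_maximum_principle[where psi = "%t x. (w t (x + h) - w t x) - (L0 + B1 * t) * norm h" and T = T and lam = rate and ?M0.0 = "2 * Cw"])
  show "continuous_on {0..T} (%t. (w t (p + h) - w t p) - (L0 + B1 * t) * norm h)" for p
   by (intro continuous_intros jump_solution_continuous[OF w])
  show "(w 0 (p + h) - w 0 p) - (L0 + B1 * 0) * norm h <= 0" for p
   using c11_boundD(2)[OF init, of p h] by simp
  show "(w t (p + h) - w t p) - (L0 + B1 * t) * norm h <= 2 * Cw" if "0 <= t" "t <= T" for t p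
  proof -
   have "0 <= (L0 + B1 * t) * norm h" using L0 B1 that by simp
   then show ?thesis using Cw[of t "p + h"] Cw[of t p] by linarith
  qed
 next
  fix t x Mx assume t: "0 < t" "t < T" and pos: "0 < (w t (x + h) - w t x) - (L0 + B1 * t) * norm h"
   and Mx: "0 <= Mx" "!!q. (w t (q + h) - w t q) - (L0 + B1 * t) * norm h <= Mx"
  let ?g = "(L0 + B1 * t) * norm h"
  have g0: "0 <= ?g" using L0 B1 t by simp
  have j: "jump kappa (w t) (x + h) - jump kappa (w t) x <= rate * (Mx - ((w t (x + h) - w t x) - ?g))"
  proof -
   have "jump kappa (w t) (x + h) - jump kappa (w t) x = jump kappa (%y. w t (y + h) + (-1) * w t y) x"
    using jump_add[of "%y. w t (y + h)" Cw "%y. (-1) * w t y" Cw x] jump_shift[of "w t" h x] jump_cmult[of "-1" "w t" x] Cw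
    by simp
   also have "... <= rate * ((Mx + ?g) - (w t (x + h) + (-1) * w t x))"
   proof (rule jump_le_max)
    show "\<bar>w t (y + h) + (-1) * w t y\<bar> <= Cw + Cw" for y using Cw[of t y] Cw[of t "y + h"] by linarith
    show "w t (y + h) + (-1) * w t y <= Mx + ?g" for y using Mx(2)[of y] by simp
   qed measurable
   finally show ?thesis by (simp add: algebra_simps)
  qed
  have bb: "- (B1 * norm h) <= b t (x + h) (w t (x + h)) - b t x (w t x)"
  proof -
   have "b t (x + h) (w t x) <= b t (x + h) (w t (x + h))"
    using b pos g0 unfolding absorption_bounds_def by simp
   moreover have "\<bar>b t (x + h) (w t x) - b t x (w t x)\<bar> <= B1 * norm h"
    using b bdd[of t x] t unfolding absorption_bounds_def by simp
   ultimately show ?thesis by linarith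
  qed
  let ?D = "(jump kappa (w t) (x + h) - b t (x + h) (w t (x + h))) - (jump kappa (w t) x - b t x (w t x)) - B1 * norm h"
  have "((%tau. (L0 + B1 * tau) * norm h) has_real_derivative B1 * norm h) (at t)"
   by (auto intro!: derivative_eq_intros)
  then have "((%tau. (w tau (x + h) - w tau x) - (L0 + B1 * tau) * norm h) has_real_derivative ?D) (at t)"
   by (intro DERIV_diff jump_solution_deriv[OF w t])
  moreover have "?D <= rate * (Mx - ((w t (x + h) - w t x) - ?g))" using j bb by linarith
  ultimately show "\<exists>D. ((%tau. (w tau (x + h) - w tau x) - (L0 + B1 * tau) * norm h) has_real_derivative D) (at t) \<and>
    D <= rate * (Mx - ((w t (x + h) - w t x) - ?g))" by blast
 qed (use T t in auto)
 then show ?thesis by simp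
qed

text \<open>The maximum principle is applied to the second difference itself, for fixed
  \<open>h\<close>. The absorption contributes its own second difference along \<open>w\<close>,
  which the already known Lipschitz bound on \<open>w\<close> makes quadratic in \<open>h\<close>;
  again \<open>kappa\<close> does not enter.\<close>

lemma second_difference_upper:
 assumes t: "0 <= t" "t <= T"
 shows "w t (x + h) + w t (x - h) - 2 * w t x <= (D0 + C2 * (1 + (L0 + B1 * T))^2 * t) * (norm h)^2"
proof -
 obtain Cw where Cw: "!!t x. \<bar>w t x\<bar> <= Cw" using jump_solution_bounded[OF w] by blast
 have [measurable]: "w t : borel_funs" for t by (rule jump_solution_borel[OF w])
 have M: "0 <= M" using bdd[OF order_refl T] abs_ge_zero order_trans by blast
 note B1 = absorption_bounds_nonneg(1)[OF b M]
 note C2 = absorption_bounds_nonneg(2)[OF b M]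
 have L0: "0 <= L0" and D0: "0 <= D0" by (rule c11_bound_nonneg[OF init])+
 define L where "L = L0 + B1 * T"
 define D1 where "D1 = C2 * (1 + L)^2"
 have L: "0 <= L" using L0 B1 T by (simp add: L_def)
 have D1: "0 <= D1" using C2 by (simp add: D1_def)
 let ?S = "%t x. w t (x + h) + w t (x - h) - 2 * w t x"
 have "?S t x - (D0 + D1 * t) * (norm h)^2 <= 0"
 proof (rule jump_maximum_principle[where psi = "%t x. ?S t x - (D0 + D1 * t) * (norm h)^2" and T = T and lam = rate and ?M0.0 = "4 * Cw"])
  show "continuous_on {0..T} (%t. ?S t p - (D0 + D1 * t) * (norm h)^2)" for p
   by (intro continuous_intros jump_solution_continuous[OF w])
  show "?S 0 p - (D0 + D1 * 0) * (norm h)^2 <= 0" for p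
   using c11_boundD(3)[OF init, of p h] by simp
  show "?S t p - (D0 + D1 * t) * (norm h)^2 <= 4 * Cw" if "0 <= t" "t <= T" for t p
  proof -
   have "0 <= (D0 + D1 * t) * (norm h)^2" using D0 D1 that by simp
   then show ?thesis using Cw[of t "p + h"] Cw[of t p] Cw[of t "p - h"] by linarith
  qed
 next
  fix t x Mx assume t: "0 < t" "t < T" and pos: "0 < ?S t x - (D0 + D1 * t) * (norm h)^2"
   and Mx: "0 <= Mx" "!!q. ?S t q - (D0 + D1 * t) * (norm h)^2 <= Mx"
  let ?g = "(D0 + D1 * t) * (norm h)^2"
  have g0: "0 <= ?g" using D0 D1 t by simp
  have j: "jump kappa (w t) (x + h) + jump kappa (w t) (x - h) - 2 * jump kappa (w t) x <= rate * (Mx - (?S t x - ?g))"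
  proof -
   have "jump kappa (w t) (x + h) + jump kappa (w t) (x - h) - 2 * jump kappa (w t) x
     = jump kappa (%y. (w t (y + h) + w t (y + - h)) + (-2) * w t y) x"
   proof -
    have "jump kappa (%y. (w t (y + h) + w t (y + - h)) + (-2) * w t y) x
     = jump kappa (%y. w t (y + h) + w t (y + - h)) x + jump kappa (%y. (-2) * w t y) x"
    proof (rule jump_add[where M = "2 * Cw" and M' = "2 * Cw"])
     show "\<bar>w t (y + h) + w t (y + - h)\<bar> <= 2 * Cw" for y using Cw[of t "y + h"] Cw[of t "y + - h"] by linarith
     show "\<bar>(-2) * w t y\<bar> <= 2 * Cw" for y using Cw[of t y] by linarith
    qed measurable
    also have "jump kappa (%y. w t (y + h) + w t (y + - h)) x = jump kappa (%y. w t (y + h)) x + jump kappa (%y. w t (y + - h)) x"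
     by (rule jump_add[where M = Cw and M' = Cw]) (auto intro: Cw)
    finally show ?thesis using jump_shift[of "w t" h x] jump_shift[of "w t" "- h" x] jump_cmult[of "-2" "w t" x] by simp
   qed
   also have "... <= rate * ((Mx + ?g) - ((w t (x + h) + w t (x + - h)) + (-2) * w t x))"
   proof (rule jump_le_max)
    show "\<bar>(w t (y + h) + w t (y + - h)) + (-2) * w t y\<bar> <= 4 * Cw" for y
     using Cw[of t y] Cw[of t "y + h"] Cw[of t "y + - h"] by linarith
    show "(w t (y + h) + w t (y + - h)) + (-2) * w t y <= Mx + ?g" for y using Mx(2)[of y] by simp
   qed measurable
   finally show ?thesis by (simp add: algebra_simps)
  qed
  have bb: "- (D1 * (norm h)^2) <= b t (x + h) (w t (x + h)) + b t (x - h) (w t (x - h)) - 2 * b t x (w t x)"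
  proof -
   \<comment> \<open>The values at \<open>x + h\<close> and \<open>x - h\<close> are written as
     \<open>m + q\<close> and \<open>m - q\<close>. Where the second difference is positive,
     \<open>w t x < m\<close>, so \<open>b t x (w t x)\<close> may be replaced by
     \<open>b t x m\<close> and \<open>absorption_bounds\<close> applies at
     \<open>m\<close>.\<close>
   define m where "m = (w t (x + h) + w t (x - h)) / 2"
   define q where "q = (w t (x + h) - w t (x - h)) / 2"
   have tt: "0 <= t" "t <= T" using t by auto
   have "\<bar>w t (x + h) - w t x\<bar> <= (L0 + B1 * t) * norm h" "\<bar>w t (x - h) - w t x\<bar> <= (L0 + B1 * t) * norm h"
    using increment_upper[OF tt, of x h] increment_upper[OF tt, of "x + h" "- h"]
     increment_upper[OF tt, of x "- h"] increment_upper[OF tt, of "x - h" h] by auto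
   moreover have "(L0 + B1 * t) * norm h <= L * norm h"
    unfolding L_def using tt B1 by (intro mult_right_mono add_left_mono mult_left_mono) auto
   ultimately have "\<bar>w t (x + h) - w t x\<bar> <= L * norm h" "\<bar>w t (x - h) - w t x\<bar> <= L * norm h" by linarith+
   moreover have "2 * q = (w t (x + h) - w t x) - (w t (x - h) - w t x)" by (simp add: q_def)
   ultimately have q: "\<bar>q\<bar> <= L * norm h" by linarith
   have "2 * m = w t (x + h) + w t (x - h)" by (simp add: m_def)
   then have m: "\<bar>m\<bar> <= M" using bdd[OF tt, of "x + h"] bdd[OF tt, of "x - h"] by linarith
   have mq: "m + q = w t (x + h)" "m - q = w t (x - h)" by (simp_all add: m_def q_def field_simps)
   have "\<bar>b t (x + h) (m + q) + b t (x - h) (m - q) - 2 * b t x m\<bar> <= C2 * (norm h + \<bar>q\<bar>)^2"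
    using b m unfolding absorption_bounds_def by blast
   also have "... <= C2 * (norm h + L * norm h)^2" using q C2 by (intro mult_left_mono power_mono) auto
   also have "... = D1 * (norm h)^2" by (simp add: D1_def power2_eq_square algebra_simps)
   finally have "\<bar>b t (x + h) (w t (x + h)) + b t (x - h) (w t (x - h)) - 2 * b t x m\<bar> <= D1 * (norm h)^2" unfolding mq .
   moreover have "b t x (w t x) <= b t x m"
    using b pos g0 unfolding absorption_bounds_def m_def by simp
   ultimately show ?thesis by linarith
  qed
  let ?D = "(jump kappa (w t) (x + h) - b t (x + h) (w t (x + h))) + (jump kappa (w t) (x - h) - b t (x - h) (w t (x - h)))
    - 2 * (jump kappa (w t) x - b t x (w t x)) - D1 * (norm h)^2"
  have "((%tau. (D0 + D1 * tau) * (norm h)^2) has_real_derivative D1 * (norm h)^2) (at t)"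
   by (auto intro!: derivative_eq_intros)
  then have "((%tau. ?S tau x - (D0 + D1 * tau) * (norm h)^2) has_real_derivative ?D) (at t)"
   by (intro DERIV_diff DERIV_add DERIV_cmult jump_solution_deriv[OF w t])
  moreover have "?D <= rate * (Mx - (?S t x - ?g))"
  proof -
   have "(p - bp) + (q - bq) - 2 * (r - br) - N <= R"
    if "p + q - 2 * r <= R" "- N <= bp + bq - 2 * br" for p q r bp bq br N R :: real using that by (simp add: right_diff_distrib)
   from this[OF j bb] show ?thesis .
  qed
  ultimately show "\<exists>D. ((%tau. ?S tau x - (D0 + D1 * tau) * (norm h)^2) has_real_derivative D) (at t) \<and>
    D <= rate * (Mx - (?S t x - ?g))" by blast
 qed (use T t in auto)
 then show ?thesis by (simp add: D1_def L_def)
qed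

end

theorem jump_solution_c11:
 assumes w: "jump_solution kappa b T w" and T: "0 <= T" and b: "absorption_bounds M B1 C2 b"
  and bdd: "!!t x. 0 <= t ==> t <= T ==> \<bar>w t x\<bar> <= M"
  and init: "c11_bound M L0 D0 (w 0)" and C2: "0 <= C2" and t: "0 <= t" "t <= T"
 shows "c11_bound M (L0 + B1 * T) (D0 + C2 * (1 + (L0 + B1 * T))^2 * T) (w t)"
proof -
 note up = increment_upper[OF w T b bdd init t] and up2 = second_difference_upper[OF w T b bdd init t]
 have init': "c11_bound M L0 D0 (%x. - w 0 x)"
  using init unfolding c11_bound_def by (auto simp: abs_le_iff algebra_simps)
 have bdd': "\<bar>- w t x\<bar> <= M" if "0 <= t" "t <= T" for t x using bdd[OF that] by simp
 note lo2 = second_difference_upper[OF jump_solution_uminus[OF w] T absorption_bounds_uminus[OF b] bdd' init' t]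
 have M: "0 <= M" using bdd[OF order_refl T] abs_ge_zero order_trans by blast
 note B1 = absorption_bounds_nonneg(1)[OF b M]
 show ?thesis
  unfolding c11_bound_def
 proof (intro conjI allI)
  fix x h :: 'a
  show "\<bar>w t x\<bar> <= M" by (rule bdd[OF t])
  have "(L0 + B1 * t) * norm h <= (L0 + B1 * T) * norm h"
   using t B1 by (intro mult_right_mono add_left_mono mult_left_mono) auto
  then show "\<bar>w t (x + h) - w t x\<bar> <= (L0 + B1 * T) * norm h"
   using up[of x h] up[of "x + h" "- h"] by auto
  have "(D0 + C2 * (1 + (L0 + B1 * T))^2 * t) * (norm h)^2 <= (D0 + C2 * (1 + (L0 + B1 * T))^2 * T) * (norm h)^2"
   using t C2 by (intro mult_right_mono add_left_mono mult_left_mono) auto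
  then show "\<bar>w t (x + h) + w t (x - h) - 2 * w t x\<bar> <= (D0 + C2 * (1 + (L0 + B1 * T))^2 * T) * (norm h)^2"
   using up2[of x h] lo2[of x h] by (simp add: abs_le_iff)
 qed
qed

end

subsection \<open>Duality for jump equations\<close>

lemma fst_snd_borel [measurable]:
 "(fst :: 'b::second_countable_topology \<times> 'c::second_countable_topology => 'b) : borel_funs"
 "(snd :: 'b \<times> 'c => 'c) : borel_funs"
 by (auto intro!: borel_measurable_continuous_onI continuous_intros)

lemma space_time_FTC:
 fixes q q' :: "real => 'a::euclidean_space => real"
 assumes t: "t0 <= t1"
  and cont: "!!x. continuous_on {t0..t1} (%t. q t x)"
  and der: "!!t x. t0 < t ==> t < t1 ==> ((%tau. q tau x) has_real_derivative q' t x) (at t)"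
  and int: "Leb1 (%(t, x). indicator {t0<..<t1} t * q' t x)"
  and i0: "Leb1 (q t0)" and i1: "Leb1 (q t1)"
 shows "(LBINT x. q t1 x) - (LBINT x. q t0 x) = (LBINT (t, x). indicator {t0<..<t1} t * q' t x)"
proof -
 let ?f = "%t x. indicator {t0<..<t1} t * q' t x"
 have int': "integrable (lborel \<Otimes>\<^sub>M lborel) (%(t, x). ?f t x)" using int by (simp add: lborel_prod)
 have "(LBINT x. q t1 x) - (LBINT x. q t0 x) = (LBINT x. q t1 x - q t0 x)"
  by (rule Bochner_Integration.integral_diff[OF i1 i0, symmetric])
 also have "... = (LBINT x. (LBINT t. ?f t x))"
 proof (rule integral_cong_AE)
  show "(%x. q t1 x - q t0 x) : borel_measurable lborel" using i0 i1 by auto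
  show "(%x. (LBINT t. ?f t x)) : borel_measurable lborel"
   using lborel_pair.integrable_snd[OF int'] by auto
  have "AE x in lborel. Leb1 (%t. ?f t x)" using lborel_pair.AE_integrable_snd[OF int'] by simp
  then show "AE x in lborel. q t1 x - q t0 x = (LBINT t. ?f t x)"
  proof eventually_elim
   case (elim x)
   have "((%t. q' t x) has_integral (q t1 x - q t0 x)) {t0..t1}"
    by (rule fundamental_theorem_of_calculus_interior[OF t cont])
     (use der in "auto simp: has_real_derivative_iff_has_vector_derivative[symmetric]")
   then have "((%t. q' t x) has_integral (q t1 x - q t0 x)) {t0<..<t1}"
    by (subst (asm) has_integral_Icc_iff_Ioo)
   moreover have "set_integrable lborel {t0<..<t1} (%t. q' t x)" using elim by (simp add: set_integrable_def)
   then have "((%t. q' t x) has_integral (LINT t:{t0<..<t1}|lborel. q' t x)) {t0<..<t1}"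
    using set_borel_integral_eq_integral by (metis integrable_integral)
   ultimately have "q t1 x - q t0 x = (LINT t:{t0<..<t1}|lborel. q' t x)" by (rule has_integral_unique)
   then show ?case by (simp add: set_lebesgue_integral_def)
  qed
 qed
 also have "... = (\<integral>(t, x). ?f t x \<partial>(lborel \<Otimes>\<^sub>M lborel))" by (rule lborel_pair.integral_snd[OF int'])
 finally show ?thesis by (simp add: lborel_prod)
qed

lemma integrable_space_time:
 fixes f :: "real => 'a::euclidean_space => real"
 assumes m: "(%(t, x). f t x) : borel_funs"
  and b: "!!t. t0 < t ==> t < t1 ==> (NN x. ennreal \<bar>f t x\<bar>) <= ennreal C"
 shows "Leb1 (%(t, x). indicator {t0<..<t1} t * f t x)"
proof (rule integrableI_bounded)
 have [measurable]: "(%p. f (fst p) (snd p)) : borel_funs" using m by (simp add: case_prod_unfold)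
 show "(%(t, x). indicator {t0<..<t1} t * f t x) : borel_measurable lborel"
  by (simp add: case_prod_unfold)
 have "(NN p. ennreal (norm (case p of (t, x) => indicator {t0<..<t1} t * f t x)))
  = (\<integral>\<^sup>+p. (case p of (t, x) => indicator {t0<..<t1} t * ennreal \<bar>f t x\<bar>) \<partial>(lborel \<Otimes>\<^sub>M lborel))"
  unfolding lborel_prod by (intro nn_integral_cong) (auto simp: indicator_def)
 also have "... = (NN t. (NN x. indicator {t0<..<t1} t * ennreal \<bar>f t x\<bar>))"
  by (subst lborel.nn_integral_fst[symmetric]) (simp_all add: lborel_prod case_prod_unfold)
 also have "... <= (NN t. ennreal C * indicator {t0<..<t1} t)"
  using b by (intro nn_integral_mono) (auto simp: indicator_def)
 also have "... = ennreal C * emeasure lborel {t0<..<t1}" by (rule nn_integral_cmult_indicator) simp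
 also have "... < \<infinity>" by (cases "t0 <= t1") (simp_all add: ennreal_mult_less_top)
 finally show "(NN p. ennreal (norm (case p of (t, x) => indicator {t0<..<t1} t * f t x))) < \<infinity>" .
qed

lemma integrable_of_nn:
 fixes f :: "'a::euclidean_space => real"
 assumes "f : borel_funs" "(NN x. ennreal \<bar>f x\<bar>) <= ennreal C"
 shows "Leb1 f"
 by (rule integrableI_bounded) (use assms in "auto intro: le_less_trans")

lemma nn_integral_abs_mult_le:
 fixes f g :: "'a::euclidean_space => real"
 assumes [measurable]: "f : borel_funs" and C: "(NN x. ennreal \<bar>f x\<bar>) <= ennreal C"
  and g: "!!x. \<bar>g x\<bar> <= X"
 shows "(NN x. ennreal \<bar>g x * f x\<bar>) <= ennreal X * ennreal C"
proof -
 have X: "0 <= X" using g abs_ge_zero order_trans by blast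
 have "(NN x. ennreal \<bar>g x * f x\<bar>) <= (NN x. ennreal X * ennreal \<bar>f x\<bar>)"
  using g X by (intro nn_integral_mono) (auto simp: abs_mult ennreal_mult[symmetric] intro!: ennreal_leI mult_right_mono)
 also have "... = ennreal X * (NN x. ennreal \<bar>f x\<bar>)" by (rule nn_integral_cmult) measurable
 also have "... <= ennreal X * ennreal C" using C by (rule mult_left_mono) simp
 finally show ?thesis .
qed

context symmetric_jumps
begin

lemma jump_continuous:
 assumes c: "continuous_on UNIV (%(t, x). phi t x)" and b: "!!t x. \<bar>phi t x\<bar> <= C"
 shows "continuous_on UNIV (%(t::real, x). jump kappa (phi t) x)"
proof -
 have c': "continuous_on S (%p. phi (f p) (g p))" if "continuous_on S f" "continuous_on S g" for S :: "'b::topological_space set" and f g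
  using continuous_on_compose2[OF c continuous_on_Pair[OF that]] by simp
 have "continuous_on UNIV (%p. \<integral>y. phi (fst p) (snd p + y) - phi (fst p) (snd p) \<partial>kappa)"
 proof (rule continuous_on_param_integral[where B = "2 * C"])
  show "finite_measure kappa" by unfold_locales
  show "(%y. phi (fst p) (snd p + y) - phi (fst p) (snd p)) : borel_measurable kappa" for p
  proof -
   have "(%y. phi (fst p) (snd p + y) - phi (fst p) (snd p)) : borel_funs"
    by (intro borel_measurable_continuous_onI c' continuous_intros)
   then show ?thesis by simp
  qed
  show "continuous_on UNIV (%p. phi (fst p) (snd p + y) - phi (fst p) (snd p))" for y
   by (intro c' continuous_intros)
  show "\<bar>phi (fst p) (snd p + y) - phi (fst p) (snd p)\<bar> <= 2 * C" for p y
   using b[of "fst p" "snd p + y"] b[of "fst p" "snd p"] by linarith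
 qed
 then show ?thesis by (simp add: jump_def case_prod_unfold)
qed

lemma nn_integral_jump_le:
 assumes [measurable]: "phi : borel_funs" and b: "!!x. \<bar>phi x\<bar> <= M"
  and C: "(NN x. ennreal \<bar>phi x\<bar>) <= ennreal C" "0 <= C"
 shows "(NN x. ennreal \<bar>jump kappa phi x\<bar>) <= ennreal (2 * rate * C)"
proof -
 have rate: "emeasure kappa UNIV = ennreal rate" by (simp add: emeasure_eq_measure)
 have "ennreal \<bar>jump kappa phi x\<bar> <= (\<integral>\<^sup>+y. ennreal \<bar>phi (x + y)\<bar> \<partial>kappa) + ennreal rate * ennreal \<bar>phi x\<bar>" for x
 proof -
  have "\<bar>jump kappa phi x\<bar> <= \<bar>\<integral>y. phi (x + y) \<partial>kappa\<bar> + rate * \<bar>phi x\<bar>"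
   using abs_triangle_ineq4[of "\<integral>y. phi (x + y) \<partial>kappa" "rate * phi x"] by (simp add: jump_eq[OF assms(1,2)] abs_mult)
  then have "ennreal \<bar>jump kappa phi x\<bar> <= ennreal \<bar>\<integral>y. phi (x + y) \<partial>kappa\<bar> + ennreal rate * ennreal \<bar>phi x\<bar>"
   by (simp add: ennreal_mult[symmetric] ennreal_plus[symmetric] ennreal_leI del: ennreal_plus)
  moreover have "ennreal \<bar>\<integral>y. phi (x + y) \<partial>kappa\<bar> <= (\<integral>\<^sup>+y. ennreal \<bar>phi (x + y)\<bar> \<partial>kappa)"
   using integral_norm_bound_ennreal[OF integrable_shift[OF assms(1,2)]] by simp
  ultimately show ?thesis by (meson add_right_mono order_trans)
 qed
 then have "(NN x. ennreal \<bar>jump kappa phi x\<bar>) <= (\<integral>\<^sup>+x. (\<integral>\<^sup>+y. ennreal \<bar>phi (x + y)\<bar> \<partial>kappa) + ennreal rate * ennreal \<bar>phi x\<bar> \<partial>lborel)"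
  by (intro nn_integral_mono) auto
 also have "... = (\<integral>\<^sup>+x. (\<integral>\<^sup>+y. ennreal \<bar>phi (x + y)\<bar> \<partial>kappa) \<partial>lborel) + ennreal rate * (NN x. ennreal \<bar>phi x\<bar>)"
 proof -
  have m: "(%x. \<integral>\<^sup>+y. ennreal \<bar>phi (x + y)\<bar> \<partial>kappa) : borel_measurable lborel"
  proof (rule borel_measurable_nn_integral)
   have "(%(x, y). ennreal \<bar>phi (x + y)\<bar>) : borel_measurable (borel \<Otimes>\<^sub>M borel)" by measurable
   then show "(%(x, y). ennreal \<bar>phi (x + y)\<bar>) : borel_measurable (lborel \<Otimes>\<^sub>M kappa)"
    by (simp cong: measurable_cong_sets sets_pair_measure_cong)
  qed
  show ?thesis using m by (simp add: nn_integral_add nn_integral_cmult)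
 qed
 also have "... = ennreal rate * (NN x. ennreal \<bar>phi x\<bar>) + ennreal rate * (NN x. ennreal \<bar>phi x\<bar>)"
  by (subst nn_integral_shift[of "%x. ennreal \<bar>phi x\<bar>"]) (auto simp: rate)
 also have "... <= ennreal rate * ennreal C + ennreal rate * ennreal C"
  using C by (intro add_mono mult_left_mono) auto
 also have "... = ennreal (2 * rate * C)"
  using C by (simp add: ennreal_mult[symmetric] ennreal_plus[symmetric] del: ennreal_plus)
 finally show ?thesis .
qed

text \<open>The equation is multiplied by \<open>xi\<close>, integrated in time for almost every
  \<open>x\<close>, and the jump operator is moved to \<open>xi\<close>. All integrability comes
  from the mass of \<open>w\<close>, so \<open>xi\<close> only has to be bounded.\<close>

theorem jump_solution_duality:
 assumes w: "jump_solution kappa b T w" and t1: "0 <= t1" "t1 <= T"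
  and L1: "!!t. 0 <= t ==> t <= T ==> (NN x. ennreal \<bar>w t x\<bar>) <= ennreal B" and B: "0 <= B"
  and b_meas: "(%(t, x). b t x (w t x)) : borel_funs"
  and b_int: "!!t. 0 < t ==> t < t1 ==> (NN x. ennreal \<bar>b t x (w t x)\<bar>) <= ennreal Cb" and Cb: "0 <= Cb"
  and xi: "continuous_on UNIV (%(t, x). xi t x)" "!!t x. \<bar>xi t x\<bar> <= X"
  and xi': "(%(t, x). xi' t x) : borel_funs" "!!t x. 0 < t ==> t < t1 ==> \<bar>xi' t x\<bar> <= X'"
   "!!t x. 0 < t ==> t < t1 ==> ((%tau. xi tau x) has_real_derivative xi' t x) (at t)"
 shows "Leb1 (%(t, x). indicator {0<..<t1} t * (w t x * (xi' t x + jump kappa (xi t) x) - xi t x * b t x (w t x)))"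
  and "(LBINT x. w t1 x * xi t1 x) - (LBINT x. w 0 x * xi 0 x)
  = (LBINT (t, x). indicator {0<..<t1} t * (w t x * (xi' t x + jump kappa (xi t) x) - xi t x * b t x (w t x)))"
proof -
 obtain Cw where Cw: "!!t x. \<bar>w t x\<bar> <= Cw" using jump_solution_bounded[OF w] by blast
 have [measurable]: "w t : borel_funs" for t by (rule jump_solution_borel[OF w])
 have xib[measurable]: "xi t : borel_funs" for t
 proof (rule borel_measurable_continuous_onI)
  show "continuous_on UNIV (xi t)"
   using continuous_on_compose2[OF xi(1) continuous_on_Pair[OF continuous_on_const[of _ t] continuous_on_id]] by simp
 qed
 have meas[measurable]: "(%p. w (fst p) (snd p)) : borel_funs" "(%p. xi (fst p) (snd p)) : borel_funs"
  "(%p. xi' (fst p) (snd p)) : borel_funs" "(%p. b (fst p) (snd p) (w (fst p) (snd p))) : borel_funs"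
  "(%p. jump kappa (w (fst p)) (snd p)) : borel_funs" "(%p. jump kappa (xi (fst p)) (snd p)) : borel_funs"
  using jump_solution_borel(2)[OF w] borel_measurable_continuous_onI[OF xi(1)] xi'(1) b_meas
   borel_measurable_continuous_onI[OF jump_continuous[OF jump_solution_continuous(1)[OF w] Cw]]
   borel_measurable_continuous_onI[OF jump_continuous[OF xi]]
  by (simp_all add: case_prod_unfold)
 have X: "0 <= X" using xi(2) abs_ge_zero order_trans by blast
 have L1': "(NN x. ennreal \<bar>w t x\<bar>) <= ennreal B" if "0 <= t" "t <= t1" for t
  using L1[of t] that t1 by simp
 have wint: "Leb1 (w t)" if "0 <= t" "t <= t1" for t
  by (rule integrable_of_nn[OF _ L1'[OF that]]) simp
 have I1: "Leb1 (%(t, x). indicator {0<..<t1} t * (xi' t x * w t x))"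
 proof (rule integrable_space_time[where C = "X' * B"])
  show "(NN x. ennreal \<bar>xi' t x * w t x\<bar>) <= ennreal (X' * B)" if "0 < t" "t < t1" for t
  proof -
   have "0 <= X'" using xi'(2)[OF that] abs_ge_zero order_trans by blast
   then show ?thesis using nn_integral_abs_mult_le[where f = "w t" and g = "xi' t", OF _ L1' xi'(2)[OF that]] that B by (simp add: ennreal_mult)
  qed
 qed (simp add: case_prod_unfold)
 have I2: "Leb1 (%(t, x). indicator {0<..<t1} t * (xi t x * jump kappa (w t) x))"
 proof (rule integrable_space_time[where C = "X * (2 * rate * B)"])
  show "(NN x. ennreal \<bar>xi t x * jump kappa (w t) x\<bar>) <= ennreal (X * (2 * rate * B))" if "0 < t" "t < t1" for t
   using nn_integral_abs_mult_le[where f = "jump kappa (w t)" and g = "xi t", OF _ nn_integral_jump_le[OF _ Cw L1' B] xi(2)] that B X by (simp add: ennreal_mult)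
 qed (simp add: case_prod_unfold)
 have I3: "Leb1 (%(t, x). indicator {0<..<t1} t * (xi t x * b t x (w t x)))"
 proof (rule integrable_space_time[where C = "X * Cb"])
  show "(NN x. ennreal \<bar>xi t x * b t x (w t x)\<bar>) <= ennreal (X * Cb)" if t: "0 < t" "t < t1" for t
  proof -
   have "(%x. (%p. b (fst p) (snd p) (w (fst p) (snd p))) (t, x)) : borel_funs"
    by (rule measurable_compose[OF _ meas(4)]) simp
   then show ?thesis using nn_integral_abs_mult_le[where f = "%x. b t x (w t x)" and g = "xi t", OF _ b_int[OF t] xi(2)] Cb X by (simp add: ennreal_mult)
  qed
 qed (simp add: case_prod_unfold)
 have I4: "Leb1 (%(t, x). indicator {0<..<t1} t * (w t x * jump kappa (xi t) x))"
 proof (rule integrable_space_time[where C = "(2 * X * rate) * B"])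
  show "(NN x. ennreal \<bar>w t x * jump kappa (xi t) x\<bar>) <= ennreal ((2 * X * rate) * B)" if "0 < t" "t < t1" for t
   using nn_integral_abs_mult_le[where f = "w t" and g = "jump kappa (xi t)", OF _ L1' jump_bound[OF xib xi(2)]] that B X by (simp add: ennreal_mult mult.commute)
 qed (simp add: case_prod_unfold)
 have eq: "(%(t, x). indicator {0<..<t1} t * (w t x * (xi' t x + jump kappa (xi t) x) - xi t x * b t x (w t x)))
  = (%p. ((case p of (t, x) => indicator {0<..<t1} t * (xi' t x * w t x)) + (case p of (t, x) => indicator {0<..<t1} t * (w t x * jump kappa (xi t) x)))
    - (case p of (t, x) => indicator {0<..<t1} t * (xi t x * b t x (w t x))))"
  by (auto simp: fun_eq_iff algebra_simps)
 show "Leb1 (%(t, x). indicator {0<..<t1} t * (w t x * (xi' t x + jump kappa (xi t) x) - xi t x * b t x (w t x)))"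
  unfolding eq by (intro Bochner_Integration.integrable_add Bochner_Integration.integrable_diff I1 I3 I4)
 have swap: "(LBINT (t, x). indicator {0<..<t1} t * (xi t x * jump kappa (w t) x))
  = (LBINT (t, x). indicator {0<..<t1} t * (w t x * jump kappa (xi t) x))"
 proof -
  have "(LBINT (t, x). indicator {0<..<t1} t * (xi t x * jump kappa (w t) x))
   = (LBINT t. (LBINT x. indicator {0<..<t1} t * (xi t x * jump kappa (w t) x)))"
   using lborel_pair.integral_fst'[of "%(t, x). indicator {0<..<t1} t * (xi t x * jump kappa (w t) x)"] I2 by (simp add: lborel_prod)
  also have "... = (LBINT t. (LBINT x. indicator {0<..<t1} t * (w t x * jump kappa (xi t) x)))"
  proof (rule Bochner_Integration.integral_cong)
   fix t
   show "(LBINT x. indicator {0<..<t1} t * (xi t x * jump kappa (w t) x)) = (LBINT x. indicator {0<..<t1} t * (w t x * jump kappa (xi t) x))"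
   proof (cases "t : {0<..<t1}")
    case True
    then show ?thesis using jump_dual(3)[of "w t" "xi t" Cw X] wint[of t] Cw xi(2) by simp
   qed simp
  qed simp
  also have "... = (LBINT (t, x). indicator {0<..<t1} t * (w t x * jump kappa (xi t) x))"
   using lborel_pair.integral_fst'[of "%(t, x). indicator {0<..<t1} t * (w t x * jump kappa (xi t) x)"] I4 by (simp add: lborel_prod)
  finally show ?thesis .
 qed
 let ?q' = "%t x. w t x * xi' t x + (jump kappa (w t) x - b t x (w t x)) * xi t x"
 have eq': "(%(t, x). indicator {0<..<t1} t * ?q' t x)
  = (%p. ((case p of (t, x) => indicator {0<..<t1} t * (xi' t x * w t x)) + (case p of (t, x) => indicator {0<..<t1} t * (xi t x * jump kappa (w t) x)))
    - (case p of (t, x) => indicator {0<..<t1} t * (xi t x * b t x (w t x))))"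
  by (auto simp: fun_eq_iff algebra_simps)
 have iq: "Leb1 (%x. w t x * xi t x)" if "0 <= t" "t <= t1" for t
  by (rule Bochner_Integration.integrable_bound[OF integrable_mult_right[OF wint[OF that], of X]])
   (use xi(2) X in "auto simp: abs_mult mult.commute[of X] intro!: AE_I2 mult_left_mono")
 have "(LBINT x. w t1 x * xi t1 x) - (LBINT x. w 0 x * xi 0 x) = (LBINT (t, x). indicator {0<..<t1} t * ?q' t x)"
 proof (rule space_time_FTC[OF t1(1), where q = "%t x. w t x * xi t x"])
  have "continuous_on {0..t1} (%t. xi t x)" for x
   using continuous_on_compose2[OF xi(1) continuous_on_Pair[OF continuous_on_id continuous_on_const[of _ x]]] by simp
  then show "continuous_on {0..t1} (%t. w t x * xi t x)" for x
   by (intro continuous_intros jump_solution_continuous[OF w])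
  show "((%tau. w tau x * xi tau x) has_real_derivative ?q' t x) (at t)" if "0 < t" "t < t1" for t x
   using DERIV_mult[OF jump_solution_deriv[OF w that(1), of x] xi'(3)[OF that, of x]] that t1 by (simp add: algebra_simps)
  show "Leb1 (%(t, x). indicator {0<..<t1} t * ?q' t x)"
   unfolding eq' by (intro Bochner_Integration.integrable_add Bochner_Integration.integrable_diff I1 I3 I2)
 qed (use t1 iq in auto)
 also have "... = (LBINT (t, x). indicator {0<..<t1} t * (w t x * (xi' t x + jump kappa (xi t) x) - xi t x * b t x (w t x)))"
  unfolding eq eq'
  by (simp only: Bochner_Integration.integral_diff[OF Bochner_Integration.integrable_add[OF I1 I2] I3]
    Bochner_Integration.integral_diff[OF Bochner_Integration.integrable_add[OF I1 I4] I3]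
    Bochner_Integration.integral_add[OF I1 I2] Bochner_Integration.integral_add[OF I1 I4] swap)
 finally show "(LBINT x. w t1 x * xi t1 x) - (LBINT x. w 0 x * xi 0 x)
  = (LBINT (t, x). indicator {0<..<t1} t * (w t x * (xi' t x + jump kappa (xi t) x) - xi t x * b t x (w t x)))" .
qed

end

subsection \<open>Smooth absorption terms\<close>

lemma DERIV_pos_square: "((%r::real. (max 0 r)^2) has_real_derivative 2 * max 0 r) (at r)"
proof (cases "r = 0")
 case True
 have "((%h::real. ((max 0 (0 + h))^2 - (max 0 0)^2) / h) \<longlongrightarrow> 0) (at 0)"
 proof (rule Lim_null_comparison)
  show "\<forall>\<^sub>F h in at 0. norm (((max 0 (0 + h))^2 - (max 0 0)^2) / h) <= \<bar>h::real\<bar>"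
   by (rule always_eventually) (auto simp: max_def power2_eq_square)
  show "((%h::real. \<bar>h\<bar>) \<longlongrightarrow> 0) (at 0)" by (rule tendsto_rabs_zero[OF tendsto_ident_at])
 qed
 then show ?thesis using True by (simp add: DERIV_def)
next
 case False
 show ?thesis
 proof (cases "r > 0")
  case True
  have "((%r::real. r^2) has_real_derivative 2 * max 0 r) (at r)" using True by (auto intro!: derivative_eq_intros)
  then show ?thesis
   by (rule has_field_derivative_transform_within_open[where S = "{0<..}"]) (use True in auto)
 next
  case neg: False
  have "((%r::real. 0) has_real_derivative 2 * max 0 r) (at r)" using neg by auto
  then show ?thesis
   by (rule has_field_derivative_transform_within_open[where S = "{..<0}"]) (use neg False in auto)
 qed
qed

text \<open>The primitive of a tent supported on \<open>[0, 1]\<close> with height 2 at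
  \<open>1/2\<close>: a transition from 0 to 1 with bounded second differences, written by squared
  positive parts so that \<open>pos_square_second\<close> applies.\<close>

definition smooth_step :: "real => real" where
 "smooth_step r = 2 * (max 0 r)^2 - 4 * (max 0 (r - 1/2))^2 + 2 * (max 0 (r - 1))^2"

lemma smooth_step_eq: "r <= 0 ==> smooth_step r = 0" "1 <= r ==> smooth_step r = 1"
 by (auto simp: smooth_step_def power2_eq_square algebra_simps)

lemma smooth_step_deriv:
 "(smooth_step has_real_derivative 4 * max 0 r - 8 * max 0 (r - 1/2) + 4 * max 0 (r - 1)) (at r)"
proof -
 have s: "((%r. (max 0 (r - c))^2) has_real_derivative 2 * max 0 (r - c)) (at r)" for c :: real
  using DERIV_shift[of "%r. (max 0 r)^2" "2 * max 0 (r - c)" r "- c"] DERIV_pos_square[of "r - c"] by simp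
 have "(smooth_step has_real_derivative 2 * (2 * max 0 r) - 4 * (2 * max 0 (r - 1/2)) + 2 * (2 * max 0 (r - 1))) (at r)"
  unfolding smooth_step_def[abs_def] by (intro DERIV_add DERIV_diff DERIV_cmult DERIV_pos_square s)
 then show ?thesis by simp
qed

lemma smooth_step_increment:
 assumes "r <= r'" shows "smooth_step r <= smooth_step r'" "smooth_step r' - smooth_step r <= 2 * (r' - r)"
proof -
 have d: "0 <= 4 * max 0 x - 8 * max 0 (x - 1/2) + 4 * max 0 (x - 1)"
  "4 * max 0 x - 8 * max 0 (x - 1/2) + 4 * max 0 (x - 1) <= 2" for x :: real
  by (auto simp: max_def)
 show "smooth_step r <= smooth_step r'"
  by (rule DERIV_nonneg_imp_nondecreasing[OF assms]) (use smooth_step_deriv d in blast)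
 have "2 * r - smooth_step r <= 2 * r' - smooth_step r'"
 proof (rule DERIV_nonneg_imp_nondecreasing[OF assms])
  fix x :: real
  have "((%x. 2 * x - smooth_step x) has_real_derivative 2 * 1 - (4 * max 0 x - 8 * max 0 (x - 1/2) + 4 * max 0 (x - 1))) (at x)"
   by (intro DERIV_diff DERIV_cmult DERIV_ident smooth_step_deriv)
  then show "\<exists>y. ((%x. 2 * x - smooth_step x) has_real_derivative y) (at x) & 0 <= y" using d(2)[of x] by force
 qed
 then show "smooth_step r' - smooth_step r <= 2 * (r' - r)" by (simp add: right_diff_distrib)
qed

lemma smooth_step_bounds: "0 <= smooth_step r" "smooth_step r <= 1"
 using smooth_step_increment(1)[of "min r 0" r] smooth_step_eq(1)[of "min r 0"]
  smooth_step_increment(1)[of r "max r 1"] smooth_step_eq(2)[of "max r 1"] by auto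

lemma smooth_step_lipschitz: "\<bar>smooth_step r - smooth_step r'\<bar> <= 2 * \<bar>r - r'\<bar>"
 using smooth_step_increment[of r r'] smooth_step_increment[of r' r] by (cases "r <= r'") auto

lemma smooth_step_second: "\<bar>smooth_step r + smooth_step r' - 2 * smooth_step ((r + r') / 2)\<bar> <= 8 * (r - r')^2"
proof -
 have eq: "(r - c + (r' - c)) / 2 = (r + r') / 2 - c" for c :: real by (simp add: field_simps)
 let ?d = "%c. (max 0 (r - c))^2 + (max 0 (r' - c))^2 - 2 * (max 0 ((r + r') / 2 - c))^2"
 have s: "\<bar>?d c\<bar> <= (r - r')^2" for c
  using pos_square_second[of "r - c" "r' - c"] unfolding eq by simp
 have "smooth_step r + smooth_step r' - 2 * smooth_step ((r + r') / 2) = 2 * ?d 0 - 4 * ?d (1/2) + 2 * ?d 1"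
  unfolding smooth_step_def by (simp add: algebra_simps)
 moreover have "\<bar>2 * x - 4 * y + 2 * z\<bar> <= 8 * D" if "\<bar>x\<bar> <= D" "\<bar>y\<bar> <= D" "\<bar>z\<bar> <= D" for x y z D :: real
  using that by linarith
 ultimately show ?thesis using s[of 0] s[of "1/2"] s[of 1] by metis
qed

text \<open>\<open>G\<close> is a smoothed staircase with steps of width \<open>a\<close>, the step
  at \<open>j a\<close> having as height the increment of \<open>g\<close> over the preceding
  interval. It lags behind \<open>g\<close>, which gives \<open>G <= g\<close>, but by no more than
  \<open>th\<close> in the argument. The first step has height \<open>g 0\<close>, since
  \<open>g\<close> is continued by 0. Finitely many steps suffice for the lower bound on
  \<open>{..R}\<close>, and finiteness makes \<open>K\<close> and \<open>C\<close> finite.\<close>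

lemma smooth_absorption_exists:
 fixes g :: "real => real"
 assumes mono: "mono_on {0..} g" and nn: "!!r. 0 <= r ==> 0 <= g r" and th: "0 < th"
 obtains G K C where "0 <= K" "0 <= C" "!!r. r <= 0 ==> G r = 0" "!!r r'. r <= r' ==> G r <= G r'"
  "!!r r'. r <= r' ==> G r' - G r <= K * (r' - r)"
  "!!r r'. \<bar>G r + G r' - 2 * G ((r + r') / 2)\<bar> <= C * (r - r')^2"
  "!!r. 0 <= r ==> G r <= g r" "!!r. th <= r ==> r <= R ==> g (r - th) <= G r"
proof -
 \<comment> \<open>The lag is twice the width: one width from rounding \<open>r / a\<close> down,
   one because a step needs a full width to rise.\<close>
 define a where "a = th / 2"
 have a: "0 < a" using th by (simp add: a_def)
 define G0 where "G0 r = (if r < 0 then 0 else g r)" for r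
 have G0_mono: "G0 r <= G0 r'" if "r <= r'" for r r'
  using that nn mono unfolding G0_def mono_on_def by auto
 define c where "c j = G0 (real j * a) - G0 (real j * a - a)" for j :: nat
 have c: "0 <= c j" for j unfolding c_def using G0_mono[of "real j * a - a" "real j * a"] a by simp
 obtain n where n: "R / a < real n" using reals_Archimedean2 by blast
 define G where "G r = (\<Sum>j\<le>n. c j * smooth_step (r / a - real j))" for r
 have tele: "(\<Sum>j<m. c j) = G0 (real m * a - a)" for m
  using a by (induction m) (auto simp: c_def G0_def algebra_simps)
 have upto: "(\<Sum>j\<le>n. c j * f j) = (\<Sum>j<m. c j) + c m * f m"
  if m: "m <= n" "!!j. j < m ==> f j = 1" "!!j. m < j ==> f j = 0" for m and f :: "nat => real"
 proof -
  have "(\<Sum>j\<le>n. c j * f j) = (\<Sum>j\<le>m. c j * f j)"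
   using m by (intro sum.mono_neutral_right) auto
  also have "... = (\<Sum>j<m. c j * f j) + c m * f m" by (simp add: lessThan_Suc_atMost[symmetric])
  finally show ?thesis using m(2) by simp
 qed
 have between: "G0 (r - th) <= G r" if "0 <= r" "r <= R" for r
 proof -
  define m where "m = nat \<lfloor>r / a\<rfloor>"
  have m: "real m <= r / a" "r / a < real m + 1"
   using that a unfolding m_def by (auto simp: floor_correct of_nat_nat)
  have "real m < real n"
  proof -
   have "r / a <= R / a" using that a by (simp add: divide_right_mono)
   then show ?thesis using m n by linarith
  qed
  then have mn: "m <= n" by simp
  have "G r = (\<Sum>j<m. c j) + c m * smooth_step (r / a - real m)"
   unfolding G_def
  proof (rule upto[OF mn])
   show "smooth_step (r / a - real j) = 1" if "j < m" for j
   proof (rule smooth_step_eq(2))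
    have "real j + 1 <= real m" using that by simp
    then show "1 <= r / a - real j" using m by linarith
   qed
   show "smooth_step (r / a - real j) = 0" if "m < j" for j
   proof (rule smooth_step_eq(1))
    have "real m + 1 <= real j" using that by simp
    then show "r / a - real j <= 0" using m by linarith
   qed
  qed
  then have "G0 (real m * a - a) <= G r" using c[of m] smooth_step_bounds by (simp add: tele)
  moreover have "r - th <= real m * a - a"
  proof -
   have "r / a * a <= (real m + 1) * a" using m a by (intro mult_right_mono) auto
   then show ?thesis using a by (simp add: a_def algebra_simps)
  qed
  ultimately show ?thesis using G0_mono order_trans by blast
 qed
 have upper: "G r <= g r" if "0 <= r" for r
 proof -
  define m where "m = nat \<lfloor>r / a\<rfloor>"
  have m: "real m <= r / a"
   using that a unfolding m_def by (auto simp: floor_correct of_nat_nat)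
  have m': "r / a < real m + 1"
   using that a unfolding m_def by (auto simp: floor_correct of_nat_nat)
  have "G r <= (\<Sum>j<Suc m. c j)"
  proof -
   have "G r <= (\<Sum>j\<le>n. if j < Suc m then c j else 0)"
    unfolding G_def
   proof (rule sum_mono)
    fix j
    show "c j * smooth_step (r / a - real j) <= (if j < Suc m then c j else 0)"
    proof (cases "j < Suc m")
     case True then show ?thesis using mult_left_mono[OF smooth_step_bounds(2) c[of j]] by simp
    next
     case False
     then have "real m + 1 <= real j" by simp
     then have "smooth_step (r / a - real j) = 0" using m' by (intro smooth_step_eq) linarith
     then show ?thesis using False by simp
    qed
   qed
   also have "... = (\<Sum>j\<in>{..n} \<inter> {..<Suc m}. c j)" by (simp add: sum.If_cases Int_def lessThan_def)
   also have "... <= (\<Sum>j<Suc m. c j)" using c by (intro sum_mono2) auto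
   finally show ?thesis .
  qed
  also have "... = G0 (real m * a)" by (simp only: tele) (simp add: algebra_simps)
  also have "... <= G0 r" using m a by (intro G0_mono) (simp add: pos_le_divide_eq)
  finally show ?thesis using that by (simp add: G0_def)
 qed
 let ?S = "\<Sum>j\<le>n. c j"
 have S: "0 <= ?S" using c by (intro sum_nonneg) auto
 show ?thesis
 proof (rule that[of "2 * ?S / a" "8 * ?S / a^2" G])
  show "0 <= 2 * ?S / a" "0 <= 8 * ?S / a^2" using S a by auto
  show "G r = 0" if "r <= 0" for r
  proof -
   have "r / a - real j <= 0" for j using that a by (simp add: divide_nonpos_pos order_trans[of _ 0])
   then show ?thesis by (simp add: G_def smooth_step_eq)
  qed
  show "G r <= G r'" if "r <= r'" for r r'
   unfolding G_def using that a c
   by (intro sum_mono mult_left_mono smooth_step_increment(1)) (auto simp: divide_right_mono)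
  show "G r' - G r <= 2 * ?S / a * (r' - r)" if "r <= r'" for r r'
  proof -
   have "G r' - G r = (\<Sum>j\<le>n. c j * (smooth_step (r' / a - real j) - smooth_step (r / a - real j)))"
    unfolding G_def by (simp add: sum_subtractf right_diff_distrib)
   also have "... <= (\<Sum>j\<le>n. c j * (2 * ((r' / a - real j) - (r / a - real j))))"
    using that a c by (intro sum_mono mult_left_mono smooth_step_increment(2)) (auto simp: divide_right_mono)
   also have "... = (\<Sum>j\<le>n. c j * (2 * ((r' - r) / a)))" by (simp add: diff_divide_distrib)
   also have "... = ?S * (2 * ((r' - r) / a))" by (rule sum_distrib_right[symmetric])
   also have "... = 2 * ?S / a * (r' - r)" by simp
   finally show ?thesis .
  qed
  show "\<bar>G r + G r' - 2 * G ((r + r') / 2)\<bar> <= 8 * ?S / a^2 * (r - r')^2" for r r'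
  proof -
   have eq: "G r + G r' - 2 * G ((r + r') / 2) = (\<Sum>j\<le>n. c j * (smooth_step (r / a - real j) + smooth_step (r' / a - real j)
     - 2 * smooth_step (((r / a - real j) + (r' / a - real j)) / 2)))"
   proof -
    have "(r + r') / 2 / a - real j = ((r / a - real j) + (r' / a - real j)) / 2" for j by (simp add: add_divide_distrib diff_divide_distrib)
    then have "G ((r + r') / 2) = (\<Sum>j\<le>n. c j * smooth_step (((r / a - real j) + (r' / a - real j)) / 2))"
     unfolding G_def by (simp only:)
    then show ?thesis unfolding G_def[of r] G_def[of r']
     by (simp only: sum_distrib_left sum.distrib[symmetric] sum_subtractf[symmetric]) (simp add: algebra_simps)
   qed
   have "\<bar>G r + G r' - 2 * G ((r + r') / 2)\<bar> <= (\<Sum>j\<le>n. c j * (8 * ((r / a - real j) - (r' / a - real j))^2))"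
    unfolding eq
   proof (rule order_trans[OF sum_abs], rule sum_mono)
    fix j
    let ?d = "smooth_step (r / a - real j) + smooth_step (r' / a - real j) - 2 * smooth_step (((r / a - real j) + (r' / a - real j)) / 2)"
    have "\<bar>c j * ?d\<bar> = c j * \<bar>?d\<bar>" unfolding abs_mult using c[of j] by simp
    also have "... <= c j * (8 * ((r / a - real j) - (r' / a - real j))^2)"
     by (rule mult_left_mono[OF smooth_step_second c])
    finally show "\<bar>c j * ?d\<bar> <= c j * (8 * ((r / a - real j) - (r' / a - real j))^2)" .
   qed
   also have "... = (\<Sum>j\<le>n. c j * (8 * ((r - r') / a)^2))" by (simp add: diff_divide_distrib)
   also have "... = ?S * (8 * ((r - r') / a)^2)" by (rule sum_distrib_right[symmetric])
   also have "... = 8 * ?S / a^2 * (r - r')^2" by (simp add: power_divide)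
   finally show ?thesis .
  qed
  show "G r <= g r" if "0 <= r" for r using that by (rule upper)
  show "g (r - th) <= G r" if "th <= r" "r <= R" for r
   using between[of r] that th by (simp add: G0_def)
 qed
qed

subsection \<open>Smoothing estimates\<close>

text \<open>Chosen such that the barrier \<open>C k t powr (- N / (2 s))\<close> decreases exactly
  as fast as the jumps lower the maximum; this equality is \<open>C_key\<close> in the proof
  below.\<close>

definition sup_const :: "'a::euclidean_space itself => real => real" where
 "sup_const _ s = (let \<omega> = unit_ball_vol (real DIM('a)); N = real DIM('a) in
  4 / \<omega> * (8 * N / (2 * s * frac_lap_const TYPE('a) s * \<omega>)) powr (N / (2 * s)))"

lemma unit_ball_vol_pos': "0 < unit_ball_vol (real n)"
 by (rule unit_ball_vol_pos) simp

lemma sup_const_pos: "0 < s ==> s < 1 ==> 0 < sup_const TYPE('a::euclidean_space) s"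
 using frac_lap_const_pos[of s, where 'a = 'a] unit_ball_vol_pos'[of "DIM('a)"]
 unfolding sup_const_def Let_def
 by (intro mult_pos_pos divide_pos_pos powr_gt_zero[THEN iffD2] less_imp_neq[symmetric]) auto

lemma integral_indicator_cball:
 "0 <= r ==> (LBINT y. indicator (cball (c::'a::euclidean_space) r) y) = unit_ball_vol (real DIM('a)) * r ^ DIM('a)"
 "Leb1 (indicator (cball (c::'a) r) :: 'a => real)"
 using emeasure_bounded_finite[OF bounded_cball, of c r]
 by (auto simp: content_cball integrable_indicator_iff)

text \<open>Ultracontractivity through the maximum principle: where \<open>w\<close> is close to its maximum \<open>m\<close>, the
  mass bound \<open>k\<close> confines \<open>{w > m/2}\<close> to a set of measure \<open>2k/m\<close>, so jumps at the corresponding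
  scale lower \<open>m\<close> at a rate of order \<open>(m/k)\<^bsup>2s/N\<^esup>\<close>.\<close>

lemma jump_solution_sup_bound:
 fixes w :: "real => 'a::euclidean_space => real"
 assumes s: "0 < s" "s < 1" and e: "0 < eps" and T: "0 <= T"
  and w: "jump_solution (jump_kernel s eps) b T w"
  and b: "!!t x r. 0 <= r ==> 0 <= b t x r"
  and w0: "!!x. w 0 x <= M" and wnn: "!!t x. 0 <= t ==> t <= T ==> 0 <= w t x"
  and L1: "!!t. 0 <= t ==> t <= T ==> (NN x. ennreal \<bar>w t x\<bar>) <= ennreal k"
  and M: "0 < M" and k: "0 < k" and eps: "unit_ball_vol (real DIM('a)) * eps ^ DIM('a) <= k / M"
  and t: "0 < t" "t <= T"
 shows "w t x <= sup_const TYPE('a) s * k * t powr (- (real DIM('a) / (2 * s)))"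
proof -
 interpret symmetric_jumps "jump_kernel s eps :: 'a measure" by (rule symmetric_jumps_jump_kernel[OF s e])
 let ?N = "real DIM('a)" and ?w = "unit_ball_vol (real DIM('a))" and ?a = "frac_lap_const TYPE('a) s"
 define E where "E = ?N / (2 * s)"
 define C where "C = sup_const TYPE('a) s"
 have N: "0 < ?N" by simp
 have pos: "0 < ?w" "0 < ?a" "0 < E" "0 < C"
  using unit_ball_vol_pos'[of "DIM('a)"] frac_lap_const_pos[OF s, where 'a = 'a] s sup_const_pos[OF s, where 'a = 'a]
  by (auto simp: E_def C_def)
 have wne[simp]: "?w \<noteq> 0" using unit_ball_vol_pos'[of "DIM('a)"] by (metis less_irrefl)
 have C_key: "?a * ?w / 8 * (?w * C / 4) powr (1 / E) = E"
 proof -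
  define X where "X = 8 * ?N / (2 * s * ?a * ?w)"
  have X: "0 < X" unfolding X_def using pos s N by (intro divide_pos_pos mult_pos_pos) auto
  have "C = 4 / ?w * X powr E" by (simp only: C_def sup_const_def Let_def E_def X_def)
  moreover have "?w \<noteq> 0" using unit_ball_vol_pos'[of "DIM('a)"] by (metis less_irrefl)
  ultimately have "?w * C / 4 = X powr E" by simp
  then have "(?w * C / 4) powr (1 / E) = X" using pos X by (simp add: powr_powr)
  moreover have "?a * ?w / 8 * X = E" unfolding X_def E_def using pos s by (simp add: field_simps)
  ultimately show ?thesis by simp
 qed
 \<comment> \<open>With this shift of time the barrier \<open>B\<close> starts at \<open>M\<close>,
   hence above the bounded initial value.\<close>
 define t1 where "t1 = (C * k / M) powr (1 / E)"
 have t1: "0 < t1" using pos k M by (simp add: t1_def)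
 define B where "B t = C * k * (t + t1) powr (- E)" for t
 have t1E: "t1 powr (- E) = M / (C * k)"
 proof -
  have "t1 powr E = C * k / M" using pos k M by (simp add: t1_def powr_powr)
  then show ?thesis by (simp add: powr_minus)
 qed
 have B0: "B 0 = M" using pos k by (simp add: B_def t1E)
 have Bpos: "0 < B t" if "0 <= t" for t using pos k t1 that by (simp add: B_def)
 have Ble: "B t <= M" if "0 <= t" for t
 proof -
  have "(t + t1) powr (- E) <= t1 powr (- E)" using that t1 pos by (intro powr_mono2') auto
  then show ?thesis using pos k B0 unfolding B_def by (metis add_0 mult_left_mono mult_pos_pos less_imp_le)
 qed
 have [measurable]: "w t : borel_funs" for t by (rule jump_solution_borel[OF w])
 obtain Cw where Cw: "!!t x. \<bar>w t x\<bar> <= Cw" using jump_solution_bounded[OF w] by blast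
 have "w t x - B t <= 0"
 proof (rule jump_maximum_principle[where psi = "%t x. w t x - B t" and T = T and lam = rate and ?M0.0 = "Cw"])
  show "continuous_on {0..T} (%t. w t p - B t)" for p
   unfolding B_def using t1 by (intro continuous_intros jump_solution_continuous[OF w]) auto
  show "w 0 p - B 0 <= 0" for p using w0 B0 by simp
  show "w t p - B t <= Cw" if "0 <= t" "t <= T" for t p using Cw[of t p] Bpos[of t] that by linarith
 next
  fix t x Mx assume t: "0 < t" "t < T" and p: "0 < w t x - B t" and Mx: "0 <= Mx" "!!q. w t q - B t <= Mx"
  let ?B = "B t"
  have Bt: "0 < ?B" "?B <= M" using Bpos[of t] Ble[of t] t by auto
  \<comment> \<open>The ball of radius \<open>rho\<close> has measure \<open>4 k / B\<close>.
    Without the ball of radius \<open>eps\<close>, of measure at most \<open>k / M <= k / B\<close>,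
    and without the set where \<open>w > B / 2\<close>, of measure at most \<open>2 k / B\<close> by
    Chebyshev, at least \<open>k / B\<close> remains for the landing set \<open>?A\<close>.\<close>
  define rho where "rho = (4 * k / (?w * ?B)) powr (1 / ?N)"
  have rho: "0 < rho" using pos k Bt by (simp add: rho_def)
  have rhoN: "rho ^ DIM('a) = 4 * k / (?w * ?B)"
  proof -
   have "rho ^ DIM('a) = rho powr ?N" using rho by (simp add: powr_realpow)
   then show ?thesis using pos k Bt N by (simp add: rho_def powr_powr)
  qed
  let ?A = "{y. eps < norm y & norm y <= rho & w t (x + y) <= ?B / 2}"
  have A[measurable]: "?A : sets borel" by measurable
  have wint: "Leb1 (%y. w t (x + y))" and wk: "(LBINT y. w t (x + y)) <= k"
  proof -
   have i: "Leb1 (w t)"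
    by (rule integrableI_bounded) (use L1[of t] t in "auto intro: le_less_trans")
   have "ennreal (LBINT y. w t y) = (NN x. ennreal \<bar>w t x\<bar>)"
    using wnn t i by (subst nn_integral_eq_integral[symmetric]) auto
   also have "... <= ennreal k" using L1 t by simp
   finally have "(LBINT y. w t y) <= k" using k by (simp add: ennreal_le_iff)
   then show "(LBINT y. w t (x + y)) <= k" by (subst lborel_integral_shift) auto
   have "integrable (distr lborel borel ((+) x)) (w t)" using i by (simp add: lborel_distr_plus)
   then show "Leb1 (%y. w t (x + y))" by (subst (asm) integrable_distr_eq) auto
  qed
  have iA: "Leb1 (indicator ?A :: 'a => real)"
   by (rule Bochner_Integration.integrable_bound[OF integral_indicator_cball(2)[where c = 0 and r = rho]]) (auto simp: indicator_def)
  have A_lower: "k / ?B <= (LBINT y. indicator ?A y)"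
  proof -
   have "(LBINT y. indicator (cball 0 rho) y - indicator (cball (0::'a) eps) y - (2 / ?B) * w t (x + y)) <= (LBINT y. indicator ?A y)"
   proof (rule Bochner_Integration.integral_mono[OF _ iA])
    show "Leb1 (%y. indicator (cball 0 rho) y - indicator (cball (0::'a) eps) y - (2 / ?B) * w t (x + y))"
     by (intro Bochner_Integration.integrable_diff integrable_mult_right wint integral_indicator_cball(2))
    fix y :: 'a
    have w0': "0 <= (2 / ?B) * w t (x + y)" using wnn[of t "x + y"] t Bt by simp
    show "indicator (cball 0 rho) y - indicator (cball (0::'a) eps) y - (2 / ?B) * w t (x + y) <= (indicator ?A y :: real)"
    proof (cases "norm y <= rho & eps < norm y & ?B / 2 < w t (x + y)")
     case True
     then have "1 <= (2 / ?B) * w t (x + y)" using Bt by (simp add: field_simps)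
     then show ?thesis by (auto simp: indicator_def)
    qed (use w0' in "auto simp: indicator_def")
   qed
   moreover have "(LBINT y. indicator (cball 0 rho) y - indicator (cball (0::'a) eps) y - (2 / ?B) * w t (x + y))
     = ?w * rho ^ DIM('a) - ?w * eps ^ DIM('a) - (2 / ?B) * (LBINT y. w t (x + y))"
    using integral_indicator_cball[where c = "0::'a" and r = rho] integral_indicator_cball[where c = "0::'a" and r = eps] rho e wint
    by (simp add: Bochner_Integration.integral_diff Bochner_Integration.integrable_diff del: content_cball integral_indicator Bochner_Integration.integral_indicator)
   moreover have "(2 / ?B) * (LBINT y. w t (x + y)) <= (2 / ?B) * k" using wk Bt by (intro mult_left_mono) auto
   moreover have "?w * rho ^ DIM('a) = 4 * k / ?B" using pos by (simp add: rhoN)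
   moreover have "k / M <= k / ?B" using Bt k M by (intro divide_left_mono) auto
   ultimately have "4 * k / ?B - k / ?B - (2 / ?B) * k <= (LBINT y. indicator ?A y)" using eps by linarith
   moreover have "4 * k / ?B - k / ?B - (2 / ?B) * k = k / ?B" by (simp add: field_simps)
   ultimately show ?thesis by simp
  qed
  have kappaA: "?a * rho powr (- (?N + 2 * s)) * (k / ?B) <= measure (jump_kernel s eps) ?A"
  proof -
   have "?a * rho powr (- (?N + 2 * s)) * (k / ?B) <= ?a * rho powr (- (?N + 2 * s)) * (LBINT y. indicator ?A y)"
    using A_lower pos by (intro mult_left_mono) auto
   also have "... = (LBINT y. ?a * rho powr (- (?N + 2 * s)) * indicator ?A y)" by simp
   also have "... <= (LBINT y. indicator {y. eps < norm y} y * kern s y * indicator ?A y)"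
   proof (rule Bochner_Integration.integral_mono)
    show "Leb1 (%y. ?a * rho powr (- (?N + 2 * s)) * indicator ?A y)" using iA by (rule integrable_mult_right)
    show "Leb1 (%y. indicator {y. eps < norm y} y * kern s y * indicator ?A y)"
     by (rule Bochner_Integration.integrable_bound[OF integrable_kern_outer[OF s e]])
      (auto simp: indicator_def)
    fix y
    have "rho powr (- (?N + 2 * s)) <= norm y powr (- (?N + 2 * s))" if "y : ?A"
     using that e s by (intro powr_mono2') auto
    then show "?a * rho powr (- (?N + 2 * s)) * indicator ?A y <= indicator {y. eps < norm y} y * kern s y * indicator ?A y"
     using pos by (auto simp: kern_def indicator_def)
   qed
   also have "... = measure (jump_kernel s eps) ?A" by (rule measure_jump_kernel[OF s A e, symmetric])
   finally show ?thesis .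
  qed
  have rate_id: "?B / 2 * (?a * rho powr (- (?N + 2 * s)) * (k / ?B)) = E * ?B / (t + t1)"
  proof -
   have q: "0 < 4 * k / (?w * ?B)" using pos k Bt by simp
   have "rho powr (- (?N + 2 * s)) = (4 * k / (?w * ?B)) powr (- (1 + 1 / E))"
   proof -
    have "(1 / ?N) * (- (?N + 2 * s)) = - ((?N + 2 * s) / ?N)"
     by (simp only: mult_minus_right times_divide_eq_left mult_1)
    also have "(?N + 2 * s) / ?N = 1 + 1 / E" using N by (simp add: add_divide_distrib E_def)
    finally have "(1 / ?N) * (- (?N + 2 * s)) = - (1 + 1 / E)" .
    then show ?thesis by (simp only: rho_def powr_powr)
   qed
   also have "... = (?w * ?B / (4 * k)) powr (1 + 1 / E)"
    by (simp only: powr_minus inverse_powr[symmetric] inverse_divide)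
   also have "... = (?w * ?B / (4 * k)) * (?w * ?B / (4 * k)) powr (1 / E)"
    using pos k Bt by (simp add: powr_add)
   also have "(?w * ?B / (4 * k)) powr (1 / E) = (?w * C / 4) powr (1 / E) / (t + t1)"
   proof -
    have "?w * ?B / (4 * k) = (?w * C / 4) * (t + t1) powr (- E)" using k by (simp add: B_def)
    moreover have "((t + t1) powr (- E)) powr (1 / E) = 1 / (t + t1)"
    proof -
     have "- E * (1 / E) = - 1" using pos by simp
     then show ?thesis unfolding powr_powr using t t1 by (simp add: powr_minus_divide)
    qed
    ultimately show ?thesis by (simp only: powr_mult) simp
   qed
   finally have rhop: "rho powr (- (?N + 2 * s)) = (?w * ?B / (4 * k)) * ((?w * C / 4) powr (1 / E) / (t + t1))" .
   have alg: "b / 2 * (a * ((v * b / (4 * k)) * (Z / tau)) * (k / b)) = (a * v / 8 * Z) * b / tau"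
    if "0 < tau" "0 < b" for a v Z b tau :: real using k that by (simp add: field_simps)
   have "?B / 2 * (?a * rho powr (- (?N + 2 * s)) * (k / ?B)) = (?a * ?w / 8 * (?w * C / 4) powr (1 / E)) * ?B / (t + t1)"
    unfolding rhop by (rule alg) (use t t1 Bt in auto)
   then show ?thesis unfolding C_key .
  qed
  have j: "jump (jump_kernel s eps) (w t) x <= rate * (Mx - (w t x - ?B)) - E * ?B / (t + t1)"
  proof -
   have "jump (jump_kernel s eps) (w t) x <= (\<integral>y. (Mx - (w t x - ?B)) - ?B / 2 * indicator ?A y \<partial>jump_kernel s eps)"
    unfolding jump_def
   proof (rule Bochner_Integration.integral_mono)
    show "integrable (jump_kernel s eps) (%y. w t (x + y) - w t x)"
     using integrable_shift[where phi = "w t" and x = x, OF _ Cw] by auto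
    show "integrable (jump_kernel s eps) (%y. (Mx - (w t x - ?B)) - ?B / 2 * indicator ?A y)"
     by (intro Bochner_Integration.integrable_diff integrable_mult_right) (auto simp: integrable_indicator_iff emeasure_eq_measure)
    fix y
    show "w t (x + y) - w t x <= (Mx - (w t x - ?B)) - ?B / 2 * indicator ?A y"
     using Mx(2)[of "x + y"] Mx(1) Bt by (auto simp: indicator_def)
   qed
   also have "... = rate * (Mx - (w t x - ?B)) - ?B / 2 * measure (jump_kernel s eps) ?A"
    by (subst Bochner_Integration.integral_diff) (auto simp: integrable_indicator_iff emeasure_eq_measure intro!: integrable_mult_right)
   also have "... <= rate * (Mx - (w t x - ?B)) - E * ?B / (t + t1)"
    using mult_left_mono[OF kappaA, of "?B / 2"] Bt unfolding rate_id by simp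
   finally show ?thesis .
  qed
  have "(B has_real_derivative - (E * ?B / (t + t1))) (at t)"
  proof -
   have "((%t. C * k * (t + t1) powr (- E)) has_real_derivative C * k * (- E * (t + t1) powr (- E - 1) * 1)) (at t)"
    using t t1 by (auto intro!: derivative_eq_intros)
   moreover have "C * k * (- E * (t + t1) powr (- E - 1) * 1) = - (E * ?B / (t + t1))"
    using t t1 by (simp add: B_def powr_diff)
   ultimately show ?thesis unfolding B_def[abs_def] by simp
  qed
  from DERIV_diff[OF jump_solution_deriv[OF w t, of x] this]
  have d: "((%tau. w tau x - B tau) has_real_derivative jump (jump_kernel s eps) (w t) x - b t x (w t x) - - (E * ?B / (t + t1))) (at t)" .
  have "0 <= b t x (w t x)" using p Bt by (intro b) simp
  then have "jump (jump_kernel s eps) (w t) x - b t x (w t x) - - (E * ?B / (t + t1)) <= rate * (Mx - (w t x - ?B))"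
   using j by linarith
  with d show "\<exists>D. ((%tau. w tau x - B tau) has_real_derivative D) (at t) & D <= rate * (Mx - (w t x - B t))" by blast
 qed (use T t in auto)
 then have "w t x <= C * k * (t + t1) powr (- E)" by (simp add: B_def)
 also have "... <= C * k * t powr (- E)"
  using pos k t t1 by (intro mult_left_mono powr_mono2') auto
 finally show ?thesis by (simp add: C_def E_def)
qed

text \<open>The barrier is \<open>psi 0 y + \<omega> + 2 M0 (1 - bump)\<close> plus a linear
  function of time that pays for the jumps of the bump. Initially it dominates by the oscillation
  near \<open>y\<close> and by the sup norm elsewhere; at \<open>y\<close> the bump is 1 and the
  term with \<open>M0\<close> disappears.\<close>

lemma jump_solution_time_modulus:
 fixes psi :: "real => 'a::euclidean_space => real"
 assumes s: "0 < s" "s < 1" and e: "0 < eps" and T: "0 <= T"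
  and w: "jump_solution (jump_kernel s eps) (%_ _ _. 0) T psi"
  and bdd: "!!x. \<bar>psi 0 x\<bar> <= M0" and r: "0 < r"
  and osc: "!!x. norm (x - y) <= r ==> psi 0 x <= psi 0 y + \<omega>" and om: "0 <= \<omega>"
  and K: "!!x. \<bar>jump (jump_kernel s eps) (bump_at y r) x\<bar> <= K"
  and t: "0 <= t" "t <= T"
 shows "psi t y <= psi 0 y + \<omega> + 2 * M0 * K * t"
proof -
 interpret symmetric_jumps "jump_kernel s eps :: 'a measure" by (rule symmetric_jumps_jump_kernel[OF s e])
 have M0: "0 <= M0" using bdd abs_ge_zero order_trans by blast
 have K0: "0 <= K" using K abs_ge_zero order_trans by blast
 have bm[measurable]: "bump_at y r : borel_funs" using c11_borel[OF c11_bump_at[OF r]] .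
 define c where "c t = psi 0 y + \<omega> + 2 * M0 + 2 * M0 * K * t" for t
 let ?B = "%t x. c t + (- 2 * M0) * bump_at y r x"
 have "psi t y <= ?B t y"
 proof (rule comparison_above[OF w T, where B = ?B and C = "\<bar>psi 0 y\<bar> + \<omega> + 4 * M0 + 2 * M0 * K * T"])
  show "?B t : borel_funs" for t by measurable
  show "\<bar>?B t x\<bar> <= \<bar>psi 0 y\<bar> + \<omega> + 4 * M0 + 2 * M0 * K * T" if "0 <= t" "t <= T" for t x
  proof -
   have "2 * M0 * K * t <= 2 * M0 * K * T" "0 <= 2 * M0 * K * t" using M0 K0 that by (auto intro!: mult_left_mono)
   moreover have "0 <= 2 * M0 * bump_at y r x" "2 * M0 * bump_at y r x <= 2 * M0"
    using M0 bump_at_bounds[of y r x] by (auto simp: mult_left_le)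
   ultimately show ?thesis using om M0 unfolding c_def by linarith
  qed
  show "continuous_on {0..T} (%t. ?B t x)" for x unfolding c_def by (intro continuous_intros)
  show "psi 0 x <= ?B 0 x" for x
  proof (cases "norm (x - y) <= r")
   case True
   have "2 * M0 * bump_at y r x <= 2 * M0" using M0 bump_at_bounds[of y r x] by (simp add: mult_left_le)
   then show ?thesis using osc[OF True] by (simp add: c_def)
  next
   case False
   then have "bump_at y r x = 0" by (simp add: bump_at_eq_0_iff[OF r])
   then show ?thesis using bdd[of x] bdd[of y] om by (simp add: c_def)
  qed
  fix t x
  show "\<exists>D. ((%tau. ?B tau x) has_real_derivative D) (at t) & jump (jump_kernel s eps) (?B t) x - 0 <= D"
  proof (intro exI conjI)
   show "((%tau. ?B tau x) has_real_derivative 2 * M0 * K) (at t)"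
    unfolding c_def by (auto intro!: derivative_eq_intros)
   have "jump (jump_kernel s eps) (?B t) x = jump (jump_kernel s eps) (%x. (- 2 * M0) * bump_at y r x) x"
    by (simp add: jump_def)
   also have "... = (- 2 * M0) * jump (jump_kernel s eps) (bump_at y r) x" by (rule jump_cmult)
   also have "... <= 2 * M0 * \<bar>jump (jump_kernel s eps) (bump_at y r) x\<bar>"
   proof -
    have "2 * M0 * (- J) <= 2 * M0 * \<bar>J\<bar>" for J using M0 by (intro mult_left_mono) auto
    from this[of "jump (jump_kernel s eps) (bump_at y r) x"] show ?thesis
     by (simp only: mult_minus_right mult_minus_left)
   qed
   also have "... <= 2 * M0 * K" using K M0 by (intro mult_left_mono) auto
   finally show "jump (jump_kernel s eps) (?B t) x - 0 <= 2 * M0 * K" by simp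
  qed
 qed (use t in auto)
 then show ?thesis by (simp add: c_def bump_at_center)
qed

text \<open>The barrier is \<open>2 M bump_at z R + 2 M K t\<close>. On the ball of radius
  \<open>R / 2\<close>, which contains the points with positive initial value, the bump is at least
  9/16, so twice the bump exceeds 1; at distance \<open>R\<close> and beyond it vanishes.\<close>

lemma jump_solution_decay:
 fixes w :: "real => 'a::euclidean_space => real"
 assumes s: "0 < s" "s < 1" and e: "0 < eps" and T: "0 <= T"
  and w: "jump_solution (jump_kernel s eps) b T w"
  and b: "!!t x r r'. r <= r' ==> b t x r <= b t x r'" "!!t x. b t x 0 = 0"
  and w0: "!!x. w 0 x <= M" "!!x. r0 <= norm (x - z) ==> w 0 x <= 0" and M: "0 <= M" and R: "0 < R" "2 * r0 <= R"
  and K: "!!x. \<bar>jump (jump_kernel s eps) (bump_at z R) x\<bar> <= K"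
  and t: "0 <= t" "t <= T" and x: "R <= norm (x - z)"
 shows "w t x <= 2 * M * K * t"
proof -
 interpret symmetric_jumps "jump_kernel s eps :: 'a measure" by (rule symmetric_jumps_jump_kernel[OF s e])
 have K0: "0 <= K" using K abs_ge_zero order_trans by blast
 have bm[measurable]: "bump_at z R : borel_funs" using c11_borel[OF c11_bump_at[OF R(1)]] .
 let ?B = "%t x. 2 * M * K * t + (2 * M) * bump_at z R x"
 have Bnn: "0 <= ?B t x" if "0 <= t" for t x using M K0 that bump_at_bounds[of z R x] by simp
 have "w t x <= ?B t x"
 proof (rule comparison_above[OF w T, where B = ?B and C = "2 * M * K * T + 2 * M"])
  show "?B t : borel_funs" for t by measurable
  show "\<bar>?B t x\<bar> <= 2 * M * K * T + 2 * M" if "0 <= t" "t <= T" for t x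
  proof -
   have "2 * M * K * t <= 2 * M * K * T" "2 * M * bump_at z R x <= 2 * M"
    using M K0 that bump_at_bounds[of z R x] by (auto intro!: mult_left_mono simp: mult_left_le)
   then show ?thesis using Bnn[OF that(1), of x] by linarith
  qed
  show "continuous_on {0..T} (%t. ?B t x)" for x by (intro continuous_intros)
  show "w 0 x <= ?B 0 x" for x
  proof (cases "r0 <= norm (x - z)")
   case True
   then show ?thesis using w0(2)[OF True] M bump_at_bounds[of z R x] by (simp add: order_trans[of _ 0])
  next
   case False
   have "norm (x - z) / R <= 1 / 2" using False R by (simp add: field_simps)
   moreover define v where "v = (1 / R) *\<^sub>R (x - z)"
   ultimately have "norm v <= 1 / 2" unfolding v_def norm_scaleR using R by simp
   then have "(norm v)^2 <= (1 / 2)^2" by (intro power_mono) auto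
   then have "3 / 4 <= 1 - (norm v)^2" by (simp add: power2_eq_square)
   then have "3 / 4 <= max 0 (1 - (norm v)^2)" by linarith
   then have "(3 / 4)^2 <= bump v" unfolding bump_def by (rule power_mono) simp
   then have "(3 / 4)^2 <= bump_at z R x" by (simp only: bump_at_def v_def)
   then have "1 <= 2 * bump_at z R x" by (simp add: power2_eq_square)
   then have "M * 1 <= M * (2 * bump_at z R x)" using M by (intro mult_left_mono)
   then show ?thesis using w0(1)[of x] by simp
  qed
  fix t x assume t: "0 < t" "t < T"
  show "\<exists>D. ((%tau. ?B tau x) has_real_derivative D) (at t) & jump (jump_kernel s eps) (?B t) x - b t x (?B t x) <= D"
  proof (intro exI conjI)
   show "((%tau. ?B tau x) has_real_derivative 2 * M * K) (at t)"
    by (auto intro!: derivative_eq_intros)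
   have "jump (jump_kernel s eps) (?B t) x = jump (jump_kernel s eps) (%x. (2 * M) * bump_at z R x) x"
    by (simp add: jump_def)
   also have "... = (2 * M) * jump (jump_kernel s eps) (bump_at z R) x" by (rule jump_cmult)
   also have "... <= 2 * M * K" using K[of x] M by (intro mult_left_mono) auto
   moreover have "0 <= b t x (?B t x)" using b(1)[OF Bnn[of t x], of t x] b(2) t by simp
   ultimately show "jump (jump_kernel s eps) (?B t) x - b t x (?B t x) <= 2 * M * K" by linarith
  qed
 qed (use t b in auto)
 also have "bump_at z R x = 0" by (simp add: bump_at_eq_0_iff[OF R(1)] x)
 finally show ?thesis by simp
qed

text \<open>The solution \<open>K\<close> of the balance \<open>K_key\<close> in the proof below.
  There 20 comes from the radius \<open>n / 20\<close> of the set of unshared jumps and 100 from the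
  relative gain of one percent.\<close>

definition holder_const :: "'a::euclidean_space itself => real => real" where
 "holder_const _ s = 2 * (100 * (1 / (4 * s)) / (frac_lap_const TYPE('a) s * unit_ball_vol (real DIM('a)) / 20 ^ DIM('a))) powr (1 / (4 * s))"

text \<open>Doubling of variables with \<open>L(t) |x - y|\<^bsup>1/2\<^esup>\<close>. The two copies jump together except for jumps
  \<open>z\<close> close to \<open>-(x - y)/2\<close>, which only one of them performs; strict concavity of the square root
  gives the gain \<open>\<surd>0.55 + \<surd>1.55 < 1.99\<close>.\<close>

lemma jump_solution_holder:
 fixes psi :: "real => 'a::euclidean_space => real"
 assumes s: "0 < s" "s < 1" and e: "0 < eps" and T: "0 <= T"
  and w: "jump_solution (jump_kernel s eps) (%_ _ _. 0) T psi"
  and bdd: "!!t x. 0 <= t ==> t <= T ==> \<bar>psi t x\<bar> <= M0"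
  and lip: "!!t x y. 0 <= t ==> t <= T ==> \<bar>psi t x - psi t y\<bar> <= Lip * norm (x - y)"
  and M0: "0 < M0" and Lip: "0 <= Lip" and t1: "0 < t1"
  and init: "sqrt (2 * M0 * Lip) <= holder_const TYPE('a) s * M0 * t1 powr (- (1 / (4 * s)))"
  and eps: "Lip * sqrt (8 * eps) <= holder_const TYPE('a) s * M0 * (T + t1) powr (- (1 / (4 * s)))"
  and t: "0 < t" "t <= T"
 shows "psi t x - psi t y <= holder_const TYPE('a) s * M0 * t powr (- (1 / (4 * s))) * sqrt (norm (x - y))"
proof -
 interpret symmetric_jumps "jump_kernel s eps :: 'a measure" by (rule symmetric_jumps_jump_kernel[OF s e])
 let ?w = "unit_ball_vol (real DIM('a))" and ?a = "frac_lap_const TYPE('a) s" and ?N = "real DIM('a)"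
 define q where "q = 1 / (4 * s)"
 define c where "c = ?a * ?w / 20 ^ DIM('a)"
 define K where "K = holder_const TYPE('a) s"
 have wpos: "0 < ?w" by (rule unit_ball_vol_pos) simp
 have pos: "0 < q" "0 < c" "0 < ?a"
  using frac_lap_const_pos[OF s, where 'a = 'a] wpos s by (auto simp: q_def c_def intro!: divide_pos_pos mult_pos_pos)
 have K_eq: "K = 2 * (100 * q / c) powr q" by (simp add: K_def holder_const_def q_def c_def)
 have K: "0 < K" using pos by (simp add: K_eq)
 have K_key: "c / 100 * (K / 2) powr (4 * s) = q"
 proof -
  have "(K / 2) powr (4 * s) = (100 * q / c) powr (q * (4 * s))" unfolding K_eq using pos by (simp add: powr_powr)
  also have "q * (4 * s) = 1" using s by (simp add: q_def)
  finally show ?thesis using pos by simp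
 qed
 \<comment> \<open>By scaling, time \<open>t\<close> corresponds to the distance
   \<open>t powr (1 / (2 s))\<close>, whose square root has the exponent \<open>q\<close>. The shift
   \<open>t1\<close> keeps the barrier finite at time 0.\<close>
 define L where "L t = K * M0 * (t + t1) powr (- q)" for t
 have Lpos: "0 < L t" if "0 <= t" for t using that t1 K M0 by (simp add: L_def)
 have Lmono: "L T <= L t" if "0 <= t" "t <= T" for t
  unfolding L_def using that t1 K M0 pos by (intro mult_left_mono powr_mono2') auto
 have [measurable]: "psi t : borel_funs" for t by (rule jump_solution_borel[OF w])
 obtain Cw where Cw: "!!t x. \<bar>psi t x\<bar> <= Cw" using jump_solution_bounded[OF w] by blast
 let ?F = "%t (p::'a \<times> 'a). psi t (fst p) - psi t (snd p) - L t * sqrt (norm (fst p - snd p))"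
 have "?F t (x, y) <= 0"
 proof (rule jump_maximum_principle[where psi = ?F and T = T and lam = "2 * rate" and ?M0.0 = "2 * Cw"])
  show "continuous_on {0..T} (%t. ?F t p)" for p
   unfolding L_def using t1 by (intro continuous_intros jump_solution_continuous[OF w]) auto
  show "?F 0 p <= 0" for p
  proof -
   let ?n = "norm (fst p - snd p)"
   define d where "d = \<bar>psi 0 (fst p) - psi 0 (snd p)\<bar>"
   have d: "0 <= d" "d <= 2 * M0" "d <= Lip * ?n"
    using bdd[of 0 "fst p"] bdd[of 0 "snd p"] lip[of 0 "fst p" "snd p"] T by (auto simp: d_def)
   \<comment> \<open>The geometric mean of the sup bound and the Lipschitz bound produces the square
     root of the distance.\<close>
   have "d * d <= (2 * M0) * (Lip * ?n)" using d M0 by (intro mult_mono) auto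
   then have "d <= sqrt (2 * M0 * Lip * ?n)" using d by (intro real_le_rsqrt) (simp add: power2_eq_square mult.assoc)
   also have "... = sqrt (2 * M0 * Lip) * sqrt ?n" by (rule real_sqrt_mult)
   also have "... <= L 0 * sqrt ?n"
    using init by (intro mult_right_mono) (auto simp: L_def K_def q_def)
   finally show ?thesis unfolding d_def by linarith
  qed
  show "?F t p <= 2 * Cw" if "0 <= t" "t <= T" for t p
  proof -
   have "0 <= L t * sqrt (norm (fst p - snd p))" using Lpos[OF that(1)] by simp
   then show ?thesis using Cw[of t "fst p"] Cw[of t "snd p"] by linarith
  qed
 next
  fix t p Mx assume t: "0 < t" "t < T" and p: "0 < ?F t p" and Mx: "0 <= Mx" "!!q. ?F t q <= Mx"
  obtain x y where xy: "p = (x, y)" by (cases p)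
  define a where "a = x - y"
  define n where "n = norm a"
  have Lt: "0 < L t" "L T <= L t" using Lpos[of t] Lmono[of t] t by auto
  have gt: "L t * sqrt n < psi t x - psi t y" using p by (simp add: xy n_def a_def)
  \<comment> \<open>Closer pairs are excluded by the Lipschitz bound together with the hypothesis
    \<open>eps\<close>. For the others all jumps in \<open>?D\<close> are longer than the truncation
    length, hence present in the kernel.\<close>
  have n8: "8 * eps < n"
  proof (rule ccontr)
   assume "~ 8 * eps < n"
   then have "sqrt n <= sqrt (8 * eps)" by simp
   have n0: "0 <= n" by (simp add: n_def)
   have "psi t x - psi t y <= Lip * n" using lip[of t x y] t by (simp add: n_def a_def)
   also have "... = Lip * sqrt n * sqrt n" using n0 by simp
   also have "... <= Lip * sqrt (8 * eps) * sqrt n"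
    using \<open>sqrt n <= sqrt (8 * eps)\<close> Lip n0 by (intro mult_right_mono mult_left_mono) auto
   also have "... <= L T * sqrt n" using eps n0 by (intro mult_right_mono) (auto simp: L_def K_def q_def)
   also have "... <= L t * sqrt n" using Lt n0 by (intro mult_right_mono) auto
   finally show False using gt by simp
  qed
  have n: "0 < n" using n8 e by simp
  \<comment> \<open>Near \<open>z = - a / 2\<close>, a jump of the first copy alone halves the
    distance and a jump of the second copy alone multiplies it by 3/2.\<close>
  let ?D = "cball (- (1/2) *\<^sub>R a) (n / 20)"
  have zD: "9 / 20 * n <= norm z" "norm z <= 11 / 20 * n" "norm (a + z) <= 11 / 20 * n" "norm (a - z) <= 31 / 20 * n"
   if "z : ?D" for z
  proof -
   define v where "v = z + (1/2) *\<^sub>R a"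
   have v: "norm v <= n / 20" using that by (simp add: v_def dist_norm norm_minus_commute algebra_simps)
   have h: "norm ((1/2) *\<^sub>R a) = n / 2" by (simp add: n_def)
   have h3: "norm ((3/2) *\<^sub>R a) = 3 / 2 * n" by (simp add: n_def)
   have z: "z = v - (1/2) *\<^sub>R a" "a + z = v + (1/2) *\<^sub>R a" "a - z = (3/2) *\<^sub>R a - v"
   proof -
    have 1: "(1/2) *\<^sub>R a + (1/2) *\<^sub>R a = a" by (simp flip: scaleR_left_distrib)
    have 2: "(3/2) *\<^sub>R a = a + (1/2) *\<^sub>R a" using scaleR_left_distrib[of 1 "1/2" a] by simp
    show "z = v - (1/2) *\<^sub>R a" by (simp add: v_def)
    show "a + z = v + (1/2) *\<^sub>R a" by (subst (1) 1[symmetric]) (simp add: v_def add_ac)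
    show "a - z = (3/2) *\<^sub>R a - v" unfolding 2 by (simp add: v_def)
   qed
   show "norm z <= 11 / 20 * n" using norm_triangle_ineq4[of v "(1/2) *\<^sub>R a"] v h unfolding z(1) by linarith
   show "9 / 20 * n <= norm z" using norm_triangle_ineq2[of "(1/2) *\<^sub>R a" v] v h unfolding z(1) by (simp add: norm_minus_commute)
   show "norm (a + z) <= 11 / 20 * n" using norm_triangle_ineq[of v "(1/2) *\<^sub>R a"] v h unfolding z(2) by linarith
   show "norm (a - z) <= 31 / 20 * n" using norm_triangle_ineq4[of "(3/2) *\<^sub>R a" v] v h3 unfolding z(3) by linarith
  qed
  have kappaD: "c * n powr (- (2 * s)) <= measure (jump_kernel s eps) ?D"
  proof -
   have "c * n powr (- (2 * s)) = ?a * n powr (- (?N + 2 * s)) * (?w * (n / 20) ^ DIM('a))"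
    using n by (simp add: c_def powr_diff powr_minus powr_add powr_realpow power_divide field_simps)
   also have "?w * (n / 20) ^ DIM('a) = (LBINT y. indicator ?D y)"
    using n by (simp add: content_cball)
   also have "?a * n powr (- (?N + 2 * s)) * ... = (LBINT y. ?a * n powr (- (?N + 2 * s)) * indicator ?D y)" by simp
   also have "... <= (LBINT y. indicator {y. eps < norm y} y * kern s y * indicator ?D y)"
   proof (rule Bochner_Integration.integral_mono)
    show "Leb1 (%y. ?a * n powr (- (?N + 2 * s)) * indicator ?D y)"
     using emeasure_bounded_finite[OF bounded_cball, of "- (1/2) *\<^sub>R a" "n / 20"]
     by (intro integrable_mult_right) (auto simp: integrable_indicator_iff)
    show "Leb1 (%y. indicator {y. eps < norm y} y * kern s y * indicator ?D y)"
     by (rule Bochner_Integration.integrable_bound[OF integrable_kern_outer[OF s e]]) (auto simp: indicator_def)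
    fix z
    show "?a * n powr (- (?N + 2 * s)) * indicator ?D z <= indicator {y. eps < norm y} z * kern s z * indicator ?D z"
    proof (cases "z : ?D")
     case True
     have "0 < norm z" using zD(1)[OF True] n by linarith
     moreover have "norm z <= n" using zD(2)[OF True] n by linarith
     ultimately have "n powr (- (?N + 2 * s)) <= norm z powr (- (?N + 2 * s))"
      using s by (intro powr_mono2') auto
     moreover have "eps < norm z" using zD(1)[OF True] n8 e by linarith
     ultimately show ?thesis using True pos by (simp add: kern_def)
    qed simp
   qed
   also have "... = measure (jump_kernel s eps) ?D" by (rule measure_jump_kernel[OF s _ e, symmetric]) simp
   finally show ?thesis .
  qed
  have num: "sqrt (11 / 20) + sqrt (31 / 20) <= 199 / 100"
  proof -
   have "sqrt (11 / 20) <= 742 / 1000" by (rule real_le_lsqrt) (auto simp: power2_eq_square)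
   moreover have "sqrt (31 / 20) <= 1245 / 1000" by (rule real_le_lsqrt) (auto simp: power2_eq_square)
   ultimately show ?thesis by linarith
  qed
  let ?G = "L t * sqrt n"
  \<comment> \<open>For \<open>z\<close> in \<open>?D\<close> the bounds \<open>?F <= Mx\<close> at
    \<open>(x + z, y)\<close> and \<open>(x, y + z)\<close> are added, and the square roots sum up
    to at most 1.99 times the old one. All other jumps are made by both copies, which leaves their
    distance unchanged.\<close>
  have pt: "(psi t (x + z) - psi t x) - (psi t (y + z) - psi t y) <= 2 * (Mx - ?F t p) - (1 / 100) * ?G * indicator ?D z" for z
  proof (cases "z : ?D")
   case True
   have F1: "psi t (x + z) - psi t y - L t * sqrt (norm (a + z)) <= Mx" using Mx(2)[of "(x + z, y)"] by (simp add: a_def algebra_simps)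
   have F2: "psi t x - psi t (y + z) - L t * sqrt (norm (a - z)) <= Mx" using Mx(2)[of "(x, y + z)"] by (simp add: a_def algebra_simps)
   have "sqrt (norm (a + z)) <= sqrt (11 / 20) * sqrt n" "sqrt (norm (a - z)) <= sqrt (31 / 20) * sqrt n"
    using zD(3,4)[OF True] by (simp_all add: real_sqrt_mult[symmetric] del: real_sqrt_mult)
   then have "sqrt (norm (a + z)) + sqrt (norm (a - z)) <= (sqrt (11 / 20) + sqrt (31 / 20)) * sqrt n"
    unfolding distrib_right by linarith
   also have "... <= 199 / 100 * sqrt n" using num n by (intro mult_right_mono) auto
   finally have "L t * (sqrt (norm (a + z)) + sqrt (norm (a - z))) <= L t * (199 / 100 * sqrt n)"
    using Lt by (intro mult_left_mono) auto
   then have "L t * sqrt (norm (a + z)) + L t * sqrt (norm (a - z)) <= 199 / 100 * ?G" by (simp add: distrib_left)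
   then have "(psi t (x + z) - psi t x) - (psi t (y + z) - psi t y) <= 2 * Mx - 2 * (psi t x - psi t y) + 199 / 100 * ?G"
    using F1 F2 by simp
   then show ?thesis using True by (simp add: xy n_def a_def)
  next
   case False
   have F1: "?F t (x + z, y + z) <= Mx" by (rule Mx(2))
   have F2: "?F t p <= Mx" by (rule Mx(2))
   show ?thesis using F1 F2 False by (simp add: xy)
  qed
  have j: "jump (jump_kernel s eps) (psi t) x - jump (jump_kernel s eps) (psi t) y <= 2 * rate * (Mx - ?F t p) - (1 / 100) * ?G * measure (jump_kernel s eps) ?D"
  proof -
   have i: "integrable (jump_kernel s eps) (%z. psi t (x + z) - psi t x)" for x using integrable_shift[where phi = "psi t" and x = x, OF _ Cw] by auto
   have iD: "integrable (jump_kernel s eps) (%z. (1 / 100) * ?G * indicator ?D z)"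
    by (intro integrable_mult_right) (auto simp: integrable_indicator_iff emeasure_eq_measure)
   have "jump (jump_kernel s eps) (psi t) x - jump (jump_kernel s eps) (psi t) y
    = (\<integral>z. (psi t (x + z) - psi t x) - (psi t (y + z) - psi t y) \<partial>jump_kernel s eps)"
    unfolding jump_def by (rule Bochner_Integration.integral_diff[OF i i, symmetric])
   also have "... <= (\<integral>z. 2 * (Mx - ?F t p) - (1 / 100) * ?G * indicator ?D z \<partial>jump_kernel s eps)"
    by (rule Bochner_Integration.integral_mono[OF Bochner_Integration.integrable_diff[OF i i] Bochner_Integration.integrable_diff[OF integrable_const iD]]) (rule pt)
   also have "... = 2 * rate * (Mx - ?F t p) - (1 / 100) * ?G * measure (jump_kernel s eps) ?D"
    by (subst Bochner_Integration.integral_diff[OF integrable_const iD]) (simp add: mult_ac)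
   finally show ?thesis .
  qed
  \<comment> \<open>Positivity of \<open>?F\<close> gives \<open>L t sqrt n <= 2 M0\<close>, so the
    points are close and \<open>?D\<close> carries a rate of order \<open>n powr (- 2 s)\<close>. By
    the choice of \<open>K\<close> this outweighs the decrease of \<open>L\<close>.\<close>
  have gain: "q * L t / (t + t1) * sqrt n <= (1 / 100) * ?G * measure (jump_kernel s eps) ?D"
  proof -
   have "L t * sqrt n <= 2 * M0" using gt bdd[of t x] bdd[of t y] t by linarith
   then have "sqrt n <= 2 * M0 / L t" using Lt by (simp add: field_simps)
   moreover have "2 * M0 / L t = 2 / K * (t + t1) powr q" using M0 K t t1 by (simp add: L_def powr_minus field_simps)
   ultimately have "sqrt n powr (4 * s) <= (2 / K * (t + t1) powr q) powr (4 * s)" using s n by (intro powr_mono2) auto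
   also have "... = (2 / K) powr (4 * s) * (t + t1)"
   proof -
    have "((t + t1) powr q) powr (4 * s) = t + t1" using s t t1 by (simp add: powr_powr q_def)
    then show ?thesis using powr_mult[of "2 / K" "(t + t1) powr q" "4 * s"] K by simp
   qed
   also have "sqrt n powr (4 * s) = n powr (2 * s)" using n by (simp add: powr_half_sqrt[symmetric] powr_powr)
   finally have "n powr (2 * s) <= (2 / K) powr (4 * s) * (t + t1)" .
   then have "1 / ((2 / K) powr (4 * s) * (t + t1)) <= 1 / n powr (2 * s)"
    using n K t t1 by (intro divide_left_mono) auto
   also have "1 / ((2 / K) powr (4 * s) * (t + t1)) = (K / 2) powr (4 * s) / (t + t1)"
    using K by (simp add: powr_divide)
   also have "1 / n powr (2 * s) = n powr (- (2 * s))" by (simp add: powr_minus_divide)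
   finally have "c / 100 * ((K / 2) powr (4 * s) / (t + t1)) <= c / 100 * n powr (- (2 * s))"
    using pos by (intro mult_left_mono) auto
   moreover have "c / 100 * ((K / 2) powr (4 * s) / (t + t1)) = q / (t + t1)" by (simp only: K_key[symmetric] times_divide_eq_right)
   ultimately have "q / (t + t1) <= c / 100 * n powr (- (2 * s))" by (simp only:)
   also have "... <= (1 / 100) * measure (jump_kernel s eps) ?D" using kappaD by simp
   finally have "?G * (q / (t + t1)) <= ?G * ((1 / 100) * measure (jump_kernel s eps) ?D)"
    using Lt n by (intro mult_left_mono) auto
   then show ?thesis by (simp add: mult_ac)
  qed
  have dL: "(L has_real_derivative - (q * L t / (t + t1))) (at t)"
  proof -
   have "((%t. K * M0 * (t + t1) powr (- q)) has_real_derivative K * M0 * (- q * (t + t1) powr (- q - 1) * 1)) (at t)"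
    using t t1 by (auto intro!: derivative_eq_intros)
   moreover have "K * M0 * (- q * (t + t1) powr (- q - 1) * 1) = - (q * L t / (t + t1))"
    using t t1 by (simp add: L_def powr_diff)
   ultimately show ?thesis unfolding L_def[abs_def] by simp
  qed
  have "((%tau. psi tau x - psi tau y - L tau * sqrt n) has_real_derivative
    (jump (jump_kernel s eps) (psi t) x - 0) - (jump (jump_kernel s eps) (psi t) y - 0) - (- (q * L t / (t + t1))) * sqrt n) (at t)"
   by (intro DERIV_diff DERIV_cmult_right jump_solution_deriv[OF w t] dL)
  then have d: "((%tau. ?F tau p) has_real_derivative
    (jump (jump_kernel s eps) (psi t) x - 0) - (jump (jump_kernel s eps) (psi t) y - 0) - (- (q * L t / (t + t1))) * sqrt n) (at t)"
   by (simp add: xy n_def a_def)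
  have "(jump (jump_kernel s eps) (psi t) x - 0) - (jump (jump_kernel s eps) (psi t) y - 0) - (- (q * L t / (t + t1))) * sqrt n
   <= 2 * rate * (Mx - ?F t p)"
  proof -
   have "Jx - 0 - (Jy - 0) - (- A) * r <= X" if "Jx - Jy <= X - Y" "A * r <= Y" for Jx Jy A r X Y :: real
    using that by simp
   from this[OF j gain] show ?thesis .
  qed
  with d show "\<exists>D. ((%tau. ?F tau p) has_real_derivative D) (at t) & D <= 2 * rate * (Mx - ?F t p)" by blast
 qed (use T t in auto)
 then have "psi t x - psi t y <= L t * sqrt (norm (x - y))" by simp
 also have "... <= (K * M0 * t powr (- q)) * sqrt (norm (x - y))"
  unfolding L_def using K M0 t t1 pos by (intro mult_right_mono mult_left_mono powr_mono2') auto
 finally show ?thesis by (simp add: K_def q_def)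
qed

subsection \<open>Comparison with classical solutions\<close>

lemma Ls_trunc_integrable:
 fixes u :: "'a::euclidean_space => real"
 assumes s: "0 < s" "s < 1" and u: "u : Ls_space s" and c: "continuous_on UNIV u" and d: "0 < \<delta>"
 shows "Leb1 (%y. indicator {y. \<delta> < norm y} y * kern s y * u (x + y))"
proof -
 have [measurable]: "u : borel_funs" using c by (rule borel_measurable_continuous_onI)
 let ?p = "real DIM('a) + 2 * s" and ?a = "frac_lap_const TYPE('a) s"
 have p: "0 < ?p" using s by (simp add: add_nonneg_pos)
 have a: "0 < ?a" by (rule frac_lap_const_pos[OF s])
 let ?g = "%x. \<bar>u x\<bar> / (1 + norm x powr ?p)"
 have "integrable lebesgue ?g" using u by (simp add: Ls_space_def)
 then have "integrable lborel ?g" by (subst (asm) integrable_completion) auto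
 then have "integrable (distr lborel borel ((+) x)) ?g" by (simp add: lborel_distr_plus)
 then have i: "Leb1 (%y. ?g (x + y))" by (subst (asm) integrable_distr_eq) auto
 define C where "C = (1 / \<delta>) powr ?p + (norm x / \<delta> + 1) powr ?p"
 have C: "0 <= C" by (simp add: C_def)
 show ?thesis
 proof (rule Bochner_Integration.integrable_bound[OF integrable_mult_right[OF i, of "?a * C"]])
  show "AE y in lborel. norm (indicator {y. \<delta> < norm y} y * kern s y * u (x + y)) <= norm (?a * C * ?g (x + y))"
  proof (rule AE_I2)
   fix y :: 'a
   show "norm (indicator {y. \<delta> < norm y} y * kern s y * u (x + y)) <= norm (?a * C * ?g (x + y))"
   proof (cases "\<delta> < norm y")
    case True
    let ?m = "norm (x + y)" and ?n = "norm y"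
    have n: "0 < ?n" using True d by linarith
    have "1 <= ?n / \<delta>" using True d by simp
    then have "1 powr ?p <= (?n / \<delta>) powr ?p" using p by (intro powr_mono2) auto
    then have 1: "1 <= (1 / \<delta>) powr ?p * ?n powr ?p" using d n by (simp add: powr_mult[symmetric])
    have "norm x * \<delta> <= norm x * ?n" using True by (intro mult_left_mono) auto
    then have "norm x <= norm x / \<delta> * ?n" using d by (simp add: field_simps)
    then have "?m <= (norm x / \<delta> + 1) * ?n"
     using norm_triangle_ineq[of x y] by (simp add: distrib_right)
    then have "?m powr ?p <= ((norm x / \<delta> + 1) * ?n) powr ?p" using p by (intro powr_mono2) auto
    also have "... = (norm x / \<delta> + 1) powr ?p * ?n powr ?p" by (rule powr_mult)
    finally have key: "1 + ?m powr ?p <= C * ?n powr ?p" using 1 by (simp add: C_def distrib_right)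
    have pm: "0 < 1 + ?m powr ?p" by (simp add: add_pos_nonneg)
    have "1 / ?n powr ?p <= C / (1 + ?m powr ?p)" using key pm n by (simp add: field_simps)
    then have "?a * (1 / ?n powr ?p) * \<bar>u (x + y)\<bar> <= ?a * (C / (1 + ?m powr ?p)) * \<bar>u (x + y)\<bar>"
     using a by (intro mult_right_mono mult_left_mono) auto
    moreover have "kern s y = ?a * (1 / ?n powr ?p)" by (simp only: kern_inverse inverse_eq_divide)
    ultimately show ?thesis using True a C pm by (simp add: abs_mult)
   qed (use a C in simp)
  qed
 qed measurable
qed

text \<open>At a maximum of \<open>phi - u\<close> the truncated operators are ordered for every
  truncation length, and the order passes to the limit. The integrability of \<open>u\<close>
  against long jumps comes from \<open>Ls_space\<close>.\<close>

lemma frac_lap_touching: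
 fixes u phi :: "'a::euclidean_space => real"
 assumes s: "0 < s" "s < 1" and u: "u : Ls_space s" "continuous_on UNIV u" and phi: "c11_bound M B D phi"
  and touch: "!!y. phi y - u y <= phi x - u x" and L: "has_frac_lap s u x L"
 shows "L <= full_lap s phi x"
proof -
 have [measurable]: "u : borel_funs" "phi : borel_funs"
  using u(2) c11_bound_borel[OF phi] by (auto intro: borel_measurable_continuous_onI)
 have le: "frac_lap_trunc s \<delta> u x <= frac_lap_trunc s \<delta> phi x" if d: "0 < \<delta>" for \<delta>
 proof -
  interpret symmetric_jumps "jump_kernel s \<delta> :: 'a measure" by (rule symmetric_jumps_jump_kernel[OF s d])
  have "integrable (jump_kernel s \<delta>) (%y. u (x + y))"
   using Ls_trunc_integrable[OF s u d, of x] by (subst integrable_jump_kernel[OF s]) auto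
  then have i1: "integrable (jump_kernel s \<delta>) (%y. u (x + y) - u x)" by auto
  have i2: "integrable (jump_kernel s \<delta>) (%y. phi (x + y) - phi x)"
   using integrable_shift[of phi M x] c11_boundD(1)[OF phi] by auto
  have "jump (jump_kernel s \<delta>) phi x <= jump (jump_kernel s \<delta>) u x"
   unfolding jump_def by (rule Bochner_Integration.integral_mono[OF i2 i1]) (use touch[of "x + _"] in "auto simp: algebra_simps")
  then show ?thesis by (simp add: frac_lap_trunc_eq_jump[OF s])
 qed
 show ?thesis
 proof (rule tendsto_le[OF _ c11_has_frac_lap(1)[OF s phi, unfolded has_frac_lap_def] L[unfolded has_frac_lap_def]])
  show "\<forall>\<^sub>F eps in at_right 0. frac_lap_trunc s eps u x <= frac_lap_trunc s eps phi x"
   using le by (auto simp: eventually_at_right_field intro!: exI[of _ 1])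
 qed simp
qed

lemma classical_solution_continuous:
 assumes "classical_solution s f u" "0 < t"
 shows "continuous_on UNIV (u t)"
proof -
 have "continuous_on half_space (%(t, x). u t x)" using assms by (simp add: classical_solution_def)
 from continuous_on_compose2[OF this continuous_on_Pair[OF continuous_on_const[of _ t] continuous_on_id]] assms(2)
 show ?thesis by (auto simp: half_space_def)
qed

text \<open>Since \<open>u\<close> is nonnegative and \<open>w\<close> is below \<open>th\<close>
  far away, a positive excess of \<open>w\<close> over \<open>u\<close> attains its maximum on a
  compact set, where \<open>w\<close> touches \<open>u\<close> from below up to a constant. The
  slope \<open>2 th\<close> in time pays \<open>th\<close> for replacing the fractional Laplacian of
  \<open>w\<close> by \<open>J\<close>, and the other \<open>th\<close> makes the inequality strict.
  The offset \<open>th\<close> is what allows \<open>f\<close> to be compared with \<open>F\<close>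
  only for \<open>r <= w - th\<close>.\<close>

lemma classical_above_subsolution:
 fixes u w :: "real => 'a::euclidean_space => real"
 assumes s: "0 < s" "s < 1" and u: "classical_solution s f u" and unn: "!!t x. 0 < t ==> 0 <= u t x"
  and t0: "0 < t0" and th: "0 < th"
  and wc: "continuous_on UNIV (%(sig, x). w sig x)" and reg: "!!sig. 0 <= sig ==> sig <= T ==> c11_bound M B D (w sig)"
  and der: "!!sig x. 0 < sig ==> sig < T ==> ((%tau. w tau x) has_real_derivative J sig x - F sig x) (at sig)"
  and J: "!!sig x. 0 <= sig ==> sig <= T ==> \<bar>full_lap s (w sig) x + J sig x\<bar> <= th"
  and F: "!!sig x r. 0 < sig ==> sig < T ==> 0 <= r ==> r <= w sig x - th ==> f (t0 + sig) x r <= F sig x"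
  and init: "!!x. w 0 x <= u t0 x + th"
  and far: "!!sig x. 0 <= sig ==> sig <= T ==> R <= norm (x - z) ==> w sig x < th"
  and sig: "0 <= sig" "sig < T"
 shows "w sig x - th - 2 * th * sig <= u (t0 + sig) x"
proof (rule ccontr)
 define q where "q tau y = w tau y - th - 2 * th * tau - u (t0 + tau) y" for tau y
 assume "~ ?thesis"
 then have q0: "0 < q sig x" by (simp add: q_def)
 have far': "q tau y < 0" if "0 <= tau" "tau <= T" "R <= norm (y - z)" for tau y
 proof -
  have "0 <= th * tau" using th that by simp
  then show ?thesis using far[OF that] unn[of "t0 + tau" y] t0 that unfolding q_def by linarith
 qed
 have xz: "norm (x - z) < R" using far'[of sig x] sig q0 by (meson less_asym less_imp_le not_le)
 let ?S = "{0..sig} \<times> cball z R"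
 have "continuous_on ?S (%p. u (t0 + fst p) (snd p))"
 proof -
  have "continuous_on half_space (%(t, x). u t x)" using u by (simp add: classical_solution_def)
  moreover have "continuous_on ?S (%p. (t0 + fst p, snd p))" by (intro continuous_intros)
  moreover have "(%p. (t0 + fst p, snd p)) ` ?S \<subseteq> half_space" using t0 by (auto simp: half_space_def)
  ultimately have "continuous_on ?S (%p. (%(t, x). u t x) (t0 + fst p, snd p))" by (rule continuous_on_compose2)
  then show ?thesis by simp
 qed
 moreover have "continuous_on ?S (%p. w (fst p) (snd p))"
  using wc by (auto simp: case_prod_unfold intro: continuous_on_subset)
 ultimately have "continuous_on ?S (%p. q (fst p) (snd p))" unfolding q_def by (intro continuous_intros)
 moreover have "compact ?S" by (intro compact_Times compact_Icc compact_cball)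
 moreover have S0: "(sig, x) : ?S" using sig xz by (simp add: dist_norm norm_minus_commute less_imp_le)
 ultimately obtain p where p: "p : ?S" "!!p'. p' : ?S ==> q (fst p') (snd p') <= q (fst p) (snd p)"
  using continuous_attains_sup[of ?S "%p. q (fst p) (snd p)"] by blast
 obtain tau y where ty: "p = (tau, y)" by (cases p)
 have tau: "0 <= tau" "tau <= sig" using p(1) by (auto simp: ty)
 have qp: "0 < q tau y" using p(2)[OF S0] q0 by (simp add: ty)
 have max: "q tau' y' <= q tau y" if "0 <= tau'" "tau' <= sig" for tau' y'
 proof (cases "norm (y' - z) <= R")
  case True
  then show ?thesis using p(2)[of "(tau', y')"] that by (simp add: ty dist_norm norm_minus_commute)
 next
  case False
  then show ?thesis using far'[of tau' y'] that sig qp by simp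
 qed
 have tau0: "0 < tau"
 proof (rule ccontr)
  assume "~ 0 < tau"
  then have "tau = 0" using tau by simp
  then show False using qp init[of y] by (simp add: q_def)
 qed
 have tT: "tau < T" using tau sig by linarith
 have tt: "0 < t0 + tau" using t0 tau0 by simp
 obtain Du L where DL: "((%r. u r y) has_real_derivative Du) (at (t0 + tau))" "has_frac_lap s (u (t0 + tau)) y L"
  "Du + L + f (t0 + tau) y (u (t0 + tau) y) = 0"
  using u tt unfolding classical_solution_def by meson
 have Ls: "u (t0 + tau) : Ls_space s" using u tt by (simp add: classical_solution_def)
 have "L <= full_lap s (w tau) y"
 proof (rule frac_lap_touching[OF s Ls classical_solution_continuous[OF u tt] reg _ DL(2)])
  show "w tau y' - u (t0 + tau) y' <= w tau y - u (t0 + tau) y" for y'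
   using max[of tau y'] tau by (simp add: q_def)
 qed (use tau tT in auto)
 moreover have "\<bar>full_lap s (w tau) y + J tau y\<bar> <= th" using J tau tT by simp
 moreover have "f (t0 + tau) y (u (t0 + tau) y) <= F tau y"
 proof (rule F[OF tau0 tT])
  show "0 <= u (t0 + tau) y" using unn tt by simp
  have "0 <= th * tau" using th tau by simp
  then show "u (t0 + tau) y <= w tau y - th" using qp unfolding q_def by linarith
 qed
 ultimately have neg: "J tau y - F tau y - 2 * th - Du < 0" using DL(3) th by linarith
 have "((%r. u (t0 + r) y) has_real_derivative Du) (at tau)"
  using DERIV_shift[of "%r. u r y" Du tau t0] DL(1) by (simp add: add.commute)
 moreover have "((%r. th + 2 * th * r) has_real_derivative 2 * th) (at tau)" by (auto intro!: derivative_eq_intros)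
 ultimately have "((%r. w r y - (th + 2 * th * r) - u (t0 + r) y) has_real_derivative J tau y - F tau y - 2 * th - Du) (at tau)"
  by (intro DERIV_diff der tau0 tT)
 then have dq: "((%r. q r y) has_real_derivative J tau y - F tau y - 2 * th - Du) (at tau)"
  by (simp add: q_def diff_diff_eq)
 \<comment> \<open>The maximum is over times up to \<open>sig\<close> only, but to its left a
   negative derivative is already contradictory.\<close>
 obtain d where d: "0 < d" "!!h. 0 < h ==> h < d ==> q tau y < q (tau - h) y"
  using DERIV_neg_dec_left[OF dq neg] by auto
 define h where "h = min (d / 2) (tau / 2)"
 have h: "0 < h" "h < d" "h < tau" using d tau0 by (auto simp: h_def)
 then show False using d(2)[of h] max[of "tau - h" y] tau by simp
qed

text \<open>First a radius is fixed beyond which the jumps have a small total rate; then spreading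
  the bump divides its second differences by \<open>R^2\<close>, which takes care of the shorter
  jumps.\<close>

lemma jump_bump_small:
 assumes s: "0 < s" "s < 1" and d: "0 < \<delta>"
 shows "\<exists>R0>0. \<forall>R\<ge>R0. \<forall>eps>0. \<forall>x. \<bar>jump (jump_kernel s eps) (bump_at (z::'a::euclidean_space) R) x\<bar> <= \<delta>"
proof -
 obtain M B D where b: "c11_bound M B D (bump :: 'a => real)" using c11_bump unfolding c11_def by blast
 note nn = c11_bound_nonneg[OF b]
 obtain r where r: "0 < r" "measure (jump_kernel s r :: 'a measure) UNIV <= \<delta> / (4 * (M + 1))"
  using rate_small[OF s, of "\<delta> / (4 * (M + 1))"] d nn by auto
 have m: "2 * M * measure (jump_kernel s r :: 'a measure) UNIV <= \<delta> / 2"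
 proof -
  have "2 * M * measure (jump_kernel s r :: 'a measure) UNIV <= 2 * M * (\<delta> / (4 * (M + 1)))" using r nn by (intro mult_left_mono) auto
  also have "... <= \<delta> / 2" using nn d by (simp add: field_simps)
  finally show ?thesis .
 qed
 let ?m = "m2 TYPE('a) s r"
 have m0: "0 <= ?m" by (rule m2_nonneg[OF s])
 define R0 where "R0 = max 1 (2 * D * ?m / \<delta>)"
 show ?thesis
 proof (intro exI[of _ R0] conjI allI impI)
  show "0 < R0" by (simp add: R0_def)
  fix R eps x assume R: "R0 <= R" and e: "(0::real) < eps"
  have R1: "1 <= R" "2 * D * ?m / \<delta> <= R" using R by (auto simp: R0_def)
  have cb: "c11_bound M (B * \<bar>1 / R\<bar>) (D * (1 / R)^2) (bump_at z R)"
   unfolding bump_at_def[abs_def] by (rule c11_affine[OF b]) (use R1 in auto)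
  have "\<bar>jump (jump_kernel s eps) (bump_at z R) x\<bar> <= D * (1 / R)^2 * ?m + 2 * M * measure (jump_kernel s r :: 'a measure) UNIV"
   by (rule jump_kernel_bound[OF s cb e r(1)])
  also have "D * (1 / R)^2 * ?m <= \<delta> / 2"
  proof -
   have "R <= R^2" using R1 by (simp add: power2_eq_square)
   then have "2 * D * ?m / \<delta> <= R^2" using R1 by linarith
   then have "2 * (D * ?m) <= \<delta> * R^2" using d by (simp add: field_simps)
   then show ?thesis using R1 by (simp add: field_simps power2_eq_square)
  qed
  finally show "\<bar>jump (jump_kernel s eps) (bump_at z R) x\<bar> <= \<delta>" using m by linarith
 qed
qed

lemma jump_bump_bounded:
 assumes s: "0 < s" "s < 1" and r: "0 < r"
 shows "\<exists>K\<ge>0. \<forall>eps>0. \<forall>z x. \<bar>jump (jump_kernel s eps) (bump_at (z::'a::euclidean_space) r) x\<bar> <= K"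
proof -
 obtain M B D where b: "c11_bound M B D (bump :: 'a => real)" using c11_bump unfolding c11_def by blast
 define K where "K = D * (1 / r)^2 * m2 TYPE('a) s 1 + 2 * M * measure (jump_kernel s 1 :: 'a measure) UNIV"
 have K: "\<bar>jump (jump_kernel s eps) (bump_at z r) x\<bar> <= K" if "0 < eps" for eps and z x :: 'a
 proof -
  have cb: "c11_bound M (B * \<bar>1 / r\<bar>) (D * (1 / r)^2) (bump_at z r)"
   unfolding bump_at_def[abs_def] by (rule c11_affine[OF b]) (use r in auto)
  show ?thesis unfolding K_def by (rule jump_kernel_bound[OF s cb that]) simp
 qed
 moreover have "0 <= K" using K[of 1 0 0] abs_ge_zero order_trans by (metis zero_less_one)
 ultimately show ?thesis by blast
qed

section \<open>Approximate solutions started at the time t0\<close>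

definition time_weight :: "real => real => real => real => real" where
 "time_weight \<beta> t0 T sig = (t0 + max 0 (min T sig)) powr \<beta>"

text \<open>Time is counted from \<open>t0\<close>, so \<open>sig\<close> stands for the time
  \<open>t0 + sig\<close> of \<open>u\<close>. The two bounds on \<open>G\<close> serve opposite
  comparisons: \<open>g (r - th) <= G r\<close> makes \<open>w - th\<close> absorb at least as much
  as \<open>f\<close> does, while \<open>G <= g\<close> bounds the absorbed mass and makes
  \<open>w\<close> absorb no more than the weak solution. \<open>defect\<close> says that on
  \<open>w\<close> the jump operator is within \<open>th\<close> of the negative fractional
  Laplacian.\<close>

locale approximant =
 fixes s \<beta> :: real and g :: "real => real" and z :: "'a::euclidean_space" and t0 T th k eps M B D R :: real
  and G :: "real => real" and w :: "real => 'a => real"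
 assumes s: "0 < s" "s < 1" and t0: "0 < t0" and T: "0 < T" and th: "0 < th" and eps: "0 < eps" and k: "0 < k"
  and sol: "jump_solution (jump_kernel s eps) (%sig x r. time_weight \<beta> t0 T sig * G r) T w"
  and G0: "!!r. r <= 0 ==> G r = 0" and G_mono: "!!r r'. r <= r' ==> G r <= G r'"
  and G_lip: "\<exists>K\<ge>0. \<forall>r\<ge>0. G r <= K * r" and G_cont: "continuous_on UNIV G"
  and G_le: "!!r. 0 <= r ==> G r <= g r" and G_ge: "!!r. th <= r ==> r <= M ==> g (r - th) <= G r"
  and reg: "!!sig. 0 <= sig ==> sig <= T ==> c11_bound M B D (w sig)"
  and nonneg: "!!sig x. 0 <= sig ==> sig <= T ==> 0 <= w sig x"
  and mass: "!!sig. 0 <= sig ==> sig <= T ==> (NN x. ennreal \<bar>w sig x\<bar>) <= ennreal k"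
  and defect: "D * m2 TYPE('a) s eps <= th"
  and far: "!!sig x. 0 <= sig ==> sig <= T ==> R <= norm (x - z) ==> w sig x < th"
  and sup: "!!sig x. 0 < sig ==> sig <= T ==> w sig x <= sup_const TYPE('a) s * k * sig powr (- (real DIM('a) / (2 * s)))"

lemma time_weight_bounds:
 assumes "0 < t0" "0 < T"
 shows "0 <= time_weight \<beta> t0 T sig" "time_weight \<beta> t0 T sig <= t0 powr \<beta> + (t0 + T) powr \<beta>"
proof -
 show "0 <= time_weight \<beta> t0 T sig" by (simp add: time_weight_def)
 let ?m = "t0 + max 0 (min T sig)"
 have m: "t0 <= ?m" "?m <= t0 + T" using assms by auto
 show "time_weight \<beta> t0 T sig <= t0 powr \<beta> + (t0 + T) powr \<beta>"
 proof (cases "0 <= \<beta>")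
  case True
  then have "?m powr \<beta> <= (t0 + T) powr \<beta>" using m assms by (intro powr_mono2) auto
  then show ?thesis unfolding time_weight_def using powr_ge_zero[of t0 \<beta>] by linarith
 next
  case False
  then have "?m powr \<beta> <= t0 powr \<beta>" using m assms by (intro powr_mono2') auto
  then show ?thesis unfolding time_weight_def using powr_ge_zero[of "t0 + T" \<beta>] by linarith
 qed
qed

lemma time_weight_continuous: "0 < t0 ==> continuous_on S f ==> continuous_on S (%p. time_weight \<beta> t0 T (f p))"
proof -
 assume t0: "0 < t0" and f: "continuous_on S f"
 have "continuous_on S (%p. t0 + max 0 (min T (f p)))" by (intro continuous_intros f)
 moreover have "t0 + max 0 r \<noteq> 0" for r using t0 by (simp add: add_pos_nonneg less_imp_neq[symmetric])
 ultimately show ?thesis unfolding time_weight_def by (intro continuous_on_powr continuous_on_const) auto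
qed

lemma approximant_exists:
 fixes z :: "'a::euclidean_space"
 assumes s: "0 < s" "s < 1" and t0: "0 < t0" and T: "0 < T" and th: "0 < th" and k: "0 < k"
  and g: "mono_on {0..} g" "!!r. 0 <= r ==> 0 <= g r"
  and mu: "c11 \<mu>" "!!x. 0 <= \<mu> x" "!!x. r0 <= norm (x - z) ==> \<mu> x = 0"
   "(NN x. ennreal \<bar>\<mu> x\<bar>) <= ennreal k"
 obtains eps M B D R G w where "approximant s \<beta> g z t0 T th k eps M B D R G w" "!!x. w 0 x = \<mu> x"
proof -
 obtain M1 B1 D1 where b1: "c11_bound M1 B1 D1 \<mu>" using mu(1) unfolding c11_def by blast
 define M where "M = M1 + 1"
 have M: "0 < M" "M1 <= M" using c11_bound_nonneg[OF b1] by (auto simp: M_def)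
 have bM: "c11_bound M B1 D1 \<mu>" using b1 M(2) unfolding c11_bound_def by (meson order_trans)
 obtain G K C where G: "0 <= K" "0 <= C" "!!r. r <= 0 ==> G r = 0" "!!r r'. r <= r' ==> G r <= G r'"
  "!!r r'. r <= r' ==> G r' - G r <= K * (r' - r)"
  "!!r r'. \<bar>G r + G r' - 2 * G ((r + r') / 2)\<bar> <= C * (r - r')^2"
  "!!r. 0 <= r ==> G r <= g r" "!!r. th <= r ==> r <= M ==> g (r - th) <= G r"
 proof -
  show ?thesis
  proof (rule smooth_absorption_exists[OF g th, where R = M])
   fix K C :: real and G :: "real => real"
   assume a: "0 <= K" "0 <= C" "!!r. r <= 0 ==> G r = 0" "!!r r'. r <= r' ==> G r <= G r'"
    "!!r r'. r <= r' ==> G r' - G r <= K * (r' - r)"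
    "!!r r'. \<bar>G r + G r' - 2 * G ((r + r') / 2)\<bar> <= C * (r - r')^2"
    "!!r. 0 <= r ==> G r <= g r" "!!r. th <= r ==> r <= M ==> g (r - th) <= G r"
   show ?thesis by (rule that) (fact a)+
  qed
 qed
 have G_cont: "continuous_on UNIV G"
 proof -
  have "K-lipschitz_on UNIV G"
  proof (rule lipschitz_onI)
   show "dist (G r) (G r') <= K * dist r r'" for r r'
    using G(4,5)[of r r'] G(4,5)[of r' r] by (cases "r <= r'") (auto simp: dist_real_def)
  qed (rule G(1))
  then show ?thesis by (rule lipschitz_on_continuous_on)
 qed
 let ?p = "time_weight \<beta> t0 T" and ?P = "t0 powr \<beta> + (t0 + T) powr \<beta>"
 note p = time_weight_bounds[OF t0 T, of \<beta>]
 have P: "0 <= ?P" by simp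
 let ?b = "%sig (x::'a) r. ?p sig * G r"
 \<comment> \<open>The constant of \<open>jump_solution_c11\<close>, with 0 for the dependence of
   the absorption on \<open>x\<close>. It is fixed before \<open>eps\<close>, which can therefore be
   chosen with \<open>D m2 <= th\<close>.\<close>
 define D where "D = D1 + ?P * (4 * C) * (1 + (B1 + 0 * T))^2 * T"
 have D: "0 <= D" unfolding D_def using c11_bound_nonneg[OF b1] P G(2) T by (intro add_nonneg_nonneg mult_nonneg_nonneg) auto
 obtain r1 where r1: "0 < r1" "!!eps. eps <= r1 ==> m2 TYPE('a) s eps <= th / (D + 1)"
  using m2_small[OF s, of "th / (D + 1)"] th D by auto
 let ?v = "unit_ball_vol (real DIM('a))"
 have v: "0 < ?v" by (rule unit_ball_vol_pos) simp
 \<comment> \<open>\<open>r1\<close> serves \<open>defect\<close>, \<open>k / (M * ?v)\<close>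
   serves the hypothesis of \<open>jump_solution_sup_bound\<close>, and 1 bounds the power
   \<open>eps ^ DIM('a)\<close> by \<open>eps\<close>.\<close>
 define eps where "eps = min r1 (min 1 (k / (M * ?v)))"
 have kMv: "0 < k / (M * ?v)" using k M v by (intro divide_pos_pos mult_pos_pos)
 have eps: "0 < eps" "eps <= r1" using r1 kMv by (auto simp: eps_def)
 have eps2: "?v * eps ^ DIM('a) <= k / M"
 proof -
  have "eps ^ DIM('a) <= eps ^ 1" using eps by (intro power_decreasing) (auto simp: eps_def)
  also have "... <= k / (M * ?v)" by (simp add: eps_def)
  finally have "?v * eps ^ DIM('a) <= ?v * (k / (M * ?v))" using v by (intro mult_left_mono) auto
  also have "... = k / M" using less_imp_neq[OF v] by simp
  finally show ?thesis .
 qed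
 interpret symmetric_jumps "jump_kernel s eps :: 'a measure" by (rule symmetric_jumps_jump_kernel[OF s eps(1)])
 interpret E: jump_equation "jump_kernel s eps :: 'a measure" ?b "?P * K" T 0 0 M k \<mu>
 proof
  show "0 < T" by (rule T)
  show "0 <= ?P * K" using P G(1) by simp
  show "continuous_on UNIV (%(t, x, r). ?p t * G r)"
   unfolding case_prod_unfold
   by (intro continuous_intros time_weight_continuous[OF t0] continuous_on_compose2[OF G_cont]) auto
  show "?p t * G r <= ?p t * G r'" if "r <= r'" for t r r' using p G(4)[OF that] by (intro mult_left_mono)
  show "?p t * G r' - ?p t * G r <= ?P * K * (r' - r)" if "r <= r'" for t r r'
  proof -
   have "?p t * (G r' - G r) <= ?P * (K * (r' - r))" using p P G(4,5)[OF that] by (intro mult_mono) auto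
   then show ?thesis by (simp add: right_diff_distrib mult.assoc)
  qed
  show "\<bar>?p t * G 0\<bar> <= 0" for t using G(3) by simp
  show "(NN x. ennreal \<bar>?p t * G 0\<bar>) <= ennreal 0" for t using G(3) by simp
  show "continuous_on UNIV \<mu>" by (rule c11_continuous[OF mu(1)])
  show "\<bar>\<mu> x\<bar> <= M" for x using c11_boundD(1)[OF bM] .
  show "(NN x. ennreal \<bar>\<mu> x\<bar>) <= ennreal k" by (rule mu(4))
  show "0 <= k" using k by simp
 qed auto
 obtain w where w: "jump_solution (jump_kernel s eps) ?b T w" "!!x. w 0 x = \<mu> x"
  "!!t. 0 <= t ==> t <= T ==> (NN x. ennreal \<bar>w t x\<bar>) <= ennreal (k + 0 * t)"
  using E.solution_exists by blast
 have T0: "0 <= T" using T by simp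
 have bmono: "?b t x r <= ?b t x r'" if "r <= r'" for t x r r' using p G(4)[OF that] by (intro mult_left_mono)
 have up: "w t x <= M" if "0 <= t" "t <= T" for t x
 proof (rule comparison_above[OF w(1) T0, where B = "%_ _. M" and C = M])
  show "w 0 x <= M" for x using w(2) c11_boundD(1)[OF bM, of x] by simp
  show "\<exists>D. ((%tau. M) has_real_derivative D) (at t) & jump (jump_kernel s eps) (%_. M) x - ?b t x M <= D" for t x
   using p[of t] G(3)[of 0] G(4)[of 0 M] M by (intro exI[of _ 0]) (simp add: jump_def)
 qed (use that M bmono in auto)
 have lo: "0 <= w t x" if "0 <= t" "t <= T" for t x
 proof (rule comparison_below[OF w(1) T0, where B = "%_ _. 0" and C = 0])
  show "0 <= w 0 x" for x using w(2) mu(2) by simp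
  show "\<exists>D. ((%tau. 0) has_real_derivative D) (at t) & D <= jump (jump_kernel s eps) (%_. 0) x - ?b t x 0" for t x
   using G(3)[of 0] by (intro exI[of _ 0]) (simp add: jump_def)
 qed (use that bmono in auto)
 have ab: "absorption_bounds M 0 (?P * (4 * C)) ?b"
  unfolding absorption_bounds_def
 proof (intro conjI allI impI)
  show "?p t * G r <= ?p t * G r'" if "r <= r'" for t r r' using p G(4)[OF that] by (intro mult_left_mono)
  show "\<bar>?p t * G r - ?p t * G r\<bar> <= 0 * norm h" for t r and h :: 'a by simp
  show "\<bar>?p t * G (r + q) + ?p t * G (r - q) - 2 * (?p t * G r)\<bar> <= ?P * (4 * C) * (norm h + \<bar>q\<bar>)^2" for t r q and h :: 'a
  proof -
   have "\<bar>G (r + q) + G (r - q) - 2 * G r\<bar> <= C * (2 * q)^2" using G(6)[of "r + q" "r - q"] by simp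
   also have "... = 4 * C * \<bar>q\<bar>^2" by (simp add: power2_eq_square)
   also have "... <= 4 * C * (norm h + \<bar>q\<bar>)^2" using G(2) by (intro mult_left_mono power_mono) auto
   finally have 1: "\<bar>G (r + q) + G (r - q) - 2 * G r\<bar> <= 4 * C * (norm h + \<bar>q\<bar>)^2" .
   have "\<bar>?p t * G (r + q) + ?p t * G (r - q) - 2 * (?p t * G r)\<bar> = ?p t * \<bar>G (r + q) + G (r - q) - 2 * G r\<bar>"
   proof -
    have "?p t * G (r + q) + ?p t * G (r - q) - 2 * (?p t * G r) = ?p t * (G (r + q) + G (r - q) - 2 * G r)"
     by (simp add: algebra_simps)
    then show ?thesis using p(1)[of t] by (simp only: abs_mult abs_of_nonneg)
   qed
   also have "... <= ?P * (4 * C * (norm h + \<bar>q\<bar>)^2)" using p[of t] 1 P by (intro mult_mono) auto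
   finally show ?thesis by (simp add: mult.assoc)
  qed
 qed
 have bdd: "\<bar>w t x\<bar> <= M" if "0 <= t" "t <= T" for t x using up[OF that, of x] lo[OF that, of x] by simp
 have w0: "w 0 = \<mu>" using w(2) by auto
 have reg: "c11_bound M (B1 + 0 * T) D (w t)" if "0 <= t" "t <= T" for t
  unfolding D_def using jump_solution_c11[OF w(1) T0 ab bdd _ _ that, of B1 D1] bM w0 P G(2) by simp
 have "0 < 2 * M * T + 1" using M T by (simp add: add_pos_pos)
 then have "0 < th / (2 * M * T + 1) / 2" using th by simp
 then obtain R0 where R0: "0 < R0" "!!R eps x. R0 <= R ==> 0 < eps ==> \<bar>jump (jump_kernel s eps) (bump_at z R) x\<bar> <= th / (2 * M * T + 1) / 2"
  using jump_bump_small[OF s, of "th / (2 * M * T + 1) / 2" z] by blast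
 define R where "R = max R0 (2 * \<bar>r0\<bar>)"
 have far: "w t x < th" if t: "0 <= t" "t <= T" and x: "R <= norm (x - z)" for t x
 proof -
  have "w t x <= 2 * M * (th / (2 * M * T + 1) / 2) * t"
  proof (rule jump_solution_decay[OF s eps(1) T0 w(1), where ?r0.0 = r0 and z = z and R = R])
   show "w 0 x <= M" for x using up[of 0 x] T0 by simp
   show "w 0 x <= 0" if "r0 <= norm (x - z)" for x using mu(3)[OF that] w(2) by simp
   show "\<bar>jump (jump_kernel s eps) (bump_at z R) x\<bar> <= th / (2 * M * T + 1) / 2" for x
    using R0(2)[of R eps x] eps by (simp add: R_def)
  qed (use bmono G(3)[of 0] M R0(1) t x in "auto simp: R_def")
  also have "... <= 2 * M * (th / (2 * M * T + 1) / 2) * T" using M th T t by (intro mult_left_mono) auto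
  also have "... < th"
  proof -
   define X where "X = 2 * M * T"
   have X: "0 < X" using M T by (simp add: X_def)
   have "2 * M * (th / (2 * M * T + 1) / 2) * T = X / (X + 1) * (th / 2)" by (simp add: X_def)
   also have "... <= 1 * (th / 2)" using X th by (intro mult_right_mono) auto
   finally show ?thesis using th by simp
  qed
  finally show ?thesis .
 qed
 have "approximant s \<beta> g z t0 T th k eps M (B1 + 0 * T) D R G w"
 proof
  show "\<exists>K\<ge>0. \<forall>r\<ge>0. G r <= K * r" using G(1) G(5)[of 0] G(3)[of 0] by (intro exI[of _ K]) auto
  show "D * m2 TYPE('a) s eps <= th"
  proof -
   have "D * m2 TYPE('a) s eps <= D * (th / (D + 1))" using r1(2)[OF eps(2)] D by (intro mult_left_mono)
   also have "... <= th" using D th by (simp add: field_simps)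
   finally show ?thesis .
  qed
  show "w sig x <= sup_const TYPE('a) s * k * sig powr (- (real DIM('a) / (2 * s)))" if "0 < sig" "sig <= T" for sig x
  proof (rule jump_solution_sup_bound[OF s eps(1) T0 w(1)])
   show "0 <= ?b t x r" if "0 <= r" for t x r using p[of t] G(3)[of 0] G(4)[OF that] by simp
   show "w 0 x <= M" for x using up[of 0 x] T0 by simp
  qed (use lo w(3) M(1) k eps2 that in auto)
 qed (use s t0 T th eps(1) k w(1,3) G G_cont reg lo far in auto)
 then show ?thesis using w(2) by (rule that)
qed

context approximant
begin

lemma sj: "symmetric_jumps (jump_kernel s eps :: 'a measure)"
 by (rule symmetric_jumps_jump_kernel[OF s eps])

lemma weight_eq: "0 <= sig ==> sig <= T ==> time_weight \<beta> t0 T sig = (t0 + sig) powr \<beta>"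
 using T by (simp add: time_weight_def)

lemma G_nonneg: "0 <= G r"
 using G0[of "min r 0"] G_mono[of "min r 0" r] by simp

lemma le_classical_solution:
 assumes u: "classical_solution s f u" and unn: "!!t x. 0 < t ==> 0 <= u t x"
  and f: "!!t x r. 0 < t ==> 0 <= r ==> f t x r <= t powr \<beta> * g r"
  and init: "!!x. w 0 x <= u t0 x + th" and sig: "0 <= sig" "sig < T"
 shows "w sig x - th - 2 * th * sig <= u (t0 + sig) x"
proof (rule classical_above_subsolution[OF s u unn t0 th jump_solution_continuous(1)[OF sol] reg jump_solution_deriv[OF sol] _ _ init far sig])
 show "\<bar>full_lap s (w sig) x + jump (jump_kernel s eps) (w sig) x\<bar> <= th" if "0 <= sig" "sig <= T" for sig x
  using jump_kernel_error[OF s reg[OF that] eps, of x] defect by linarith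
 show "f (t0 + sig) x r <= time_weight \<beta> t0 T sig * G (w sig x)"
  if "0 < sig" "sig < T" "0 <= r" "r <= w sig x - th" for sig x r
 proof -
  have "f (t0 + sig) x r <= (t0 + sig) powr \<beta> * g r" using f t0 that by simp
  also have "g r <= G (w sig x)"
  proof -
   have "w sig x <= M" using c11_boundD(1)[OF reg[of sig], of x] that by simp
   then have "g ((r + th) - th) <= G (r + th)" using that by (intro G_ge) auto
   also have "... <= G (w sig x)" using that by (intro G_mono) simp
   finally show ?thesis by simp
  qed
  finally show ?thesis using that by (simp add: weight_eq mult_left_mono)
 qed
qed auto

end

subsection \<open>Absorption and persistence of mass\<close>

text \<open>Cauchy condensation: on the block from \<open>2^(j+1)\<close> to \<open>2^(j+2)\<close>
  monotonicity bounds \<open>g\<close> below by its value at the left end, and the power is smallest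
  at the right end. Block length times power gives \<open>(2 powr (- (1 + e))) ^ j\<close> up to the
  constant \<open>2 powr (- (3 + 2 e))\<close>.\<close>

lemma dyadic_summable:
 fixes g :: "real => real"
 assumes mono: "mono_on {0..} g" and nn: "!!r. 0 <= r ==> 0 <= g r" and e: "0 <= e"
  and int: "set_integrable lebesgue {1..} (%sig. g sig * sig powr (- 2 - e))"
 shows "summable (%j. g (2 ^ (j + 1)) * (2 powr (- (1 + e))) ^ j)"
proof (rule summableI_nonneg_bounded)
 let ?c = "%j. g (2 ^ (j + 1)) * (2 powr (- (1 + e))) ^ j"
 let ?f = "%sig. indicator {1..} sig * (g sig * sig powr (- 2 - e))"
 show "0 <= ?c j" for j using nn[of "2 ^ (j + 1)"] by simp
 fix n
 define A where "A j = {2 ^ (j + 1)..<(2::real) ^ (j + 2)}" for j :: nat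
 define d where "d j = g (2 ^ (j + 1)) * (2 ^ (j + 2)) powr (- 2 - e)" for j :: nat
 have i: "integrable lebesgue ?f" using int by (simp add: set_integrable_def)
 have "(\<Sum>j<n. d j * 2 ^ (j + 1)) = (\<integral>sig. (\<Sum>j<n. d j * indicator (A j) sig) \<partial>lebesgue)"
  by (subst Bochner_Integration.integral_sum) (auto simp: A_def)
 also have "... <= (\<integral>sig. ?f sig \<partial>lebesgue)"
 proof (rule Bochner_Integration.integral_mono[OF _ i])
  show "integrable lebesgue (%sig. \<Sum>j<n. d j * indicator (A j) sig)"
   by (intro Bochner_Integration.integrable_sum integrable_mult_right) (auto simp: A_def integrable_indicator_iff)
  fix sig :: real
  have f0: "0 <= ?f sig" using nn[of sig] by (auto simp: indicator_def)
  show "(\<Sum>j<n. d j * indicator (A j) sig) <= ?f sig"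
  proof (cases "\<exists>m. sig : A m")
   case True
   then obtain m where m: "sig : A m" by blast
   have "indicator (A j) sig = (0::real)" if "j \<noteq> m" for j
   proof (rule ccontr)
    assume "indicator (A j) sig \<noteq> (0::real)"
    then have "sig : A j" by (auto simp: indicator_def)
    then have "(2::real) ^ (j + 1) < 2 ^ (m + 2)" "(2::real) ^ (m + 1) < 2 ^ (j + 2)" using m by (auto simp: A_def)
    then have "j + 1 < m + 2" "m + 1 < j + 2" by (simp_all only: power_strict_increasing_iff one_less_numeral_iff semiring_norm)
    then show False using that by simp
   qed
   then have "(\<Sum>j<n. d j * indicator (A j) sig) = (\<Sum>j<n. if j = m then d m else 0)"
    using m by (intro sum.cong) auto
   also have "... <= d m"
    using nn[of "2 ^ (m + 1)"] by (simp add: d_def)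
   also have "d m <= ?f sig"
   proof -
    have s: "2 ^ (m + 1) <= sig" "sig <= 2 ^ (m + 2)" using m by (auto simp: A_def)
    have "(1::real) <= 2 ^ (m + 1)" by (rule one_le_power) simp
    then have s1: "1 <= sig" using s by linarith
    have "g (2 ^ (m + 1)) <= g sig" using mono s s1 by (auto simp: mono_on_def)
    moreover have "(2 ^ (m + 2)) powr (- 2 - e) <= sig powr (- 2 - e)" using s s1 e by (intro powr_mono2') auto
    ultimately show ?thesis using s1 nn[of sig] unfolding d_def by (simp add: mult_mono)
   qed
   finally show ?thesis .
  qed (use f0 in auto)
 qed
 finally have "(\<Sum>j<n. d j * 2 ^ (j + 1)) <= (\<integral>sig. ?f sig \<partial>lebesgue)" .
 moreover have "d j * 2 ^ (j + 1) = 2 powr (- (3 + 2 * e)) * ?c j" for j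
 proof -
  have "(2 ^ (j + 2)) powr (- 2 - e) * 2 ^ (j + 1) = 2 powr ((real j + 2) * (- 2 - e) + (real j + 1))"
  proof -
   have "(2::real) ^ (j + 2) = 2 powr (real j + 2)" "(2::real) ^ (j + 1) = 2 powr (real j + 1)"
    using powr_realpow[of 2 "j + 2"] powr_realpow[of 2 "j + 1"] by (simp_all add: add.commute)
   then show ?thesis by (simp only: powr_powr powr_add[of 2 "(real j + 2) * (- 2 - e)" "real j + 1"])
  qed
  also have "(real j + 2) * (- 2 - e) + (real j + 1) = - (3 + 2 * e) + (- (1 + e)) * real j" by (simp add: algebra_simps)
  also have "2 powr ... = 2 powr (- (3 + 2 * e)) * (2 powr (- (1 + e))) ^ j"
   by (simp add: powr_add powr_powr[symmetric] powr_realpow)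
  finally show ?thesis by (simp add: d_def mult_ac)
 qed
 ultimately have "2 powr (- (3 + 2 * e)) * (\<Sum>j<n. ?c j) <= (\<integral>sig. ?f sig \<partial>lebesgue)"
  by (simp only: sum_distrib_left)
 then have "2 powr (3 + 2 * e) * (2 powr (- (3 + 2 * e)) * (\<Sum>j<n. ?c j)) <= 2 powr (3 + 2 * e) * (\<integral>sig. ?f sig \<partial>lebesgue)"
  by (intro mult_left_mono) auto
 then show "(\<Sum>j<n. ?c j) <= 2 powr (3 + 2 * e) * (\<integral>sig. ?f sig \<partial>lebesgue)"
  by (simp add: mult.assoc[symmetric] powr_add[symmetric])
qed

lemma nn_integral_powr_0:
 assumes a: "-1 < a" and c: "0 <= c"
 shows "(NN sig. ennreal (sig powr a) * indicator {0<..c} sig) = ennreal (c powr (a + 1) / (a + 1))"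
proof -
 have "((%x. x powr a) has_integral c powr (a + 1) / (a + 1)) {0..c}" by (rule has_integral_powr_from_0[OF a c])
 from nn_integral_has_integral_lebesgue[OF _ this] have "(NN sig. ennreal (indicator {0..c} sig * sig powr a)) = ennreal (c powr (a + 1) / (a + 1))"
  by (simp add: nn_integral_completion)
 moreover have "(NN sig. ennreal (sig powr a) * indicator {0<..c} sig) = (NN sig. ennreal (indicator {0..c} sig * sig powr a))"
  by (intro nn_integral_cong) (auto simp: indicator_def)
 ultimately show ?thesis by simp
qed

text \<open>Bounds the absorption at time \<open>\<sigma>\<close> over the ball \<open>B\<^sub>\<rho>\<close> from the mass \<open>k\<close> and the sup bound
  alone: the layer \<open>2\<^sup>j \<le> w < 2\<^bsup>j+1\<^esup>\<close> has measure at most \<open>k/2\<^sup>j\<close> and is empty after the time \<open>q\<^sub>j\<close>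
  at which the sup bound falls below \<open>2\<^sup>j\<close>.\<close>

definition layer_time :: "'a::euclidean_space itself => real => real => nat => real" where
 "layer_time _ s k j = (sup_const TYPE('a) s * k / 2 ^ j) powr (2 * s / real DIM('a))"

definition absorption_majorant ::
  "'a::euclidean_space itself => real => real => (real => real) => real => real => real => ennreal" where
 "absorption_majorant ty s \<beta> g k rho sig = ennreal (2 powr \<bar>\<beta>\<bar> * sig powr min \<beta> 0) *
  (ennreal (g 1 * (unit_ball_vol (real DIM('a)) * rho ^ DIM('a))) +
   (\<Sum>j. ennreal (g (2 ^ (j + 1)) * (k / 2 ^ j)) * indicator {0<..layer_time ty s k j} sig))"

lemma absorption_majorant_measurable [measurable]: "absorption_majorant ty s \<beta> g k rho : borel_funs"
 unfolding absorption_majorant_def[abs_def] by measurable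

text \<open>This is where subcriticality enters. With \<open>a = min \<beta> 0\<close>, layer
  \<open>j\<close> contributes \<open>g (2^(j+1)) k / 2^j\<close> times
  \<open>q_j powr (a + 1)\<close> up to a constant, and \<open>q_j\<close> is proportional to
  \<open>2^j\<close> to the power \<open>- 2 s / N\<close>. So the sum over \<open>j\<close> is the
  dyadic form of the integral condition, with \<open>e = 2 s (1 + a) / N\<close>.\<close>

lemma absorption_majorant_finite:
 assumes s: "0 < s" "s < 1" and b: "-1 < \<beta>" and k: "0 < k" and rho: "0 < rho"
  and g: "mono_on {0..} g" "!!r. 0 <= r ==> 0 <= g r"
  and int: "set_integrable lebesgue {1..} (%sig. g sig * sig powr (- 2 - 2 * s * (1 + min \<beta> 0) / real DIM('a::euclidean_space)))"
 shows "(NN sig. absorption_majorant TYPE('a) s \<beta> g k rho sig * indicator {0<..1} sig) < \<infinity>"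
proof -
 define a where "a = min \<beta> 0"
 have a: "-1 < a" using b by (simp add: a_def)
 define e where "e = 2 * s * (1 + a) / real DIM('a)"
 have e: "0 <= e" using s a by (simp add: e_def)
 let ?C = "sup_const TYPE('a) s" and ?q = "layer_time TYPE('a) s k"
 have C: "0 < ?C" by (rule sup_const_pos[OF s])
 let ?d = "%j. g (2 ^ (j + 1)) * (k / 2 ^ j)"
 let ?c0 = "g 1 * (unit_ball_vol (real DIM('a)) * rho ^ DIM('a))"
 have c0: "0 <= ?c0" using g(2)[of 1] rho by (intro mult_nonneg_nonneg) auto
 have d: "0 <= ?d j" for j using g(2)[of "2 ^ (j + 1)"] k by simp
 have sm: "summable (%j. ?d j * (?q j powr (a + 1) / (a + 1)))"
 proof -
  have "?d j * (?q j powr (a + 1) / (a + 1)) = k * (?C * k) powr e / (a + 1) * (g (2 ^ (j + 1)) * (2 powr (- (1 + e))) ^ j)" for j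
  proof -
   have "?q j powr (a + 1) = (?C * k / 2 ^ j) powr e"
    unfolding layer_time_def powr_powr by (simp add: e_def add.commute)
   also have "... = (?C * k) powr e / (2 ^ j) powr e" using C k by (intro powr_divide)
   finally have 1: "?q j powr (a + 1) = (?C * k) powr e / (2 ^ j) powr e" .
   have "(2 powr (- (1 + e))) ^ j = 2 powr (- (1 + e) * real j)" by (simp add: powr_powr[symmetric] powr_realpow)
   also have "... = 2 powr (- ((1 + e) * real j))" by (simp only: mult_minus_left)
   also have "... = 1 / 2 powr ((1 + e) * real j)" by (rule powr_minus_divide)
   also have "2 powr ((1 + e) * real j) = 2 ^ j * (2 ^ j) powr e"
   proof -
    have "(1 + e) * real j = real j + real j * e" by (simp add: algebra_simps)
    then have "2 powr ((1 + e) * real j) = 2 powr real j * (2 powr real j) powr e" by (simp only: powr_add powr_powr)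
    moreover have "2 powr real j = 2 ^ j" by (simp add: powr_realpow)
    ultimately show ?thesis by (simp only:)
   qed
   finally have 2: "(2 powr (- (1 + e))) ^ j = 1 / (2 ^ j * (2 ^ j) powr e)" .
   show ?thesis unfolding 1 2 by (simp add: mult_ac)
  qed
  moreover have "summable (%j. k * (?C * k) powr e / (a + 1) * (g (2 ^ (j + 1)) * (2 powr (- (1 + e))) ^ j))"
   using int[folded a_def] unfolding e_def[symmetric] by (intro summable_mult dyadic_summable[OF g e])
  ultimately show ?thesis by simp
 qed
 have "(NN sig. absorption_majorant TYPE('a) s \<beta> g k rho sig * indicator {0<..1} sig)
  <= (NN sig. ennreal (2 powr \<bar>\<beta>\<bar>) * (ennreal ?c0 * (ennreal (sig powr a) * indicator {0<..1} sig)
    + (\<Sum>j. ennreal (?d j) * (ennreal (sig powr a) * indicator {0<..?q j} sig))))"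
 proof (rule nn_integral_mono)
  fix sig :: real
  show "absorption_majorant TYPE('a) s \<beta> g k rho sig * indicator {0<..1} sig
   <= ennreal (2 powr \<bar>\<beta>\<bar>) * (ennreal ?c0 * (ennreal (sig powr a) * indicator {0<..1} sig)
    + (\<Sum>j. ennreal (?d j) * (ennreal (sig powr a) * indicator {0<..?q j} sig)))"
  proof (cases "sig : {0<..1}")
   case True
   have "(\<Sum>j. ennreal (?d j) * (ennreal (sig powr a) * indicator {0<..?q j} sig))
     = ennreal (sig powr a) * (\<Sum>j. ennreal (?d j) * indicator {0<..?q j} sig)"
    by (subst ennreal_suminf_cmult[symmetric]) (simp add: mult_ac)
   then show ?thesis using True
    by (simp add: absorption_majorant_def a_def[symmetric] ennreal_mult algebra_simps)
  qed simp
 qed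
 also have "... = ennreal (2 powr \<bar>\<beta>\<bar>) * (ennreal ?c0 * (NN sig. ennreal (sig powr a) * indicator {0<..1} sig)
    + (\<Sum>j. ennreal (?d j) * (NN sig. ennreal (sig powr a) * indicator {0<..?q j} sig)))"
  by (simp add: nn_integral_cmult nn_integral_add nn_integral_suminf)
 also have "... = ennreal (2 powr \<bar>\<beta>\<bar>) * (ennreal ?c0 * ennreal (1 powr (a + 1) / (a + 1))
    + (\<Sum>j. ennreal (?d j) * ennreal (?q j powr (a + 1) / (a + 1))))"
  by (subst nn_integral_powr_0[OF a], simp, subst nn_integral_powr_0[OF a]) (auto simp: layer_time_def)
 also have "(\<Sum>j. ennreal (?d j) * ennreal (?q j powr (a + 1) / (a + 1))) = ennreal (\<Sum>j. ?d j * (?q j powr (a + 1) / (a + 1)))"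
 proof -
  have "(\<Sum>j. ennreal (?d j) * ennreal (?q j powr (a + 1) / (a + 1))) = (\<Sum>j. ennreal (?d j * (?q j powr (a + 1) / (a + 1))))"
   using d a by (intro suminf_cong ennreal_mult[symmetric]) auto
  also have "... = ennreal (\<Sum>j. ?d j * (?q j powr (a + 1) / (a + 1)))"
   by (rule suminf_ennreal2[OF _ sm]) (rule mult_nonneg_nonneg[OF d], use a in simp)
  finally show ?thesis .
 qed
 also have "ennreal (2 powr \<bar>\<beta>\<bar>) * (ennreal ?c0 * ennreal (1 powr (a + 1) / (a + 1)) + ennreal (\<Sum>j. ?d j * (?q j powr (a + 1) / (a + 1)))) < \<infinity>"
  by (simp add: ennreal_mult_less_top)
 finally show ?thesis .
qed

lemma nn_integral_initial_small:
 fixes H :: "real => ennreal"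
 assumes [measurable]: "H : borel_funs" and fin: "(NN sig. H sig * indicator {0<..1} sig) < \<infinity>" and d: "0 < \<delta>"
 shows "\<exists>tau>0. tau <= 1 & (NN sig. H sig * indicator {0<..<tau} sig) <= ennreal \<delta>"
proof -
 define A where "A n = {0<..<1 / real (Suc n)}" for n
 have em: "emeasure (density lborel H) (A n) = (NN sig. H sig * indicator (A n) sig)" for n
  by (rule emeasure_density) (auto simp: A_def)
 have "(%n. emeasure (density lborel H) (A n)) \<longlonglongrightarrow> emeasure (density lborel H) (\<Inter>n. A n)"
 proof (rule Lim_emeasure_decseq)
  show "range A \<subseteq> sets (density lborel H)" by (auto simp: A_def)
  show "decseq A"
  proof (rule decseq_SucI)
   fix n
   have "1 / real (Suc (Suc n)) <= 1 / real (Suc n)" by (intro divide_left_mono) auto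
   then show "A (Suc n) \<subseteq> A n" by (auto simp: A_def)
  qed
  show "emeasure (density lborel H) (A n) \<noteq> \<infinity>" for n
  proof -
   have "A n \<subseteq> {0<..1}"
   proof
    fix x assume "x : A n"
    moreover have "1 / real (Suc n) <= 1" by simp
    ultimately show "x : {0<..1}" unfolding A_def greaterThanLessThan_iff greaterThanAtMost_iff by linarith
   qed
   then have "emeasure (density lborel H) (A n) <= (NN sig. H sig * indicator {0<..1} sig)"
    unfolding em by (intro nn_integral_mono mult_left_mono) (auto simp: indicator_def)
   then show ?thesis using fin by (auto simp: less_top[symmetric] top_unique)
  qed
 qed
 also have "(\<Inter>n. A n) = {}"
 proof (rule equals0I)
  fix x assume "x : (\<Inter>n. A n)"
  then have x: "x : A n" for n by blast
  then have "0 < x" by (auto simp: A_def)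
  then obtain n where "1 / real (Suc n) < x" using nat_approx_posE by blast
  then show False using x[of n] by (simp add: A_def)
 qed
 finally have "(%n. emeasure (density lborel H) (A n)) \<longlonglongrightarrow> 0" by simp
 then have "eventually (%n. emeasure (density lborel H) (A n) < ennreal \<delta>) sequentially"
  using d by (intro order_tendstoD) auto
 then obtain n where "emeasure (density lborel H) (A n) < ennreal \<delta>" by (auto simp: eventually_sequentially)
 then have "(NN sig. H sig * indicator (A n) sig) <= ennreal \<delta>" unfolding em by (rule less_imp_le)
 moreover have "0 < 1 / real (Suc n)" "1 / real (Suc n) <= 1" by simp_all
 ultimately show ?thesis unfolding A_def by blast
qed

context approximant
begin

abbreviation absorb where "absorb \<equiv> %sig x. time_weight \<beta> t0 T sig * G (w sig x)"

lemma w_borel [measurable]: "w sig : borel_funs"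
 by (rule jump_solution_borel[OF sol])

lemma G_borel [measurable]: "G : borel_funs"
 using G_cont by (rule borel_measurable_continuous_onI)

text \<open>The bound must not depend on \<open>t0\<close>. For negative \<open>\<beta>\<close> the
  worst case is \<open>t0 = 0\<close>; for positive \<open>\<beta>\<close> the weight does not
  become small with \<open>sig\<close> uniformly in \<open>t0\<close>, so only the exponent 0 is
  available. This is why the condition on \<open>g\<close> stops improving at
  \<open>\<beta> = 0\<close>.\<close>

lemma weight_le:
 assumes "sig <= 1" "t0 <= 1" "0 < sig" "sig <= T"
 shows "time_weight \<beta> t0 T sig <= 2 powr \<bar>\<beta>\<bar> * sig powr min \<beta> 0"
proof (cases "\<beta> \<ge> 0")
 case True
 have "(t0 + sig) powr \<beta> <= 2 powr \<beta>" using assms t0 True by (intro powr_mono2) auto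
 then show ?thesis using assms True by (simp add: weight_eq min_def)
next
 case False
 have "(t0 + sig) powr \<beta> <= sig powr \<beta>" using assms t0 False by (intro powr_mono2') auto
 also have "... <= 2 powr \<bar>\<beta>\<bar> * sig powr \<beta>"
  using mult_right_mono[of 1 "2 powr \<bar>\<beta>\<bar>" "sig powr \<beta>"] ge_one_powr_ge_zero[of 2 "\<bar>\<beta>\<bar>"] by simp
 finally show ?thesis using assms False by (simp add: weight_eq min_def)
qed

text \<open>On the layer \<open>2^j <= w < 2^(j+1)\<close> one has
  \<open>g w <= g (2^(j+1)) w / 2^j\<close>, which turns the measure of the layer into the mass of
  \<open>w\<close>. Values below 1 are estimated by \<open>g 1\<close> on the ball.\<close>

lemma absorption_le_majorant:
 assumes TT: "sig <= 1" "t0 <= 1" and sig: "0 < sig" "sig <= T" and rho: "0 < rho"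
  and g: "mono_on {0..} g" "!!r. 0 <= r ==> 0 <= g r"
 shows "(NN x. ennreal (bump_at z rho x * absorb sig x)) <= absorption_majorant TYPE('a) s \<beta> g k rho sig"
proof -
 let ?W = "2 powr \<bar>\<beta>\<bar> * sig powr min \<beta> 0" and ?q = "layer_time TYPE('a) s k"
 let ?v = "unit_ball_vol (real DIM('a))"
 \<comment> \<open>The sup bound solved for the time: once \<open>sig\<close> exceeds the layer
   time, \<open>w\<close> is below \<open>2^j\<close>.\<close>
 have q: "sig <= ?q j" if "2 ^ j <= w sig x" for j x
 proof -
  let ?C = "sup_const TYPE('a) s" and ?E = "real DIM('a) / (2 * s)"
  have C: "0 < ?C" by (rule sup_const_pos[OF s])
  have "2 ^ j <= ?C * k * sig powr (- ?E)" using that sup[OF sig, of x] by linarith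
  then have "sig powr ?E <= ?C * k / 2 ^ j" using sig by (simp add: powr_minus field_simps)
  then have "(sig powr ?E) powr (2 * s / real DIM('a)) <= ?q j"
   unfolding layer_time_def using s by (intro powr_mono2) auto
  then show ?thesis using sig s by (simp add: powr_powr)
 qed
 have pt: "ennreal (bump_at z rho x * absorb sig x)
  <= ennreal ?W * (ennreal (g 1) * indicator (cball z rho) x
    + (\<Sum>j. ennreal (g (2 ^ (j + 1)) / 2 ^ j) * indicator {0<..?q j} sig * ennreal \<bar>w sig x\<bar>))" for x
 proof -
  let ?S = "\<Sum>j. ennreal (g (2 ^ (j + 1)) / 2 ^ j) * indicator {0<..?q j} sig * ennreal \<bar>w sig x\<bar>"
  have wnn: "0 <= w sig x" using nonneg sig by simp
  have tw: "0 <= time_weight \<beta> t0 T sig" "time_weight \<beta> t0 T sig <= ?W"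
   using time_weight_bounds(1)[OF t0 T] weight_le[OF TT sig] by auto
  have bb: "bump_at z rho x <= indicator (cball z rho) x"
   using bump_at_bounds[of z rho x] bump_at_eq_0_iff[OF rho, of z x] by (auto simp: indicator_def dist_norm norm_minus_commute)
  have "bump_at z rho x * absorb sig x <= indicator (cball z rho) x * (?W * g (w sig x))"
   using bb tw G_le[OF wnn] G_nonneg bump_at_bounds[of z rho x] by (intro mult_mono mult_nonneg_nonneg) auto
  also have "... = ?W * (indicator (cball z rho) x * g (w sig x))" by simp
  finally have "ennreal (bump_at z rho x * absorb sig x) <= ennreal (?W * (indicator (cball z rho) x * g (w sig x)))"
   by (rule ennreal_leI)
  also have "... = ennreal ?W * ennreal (indicator (cball z rho) x * g (w sig x))"
   using g(2)[OF wnn] by (intro ennreal_mult) auto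
  also have "ennreal (indicator (cball z rho) x * g (w sig x)) <= ennreal (g 1) * indicator (cball z rho) x + ?S"
  proof (cases "w sig x < 1")
   case True
   have "g (w sig x) <= g 1" using g(1) True wnn by (auto simp: mono_on_def)
   then have "ennreal (indicator (cball z rho) x * g (w sig x)) <= ennreal (g 1) * indicator (cball z rho) x"
    by (auto simp: indicator_def intro: ennreal_leI)
   then show ?thesis by (rule order_trans) simp
  next
   case False
   have ex: "\<exists>j. w sig x < 2 ^ (j + 1)"
   proof -
    obtain n where n: "w sig x < 2 ^ n" using real_arch_pow[of 2 "w sig x"] by auto
    moreover have "(2::real) ^ n <= 2 ^ (n + 1)" by simp
    ultimately have "w sig x < 2 ^ (n + 1)" by linarith
    then show ?thesis ..
   qed
   define j where "j = (LEAST j. w sig x < 2 ^ (j + 1))"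
   have j1: "w sig x < 2 ^ (j + 1)" unfolding j_def using ex by (rule LeastI_ex)
   have j2: "2 ^ j <= w sig x"
   proof (cases j)
    case 0 then show ?thesis using False by simp
   next
    case (Suc i)
    then have "~ w sig x < 2 ^ (i + 1)" using not_less_Least[of i "%j. w sig x < 2 ^ (j + 1)"] j_def by auto
    then show ?thesis using Suc by simp
   qed
   have "g (w sig x) <= g (2 ^ (j + 1))" using g(1) j1 wnn by (auto simp: mono_on_def)
   also have "... <= g (2 ^ (j + 1)) / 2 ^ j * w sig x"
    using j2 mult_left_mono[of 1 "w sig x / 2 ^ j" "g (2 ^ (j + 1))"] g(2)[of "2 ^ (j + 1)"] by simp
   finally have "indicator (cball z rho) x * g (w sig x) <= g (2 ^ (j + 1)) / 2 ^ j * w sig x"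
    using g(2)[OF wnn] by (auto simp: indicator_def)
   then have "ennreal (indicator (cball z rho) x * g (w sig x)) <= ennreal (g (2 ^ (j + 1)) / 2 ^ j * w sig x)" by (rule ennreal_leI)
   also have "... = ennreal (g (2 ^ (j + 1)) / 2 ^ j) * indicator {0<..?q j} sig * ennreal \<bar>w sig x\<bar>"
   proof -
    have "ennreal (g (2 ^ (j + 1)) / 2 ^ j * w sig x) = ennreal (g (2 ^ (j + 1)) / 2 ^ j) * ennreal (w sig x)"
     using wnn g(2)[of "2 ^ (j + 1)"] by (intro ennreal_mult) auto
    then show ?thesis using q[OF j2] sig wnn by simp
   qed
   also have "... <= ?S" by (rule ennreal_le_suminf)
   finally show ?thesis by (rule order_trans) simp
  qed
  finally show ?thesis by (simp add: mult_left_mono)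
 qed
 have "(NN x. ennreal (bump_at z rho x * absorb sig x)) <= (NN x. ennreal ?W * (ennreal (g 1) * indicator (cball z rho) x
    + (\<Sum>j. ennreal (g (2 ^ (j + 1)) / 2 ^ j) * indicator {0<..?q j} sig * ennreal \<bar>w sig x\<bar>)))"
  by (intro nn_integral_mono pt)
 also have "... = ennreal ?W * (ennreal (g 1) * emeasure lborel (cball z rho)
    + (\<Sum>j. ennreal (g (2 ^ (j + 1)) / 2 ^ j) * indicator {0<..?q j} sig * (NN x. ennreal \<bar>w sig x\<bar>)))"
  by (simp add: nn_integral_cmult nn_integral_add nn_integral_suminf)
 also have "... <= ennreal ?W * (ennreal (g 1) * emeasure lborel (cball z rho)
    + (\<Sum>j. ennreal (g (2 ^ (j + 1)) / 2 ^ j) * indicator {0<..?q j} sig * ennreal k))"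
  using mass[of sig] sig by (intro mult_left_mono add_left_mono suminf_le) auto
 also have "... = absorption_majorant TYPE('a) s \<beta> g k rho sig"
 proof -
  have "ennreal (g (2 ^ (j + 1)) / 2 ^ j) * indicator {0<..?q j} sig * ennreal k = ennreal (g (2 ^ (j + 1)) * (k / 2 ^ j)) * indicator {0<..?q j} sig" for j
   using g(2)[of "2 ^ (j + 1)"] k by (auto simp: ennreal_mult[symmetric] indicator_def)
  moreover have "ennreal (g 1) * emeasure lborel (cball z rho) = ennreal (g 1 * (?v * rho ^ DIM('a)))"
   using rho g(2)[of 1] by (simp add: emeasure_cball ennreal_mult[symmetric])
  ultimately show ?thesis unfolding absorption_majorant_def by simp
 qed
 finally show ?thesis .
qed

lemma absorb_measurable: "(%(sig, x). absorb sig x) : borel_funs"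
proof -
 have "continuous_on UNIV (%p. time_weight \<beta> t0 T (fst p) * G (w (fst p) (snd p)))"
 proof (intro continuous_intros time_weight_continuous[OF t0])
  have "continuous_on UNIV (%p. w (fst p) (snd p))"
   using jump_solution_continuous(1)[OF sol, of UNIV] by (simp add: case_prod_unfold)
  from continuous_on_compose2[OF G_cont this] show "continuous_on UNIV (%p. G (w (fst p) (snd p)))" by simp
 qed
 then show ?thesis by (simp add: case_prod_unfold borel_measurable_continuous_onI)
qed

lemma absorb_nonneg: "0 <= absorb sig x"
 using time_weight_bounds(1)[OF t0 T] G_nonneg by simp

text \<open>A qualitative bound, through the Lipschitz constant of \<open>G\<close>: it provides the
  integrability asked for in the duality formula. The bound that is uniform in the approximation is
  \<open>absorption_le_majorant\<close>.\<close>

lemma absorb_mass: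
 obtains Cb where "0 <= Cb" "!!sig. 0 <= sig ==> sig <= T ==> (NN x. ennreal \<bar>absorb sig x\<bar>) <= ennreal Cb"
proof -
 obtain K where K: "0 <= K" "!!r. 0 <= r ==> G r <= K * r" using G_lip by blast
 let ?P = "t0 powr \<beta> + (t0 + T) powr \<beta>"
 show ?thesis
 proof (rule that[of "?P * K * k"])
  show "0 <= ?P * K * k" using K k by simp
  fix sig assume sig: "0 <= sig" "sig <= T"
  have "(NN x. ennreal \<bar>absorb sig x\<bar>) <= (NN x. ennreal (?P * K) * ennreal \<bar>w sig x\<bar>)"
  proof (rule nn_integral_mono)
   fix x
   have "absorb sig x <= ?P * (K * w sig x)"
    using time_weight_bounds[OF t0 T, of \<beta> sig] K(2)[OF nonneg[OF sig, of x]] G_nonneg by (intro mult_mono) auto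
   then have "ennreal \<bar>absorb sig x\<bar> <= ennreal (?P * K * \<bar>w sig x\<bar>)"
    using absorb_nonneg[of sig x] nonneg[OF sig, of x] by (intro ennreal_leI) (simp add: mult.assoc)
   also have "... = ennreal (?P * K) * ennreal \<bar>w sig x\<bar>" using K by (intro ennreal_mult) auto
   finally show "ennreal \<bar>absorb sig x\<bar> <= ennreal (?P * K) * ennreal \<bar>w sig x\<bar>" .
  qed
  also have "... = ennreal (?P * K) * (NN x. ennreal \<bar>w sig x\<bar>)" by (rule nn_integral_cmult) measurable
  also have "... <= ennreal (?P * K) * ennreal k" by (intro mult_left_mono mass sig) simp
  also have "... = ennreal (?P * K * k)" using K k by (intro ennreal_mult[symmetric]) auto
  finally show "(NN x. ennreal \<bar>absorb sig x\<bar>) <= ennreal (?P * K * k)" .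
 qed
qed

lemma w_integrable: "0 <= sig ==> sig <= T ==> Leb1 (w sig)"
 by (rule integrable_of_nn[OF _ mass]) auto

lemma duality:
 assumes t1: "0 <= t1" "t1 <= T"
  and xi: "continuous_on UNIV (%(t, x). xi t x)" "!!t x. \<bar>xi t x\<bar> <= X"
  and xi': "(%(t, x). xi' t x) : borel_funs" "!!t x. 0 < t ==> t < t1 ==> \<bar>xi' t x\<bar> <= X'"
   "!!t x. 0 < t ==> t < t1 ==> ((%tau. xi tau x) has_real_derivative xi' t x) (at t)"
 shows "Leb1 (%(t, x). indicator {0<..<t1} t * (w t x * (xi' t x + jump (jump_kernel s eps) (xi t) x) - xi t x * absorb t x))"
  and "(LBINT x. w t1 x * xi t1 x) - (LBINT x. w 0 x * xi 0 x)
  = (LBINT (t, x). indicator {0<..<t1} t * (w t x * (xi' t x + jump (jump_kernel s eps) (xi t) x) - xi t x * absorb t x))"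
proof -
 obtain Cb where Cb: "0 <= Cb" "!!sig. 0 <= sig ==> sig <= T ==> (NN x. ennreal \<bar>absorb sig x\<bar>) <= ennreal Cb"
  using absorb_mass by blast
 have k0: "0 <= k" using k by simp
 have Cb': "(NN x. ennreal \<bar>absorb sig x\<bar>) <= ennreal Cb" if "0 < sig" "sig < t1" for sig using Cb(2)[of sig] that t1 by simp
 note D = symmetric_jumps.jump_solution_duality[OF sj sol t1 mass k0 absorb_measurable Cb' Cb(1) xi xi']
 show "Leb1 (%(t, x). indicator {0<..<t1} t * (w t x * (xi' t x + jump (jump_kernel s eps) (xi t) x) - xi t x * absorb t x))"
  by (rule D(1))
 show "(LBINT x. w t1 x * xi t1 x) - (LBINT x. w 0 x * xi 0 x)
  = (LBINT (t, x). indicator {0<..<t1} t * (w t x * (xi' t x + jump (jump_kernel s eps) (xi t) x) - xi t x * absorb t x))"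
  by (rule D(2))
qed

text \<open>The equation is tested with a bump that does not depend on time: jumps carry away at
  most \<open>K k sig\<close>, and the absorption seen by the bump is at most the integral of the
  majorant.\<close>

lemma local_mass_lower_bound:
 assumes TT: "sig <= 1" "t0 <= 1" and sig: "0 <= sig" "sig <= T" and rho: "0 < rho"
  and g: "mono_on {0..} g" "!!r. 0 <= r ==> 0 <= g r"
  and K: "!!x. \<bar>jump (jump_kernel s eps) (bump_at z rho) x\<bar> <= K"
  and H: "(NN tau. absorption_majorant TYPE('a) s \<beta> g k rho tau * indicator {0<..<sig} tau) <= ennreal \<delta>" and d: "0 <= \<delta>"
 shows "(LBINT x. w 0 x * bump_at z rho x) - K * k * sig - \<delta> <= (LBINT x. w sig x * bump_at z rho x)"
proof -
 have K0: "0 <= K" using K abs_ge_zero order_trans by blast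
 have bc: "continuous_on UNIV (bump_at z rho)" by (rule c11_continuous[OF c11_bump_at[OF rho]])
 have [measurable]: "bump_at z rho : borel_funs" by (rule borel_measurable_continuous_onI[OF bc])
 have xi: "continuous_on UNIV (%(t::real, x). bump_at z rho x)"
  using continuous_on_compose2[OF bc continuous_on_snd[OF continuous_on_id], of UNIV] by (simp add: case_prod_unfold)
 note D = duality[OF sig xi, of 1 "%_ _. 0" 0, simplified]
 have bb: "\<bar>bump_at z rho x\<bar> <= 1" for x using bump_at_bounds[of z rho x] by simp
 let ?h = "%t x. indicator {0<..<sig} t * (w t x * jump (jump_kernel s eps) (bump_at z rho) x - bump_at z rho x * absorb t x)"
 have D2: "(LBINT x. w sig x * bump_at z rho x) - (LBINT x. w 0 x * bump_at z rho x) = (LBINT (t, x). ?h t x)"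
  by (rule D(2)) (use bb in auto)
 have "- (LBINT (t, x). ?h t x) = (LBINT p. - (case p of (t, x) => ?h t x))" by simp
 also have "... <= K * k * sig + \<delta>"
 proof (rule integral_real_bounded)
  show "0 <= K * k * sig + \<delta>" using K0 k sig d by simp
  have m1[measurable]: "(%p. w (fst p) (snd p)) : borel_funs" "(%p. absorb (fst p) (snd p)) : borel_funs"
   using jump_solution_borel(2)[OF sol] absorb_measurable by (simp_all add: case_prod_unfold)
  let ?F = "%t x. indicator {0<..<sig} t * (ennreal K * ennreal \<bar>w t x\<bar> + ennreal (bump_at z rho x * absorb t x))"
  have "(NN p. ennreal (- (case p of (t, x) => ?h t x))) <= (NN p. (case p of (t, x) => ?F t x))"
  proof (rule nn_integral_mono, clarify)
   fix t x
   show "ennreal (- ?h t x) <= ?F t x"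
   proof (cases "t : {0<..<sig}")
    case True
    have "- (w t x * jump (jump_kernel s eps) (bump_at z rho) x) <= \<bar>w t x\<bar> * K"
     using mult_left_mono[OF K[of x], of "\<bar>w t x\<bar>"] abs_mult[of "w t x" "jump (jump_kernel s eps) (bump_at z rho) x"] by linarith
    then have "- ?h t x <= K * \<bar>w t x\<bar> + bump_at z rho x * absorb t x" using True by (simp add: mult.commute)
    then have "ennreal (- ?h t x) <= ennreal (K * \<bar>w t x\<bar> + bump_at z rho x * absorb t x)" by (rule ennreal_leI)
    also have "... = ennreal K * ennreal \<bar>w t x\<bar> + ennreal (bump_at z rho x * absorb t x)"
     using K0 absorb_nonneg[of t x] bump_at_bounds[of z rho x] by (simp add: ennreal_plus ennreal_mult)
    finally show ?thesis using True by simp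
   qed simp
  qed
  also have "... = (NN t. (NN x. ?F t x))"
   unfolding lborel_prod[symmetric]
   by (subst lborel.nn_integral_fst[symmetric]) (simp_all add: lborel_prod case_prod_unfold)
  also have "... <= (NN t. ennreal (K * k) * indicator {0<..<sig} t + absorption_majorant TYPE('a) s \<beta> g k rho t * indicator {0<..<sig} t)"
  proof (rule nn_integral_mono)
   fix t :: real
   show "(NN x. ?F t x) <= ennreal (K * k) * indicator {0<..<sig} t + absorption_majorant TYPE('a) s \<beta> g k rho t * indicator {0<..<sig} t"
   proof (cases "t : {0<..<sig}")
    case True
    then have t: "0 < t" "t <= T" "t <= 1" using sig TT by auto
    have "(NN x. ?F t x) = (NN x. ennreal K * ennreal \<bar>w t x\<bar> + ennreal (bump_at z rho x * absorb t x))" using True by simp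
    also have "... = ennreal K * (NN x. ennreal \<bar>w t x\<bar>) + (NN x. ennreal (bump_at z rho x * absorb t x))"
     by (simp add: nn_integral_add nn_integral_cmult)
    also have "... <= ennreal K * ennreal k + absorption_majorant TYPE('a) s \<beta> g k rho t"
     using t by (intro add_mono mult_left_mono mass absorption_le_majorant[OF t(3) TT(2) t(1,2) rho g]) auto
    finally show ?thesis using True K0 k by (simp add: ennreal_mult)
   qed simp
  qed
  also have "... = ennreal (K * k) * emeasure lborel {0<..<sig} + (NN tau. absorption_majorant TYPE('a) s \<beta> g k rho tau * indicator {0<..<sig} tau)"
   by (subst nn_integral_add) (auto simp: nn_integral_cmult_indicator)
  also have "... <= ennreal (K * k) * ennreal sig + ennreal \<delta>" using H sig by (intro add_mono mult_left_mono) auto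
  also have "... = ennreal (K * k * sig + \<delta>)" using K0 k sig d by (simp add: ennreal_mult[symmetric] ennreal_plus[symmetric] del: ennreal_plus)
  finally show "(NN p. ennreal (- (case p of (t, x) => ?h t x))) <= ennreal (K * k * sig + \<delta>)" .
 qed
 finally show ?thesis using D2 by linarith
qed

text \<open>The constant 1 is annihilated by the jump operator, so testing with it identifies the
  absorbed mass with the loss of mass. Lower bounds on the mass thus become upper bounds on the
  absorption over the whole space.\<close>

lemma total_absorption:
 assumes sig: "0 <= sig" "sig <= T"
 shows "Leb1 (%(t, x). indicator {0<..<sig} t * absorb t x)"
  "(LBINT (t, x). indicator {0<..<sig} t * absorb t x) = (LBINT x. w 0 x) - (LBINT x. w sig x)"
proof -
 have j0: "jump (jump_kernel s eps) (%_. 1) x = 0" for x :: 'a by (simp add: jump_def)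
 have xi: "continuous_on UNIV (%(t::real, x::'a). 1::real)" by simp
 note D = duality[OF sig xi, of 1 "%_ _. 0" 0, simplified j0, simplified]
 have eq: "(%(t, x). indicator {0<..<sig} t * absorb t x) = (%p. - (case p of (t, x) => - (indicator {0<..<sig} t * absorb t x)))"
  by (simp add: fun_eq_iff)
 show i: "Leb1 (%(t, x). indicator {0<..<sig} t * absorb t x)"
  unfolding eq by (rule Bochner_Integration.integrable_minus) (use D(1) in simp)
 show "(LBINT (t, x). indicator {0<..<sig} t * absorb t x) = (LBINT x. w 0 x) - (LBINT x. w sig x)"
  using D(2) unfolding eq by simp
qed

end

section \<open>Extraction of smooth data of prescribed mass\<close>

lemma bump_at_lower: "0 < r ==> 1 - 2 * (norm (x - p))^2 / r^2 <= bump_at p r x"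
proof -
 assume r: "0 < r"
 define q where "q = (norm (x - p))^2 / r^2"
 have n: "(norm ((1 / r) *\<^sub>R (x - p)))^2 = q"
  unfolding norm_scaleR q_def using r by (simp add: power_mult_distrib power_divide)
 have q0: "0 <= q" by (simp add: q_def)
 have "1 - 2 * q <= (max 0 (1 - q))^2"
 proof (cases "q <= 1")
  case True
  have "1 - 2 * q <= (1 - q)^2" by (simp add: power2_eq_square algebra_simps)
  then show ?thesis using True by simp
 qed (use q0 in auto)
 then show ?thesis unfolding bump_at_def bump_def n by (simp add: q_def)
qed

lemma bump_at_le_indicator: "0 < r ==> bump_at p r x <= indicator (ball p r) x"
 using bump_at_bounds[of p r x] bump_at_eq_0_iff[of r p x] by (auto simp: indicator_def dist_norm norm_minus_commute)

lemma integrable_indicator_ball: "Leb1 (indicator (ball (c::'a::euclidean_space) r) :: 'a => real)"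
 using emeasure_bounded_finite[OF bounded_ball, of c r] by (auto simp: integrable_indicator_iff)

lemma bump_at_borel: "0 < r ==> bump_at p r : borel_funs"
 by (rule c11_borel[OF c11_bump_at])

lemma bump_at_integrable: assumes "0 < r" shows "Leb1 (bump_at (p::'a::euclidean_space) r)"
 by (rule Bochner_Integration.integrable_bound[OF integrable_indicator_ball[of p r]])
  (use bump_at_le_indicator[OF assms, of p] bump_at_bounds[of p r] bump_at_borel[OF assms] in auto)

lemma bump_at_integral_pos: assumes r: "0 < r" shows "0 < (LBINT x. bump_at (p::'a::euclidean_space) r x)"
proof -
 have "0 < 1 / 2 * (unit_ball_vol (real DIM('a)) * (r / 2) ^ DIM('a))"
  using r unit_ball_vol_pos'[of "DIM('a)"] by (intro mult_pos_pos) auto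
 also have "... = (LBINT x. 1 / 2 * indicator (cball p (r / 2)) x)"
  using integral_indicator_cball(1)[of "r / 2" p] r by simp
 also have "... <= (LBINT x. bump_at p r x)"
 proof (rule Bochner_Integration.integral_mono[OF _ bump_at_integrable[OF r]])
  show "Leb1 (%x. 1 / 2 * indicator (cball p (r / 2)) x :: real)"
   by (intro integrable_mult_right integral_indicator_cball(2))
  fix x
  show "1 / 2 * indicator (cball p (r / 2)) x <= bump_at p r x"
  proof (cases "x : cball p (r / 2)")
   case True
   then have "(norm (x - p))^2 <= (r / 2)^2" by (intro power_mono) (auto simp: dist_norm norm_minus_commute)
   then have "2 * (norm (x - p))^2 / r^2 <= 1 / 2" using r by (simp add: power2_eq_square field_simps)
   then show ?thesis using bump_at_lower[OF r, of x p] True by simp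
  qed (use bump_at_bounds in auto)
 qed
 finally show ?thesis .
qed

lemma ball_pred_borel [measurable]: "Measurable.pred borel (%x. x : ball (c::'a::metric_space) r)"
proof -
 have "{x : space borel. x : ball c r} = ball c r" by auto
 then show ?thesis unfolding pred_def using borel_open[OF open_ball[of c r]] by (simp only:)
qed

text \<open>The part of \<open>u0\<close> in the ball is mollified, which exceeds \<open>u0\<close>
  by at most \<open>th\<close> if the scale is small enough, and then multiplied by
  \<open>k / V < 1\<close> to have mass exactly \<open>k\<close>. The reduction keeps it below
  \<open>u0 + th\<close>.\<close>

lemma mollified_data_exists:
 fixes u0 :: "'a::euclidean_space => real"
 assumes c: "continuous_on UNIV u0" and nn: "!!x. 0 <= u0 x" and k: "0 < k" and r: "0 < r" and th: "0 < th"
  and m: "k < (LINT x:ball z r|lebesgue. u0 x)"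
 obtains \<mu> where "c11 \<mu>" "!!x. 0 <= \<mu> x" "!!x. 2 * r <= norm (x - z) ==> \<mu> x = 0"
  "(NN x. ennreal \<bar>\<mu> x\<bar>) = ennreal k" "!!x. \<mu> x <= u0 x + th"
proof -
 have [measurable]: "u0 : borel_funs" using c by (rule borel_measurable_continuous_onI)
 define v where "v y = indicator (ball z r) y * u0 y" for y
 have vm[measurable]: "v : borel_funs" unfolding v_def[abs_def] by measurable
 have v0: "0 <= v y" for y using nn by (simp add: v_def)
 define V where "V = (LBINT y. v y)"
 have vi: "Leb1 v"
 proof -
  have "Leb1 (%x. indicator (cball z r) x *\<^sub>R u0 x)"
   by (rule borel_integrable_compact[OF compact_cball continuous_on_subset[OF c]]) simp
  then show ?thesis
   by (rule Bochner_Integration.integrable_bound) (auto simp: v_def indicator_def)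
 qed
 have V: "k < V"
 proof -
  have "(LINT x:ball z r|lebesgue. u0 x) = V"
   unfolding set_lebesgue_integral_def V_def v_def by (subst integral_completion) auto
  then show ?thesis using m by simp
 qed
 have "uniformly_continuous_on (cball z (3 * r)) u0"
  by (rule compact_uniformly_continuous[OF continuous_on_subset[OF c] compact_cball]) simp
 then obtain d0 where d0: "0 < d0" "!!x y. x : cball z (3 * r) ==> y : cball z (3 * r) ==> dist y x < d0 ==> dist (u0 y) (u0 x) < th"
  unfolding uniformly_continuous_on_def using th by metis
 \<comment> \<open>\<open>d0\<close> comes from uniform continuity and controls the excess over
   \<open>u0\<close>; \<open>d <= r\<close> keeps the support in the ball of radius
   \<open>2 r\<close>.\<close>
 define d where "d = min d0 r"
 have d: "0 < d" "d <= d0" "d <= r" using d0 r by (auto simp: d_def)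
 define I where "I = (LBINT x. bump_at (0::'a) d x)"
 have I: "0 < I" unfolding I_def by (rule bump_at_integral_pos[OF d(1)])
 define rho where "rho x = bump_at (0::'a) d x / I" for x
 obtain M B D where cb: "c11_bound M B D rho"
  using c11_cmult[OF c11_bump_at[OF d(1), of "0::'a"], of "1 / I"] unfolding rho_def[abs_def] c11_def by auto
 have rm[measurable]: "rho : borel_funs" by (rule c11_bound_borel[OF cb])
 have r0: "0 <= rho x" for x unfolding rho_def using bump_at_bounds(1)[of 0 d x] I by simp
 have rz: "rho x = 0" if "d <= norm x" for x unfolding rho_def using bump_at_eq_0_iff[OF d(1), of 0 x] that by simp
 have ri: "Leb1 rho" unfolding rho_def[abs_def] using bump_at_integrable[OF d(1), of "0::'a"] by simp
 have rI: "(LBINT x. rho x) = 1" unfolding rho_def using I by (simp add: I_def)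
 have ry: "Leb1 (%y. rho (x - y))" "(LBINT y. rho (x - y)) = 1" for x
 proof -
  have "integrable (distr lborel borel uminus) rho" using ri by (simp add: lborel_distr_uminus_euclidean)
  then have i: "Leb1 (%y. rho (- y))" by (subst (asm) integrable_distr_eq) auto
  then have "integrable (distr lborel borel ((+) (- x))) (%y. rho (- y))" by (simp add: lborel_distr_plus)
  then show "Leb1 (%y. rho (x - y))" by (subst (asm) integrable_distr_eq) auto
  have "(LBINT y. rho (- (- x + y))) = (LBINT y. rho (- y))" by (rule lborel_integral_shift) measurable
  also have "... = 1" using lborel_integral_reflect[of rho] rI by simp
  finally show "(LBINT y. rho (x - y)) = 1" by simp
 qed
 have rv: "Leb1 (%y. rho (x - y) * v y)" for x
  by (rule Bochner_Integration.integrable_bound[OF integrable_mult_right[OF vi, of M]])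
   (use c11_boundD(1)[OF cb] c11_bound_nonneg[OF cb] in "auto simp: abs_mult intro!: AE_I2 mult_right_mono")
 define m where "m x = (LBINT y. rho (x - y) * v y)" for x
 have m0: "0 <= m x" for x unfolding m_def using r0 v0 by (intro Bochner_Integration.integral_nonneg) simp
 have lin: "\<bar>(LBINT y. h y * v y)\<bar> <= A * V" if [measurable]: "h : borel_funs" and A: "!!y. \<bar>h y\<bar> <= A" for h :: "'a => real" and A
 proof -
  have hi: "Leb1 (%y. h y * v y)"
   by (rule Bochner_Integration.integrable_bound[OF integrable_mult_right[OF vi, of A]])
    (use A order_trans[OF abs_ge_zero A] in "auto simp: abs_mult intro!: AE_I2 mult_right_mono")
  have "\<bar>(LBINT y. h y * v y)\<bar> <= (LBINT y. \<bar>h y * v y\<bar>)" by (rule integral_abs_bound)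
  also have "... <= (LBINT y. A * v y)"
   by (rule Bochner_Integration.integral_mono[OF integrable_abs[OF hi] integrable_mult_right[OF vi]])
    (use A v0 in "auto simp: abs_mult intro!: mult_right_mono")
  finally show ?thesis by (simp add: V_def)
 qed
 have cm: "c11_bound (M * V) (B * V) (D * V) m"
  unfolding c11_bound_def
 proof (intro conjI allI)
  fix x h
  show "\<bar>m x\<bar> <= M * V" unfolding m_def by (rule lin) (use c11_boundD(1)[OF cb] in auto)
  have "m (x + h) - m x = (LBINT y. (rho (x + h - y) - rho (x - y)) * v y)"
   unfolding m_def Bochner_Integration.integral_diff[OF rv rv, symmetric] by (simp add: left_diff_distrib)
  also have "\<bar>...\<bar> <= (B * norm h) * V"
   by (rule lin) (use c11_boundD(2)[OF cb, of "x - _" h] in "auto simp: algebra_simps")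
  finally show "\<bar>m (x + h) - m x\<bar> <= B * V * norm h" by (simp add: mult_ac)
  have "m (x + h) + m (x - h) - 2 * m x = (LBINT y. (rho (x + h - y) * v y + rho (x - h - y) * v y) - 2 * (rho (x - y) * v y))"
   unfolding m_def using rv by (simp add: Bochner_Integration.integral_diff Bochner_Integration.integral_add)
  also have "... = (LBINT y. (rho (x + h - y) + rho (x - h - y) - 2 * rho (x - y)) * v y)"
   by (simp add: algebra_simps)
  also have "\<bar>...\<bar> <= (D * (norm h)^2) * V"
   by (rule lin) (use c11_boundD(3)[OF cb, of "x - _" h] in "auto simp: algebra_simps")
  finally show "\<bar>m (x + h) + m (x - h) - 2 * m x\<bar> <= D * V * (norm h)^2" by (simp add: mult_ac)
 qed
 have msupp: "m x = 0" if "2 * r <= norm (x - z)" for x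
 proof -
  have z: "rho (x - y) * v y = 0" for y
  proof (cases "y : ball z r")
   case True
   then have "norm (z - y) < r" by (simp add: dist_norm)
   moreover have "norm (x - z) <= norm (x - y) + norm (z - y)"
    using norm_triangle_ineq4[of "x - y" "z - y"] by simp
   ultimately have "d <= norm (x - y)" using that d by linarith
   then show ?thesis by (simp add: rz)
  qed (simp add: v_def)
  show ?thesis unfolding m_def z by simp
 qed
 have mle: "m x <= u0 x + th" for x
 proof (cases "2 * r <= norm (x - z)")
  case True
  then show ?thesis using msupp[OF True] nn[of x] th by simp
 next
  case False
  have "m x <= (LBINT y. (u0 x + th) * rho (x - y))"
   unfolding m_def
  proof (rule Bochner_Integration.integral_mono[OF rv])
   show "Leb1 (%y. (u0 x + th) * rho (x - y))" using ry(1) by (rule integrable_mult_right)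
   fix y
   show "rho (x - y) * v y <= (u0 x + th) * rho (x - y)"
   proof (cases "d <= norm (x - y)")
    case True
    then show ?thesis by (simp add: rz)
   next
    case F2: False
    have "v y <= u0 x + th"
    proof (cases "y : ball z r")
     case True
     have "x : cball z (3 * r)" "y : cball z (3 * r)" using False True r by (auto simp: dist_norm norm_minus_commute)
     moreover have "dist y x < d0" using F2 d by (simp add: dist_norm norm_minus_commute)
     ultimately have "dist (u0 y) (u0 x) < th" by (rule d0(2))
     then show ?thesis using True by (simp add: v_def dist_real_def)
    qed (use nn[of x] th in "simp add: v_def")
    then show ?thesis using mult_right_mono[OF _ r0] by (simp add: mult.commute)
   qed
  qed
  also have "... = u0 x + th" using ry(2) by simp
  finally show ?thesis .
 qed
 have mm[measurable]: "m : borel_funs" by (rule c11_bound_borel[OF cm])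
 have mI: "(NN x. ennreal (m x)) = ennreal V"
 proof -
  have "(NN x. ennreal (m x)) = (NN x. (NN y. ennreal (rho (x - y)) * ennreal (v y)))"
   unfolding m_def
   by (intro nn_integral_cong, subst nn_integral_eq_integral[symmetric, OF rv])
    (use r0 v0 in "auto simp: ennreal_mult")
  also have "... = (NN y. (NN x. ennreal (rho (x - y)) * ennreal (v y)))"
   by (rule lborel_pair.Fubini'[symmetric]) (simp add: case_prod_unfold)
  also have "... = (NN y. ennreal (v y))"
  proof (rule nn_integral_cong)
   fix y
   have "integrable (distr lborel borel ((+) (- y))) rho" using ri by (simp add: lborel_distr_plus)
   then have i: "Leb1 (%x. rho (- y + x))" by (subst (asm) integrable_distr_eq) auto
   have "(NN x. ennreal (rho (- y + x))) = ennreal (LBINT x. rho (- y + x))"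
    by (rule nn_integral_eq_integral[OF i]) (use r0 in auto)
   also have "(LBINT x. rho (- y + x)) = 1" using lborel_integral_shift[OF rm, of "- y"] rI by simp
   finally have "(NN x. ennreal (rho (x - y))) = 1" by simp
   then show "(NN x. ennreal (rho (x - y)) * ennreal (v y)) = ennreal (v y)"
    by (simp add: nn_integral_multc)
  qed
  also have "... = ennreal V" unfolding V_def by (rule nn_integral_eq_integral[OF vi]) (use v0 in auto)
  finally show ?thesis .
 qed
 show ?thesis
 proof (rule that[of "%x. (k / V) * m x"])
  have kV: "0 <= k / V" "k / V <= 1" using k V by auto
  show "c11 (%x. (k / V) * m x)" by (rule c11_cmult[OF c11I[OF cm]])
  show "0 <= (k / V) * m x" for x by (rule mult_nonneg_nonneg[OF kV(1) m0])
  show "(k / V) * m x = 0" if "2 * r <= norm (x - z)" for x using msupp[OF that] by simp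
  show "(k / V) * m x <= u0 x + th" for x using mle[of x] mult_right_mono[OF kV(2) m0[of x]] by simp
  have "(NN x. ennreal \<bar>(k / V) * m x\<bar>) = (NN x. ennreal (k / V) * ennreal (m x))"
   by (intro nn_integral_cong) (simp only: abs_of_nonneg[OF mult_nonneg_nonneg[OF kV(1) m0]] ennreal_mult[OF kV(1) m0])
  also have "... = ennreal (k / V) * ennreal V" by (simp add: nn_integral_cmult mI)
  also have "... = ennreal k" using k V by (simp add: ennreal_mult[symmetric])
  finally show "(NN x. ennreal \<bar>(k / V) * m x\<bar>) = ennreal k" .
 qed
qed

lemma singular_set_mass:
 assumes z: "z : singular_set u" and r: "0 < r" and t: "0 < t"
 obtains t0 where "0 < t0" "t0 < t" "k < (LINT x:ball z r|lebesgue. u t0 x)"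
proof -
 have "Limsup (at_right 0) (%t. ereal (LINT x:ball z r|lebesgue. u t x)) = \<infinity>"
  using z r by (simp add: singular_set_def)
 have "\<exists>t0. 0 < t0 & t0 < t & k < (LINT x:ball z r|lebesgue. u t0 x)"
 proof (rule ccontr)
  assume n: "~ ?thesis"
  have "(LINT x:ball z r|lebesgue. u y x) <= k" if "0 < y" "y < t" for y
  proof (rule ccontr)
   assume "~ ?thesis"
   then show False using n that unfolding not_le by blast
  qed
  then have "eventually (%t. ereal (LINT x:ball z r|lebesgue. u t x) <= ereal k) (at_right 0)"
   using t unfolding eventually_at_right_field by (intro exI[of _ t]) auto
  then have "Limsup (at_right 0) (%t. ereal (LINT x:ball z r|lebesgue. u t x)) <= ereal k"
   by (rule Limsup_bounded)
  then show False using z r by (simp add: singular_set_def)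
 qed
 then show ?thesis using that by blast
qed

section \<open>Persistence of mass at a singular point\<close>

locale singular_solution =
 fixes f :: "real => 'a::euclidean_space => real => real" and g :: "real => real"
  and u :: "real => 'a => real" and s \<beta> :: real and z :: 'a
 assumes s: "0 < s" "s < 1" and \<beta>: "-1 < \<beta>"
  and f: "!!t x r. 0 < t ==> 0 <= r ==> f t x r <= t powr \<beta> * g r"
  and g: "mono_on {0..} g" "!!r. 0 <= r ==> 0 <= g r"
  and g_int: "set_integrable lebesgue {1..} (%sig. g sig * sig powr (- 2 - 2 * s * (1 + min \<beta> 0) / real DIM('a)))"
  and u: "classical_solution s f u" and unn: "!!t x. 0 < t ==> 0 <= u t x"
  and z: "z : singular_set u"
begin

lemma approximant_below:
 assumes k: "0 < k" and r: "0 < r" and th: "0 < th" and tm: "0 < tm" and T: "0 < T"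
 obtains t0 eps M B D R G w where "0 < t0" "t0 < tm" "approximant s \<beta> g z t0 T th k eps M B D R G w"
  "!!x. 2 * r <= norm (x - z) ==> w 0 x = 0" "(LBINT x. w 0 x) = k"
  "!!sig x. 0 <= sig ==> sig < T ==> w sig x - th - 2 * th * sig <= u (t0 + sig) x"
proof -
 obtain t0 where t0: "0 < t0" "t0 < tm" "k < (LINT x:ball z r|lebesgue. u t0 x)"
  using singular_set_mass[OF z r tm] by blast
 obtain \<mu> where mu: "c11 \<mu>" "!!x. 0 <= \<mu> x" "!!x. 2 * r <= norm (x - z) ==> \<mu> x = 0"
  "(NN x. ennreal \<bar>\<mu> x\<bar>) = ennreal k" "!!x. \<mu> x <= u t0 x + th"
  using mollified_data_exists[OF classical_solution_continuous[OF u t0(1)] unn[OF t0(1)] k r th t0(3)] by blast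
 have mass: "(NN x. ennreal \<bar>\<mu> x\<bar>) <= ennreal k" using mu(4) by simp
 obtain eps M B D R G w where A: "approximant s \<beta> g z t0 T th k eps M B D R G w" and w0: "!!x. w 0 x = \<mu> x"
  using approximant_exists[OF s t0(1) T th k g mu(1,2,3) mass] by blast
 show ?thesis
 proof (rule that[OF t0(1,2) A])
  show "w 0 x = 0" if "2 * r <= norm (x - z)" for x using mu(3)[OF that] w0 by simp
  have w0': "w 0 = \<mu>" using w0 by auto
  have [measurable]: "\<mu> : borel_funs" by (rule c11_borel[OF mu(1)])
  have "ennreal (LBINT x. w 0 x) = (NN x. ennreal \<bar>\<mu> x\<bar>)"
   unfolding w0' using mu(2) integrable_of_nn[OF _ mass]
   by (subst nn_integral_eq_integral[symmetric]) auto
  then have "ennreal (LBINT x. w 0 x) = ennreal k" using mu(4) by simp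
  moreover have "0 <= (LBINT x. w 0 x)" unfolding w0' using mu(2) by (intro Bochner_Integration.integral_nonneg) auto
  ultimately show "(LBINT x. w 0 x) = k" using k by (simp add: ennreal_inj)
  show "w sig x - th - 2 * th * sig <= u (t0 + sig) x" if "0 <= sig" "sig < T" for sig x
   by (rule approximant.le_classical_solution[OF A u unn f _ that]) (use mu(5) w0 in auto)
 qed
qed

text \<open>All parameters of the approximation, in particular \<open>t0\<close> and
  \<open>th\<close>, are quantified inside: \<open>tau\<close> and \<open>r\<close> are fixed first,
  and only then is a start time with large mass selected.\<close>

definition keeps_mass :: "real => real => real => real => real => bool" where
 "keeps_mass k rho \<delta> tau r \<longleftrightarrow> (\<forall>t0 T th eps M B D R G w sig. approximant s \<beta> g z t0 T th k eps M B D R G w --> t0 <= 1 -->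
  (\<forall>x. 2 * r <= norm (x - z) --> w 0 x = 0) --> (LBINT x. w 0 x) = k -->
  0 <= sig --> sig <= T --> sig <= tau --> k - \<delta> <= (LBINT x. w sig x * bump_at z rho x))"

lemma keeps_massD:
 assumes "keeps_mass k rho \<delta> tau r" "approximant s \<beta> g z t0 T th k eps M B D R G w" "t0 <= 1"
  "!!x. 2 * r <= norm (x - z) ==> w 0 x = 0" "(LBINT x. w 0 x) = k" "0 <= sig" "sig <= T" "sig <= tau"
 shows "k - \<delta> <= (LBINT x. w sig x * bump_at z rho x)"
 using assms(1)[unfolded keeps_mass_def, rule_format, OF assms(2,3) _ assms(5-8)] assms(4) by blast

text \<open>The constant loss is absorbed by small \<open>\<tau>\<close>; the radius \<open>r\<close> of the support of the data only has
  to be small compared with \<open>\<rho>\<close>.\<close>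

lemma uniform_local_mass:
 assumes k: "0 < k" and rho: "0 < rho" and d: "0 < \<delta>"
 obtains tau r where "0 < tau" "tau <= 1" "0 < r"
  "keeps_mass k rho \<delta> tau r"
proof -
 obtain K where K: "0 <= K" "!!eps x. 0 < eps ==> \<bar>jump (jump_kernel s eps) (bump_at z rho) x\<bar> <= K"
  using jump_bump_bounded[OF s rho, where 'a = 'a] by blast
 have d3: "0 < \<delta> / 3" using d by simp
 obtain tau1 where t1: "0 < tau1" "tau1 <= 1" "(NN sig. absorption_majorant TYPE('a) s \<beta> g k rho sig * indicator {0<..<tau1} sig) <= ennreal (\<delta> / 3)"
  using nn_integral_initial_small[OF absorption_majorant_measurable absorption_majorant_finite[OF s \<beta> k rho g g_int] d3] by blast
 define tau where "tau = min tau1 (\<delta> / 3 / (K * k + 1))"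
 have Kk: "0 <= K * k" using K k by simp
 have t: "0 < tau" "tau <= 1" "tau <= tau1" using t1 d Kk by (auto simp: tau_def intro!: divide_pos_pos add_nonneg_pos)
 have tK: "K * k * tau <= \<delta> / 3"
 proof -
  have "K * k * tau <= K * k * (\<delta> / 3 / (K * k + 1))" using Kk by (intro mult_left_mono) (auto simp: tau_def)
  also have "... = K * k / (K * k + 1) * (\<delta> / 3)" by simp
  also have "... <= 1 * (\<delta> / 3)" using Kk d by (intro mult_right_mono) auto
  finally show ?thesis by simp
 qed
 \<comment> \<open>On the support of the data, of radius \<open>2 r = 2 rho q\<close>, the bump is
   at least \<open>1 - 8 q\<close>; so \<open>24 k q <= \<delta>\<close> makes the initial loss at
   most \<open>\<delta> / 3\<close>. The other two thirds are for the jumps and for the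
   absorption.\<close>
 define q where "q = min 1 (\<delta> / (24 * k))"
 have q: "0 < q" "q <= 1" "24 * k * q <= \<delta>" using d k by (auto simp: q_def field_simps min_def)
 define r where "r = rho * q"
 have r: "0 < r" using rho q by (simp add: r_def)
 show ?thesis
 proof (rule that[OF t(1,2) r], unfold keeps_mass_def, intro allI impI)
  fix t0 T th eps M B D R G w sig
  assume A: "approximant s \<beta> g z t0 T th k eps M B D R G w" and t01: "t0 <= 1"
   and supp: "\<forall>x. 2 * r <= norm (x - z) --> w 0 x = 0" and w0k: "(LBINT x. w 0 x) = k"
   and sig: "0 <= sig" "sig <= T" "sig <= tau"
  interpret approximant s \<beta> g z t0 T th k eps M B D R G w by (rule A)
  have H: "(NN tau. absorption_majorant TYPE('a) s \<beta> g k rho tau * indicator {0<..<sig} tau) <= ennreal (\<delta> / 3)"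
   by (rule order_trans[OF nn_integral_mono t1(3)]) (use sig t in "auto simp: indicator_def")
  have s1: "sig <= 1" using sig t by linarith
  have d0: "0 <= \<delta> / 3" using d by simp
  have "(LBINT x. w 0 x * bump_at z rho x) - K * k * sig - \<delta> / 3 <= (LBINT x. w sig x * bump_at z rho x)"
   by (rule local_mass_lower_bound[OF s1 t01 sig(1,2) rho g K(2)[OF eps] H d0])
  moreover have "K * k * sig <= \<delta> / 3" using mult_left_mono[OF sig(3) Kk] tK by linarith
  moreover have "k - \<delta> / 3 <= (LBINT x. w 0 x * bump_at z rho x)"
  proof -
   have wi: "Leb1 (w 0)" using w_integrable[of 0] T by simp
   have w0: "0 <= w 0 x" for x using nonneg[of 0 x] T by simp
   have [measurable]: "bump_at z rho : borel_funs" by (rule bump_at_borel[OF rho])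
   have "k - \<delta> / 3 <= k * (1 - 8 * q)" using q by (simp add: algebra_simps)
   also have "... = (LBINT x. w 0 x * (1 - 8 * q))" using w0k by simp
   also have "... <= (LBINT x. w 0 x * bump_at z rho x)"
   proof (rule Bochner_Integration.integral_mono)
    show "Leb1 (%x. w 0 x * (1 - 8 * q))" using wi by simp
    show "Leb1 (%x. w 0 x * bump_at z rho x)"
     by (rule Bochner_Integration.integrable_bound[OF wi])
      (use bump_at_bounds[of z rho] in "auto simp: abs_mult intro!: AE_I2 mult_left_le")
    fix x
    show "w 0 x * (1 - 8 * q) <= w 0 x * bump_at z rho x"
    proof (cases "2 * r <= norm (x - z)")
     case True
     then show ?thesis using supp by simp
    next
     case False
     then have "(norm (x - z))^2 <= (2 * r)^2" by (intro power_mono) auto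
     also have "(2 * r)^2 = 4 * q * q * rho^2" by (simp add: r_def power2_eq_square)
     also have "... <= 4 * q * rho^2" using q by (intro mult_right_mono) auto
     finally have "2 * (norm (x - z))^2 / rho^2 <= 8 * q" using rho by (simp add: field_simps)
     then have "1 - 8 * q <= bump_at z rho x" using bump_at_lower[OF rho, of x z] by linarith
     then show ?thesis using w0 by (intro mult_left_mono)
    qed
   qed
   finally show ?thesis .
  qed
  ultimately show "k - \<delta> <= (LBINT x. w sig x * bump_at z rho x)" by linarith
 qed
qed

text \<open>The singular set provides large mass only along some times tending to 0. For any
  \<open>t < tau\<close> such a time \<open>t0\<close> is chosen before \<open>t\<close>, and the
  mass found there is still present at \<open>t\<close>, because \<open>tau\<close> does not depend
  on \<open>t0\<close>. This turns the upper limit into a limit.\<close>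

theorem local_mass_blow_up:
 assumes rho: "0 < rho"
 shows "filterlim (%t. LINT x:ball z rho|lebesgue. u t x) at_top (at_right 0)"
 unfolding filterlim_at_top
proof
 fix Z :: real
 \<comment> \<open>Of the mass \<open>k >= Z + 2\<close>, one unit may be lost by \<open>w\<close>
   and another one to the error \<open>3 th\<close> between \<open>w\<close> and \<open>u\<close>
   over the ball.\<close>
 define k where "k = max 1 (Z + 2)"
 have k: "0 < k" by (simp add: k_def)
 obtain tau r where tr: "0 < tau" "tau <= 1" "0 < r"
  "keeps_mass k rho 1 tau r"
  by (rule uniform_local_mass[OF k rho zero_less_one])
 define V where "V = ((LBINT x. indicator (ball z rho) x) :: real)"
 have v: "0 <= V" unfolding V_def by (intro Bochner_Integration.integral_nonneg) auto
 define th where "th = 1 / (3 * (V + 1))"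
 have th: "0 < th" using v by (simp add: th_def)
 have "Z <= (LINT x:ball z rho|lebesgue. u t x)" if t: "0 < t" "t < tau" for t
 proof -
  obtain t0 eps M B D R G w where A: "0 < t0" "t0 < t" "approximant s \<beta> g z t0 2 th k eps M B D R G w"
   "!!x. 2 * r <= norm (x - z) ==> w 0 x = 0" "(LBINT x. w 0 x) = k"
   "!!sig x. 0 <= sig ==> sig < 2 ==> w sig x - th - 2 * th * sig <= u (t0 + sig) x"
   by (rule approximant_below[OF k tr(3) th t(1), of 2]) auto
  interpret approximant s \<beta> g z t0 2 th k eps M B D R G w by (rule A(3))
  define sig where "sig = t - t0"
  have sig: "0 <= sig" "sig <= 2" "sig < 2" "sig <= tau" "sig <= 1" "t0 <= 1" "t0 + sig = t" using A(1,2) t tr by (auto simp: sig_def)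
  have m: "k - 1 <= (LBINT x. w sig x * bump_at z rho x)"
   by (rule keeps_massD[OF tr(4) A(3) sig(6) A(4,5) sig(1,2,4)])
  have [measurable]: "u t : borel_funs"
   by (rule borel_measurable_continuous_onI[OF classical_solution_continuous[OF u t(1)]])
  have [measurable]: "bump_at z rho : borel_funs" by (rule bump_at_borel[OF rho])
  have wi: "Leb1 (%x. w sig x * bump_at z rho x)"
   by (rule Bochner_Integration.integrable_bound[OF w_integrable[OF sig(1,2)]])
    (use bump_at_bounds[of z rho] in "auto simp: abs_mult intro!: AE_I2 mult_left_le")
  have ui: "Leb1 (%x. indicator (ball z rho) x * u t x)"
  proof -
   have "Leb1 (%x. indicator (cball z rho) x *\<^sub>R u t x)"
    by (rule borel_integrable_compact[OF compact_cball continuous_on_subset[OF classical_solution_continuous[OF u t(1)]]]) simp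
   then show ?thesis by (rule Bochner_Integration.integrable_bound) (auto simp: indicator_def)
  qed
  have "(LBINT x. w sig x * bump_at z rho x - 3 * th * indicator (ball z rho) x) <= (LBINT x. indicator (ball z rho) x * u t x)"
  proof (rule Bochner_Integration.integral_mono[OF _ ui])
   show "Leb1 (%x. w sig x * bump_at z rho x - 3 * th * indicator (ball z rho) x)"
    by (intro Bochner_Integration.integrable_diff wi integrable_mult_right integrable_indicator_ball)
   fix x
   show "w sig x * bump_at z rho x - 3 * th * indicator (ball z rho) x <= indicator (ball z rho) x * u t x"
   proof (cases "x : ball z rho")
    case True
    have "2 * th * sig <= 2 * th * 1" using th sig by (intro mult_left_mono) auto
    then have "w sig x <= u t x + 3 * th" using A(6)[OF sig(1,3), of x] sig(7) by simp
    moreover have "w sig x * bump_at z rho x <= w sig x"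
     using nonneg[OF sig(1,2), of x] bump_at_bounds[of z rho x] by (simp add: mult_left_le)
    ultimately show ?thesis using True by simp
   next
    case False
    then have "bump_at z rho x = 0" using bump_at_le_indicator[OF rho, of z x] bump_at_bounds[of z rho x] by simp
    then show ?thesis using False by simp
   qed
  qed
  also have "(LBINT x. w sig x * bump_at z rho x - 3 * th * indicator (ball z rho) x) = (LBINT x. w sig x * bump_at z rho x) - 3 * th * V"
   unfolding V_def using wi integrable_indicator_ball[of z rho]
   by (subst Bochner_Integration.integral_diff) auto
  also have "(LBINT x. indicator (ball z rho) x * u t x) = (LINT x:ball z rho|lebesgue. u t x)"
   unfolding set_lebesgue_integral_def by (subst integral_completion) auto
  finally have "(LBINT x. w sig x * bump_at z rho x) - 3 * th * V <= (LINT x:ball z rho|lebesgue. u t x)" .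
  moreover have "3 * th * V <= 1" using v by (simp add: th_def field_simps)
  moreover have "Z + 2 <= k" by (simp add: k_def)
  ultimately show ?thesis using m by linarith
 qed
 then show "eventually (%t. Z <= (LINT x:ball z rho|lebesgue. u t x)) (at_right 0)"
  using tr(1) unfolding eventually_at_right_field by blast
qed

end

subsection \<open>Dual solutions as test functions\<close>

lemma jump_solution_shift:
 assumes w: "jump_solution kappa b T w" and a: "0 <= a" "a + T' <= T"
 shows "jump_solution kappa (%t. b (a + t)) T' (%t. w (a + t))"
 unfolding jump_solution_def
proof (intro conjI ballI allI)
 have "continuous_on UNIV (%p. w (fst p) (snd p))" using jump_solution_continuous(1)[OF w, of UNIV] by (simp add: case_prod_unfold)
 then have "continuous_on UNIV (%p. w (fst (a + fst p, snd p)) (snd (a + fst p, snd p)))"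
  by (rule continuous_on_compose2) (auto intro!: continuous_intros)
 then show "continuous_on UNIV (%(t, x). w (a + t) x)" by (simp add: case_prod_unfold)
 show "\<exists>C. \<forall>t x. \<bar>w (a + t) x\<bar> <= C" using w unfolding jump_solution_def by blast
 fix t x assume t: "t : {0<..<T'}"
 have "((%tau. w tau x) has_real_derivative jump kappa (w (a + t)) x - b (a + t) x (w (a + t) x)) (at (a + t))"
  using jump_solution_deriv[OF w, of "a + t" x] a t by simp
 moreover have "((%tau. a + tau) has_real_derivative 1) (at t)" by (auto intro!: derivative_eq_intros)
 ultimately show "((%tau. w (a + tau) x) has_real_derivative jump kappa (w (a + t)) x - b (a + t) x (w (a + t) x)) (at t)"
  using DERIV_chain2 by fastforce
qed

lemma holder_const_pos: "0 < s ==> s < 1 ==> 0 < holder_const TYPE('a::euclidean_space) s"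
 using frac_lap_const_pos[of s, where 'a = 'a] less_imp_neq[OF unit_ball_vol_pos'[of "DIM('a)"], symmetric]
 by (simp add: holder_const_def)

text \<open>The order of the quantifiers is the point: \<open>rho1\<close> and \<open>t1\<close>
  depend on the sup bound \<open>M0\<close>, and only \<open>eps1\<close> depends on the Lipschitz
  constant. In the application \<open>M0\<close> is known before the coefficient \<open>c\<close>,
  while \<open>Lip\<close> is not. The time \<open>tau - t\<close> is at least
  \<open>tau / 2\<close>, so the Hoelder estimate applies there, and the time modulus leads from
  there to \<open>tau\<close>.\<close>

lemma flow_equicontinuity:
 assumes s: "0 < s" "s < 1" and tau: "0 < tau" and M0: "0 < M0" and d: "0 < \<delta>"
 shows "\<exists>rho1>0. \<exists>t1>0. t1 <= tau & (\<forall>Lip\<ge>0. \<exists>eps1>0. \<forall>eps \<Phi> x y t. 0 < eps --> eps <= eps1 -->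
  jump_solution (jump_kernel s eps) (%_ _ _. 0) tau \<Phi> --> (\<forall>t x. 0 <= t --> t <= tau --> \<bar>\<Phi> t x\<bar> <= M0) -->
  (\<forall>t x y. 0 <= t --> t <= tau --> \<bar>\<Phi> t x - \<Phi> t y\<bar> <= Lip * norm (x - y)) -->
  0 <= t --> t <= t1 --> norm (x - y) <= rho1 --> \<bar>\<Phi> (tau - t) x - \<Phi> tau (y::'a::euclidean_space)\<bar> <= \<delta>)"
proof -
 let ?p = "1 / (4 * s)" and ?H = "holder_const TYPE('a) s"
 have H: "0 < ?H" by (rule holder_const_pos[OF s])
 define C where "C = ?H * M0 * (tau / 2) powr (- ?p)"
 have C: "0 < C" unfolding C_def using H M0 tau by (intro mult_pos_pos) auto
 define rho1 where "rho1 = (\<delta> / (4 * C))^2"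
 have rho: "0 < rho1" using d C by (simp add: rho1_def)
 have Crho: "C * sqrt a <= \<delta> / 4" if "0 <= a" "a <= rho1" for a
 proof -
  have "sqrt a <= sqrt rho1" using that by (rule_tac real_sqrt_le_mono)
  also have "... = \<delta> / (4 * C)" using d C by (simp add: rho1_def)
  finally have "C * sqrt a <= C * (\<delta> / (4 * C))" using C by (intro mult_left_mono) auto
  then show ?thesis using C by simp
 qed
 obtain K where K: "0 <= K" "!!eps z x. 0 < eps ==> \<bar>jump (jump_kernel s eps) (bump_at (z::'a) rho1) x\<bar> <= K"
  using jump_bump_bounded[OF s rho] by blast
 define t1 where "t1 = min (tau / 2) (\<delta> / 4 / (2 * M0 * K + 1))"
 have MK: "0 <= 2 * M0 * K" using M0 K by simp
 have t1: "0 < t1" unfolding t1_def using tau d MK by (intro min_less_iff_conj[THEN iffD2] conjI divide_pos_pos add_nonneg_pos) auto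
 have t1': "t1 <= tau / 2" by (simp only: t1_def min.cobounded1)
 have MKt: "2 * M0 * K * t <= \<delta> / 4" if "0 <= t" "t <= t1" for t
 proof -
  have "2 * M0 * K * t <= 2 * M0 * K * (\<delta> / 4 / (2 * M0 * K + 1))" using MK that by (intro mult_left_mono) (auto simp: t1_def)
  also have "... = 2 * M0 * K / (2 * M0 * K + 1) * (\<delta> / 4)" by simp
  also have "... <= 1 * (\<delta> / 4)"
  proof -
   have "P / (P + 1) <= 1" if "0 <= P" for P :: real using that by simp
   from mult_right_mono[OF this[OF MK], of "\<delta> / 4"] d show ?thesis by simp
  qed
  finally show ?thesis by simp
 qed
 have t1tau: "t1 <= tau" using t1' tau by simp
 show ?thesis
 proof (rule exI[of _ rho1], rule conjI[OF rho], rule exI[of _ t1], rule conjI[OF t1], rule conjI[OF t1tau], intro allI impI)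
  fix Lip :: real assume Lip: "0 <= Lip"
  define A where "A = sqrt (2 * M0 * Lip) / (?H * M0)"
  have A: "0 <= A" using H M0 Lip by (simp add: A_def)
  \<comment> \<open>This is the time shift in \<open>jump_solution_holder\<close>, chosen so small
    that the barrier dominates the initial square root modulus
    \<open>sqrt (2 M0 Lip)\<close>.\<close>
  define q where "q = (A + 1) powr (- (4 * s))"
  have q: "0 < q" using A by (simp add: q_def)
  have qp: "q powr (- ?p) = A + 1" using A s by (simp add: q_def powr_powr)
  have init: "sqrt (2 * M0 * Lip) <= ?H * M0 * q powr (- ?p)"
  proof -
   have "sqrt (2 * M0 * Lip) = ?H * M0 * A" using H M0 by (simp add: A_def)
   also have "... <= ?H * M0 * (A + 1)" using H M0 by (intro mult_left_mono) auto
   finally show ?thesis using qp by simp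
  qed
  define E where "E = ?H * M0 * (tau + q) powr (- ?p)"
  have E: "0 < E" unfolding E_def using H M0 tau q by (intro mult_pos_pos) auto
  \<comment> \<open>Chosen such that \<open>Lip sqrt (8 eps)\<close> is at most the value of the
    barrier constant at the final time.\<close>
  define eps1 where "eps1 = (E / (Lip + 1))^2 / 8"
  have e1: "0 < eps1" using E Lip by (simp add: eps1_def)
  show "\<exists>eps1>0. \<forall>eps \<Phi> x y t. 0 < eps --> eps <= eps1 -->
  jump_solution (jump_kernel s eps) (%_ _ _. 0) tau \<Phi> --> (\<forall>t x. 0 <= t --> t <= tau --> \<bar>\<Phi> t x\<bar> <= M0) -->
  (\<forall>t x y. 0 <= t --> t <= tau --> \<bar>\<Phi> t x - \<Phi> t y\<bar> <= Lip * norm (x - y)) -->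
  0 <= t --> t <= t1 --> norm (x - y) <= rho1 --> \<bar>\<Phi> (tau - t) x - \<Phi> tau (y::'a)\<bar> <= \<delta>"
  proof (rule exI[of _ eps1], rule conjI[OF e1], intro allI impI)
   fix eps and \<Phi> :: "real => 'a => real" and x y :: 'a and t
   assume e: "0 < eps" "eps <= eps1" and sol: "jump_solution (jump_kernel s eps) (%_ _ _. 0) tau \<Phi>"
    and bdd: "\<forall>t x. 0 <= t --> t <= tau --> \<bar>\<Phi> t x\<bar> <= M0"
    and lip: "\<forall>t x y. 0 <= t --> t <= tau --> \<bar>\<Phi> t x - \<Phi> t y\<bar> <= Lip * norm (x - y)"
    and t: "0 <= t" "t <= t1" and xy: "norm (x - y) <= rho1"
   have eps: "Lip * sqrt (8 * eps) <= ?H * M0 * (tau + q) powr (- ?p)"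
   proof -
    have "8 * eps <= (E / (Lip + 1))^2" using e by (simp add: eps1_def)
    then have "sqrt (8 * eps) <= E / (Lip + 1)" using E Lip by (intro real_le_lsqrt) auto
    then have "Lip * sqrt (8 * eps) <= Lip * (E / (Lip + 1))" using Lip by (intro mult_left_mono)
    also have "... = Lip / (Lip + 1) * E" by simp
    also have "... <= 1 * E" using Lip E by (intro mult_right_mono) auto
    finally show ?thesis by (simp add: E_def)
   qed
   have hol: "\<Phi> sig a - \<Phi> sig b <= \<delta> / 4" if "tau / 2 <= sig" "sig <= tau" "norm (a - b) <= rho1" for sig a b
   proof -
    have sig: "0 < sig" using that tau by linarith
    have "\<Phi> sig a - \<Phi> sig b <= ?H * M0 * sig powr (- ?p) * sqrt (norm (a - b))"
     by (rule jump_solution_holder[OF s e(1) _ sol _ _ M0 Lip q init eps]) (use tau bdd lip sig that in auto)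
    also have "... <= C * sqrt (norm (a - b))"
    proof -
     have "sig powr (- ?p) <= (tau / 2) powr (- ?p)" using that tau s by (intro powr_mono2') auto
     then have "?H * M0 * sig powr (- ?p) <= C" unfolding C_def using H M0 by (intro mult_left_mono) auto
     then show ?thesis by (intro mult_right_mono) auto
    qed
    also have "... <= \<delta> / 4" using that by (intro Crho) auto
    finally show ?thesis .
   qed
   have tt: "tau / 2 <= tau - t" "tau - t <= tau" using t t1' by auto
   have sh: "jump_solution (jump_kernel s eps) (%_ _ _. 0) t (%sig. \<Phi> (tau - t + sig))"
    using jump_solution_shift[OF sol, of "tau - t" t] tt tau by simp
   have sh': "jump_solution (jump_kernel s eps) (%_ _ _. 0) t (%sig x. - \<Phi> (tau - t + sig) x)"
    using symmetric_jumps.jump_solution_uminus[OF symmetric_jumps_jump_kernel[OF s e(1)] sh] by simp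
   have d4: "0 <= \<delta> / 4" using d by simp
   have osc: "\<Phi> (tau - t + 0) a <= \<Phi> (tau - t + 0) y + \<delta> / 4"
    "- \<Phi> (tau - t + 0) a <= - \<Phi> (tau - t + 0) y + \<delta> / 4" if "norm (a - y) <= rho1" for a
    using hol[OF tt that] hol[OF tt, of y a] that by (simp_all add: norm_minus_commute)
   have "\<Phi> (tau - t + t) y <= \<Phi> (tau - t + 0) y + \<delta> / 4 + 2 * M0 * K * t"
    by (rule jump_solution_time_modulus[OF s e(1) t(1) sh _ rho osc(1) d4 K(2)[OF e(1)] t(1) order_refl])
     (use bdd tt tau in auto)
   moreover have "- \<Phi> (tau - t + t) y <= - \<Phi> (tau - t + 0) y + \<delta> / 4 + 2 * M0 * K * t"
    by (rule jump_solution_time_modulus[OF s e(1) t(1) sh' _ rho osc(2) d4 K(2)[OF e(1)] t(1) order_refl])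
     (use bdd tt tau in auto)
   moreover have "\<Phi> (tau - t) x - \<Phi> (tau - t) y <= \<delta> / 4" "\<Phi> (tau - t) y - \<Phi> (tau - t) x <= \<delta> / 4"
    using hol[OF tt] xy by (auto simp: norm_minus_commute)
   ultimately show "\<bar>\<Phi> (tau - t) x - \<Phi> tau y\<bar> <= \<delta>" using MKt[OF t] d by simp
  qed
 qed
qed

text \<open>Bounded solutions of the dual problem \<open>-\<partial>\<^sub>t \<xi> - J\<^sub>\<epsilon> \<xi> + c \<xi> = \<eta>\<close>, \<open>\<xi>(T) = 0\<close>, where the jump
  operator \<open>J\<^sub>\<epsilon>\<close> is \<open>-(-\<Delta>)\<^sup>s\<^sub>\<epsilon>\<close>. The constants \<open>X\<close> and \<open>B\<close> will depend on \<open>\<eta>\<close> alone, while \<open>L\<close> and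
  \<open>D\<close> also depend on \<open>c\<close>, but not on \<open>\<epsilon>\<close>.\<close>

locale test_function =
 fixes s T :: real and c eta :: "real \<times> 'a::euclidean_space => real" and X L D B eps :: real and xi :: "real => 'a => real"
 assumes s: "0 < s" "s < 1" and T: "0 < T" and eps: "0 < eps" and B: "0 <= B"
  and c_cont: "continuous_on UNIV c" and c_bdd: "\<exists>C. \<forall>p. \<bar>c p\<bar> <= C"
  and eta_cont: "continuous_on UNIV eta" and eta_bdd: "\<exists>C. \<forall>p. \<bar>eta p\<bar> <= C"
  and cont: "continuous_on UNIV (%(t, x). xi t x)" and bdd: "\<exists>C. \<forall>t x. \<bar>xi t x\<bar> <= C"
  and nonneg: "!!t x. 0 <= t ==> t <= T ==> 0 <= xi t x"
  and reg: "!!t. 0 <= t ==> t <= T ==> c11_bound X L D (xi t)"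
  and mass: "!!t. 0 <= t ==> t <= T ==> (NN x. ennreal \<bar>xi t x\<bar>) <= ennreal B"
  and final: "!!x. xi T x = 0"
  and deriv: "!!t x. 0 < t ==> t < T ==>
   ((%tau. xi tau x) has_real_derivative - jump (jump_kernel s eps) (xi t) x + c (t, x) * xi t x - eta (t, x)) (at t)"
  and flow: "!!tau. 0 < tau ==> tau <= T ==> (!!t x. t < tau ==> c (t, x) = 0 & eta (t, x) = 0) ==>
   jump_solution (jump_kernel s eps) (%_ _ _. 0) tau (%sig. xi (tau - sig))"

text \<open>Reversing time gives a jump equation with absorption \<open>c r - eta\<close> and
  initial value 0, nondecreasing in \<open>r\<close> since \<open>c\<close> is nonnegative. The
  barrier \<open>Me t\<close> bounds its solution without reference to \<open>c\<close>, and so does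
  the mass estimate with the source \<open>eta\<close>; \<open>c\<close> enters only through its
  Lipschitz and second difference bounds.\<close>

lemma test_function_exists:
 fixes eta :: "real \<times> 'a::euclidean_space => real"
 assumes s: "0 < s" "s < 1" and T: "0 < T" and eta: "c11 eta" "!!p. 0 <= eta p" "!!t x. R <= norm x ==> eta (t, x) = 0"
 shows "\<exists>X B. 0 <= X & 0 <= B & (\<forall>c. c11 c --> (\<forall>p. 0 <= c p) --> (\<exists>L D. \<forall>eps>0. \<exists>xi. test_function s T c eta X L D B eps xi))"
proof -
 obtain Me Be De where e: "c11_bound Me Be De eta" using eta unfolding c11_def by blast
 note e0 = c11_bound_nonneg[OF e]
 have eM: "eta p <= Me" for p using c11_boundD(1)[OF e, of p] by simp
 define V where "V = measure lborel (cball (0::'a) R)"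
 define X where "X = Me * T"
 define B where "B = 0 + Me * V * T"
 have X: "0 <= X" using e0 T by (simp add: X_def)
 have B: "0 <= B" using e0 T by (simp add: B_def V_def)
 have em: "(NN x. ennreal \<bar>eta (t, x)\<bar>) <= ennreal (Me * V)" for t
 proof -
  have "(NN x. ennreal \<bar>eta (t, x)\<bar>) <= (NN x. ennreal Me * indicator (cball (0::'a) R) x)"
   by (intro nn_integral_mono) (use eta eM in "auto simp: indicator_def not_le intro!: ennreal_leI")
  also have "... = ennreal Me * emeasure lborel (cball (0::'a) R)" by (simp add: nn_integral_cmult_indicator)
  also have "... = ennreal (Me * V)"
   using e0 emeasure_bounded_finite[OF bounded_cball, of "0::'a" R]
   by (simp add: V_def ennreal_mult emeasure_eq_ennreal_measure)
  finally show ?thesis .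
 qed
 show ?thesis
 proof (rule exI[of _ X], rule exI[of _ B], rule conjI[OF X], rule conjI[OF B], intro allI impI)
  fix c :: "real \<times> 'a => real" assume c: "c11 c" "\<forall>p. 0 <= c p"
  obtain Mc Bc Dc where cb: "c11_bound Mc Bc Dc c" using c unfolding c11_def by blast
  note c0 = c11_bound_nonneg[OF cb]
  have cM: "c p <= Mc" for p using c11_boundD(1)[OF cb, of p] by simp
  define B1 where "B1 = Bc * X + Be"
  define C2 where "C2 = X * Dc + Bc + De"
  have C2: "0 <= C2" using X c0 e0 by (simp add: C2_def)
  define L where "L = 0 + B1 * T"
  define D where "D = 0 + C2 * (1 + (0 + B1 * T))^2 * T"
  let ?b = "%t x r. c (T - t, x) * r - eta (T - t, x)"
  have mono: "?b t x r <= ?b t x r'" if "r <= r'" for t x r r' using that c by (simp add: mult_left_mono)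
  have ab: "absorption_bounds X B1 C2 ?b"
   unfolding absorption_bounds_def
  proof (intro conjI allI impI)
   show "?b t x r <= ?b t x r'" if "r <= r'" for t x r r' by (rule mono[OF that])
   fix t and x h :: 'a and r q :: real assume r: "\<bar>r\<bar> <= X"
   note cs = c11_slice[OF cb, of "T - t"] and es = c11_slice[OF e, of "T - t"]
   let ?c = "%x. c (T - t, x)" and ?e = "%x. eta (T - t, x)"
   have "\<bar>(?c (x + h) - ?c x) * r\<bar> <= Bc * norm h * X"
    unfolding abs_mult using c11_boundD(2)[OF cs, of x h] r c0 X by (intro mult_mono) auto
   then show "\<bar>?b t (x + h) r - ?b t x r\<bar> <= B1 * norm h"
    using c11_boundD(2)[OF es, of x h] by (simp add: B1_def algebra_simps)
   have 1: "\<bar>r * (?c (x + h) + ?c (x - h) - 2 * ?c x)\<bar> <= X * (Dc * (norm h)^2)"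
    unfolding abs_mult using c11_boundD(3)[OF cs, of x h] r c0 X by (intro mult_mono) auto
   have 2: "\<bar>q * (?c (x + h) - ?c (x - h))\<bar> <= \<bar>q\<bar> * (2 * Bc * norm h)"
   proof -
    have "\<bar>?c (x + h) - ?c (x - h)\<bar> <= Bc * norm ((x + h) - (x - h))" by (rule c11_bound_lipschitz[OF cs])
    also have "(x + h) - (x - h) = 2 *\<^sub>R h" by (simp add: scaleR_2)
    finally show ?thesis unfolding abs_mult by (intro mult_left_mono) auto
   qed
   have 3: "\<bar>?e (x + h) + ?e (x - h) - 2 * ?e x\<bar> <= De * (norm h)^2" by (rule c11_boundD(3)[OF es])
   let ?n = "norm h + \<bar>q\<bar>"
   have n: "(norm h)^2 <= ?n^2" "2 * norm h * \<bar>q\<bar> <= ?n^2" by (auto simp: power2_eq_square algebra_simps)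
   have "\<bar>?b t (x + h) (r + q) + ?b t (x - h) (r - q) - 2 * ?b t x r\<bar>
    <= X * (Dc * (norm h)^2) + \<bar>q\<bar> * (2 * Bc * norm h) + De * (norm h)^2"
   proof -
    have "?b t (x + h) (r + q) + ?b t (x - h) (r - q) - 2 * ?b t x r
     = r * (?c (x + h) + ?c (x - h) - 2 * ?c x) + q * (?c (x + h) - ?c (x - h)) - (?e (x + h) + ?e (x - h) - 2 * ?e x)"
     by (simp add: algebra_simps)
    then show ?thesis using 1 2 3 by linarith
   qed
   also have "... = (X * Dc + De) * (norm h)^2 + Bc * (2 * norm h * \<bar>q\<bar>)" by (simp add: algebra_simps)
   also have "... <= (X * Dc + De) * ?n^2 + Bc * ?n^2" using n X c0 e0 by (intro add_mono mult_left_mono) auto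
   also have "... = C2 * ?n^2" by (simp add: C2_def algebra_simps)
   finally show "\<bar>?b t (x + h) (r + q) + ?b t (x - h) (r - q) - 2 * ?b t x r\<bar> <= C2 * ?n^2" .
  qed
  show "\<exists>L D. \<forall>eps>0. \<exists>xi. test_function s T c eta X L D B eps xi"
  proof (rule exI[of _ L], rule exI[of _ D], intro allI impI)
   fix eps :: real assume eps: "0 < eps"
   interpret symmetric_jumps "jump_kernel s eps :: 'a measure" by (rule symmetric_jumps_jump_kernel[OF s eps])
   have cc: "continuous_on UNIV c" and ec: "continuous_on UNIV eta" by (rule c11_continuous[OF c(1)], rule c11_continuous[OF eta(1)])
   interpret E: jump_equation "jump_kernel s eps :: 'a measure" ?b Mc T Me "Me * V" 0 0 "%_. 0"
   proof
    show "continuous_on UNIV (%(t, x, r). ?b t x r)"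
     unfolding case_prod_unfold
     by (intro continuous_intros continuous_on_compose2[OF cc] continuous_on_compose2[OF ec]) auto
    show "?b t x r' - ?b t x r <= Mc * (r' - r)" if "r <= r'" for t x r r'
     using mult_right_mono[OF cM[of "(T - t, x)"], of "r' - r"] that by (simp add: right_diff_distrib)
   qed (use T c0 e0 mono em c11_boundD(1)[OF e] in "auto simp: V_def")
   obtain psi where psi: "jump_solution (jump_kernel s eps) ?b T psi" "!!x. psi 0 x = 0"
    "!!t. 0 <= t ==> t <= T ==> (NN x. ennreal \<bar>psi t x\<bar>) <= ennreal (0 + Me * V * t)"
    using E.solution_exists by blast
   have T0: "0 <= T" using T by simp
   have lo: "0 <= psi t x" if "0 <= t" "t <= T" for t x
   proof (rule comparison_below[OF psi(1) T0 mono, where B = "%_ _. 0" and C = 0])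
    show "\<exists>D. ((%tau. 0) has_real_derivative D) (at t) & D <= jump (jump_kernel s eps) (%_. 0) x - ?b t x 0" for t x
     using eta(2) by (intro exI[of _ 0]) (simp add: jump_def)
   qed (use that psi(2) in auto)
   have up: "psi t x <= Me * t" if "0 <= t" "t <= T" for t x
   proof (rule comparison_above[OF psi(1) T0 mono, where B = "%t _. Me * t" and C = X])
    show "\<bar>Me * t\<bar> <= X" if "0 <= t" "t <= T" for t :: real
     using that e0 by (auto simp: X_def abs_mult intro!: mult_left_mono)
    show "\<exists>D. ((%tau. Me * tau) has_real_derivative D) (at t) & jump (jump_kernel s eps) (%_. Me * t) x - ?b t x (Me * t) <= D"
     if "0 < t" for t x
    proof (intro exI[of _ Me] conjI)
     show "((%tau. Me * tau) has_real_derivative Me) (at t)" by (auto intro!: derivative_eq_intros)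
     have "0 <= c (T - t, x) * (Me * t)" using c e0 that by (intro mult_nonneg_nonneg) auto
     then show "jump (jump_kernel s eps) (%_. Me * t) x - ?b t x (Me * t) <= Me"
      using eM[of "(T - t, x)"] by (simp add: jump_def)
    qed
   qed (use that psi(2) in "auto intro!: continuous_intros")
   have upX: "psi t x <= X" if "0 <= t" "t <= T" for t x
    using up[OF that, of x] mult_left_mono[OF that(2) e0(1)] by (simp add: X_def)
   have bd: "\<bar>psi t x\<bar> <= X" if "0 <= t" "t <= T" for t x using lo[OF that, of x] upX[OF that, of x] by simp
   have i0: "c11_bound X 0 0 (psi 0)" using psi(2) X by (simp add: c11_bound_def)
   show "\<exists>xi. test_function s T c eta X L D B eps xi"
   proof (intro exI[of _ "%t. psi (T - t)"], unfold_locales)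
    have pc: "continuous_on UNIV (%p. psi (fst p) (snd p))" using jump_solution_continuous(1)[OF psi(1), of UNIV] by (simp add: case_prod_unfold)
    have "continuous_on UNIV (%p. psi (fst (T - fst p, snd p)) (snd (T - fst p, snd p)))"
     by (rule continuous_on_compose2[OF pc]) (auto intro!: continuous_intros)
    then show "continuous_on UNIV (%(t, x). psi (T - t) x)" by (simp add: case_prod_unfold)
    show "c11_bound X L D (psi (T - t))" if "0 <= t" "t <= T" for t
     unfolding L_def D_def by (rule jump_solution_c11[OF psi(1) T0 ab bd i0 C2]) (use that in auto)
    show "(NN x. ennreal \<bar>psi (T - t) x\<bar>) <= ennreal B" if "0 <= t" "t <= T" for t
    proof -
     have "(NN x. ennreal \<bar>psi (T - t) x\<bar>) <= ennreal (0 + Me * V * (T - t))" by (rule psi(3)) (use that in auto)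
     also have "... <= ennreal B" unfolding B_def using that e0 by (intro ennreal_leI add_left_mono mult_left_mono) (auto simp: V_def)
     finally show ?thesis .
    qed
    show "((%tau. psi (T - tau) x) has_real_derivative - jump (jump_kernel s eps) (psi (T - t)) x + c (t, x) * psi (T - t) x - eta (t, x)) (at t)"
     if "0 < t" "t < T" for t x
    proof -
     have "((%tau. psi tau x) has_real_derivative jump (jump_kernel s eps) (psi (T - t)) x - ?b (T - t) x (psi (T - t) x)) (at (T - t))"
      using jump_solution_deriv[OF psi(1), of "T - t" x] that by simp
     moreover have "((%tau. T - tau) has_real_derivative - 1) (at t)" by (auto intro!: derivative_eq_intros)
     ultimately have "((%tau. psi (T - tau) x) has_real_derivative (jump (jump_kernel s eps) (psi (T - t)) x - ?b (T - t) x (psi (T - t) x)) * - 1) (at t)"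
      by (rule DERIV_chain2)
     then show ?thesis by (simp add: algebra_simps)
    qed
    show "jump_solution (jump_kernel s eps) (%_ _ _. 0) tau (%sig. psi (T - (tau - sig)))"
     if "0 < tau" "tau <= T" "!!t x. t < tau ==> c (t, x) = 0 & eta (t, x) = 0" for tau
    proof -
     have sh: "jump_solution (jump_kernel s eps) (%t. ?b (T - tau + t)) tau (%t. psi (T - tau + t))"
      by (rule jump_solution_shift[OF psi(1)]) (use that in auto)
     \<comment> \<open>In reversed time the last stretch of length \<open>tau\<close> belongs to
       times below \<open>tau\<close>, where \<open>c\<close> and \<open>eta\<close> vanish by
       assumption.\<close>
     have "T - (T - tau + t) < tau" if "0 < t" for t using that by simp
     then have z: "?b (T - tau + t) x r = 0" if "0 < t" for t x r using that(1) \<open>!!t x. t < tau ==> c (t, x) = 0 & eta (t, x) = 0\<close> by simp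
     have eq: "(%sig. psi (T - (tau - sig))) = (%t. psi (T - tau + t))" by (simp add: algebra_simps)
     show ?thesis unfolding eq using sh z unfolding jump_solution_def by auto
    qed
    show "\<exists>C. \<forall>p. \<bar>c p\<bar> <= C" using c11_boundD(1)[OF cb] by blast
    show "\<exists>C. \<forall>p. \<bar>eta p\<bar> <= C" using c11_boundD(1)[OF e] by blast
    show "\<exists>C. \<forall>t x. \<bar>psi (T - t) x\<bar> <= C" using psi(1) unfolding jump_solution_def by blast
    show "0 <= psi (T - t) x" if "0 <= t" "t <= T" for t x by (rule lo) (use that in auto)
    show "psi (T - T) x = 0" for x using psi(2) by simp
   qed (fact s T eps B cc ec)+
  qed
 qed
qed

context test_function
begin

lemma sj: "symmetric_jumps (jump_kernel s eps :: 'a measure)"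
 by (rule symmetric_jumps_jump_kernel[OF s eps])

lemma abs_le: "0 <= t ==> t <= T ==> \<bar>xi t x\<bar> <= X"
 using reg c11_boundD(1) by blast

lemma xi_borel [measurable]: "(%p. xi (fst p) (snd p)) : borel_funs"
 using borel_measurable_continuous_onI[OF cont] by (simp add: case_prod_unfold)

lemma c_borel [measurable]: "c : borel_funs" and eta_borel [measurable]: "eta : borel_funs"
 using c_cont eta_cont by (auto intro: borel_measurable_continuous_onI)

lemma xi_slice_borel [measurable]: "xi t : borel_funs"
proof -
 have "continuous_on UNIV (%p. xi (fst p) (snd p))" using cont by (simp add: case_prod_unfold)
 then have "continuous_on UNIV (%x. xi (fst (t, x)) (snd (t, x)))"
  by (rule continuous_on_compose2) (auto intro!: continuous_intros)
 then show ?thesis by (auto intro!: borel_measurable_continuous_onI)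
qed

lemma jump_xi_borel [measurable]: "(%p. jump (jump_kernel s eps) (xi (fst p)) (snd p)) : borel_funs"
proof -
 obtain C where "!!t x. \<bar>xi t x\<bar> <= C" using bdd by blast
 from borel_measurable_continuous_onI[OF symmetric_jumps.jump_continuous[OF sj cont this]]
 show ?thesis by (simp add: case_prod_unfold)
qed

lemma xi_integrable: "Leb1 (%(t, x). indicator {0<..<T} t * xi t x)"
 by (rule integrable_space_time[where C = B]) (use mass in "auto simp: case_prod_unfold")

lemma derivative_bounded: "\<exists>C. \<forall>t x. 0 < t --> t < T --> \<bar>- jump (jump_kernel s eps) (xi t) x + c (t, x) * xi t x - eta (t, x)\<bar> <= C"
proof -
 obtain Cc Ce where C: "!!p. \<bar>c p\<bar> <= Cc" "!!p. \<bar>eta p\<bar> <= Ce" using c_bdd eta_bdd by blast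
 show ?thesis
 proof (intro exI allI impI)
  fix t x assume t: "0 < t" "t < T"
  have "\<bar>jump (jump_kernel s eps) (xi t) x\<bar> <= 2 * X * measure (jump_kernel s eps :: 'a measure) UNIV"
   by (rule symmetric_jumps.jump_bound[OF sj]) (use abs_le t in auto)
  moreover have "\<bar>c (t, x) * xi t x\<bar> <= Cc * X"
   unfolding abs_mult using C(1)[of "(t, x)"] abs_le[of t x] t by (intro mult_mono) auto
  ultimately show "\<bar>- jump (jump_kernel s eps) (xi t) x + c (t, x) * xi t x - eta (t, x)\<bar>
   <= 2 * X * measure (jump_kernel s eps :: 'a measure) UNIV + Cc * X + Ce" using C(2)[of "(t, x)"] by linarith
 qed
qed

lemma in_test_space: "xi : test_space s T"
proof -
 have AEc: "ess_bounded_on (cylinder T) (%(t, x). h t x)" if "!!t x. 0 < t ==> t < T ==> \<bar>h t x\<bar> <= C" for h :: "real => 'a => real" and C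
  unfolding ess_bounded_on_def by (rule exI[of _ C], rule AE_I2) (use that in "auto simp: cylinder_def space_restrict_space")
 obtain C' where C': "!!t x. 0 < t ==> t < T ==> \<bar>- jump (jump_kernel s eps) (xi t) x + c (t, x) * xi t x - eta (t, x)\<bar> <= C'"
  using derivative_bounded by blast
 have lap: "\<bar>frac_lap s (xi t) x\<bar> <= D * m2 TYPE('a) s eps + 2 * X * measure (jump_kernel s eps :: 'a measure) UNIV" if "0 < t" "t < T" for t x
 proof -
  have t: "0 <= t" "t <= T" using that by auto
  have "\<bar>jump (jump_kernel s eps) (xi t) x\<bar> <= 2 * X * measure (jump_kernel s eps :: 'a measure) UNIV"
   by (rule symmetric_jumps.jump_bound[OF sj]) (use abs_le t in auto)
  then show ?thesis using jump_kernel_error[OF s reg[OF t] eps, of x] c11_has_frac_lap(2)[OF s reg[OF t], of x] by linarith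
 qed
 have trunc: "\<exists>M>0. \<exists>eps\<^sub>0>0. \<forall>eps\<in>{0<..eps\<^sub>0}. AE x in lebesgue. \<bar>frac_lap_trunc s eps (xi t) x\<bar> <= M" if "0 < t" "t < T" for t
 proof -
  let ?M = "\<bar>D * m2 TYPE('a) s 1 + 2 * X * measure (jump_kernel s 1 :: 'a measure) UNIV\<bar> + 1"
  have t: "0 <= t" "t <= T" using that by auto
  have "\<bar>frac_lap_trunc s eps (xi t) x\<bar> <= ?M" if "0 < eps" for eps x
   using jump_kernel_bound[OF s reg[OF t] that zero_less_one, of x] frac_lap_trunc_eq_jump[OF s xi_slice_borel, of eps t x] by simp
  then show ?thesis by (intro exI[of _ ?M] conjI exI[of _ 1]) auto
 qed
 have int: "set_integrable lebesgue (cylinder T) (%(t, x). xi t x)"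
 proof -
  have "integrable lebesgue (%(t, x). indicator {0<..<T} t * xi t x)"
   using xi_integrable by (subst integrable_completion) (auto intro: borel_measurable_integrable)
  then show ?thesis unfolding set_integrable_def
   by (rule Bochner_Integration.integrable_cong[THEN iffD1, rotated 2]) (auto simp: cylinder_def indicator_def)
 qed
 show ?thesis
  unfolding test_space_def mem_Collect_eq
 proof (intro conjI ballI allI)
  show "continuous_on ({0..T} \<times> UNIV) (%(t, x). xi t x)" using cont by (rule continuous_on_subset) simp
  show "set_integrable lebesgue (cylinder T) (%(t, x). xi t x)" by (rule int)
  show "ess_bounded_on (cylinder T) (%(t, x). xi t x)" by (rule AEc[of _ X]) (use abs_le in auto)
  show "ess_bounded_on (cylinder T) (%(t, x). deriv (%tau. xi tau x) t)" by (rule AEc[of _ C']) (use C' DERIV_imp_deriv[OF deriv] in auto)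
  show "ess_bounded_on (cylinder T) (%(t, x). frac_lap s (xi t) x)" by (rule AEc[OF lap])
  show "xi T x = 0" for x by (rule final)
  fix t assume "t : {0<..<T}"
  then have t: "0 < t" "t < T" by auto
  show "(%tau. xi tau x) differentiable at t" for x using deriv[OF t] unfolding real_differentiable_def by blast
  show "\<exists>L. has_frac_lap s (xi t) x L" for x using c11_has_frac_lap(1)[OF s reg[of t], of x] t by auto
  show "\<exists>M>0. \<exists>eps\<^sub>0>0. \<forall>eps\<in>{0<..eps\<^sub>0}. AE x in lebesgue. \<bar>frac_lap_trunc s eps (xi t) x\<bar> <= M" by (rule trunc[OF t])
 qed
qed

end

section \<open>Density of functions with bounded second differences\<close>

lemma open_c11_approximation:
 fixes U :: "'b::euclidean_space set"
 assumes U: "open U"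
 obtains phi where "!!j. c11 (phi j)" "!!j x. 0 <= phi j x" "!!j x. phi j x <= 1" "!!j x. x \<notin> U ==> phi j x = 0"
  "!!x. (%j::nat. phi j x) \<longlonglongrightarrow> indicator U x"
proof -
 let ?F = "{ball p r |p r. 0 < r & ball p r \<subseteq> U}"
 obtain F' where F': "F' \<subseteq> ?F" "countable F'" "\<Union>F' = \<Union>?F" using Lindelof[of ?F] by auto
 have FU: "\<Union>?F = U"
 proof
  show "U \<subseteq> \<Union>?F"
  proof
   fix x assume "x : U"
   then obtain r where "0 < r" "ball x r \<subseteq> U" using openE[OF U] by blast
   then show "x : \<Union>?F" by (intro UnionI[of "ball x r"]) auto
  qed
 qed blast
 have "\<forall>B\<in>F'. \<exists>pr. 0 < snd pr & ball (fst pr) (snd pr) \<subseteq> U & ball (fst pr) (snd pr) = B"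
 proof
  fix B assume "B : F'"
  then obtain p r where "B = ball p r" "0 < r" "ball p r \<subseteq> U" using F'(1) by blast
  then show "\<exists>pr. 0 < snd pr & ball (fst pr) (snd pr) \<subseteq> U & ball (fst pr) (snd pr) = B" by (intro exI[of _ "(p, r)"]) simp
 qed
 then obtain h where h: "!!B. B : F' ==> 0 < snd (h B) & ball (fst (h B)) (snd (h B)) \<subseteq> U & ball (fst (h B)) (snd (h B)) = B"
  by metis
 show ?thesis
 proof (cases "F' = {}")
  case True
  then have "U = {}" using F' FU by simp
  then show ?thesis using that[of "%_ _. 0"] c11_const[of 0] by auto
 next
  case False
  define B where "B = from_nat_into F'"
  have BF: "B i : F'" for i using False by (simp add: B_def from_nat_into)
  define p where "p i = fst (h (B i))" for i
  define r where "r i = snd (h (B i))" for i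
  have pr: "0 < r i" "ball (p i) (r i) \<subseteq> U" for i using h[OF BF] by (auto simp: p_def r_def)
  have cover: "\<exists>i. x : ball (p i) (r i)" if xU: "x : U" for x
  proof -
   obtain A where A: "A : F'" "x : A" using xU unfolding trans[OF F'(3) FU, symmetric] by blast
   then obtain i where "B i = A" using from_nat_into_surj[OF F'(2)] unfolding B_def by blast
   then have "ball (p i) (r i) = A" using h[OF BF[of i]] by (simp add: p_def r_def)
   then show ?thesis using A(2) by blast
  qed
  \<comment> \<open>Each point of \<open>U\<close> lies in one of the countably many balls, so
    \<open>j S j\<close> eventually exceeds 1 there and the step saturates; outside \<open>U\<close>
    all bumps vanish.\<close>
  define S where "S j x = (\<Sum>i<j. bump_at (p i) (r i) x)" for j x
  define phi where "phi j x = smooth_step (real j * S j x)" for j x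
  show ?thesis
  proof (rule that[of phi])
   fix j x
   have "c11 (%x. real j * S j x)" unfolding S_def using pr by (intro c11_cmult c11_sum c11_bump_at) auto
   from c11_compose[OF this _ smooth_step_lipschitz smooth_step_second, of 1]
   show "c11 (phi j)" unfolding phi_def[abs_def] using smooth_step_bounds by auto
   show "0 <= phi j x" "phi j x <= 1" using smooth_step_bounds by (auto simp: phi_def)
   have out: "phi j x = 0" if "x \<notin> U" for j x
   proof -
    have "bump_at (p i) (r i) x = 0" for i
     using that pr(2)[of i] bump_at_eq_0_iff[OF pr(1)[of i], of "p i" x] by (force simp: dist_norm norm_minus_commute)
    then show ?thesis by (simp add: phi_def S_def smooth_step_eq)
   qed
   show "phi j x = 0" if "x \<notin> U" by (rule out[OF that])
   show "(%j. phi j x) \<longlonglongrightarrow> indicator U x"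
   proof (cases "x : U")
    case True
    then obtain i where i: "x : ball (p i) (r i)" using cover by blast
    then have b: "0 < bump_at (p i) (r i) x"
     using bump_at_bounds(1)[of "p i" "r i" x] bump_at_eq_0_iff[OF pr(1)[of i], of "p i" x]
     by (auto simp: dist_norm norm_minus_commute less_le)
    obtain n where n: "1 / bump_at (p i) (r i) x < real n" using reals_Archimedean2 by blast
    have "phi j x = 1" if j: "max (Suc i) n <= j" for j
    proof -
     have "bump_at (p i) (r i) x <= S j x"
      unfolding S_def by (rule member_le_sum) (use j bump_at_bounds in auto)
     moreover have "1 <= real n * bump_at (p i) (r i) x" using n b by (simp add: field_simps)
     moreover have "real n * bump_at (p i) (r i) x <= real j * S j x"
      using j b calculation(1) by (intro mult_mono) auto
     ultimately show ?thesis unfolding phi_def by (intro smooth_step_eq) linarith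
    qed
    then have "eventually (%j. phi j x = 1) sequentially" unfolding eventually_sequentially by blast
    then show ?thesis using True by (simp add: tendsto_eventually)
   qed (simp add: out)
  qed
 qed
qed

text \<open>Outer regularity reduces indicators to open sets, which
  \<open>open_c11_approximation\<close> handles; measurable induction does the rest. The cut-off by
  \<open>V\<close> is built in because approximants must vanish outside \<open>V\<close> and be
  nonnegative to be admissible as coefficients and as test data.\<close>

lemma c11_dense:
 fixes m :: "'b::euclidean_space measure"
 assumes fin: "finite_measure m" and sets[measurable_cong]: "sets m = sets borel" and V: "open V"
  and f: "f : borel_funs" "!!x. 0 <= f x" "integrable m f" and d: "0 < \<delta>"
 shows "\<exists>phi. c11 phi & (\<forall>x. 0 <= phi x) & (\<forall>x. x \<notin> V --> phi x = 0) & (\<integral>x. \<bar>indicator V x * f x - phi x\<bar> \<partial>m) <= \<delta>"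
proof -
 interpret finite_measure m by (rule fin)
 have [measurable]: "V : sets borel" using V by simp
 define nice where "nice phi \<longleftrightarrow> c11 phi & (\<forall>x. 0 <= phi x) & (\<forall>x. x \<notin> V --> phi x = 0)" for phi :: "'b => real"
 have nice_int: "integrable m phi" if n: "nice phi" for phi
 proof -
  obtain M B D where "c11_bound M B D phi" using n unfolding nice_def c11_def by blast
  then have b: "\<bar>phi x\<bar> <= M" for x using c11_boundD(1) by blast
  have "phi : borel_measurable m" using c11_borel[of phi] n sets unfolding nice_def by (simp cong: measurable_cong_sets)
  then show ?thesis by (rule integrable_const_bound[of _ M, rotated]) (use b in auto)
 qed
 let ?I = "%f phi. \<integral>x. \<bar>indicator V x * f x - phi x\<bar> \<partial>m"
 have ind_int: "integrable m (%x. indicator V x * f x)" if i: "integrable m f" for f :: "'b => real"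
 proof (rule Bochner_Integration.integrable_bound[OF i])
  have [measurable]: "f : borel_measurable m" using i by (rule borel_measurable_integrable)
  show "(%x. indicator V x * f x) : borel_measurable m" by measurable
 qed (auto simp: indicator_def)
 have tri: "?I f phi <= ?I h phi + (\<integral>x. \<bar>f x - h x\<bar> \<partial>m)" if "integrable m f" "integrable m h" "nice phi" for f h phi
 proof -
  note i = ind_int[OF that(1)] ind_int[OF that(2)] nice_int[OF that(3)] that(1,2)
  have "?I f phi <= (\<integral>x. \<bar>indicator V x * h x - phi x\<bar> + \<bar>f x - h x\<bar> \<partial>m)"
   by (rule Bochner_Integration.integral_mono)
    (use i in "auto simp: indicator_def intro!: Bochner_Integration.integrable_add integrable_abs Bochner_Integration.integrable_diff")
  also have "... = ?I h phi + (\<integral>x. \<bar>f x - h x\<bar> \<partial>m)"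
   using i by (intro Bochner_Integration.integral_add integrable_abs Bochner_Integration.integrable_diff)
  finally show ?thesis .
 qed
 define P where "P f \<longleftrightarrow> (integrable m f --> (\<forall>\<delta>>0. \<exists>phi. nice phi & ?I f phi <= \<delta>))" for f :: "'b => real"
 have "P f"
  using f(1,2)
 proof (induction rule: borel_measurable_induct_real)
  case (set A)
  show ?case unfolding P_def
  proof (intro impI allI)
   fix \<delta> :: real assume d: "0 < \<delta>"
   have em: "emeasure m A = (INF U\<in>{U. A \<subseteq> U & open U}. emeasure m U)"
    by (rule outer_regular) (use sets set emeasure_finite in auto)
   have "emeasure m A < emeasure m A + ennreal (\<delta> / 2)" using d emeasure_finite[of A] by (simp add: ennreal_add_left_cancel_less)
   then obtain U where U: "A \<subseteq> U" "open U" "emeasure m U < emeasure m A + ennreal (\<delta> / 2)"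
    unfolding em INF_less_iff by blast
   have mU: "measure m U <= measure m A + \<delta> / 2"
   proof -
    have "ennreal (measure m U) < ennreal (measure m A + \<delta> / 2)" using U(3) d by (simp add: emeasure_eq_measure ennreal_plus)
    then have "measure m U < measure m A + \<delta> / 2" using d by (subst (asm) ennreal_less_iff) auto
    then show ?thesis by simp
   qed
   have As[measurable]: "A : sets m" "U : sets m" "V : sets m" using set U sets V by auto
   \<comment> \<open>Cutting the outer open set with \<open>V\<close> costs nothing in the estimate,
     since the target is multiplied by the indicator of \<open>V\<close>.\<close>
   define W where "W = U \<inter> V"
   have W: "open W" using U V by (auto simp: W_def)
   then have [measurable]: "W : sets m" using sets by simp
   obtain phi where phi: "!!j. c11 (phi j)" "!!j x. 0 <= phi j x" "!!j x. phi j x <= 1" "!!j x. x \<notin> W ==> phi j x = 0"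
    "!!x. (%j::nat. phi j x) \<longlonglongrightarrow> indicator W x" using open_c11_approximation[OF W] by blast
   have nice: "nice (phi j)" for j using phi by (auto simp: nice_def W_def)
   have [measurable]: "phi j : borel_measurable m" for j using nice_int[OF nice] by (rule borel_measurable_integrable)
   have "(%j. \<integral>x. \<bar>indicator W x - phi j x\<bar> \<partial>m) \<longlonglongrightarrow> (\<integral>x. 0 \<partial>m)"
   proof (rule integral_dominated_convergence[where w = "%_. 2"])
    show "AE x in m. (%j. \<bar>indicator W x - phi j x\<bar>) \<longlonglongrightarrow> 0"
    proof (rule AE_I2)
     fix x
     have "(%j. \<bar>indicator W x - phi j x\<bar>) \<longlonglongrightarrow> \<bar>indicator W x - indicator W x\<bar>" by (intro tendsto_intros phi)
     then show "(%j. \<bar>indicator W x - phi j x\<bar>) \<longlonglongrightarrow> 0" by simp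
    qed
    show "AE x in m. norm \<bar>indicator W x - phi j x\<bar> <= 2" for j
    proof (rule AE_I2)
     fix x
     have "0 <= phi j x" "phi j x <= 1" by (rule phi)+
     then show "norm \<bar>indicator W x - phi j x\<bar> <= 2" by (simp add: indicator_def)
    qed
   qed auto
   then have "eventually (%j. (\<integral>x. \<bar>indicator W x - phi j x\<bar> \<partial>m) < \<delta> / 2) sequentially"
    using d by (intro order_tendstoD) auto
   then obtain j where j: "(\<integral>x. \<bar>indicator W x - phi j x\<bar> \<partial>m) < \<delta> / 2" by (auto simp: eventually_sequentially)
   have i: "integrable m (indicator U :: 'b => real)" "integrable m (indicator A :: 'b => real)" "integrable m (indicator W :: 'b => real)"
    by (auto simp: integrable_indicator_iff emeasure_finite less_top[symmetric])
   have eqW: "(%x. indicator V x * indicator U x) = (indicator W :: 'b => real)" by (auto simp: W_def indicator_def fun_eq_iff)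
   have "?I (indicator A) (phi j) <= ?I (indicator U) (phi j) + (\<integral>x. \<bar>indicator A x - indicator U x\<bar> \<partial>m)"
    by (rule tri[OF i(2,1) nice])
   also have "?I (indicator U) (phi j) = (\<integral>x. \<bar>indicator W x - phi j x\<bar> \<partial>m)" using eqW by (simp add: fun_eq_iff)
   also have "(\<integral>x. \<bar>indicator A x - indicator U x :: real\<bar> \<partial>m) = (\<integral>x. indicator U x - indicator A x \<partial>m)"
    using U(1) by (intro Bochner_Integration.integral_cong) (auto simp: indicator_def)
   also have "... = measure m U - measure m A" using i by (subst Bochner_Integration.integral_diff) auto
   finally have "?I (indicator A) (phi j) <= \<delta>" using j mU by linarith
   then show "\<exists>phi. nice phi & ?I (indicator A) phi <= \<delta>" using nice by blast
  qed
 next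
  case (mult u c)
  show ?case unfolding P_def
  proof (intro impI allI)
   fix \<delta> :: real assume i: "integrable m (%x. c * u x)" and d: "0 < \<delta>"
   show "\<exists>phi. nice phi & ?I (%x. c * u x) phi <= \<delta>"
   proof (cases "c = 0")
    case True
    then show ?thesis using d c11_const[of 0] by (intro exI[of _ "%_. 0"]) (simp add: nice_def)
   next
    case False
    then have c: "0 < c" using mult by simp
    have "integrable m u" using i False by simp
    then obtain phi where phi: "nice phi" "?I u phi <= \<delta> / c" using mult.IH d c unfolding P_def by (meson divide_pos_pos)
    have "\<bar>indicator V x * (c * u x) - c * phi x\<bar> = c * \<bar>indicator V x * u x - phi x\<bar>" for x
     using c abs_mult[of c "indicator V x * u x - phi x"] by (simp add: algebra_simps)
    then have "?I (%x. c * u x) (%x. c * phi x) = c * ?I u phi" by simp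
    also have "... <= c * (\<delta> / c)" using phi c by (intro mult_left_mono) auto
    also have "... = \<delta>" using c by simp
    finally have "?I (%x. c * u x) (%x. c * phi x) <= \<delta>" .
    moreover have "nice (%x. c * phi x)" using phi c by (simp add: nice_def c11_cmult)
    ultimately show ?thesis by blast
   qed
  qed
 next
  case (add u v)
  show ?case unfolding P_def
  proof (intro impI allI)
   fix \<delta> :: real assume i: "integrable m (%x. v x + u x)" and d: "0 < \<delta>"
   have um: "u : borel_measurable m" "v : borel_measurable m" using add sets by (simp_all cong: measurable_cong_sets)
   have iu: "integrable m u" using add by (intro Bochner_Integration.integrable_bound[OF i um(1)]) auto
   have iv: "integrable m v" using add by (intro Bochner_Integration.integrable_bound[OF i um(2)]) auto
   have d2: "0 < \<delta> / 2" using d by simp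
   obtain phi where phi: "nice phi" "?I u phi <= \<delta> / 2" using add.IH(1) iu d2 unfolding P_def by blast
   obtain psi where psi: "nice psi" "?I v psi <= \<delta> / 2" using add.IH(2) iv d2 unfolding P_def by blast
   note ii = ind_int[OF iu] ind_int[OF iv] nice_int[OF phi(1)] nice_int[OF psi(1)]
   have "?I (%x. v x + u x) (%x. psi x + phi x) <= (\<integral>x. \<bar>indicator V x * u x - phi x\<bar> + \<bar>indicator V x * v x - psi x\<bar> \<partial>m)"
   proof (rule Bochner_Integration.integral_mono)
    show "integrable m (%x. \<bar>indicator V x * (v x + u x) - (psi x + phi x)\<bar>)"
     using ii ind_int[OF i] by (intro integrable_abs Bochner_Integration.integrable_diff Bochner_Integration.integrable_add)
    show "integrable m (%x. \<bar>indicator V x * u x - phi x\<bar> + \<bar>indicator V x * v x - psi x\<bar>)"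
     using ii by (intro integrable_abs Bochner_Integration.integrable_diff Bochner_Integration.integrable_add)
    show "\<bar>indicator V x * (v x + u x) - (psi x + phi x)\<bar> <= \<bar>indicator V x * u x - phi x\<bar> + \<bar>indicator V x * v x - psi x\<bar>" for x
     by (simp add: distrib_left)
   qed
   also have "... = ?I u phi + ?I v psi"
    using ii by (intro Bochner_Integration.integral_add integrable_abs Bochner_Integration.integrable_diff)
   finally have "?I (%x. v x + u x) (%x. psi x + phi x) <= \<delta>" using phi psi by linarith
   moreover have "nice (%x. psi x + phi x)" using phi psi by (simp add: nice_def c11_add)
   ultimately show "\<exists>phi. nice phi & ?I (%x. v x + u x) phi <= \<delta>" by blast
  qed
 next
  case (seq F)
  show ?case unfolding P_def
  proof (intro impI allI)
   fix \<delta> :: real assume i: "integrable m f" and d: "0 < \<delta>"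
   have lim: "(%i. F i x) \<longlonglongrightarrow> f x" for x using seq.hyps(4)[of x] by simp
   have le: "F i x <= f x" for i x
    by (rule incseq_le[OF _ lim[of x]]) (use seq.hyps(3) in "simp add: incseq_def le_fun_def")
   have Fm: "F i : borel_measurable m" for i using seq.hyps(1)[of i] sets by (simp cong: measurable_cong_sets)
   have Fi: "integrable m (F i)" for i
    by (rule Bochner_Integration.integrable_bound[OF i Fm]) (use le seq.hyps(2) order_trans[OF seq.hyps(2) le] in auto)
   have fm: "f : borel_measurable m" using i by (rule borel_measurable_integrable)
   have "(%i. \<integral>x. \<bar>f x - F i x\<bar> \<partial>m) \<longlonglongrightarrow> (\<integral>x. 0 \<partial>m)"
   proof (rule integral_dominated_convergence[where w = f])
    show "AE x in m. (%i. \<bar>f x - F i x\<bar>) \<longlonglongrightarrow> 0"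
    proof (rule AE_I2)
     fix x
     have "(%i. \<bar>f x - F i x\<bar>) \<longlonglongrightarrow> \<bar>f x - f x\<bar>" by (intro tendsto_intros lim)
     then show "(%i. \<bar>f x - F i x\<bar>) \<longlonglongrightarrow> 0" by simp
    qed
    show "AE x in m. norm \<bar>f x - F i x\<bar> <= f x" for i using le seq.hyps(2) by (intro AE_I2) auto
   qed (use i Fm fm in auto)
   then have "eventually (%i. (\<integral>x. \<bar>f x - F i x\<bar> \<partial>m) < \<delta> / 2) sequentially"
    using d by (intro order_tendstoD) auto
   then obtain i where j: "(\<integral>x. \<bar>f x - F i x\<bar> \<partial>m) < \<delta> / 2" by (auto simp: eventually_sequentially)
   have d2: "0 < \<delta> / 2" using d by simp
   obtain phi where phi: "nice phi" "?I (F i) phi <= \<delta> / 2" using seq.IH[of i] Fi d2 unfolding P_def by blast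
   have "?I f phi <= ?I (F i) phi + (\<integral>x. \<bar>f x - F i x\<bar> \<partial>m)" by (rule tri[OF \<open>integrable m f\<close> Fi phi(1)])
   then have "?I f phi <= \<delta>" using phi j by linarith
   then show "\<exists>phi. nice phi & ?I f phi <= \<delta>" using phi by blast
  qed
 qed
 then show ?thesis using f(3) d unfolding P_def nice_def by blast
qed

subsection \<open>Comparison with weak solutions\<close>

lemma integrable_bounded_mult:
 fixes f g :: "'b => real"
 assumes f: "integrable M f" and [measurable]: "g : borel_measurable M" and b: "!!p. f p \<noteq> 0 ==> \<bar>g p\<bar> <= C"
 shows "integrable M (%p. f p * g p)"
proof (rule Bochner_Integration.integrable_bound[OF integrable_mult_right[OF f, of C]])
 have [measurable]: "f : borel_measurable M" using f by (rule borel_measurable_integrable)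
 show "(%p. f p * g p) : borel_measurable M" by measurable
 show "AE p in M. norm (f p * g p) <= norm (C * f p)"
 proof (rule AE_I2)
  fix p
  show "norm (f p * g p) <= norm (C * f p)"
  proof (cases "f p = 0")
   case False
   then have "\<bar>g p\<bar> <= \<bar>C\<bar>" using b[of p] by linarith
   from mult_right_mono[OF this, of "\<bar>f p\<bar>"] show ?thesis by (simp add: abs_mult mult.commute)
  qed simp
 qed
qed

lemma cylinder_borel [measurable]: "cylinder T : sets borel"
 unfolding cylinder_def by (intro borel_open open_Times) auto

lemma cylinder_iff: "p : cylinder T \<longleftrightarrow> 0 < fst p & fst p < T"
 by (auto simp: cylinder_def mem_Times_iff)

text \<open>Kato's inequality without convexity: with \<open>c = q/Y\<close> where \<open>q Y > 0\<close> and \<open>c = 0\<close> elsewhere, \<open>c Y - q \<le> 0\<close>,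
  so that testing the equation \<open>\<partial>\<^sub>t Y + (-\<Delta>)\<^sup>s Y + q = 0\<close> with the dual solution \<open>\<xi>\<close> bounds \<open>\<integral>\<integral> Y \<eta>\<close> from above.
  As \<open>c\<close> is only integrable against \<open>|Y|\<close>, it is replaced by a smooth function, on \<open>t > \<tau>\<close> only.\<close>

lemma duality_bound:
 fixes Y q eta :: "real \<times> 'a::euclidean_space => real"
 assumes T: "0 < T" and X: "0 <= X" and [measurable]: "Y : borel_funs" "q : borel_funs"
  and Yi: "Leb1 (%p. indicator (cylinder T) p * Y p)" and qi: "Leb1 (%p. indicator (cylinder T) p * q p)"
  and sgn: "!!p. p : cylinder T ==> q p < 0 ==> Y p < 0"
  and ex: "!!c. c11 c ==> (!!p. 0 <= c p) ==> \<exists>L D. \<forall>eps>0. \<exists>xi. test_function s T c eta X L D B eps xi"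
  and key: "!!c L D. c11 c ==> (!!p. 0 <= c p) ==> (!!t x. t <= tau ==> c (t, x) = 0) ==>
   \<exists>eps1>0. \<forall>eps xi. 0 < eps --> eps <= eps1 --> test_function s T c eta X L D B eps xi -->
    (LBINT p. indicator (cylinder T) p * (Y p * (eta p - c p * xi (fst p) (snd p)) + q p * xi (fst p) (snd p))) <= a"
 shows "(LBINT p. indicator (cylinder T) p * (Y p * eta p))
  <= a + X * (LBINT p. indicator (cylinder T) p * (indicator {..tau} (fst p) * max 0 (- q p)))"
proof (rule field_le_epsilon)
 fix \<delta> :: real assume d: "0 < \<delta>"
 let ?i = "%p. indicator (cylinder T) p :: real"
 define \<delta>' where "\<delta>' = \<delta> / (X + 1)"
 have d': "0 < \<delta>'" "X * \<delta>' <= \<delta>" using d X by (auto simp: \<delta>'_def field_simps)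
 define m where "m = density lborel (%p. ennreal \<bar>?i p * Y p\<bar>)"
 have im: "(%p. ennreal \<bar>?i p * Y p\<bar>) : borel_measurable lborel" by measurable
 have fin: "finite_measure m"
 proof
  have "emeasure m (space m) = (NN p. ennreal \<bar>?i p * Y p\<bar>)"
   unfolding m_def by (subst emeasure_density[OF im]) auto
  also have "... < \<infinity>" using Yi unfolding integrable_iff_bounded by simp
  finally show "emeasure m (space m) \<noteq> \<infinity>" by simp
 qed
 have ms: "sets m = sets borel" by (simp add: m_def)
 define c0 where "c0 p = (if 0 < q p * Y p then q p / Y p else 0)" for p
 have [measurable]: "c0 : borel_funs" unfolding c0_def[abs_def] by measurable
 have c0: "0 <= c0 p" for p by (auto simp: c0_def zero_less_mult_iff intro: divide_nonneg_nonneg divide_nonpos_nonpos)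
 have c0Y: "\<bar>Y p\<bar> * c0 p <= \<bar>q p\<bar>" for p
  by (auto simp: c0_def zero_less_mult_iff abs_of_pos abs_of_neg)
 have c0i: "integrable m c0"
 proof -
  have "Leb1 (%p. \<bar>?i p * Y p\<bar> *\<^sub>R c0 p)"
   by (rule Bochner_Integration.integrable_bound[OF qi]) (use c0Y c0 in "auto simp: abs_mult indicator_def")
  then show ?thesis unfolding m_def by (subst integrable_density) auto
 qed
 define V :: "(real \<times> 'a) set" where "V = {tau<..} \<times> UNIV"
 have V: "open V" unfolding V_def by (intro open_Times) auto
 have c0b: "c0 : borel_funs" by measurable
 obtain c where c: "c11 c" "!!p. 0 <= c p" "!!p. p \<notin> V ==> c p = 0" "(\<integral>p. \<bar>indicator V p * c0 p - c p\<bar> \<partial>m) <= \<delta>'"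
  using c11_dense[OF fin ms V c0b c0 c0i d'(1)] by blast
 have [measurable]: "V : sets borel" using V by simp
 have [measurable]: "c : borel_funs" by (rule c11_borel[OF c(1)])
 obtain Mc where Mc: "!!p. \<bar>c p\<bar> <= Mc" using c(1) c11_boundD(1) unfolding c11_def by blast
 let ?e = "%p. \<bar>?i p * Y p\<bar> * \<bar>indicator V p * c0 p - c p\<bar>"
 have ei: "integrable lborel ?e"
 proof -
  have "Leb1 (%p. \<bar>?i p * q p\<bar> + Mc * \<bar>?i p * Y p\<bar>)" using Yi qi by auto
  then show ?thesis
  proof (rule Bochner_Integration.integrable_bound)
   show "AE p in lborel. norm (?e p) <= norm (\<bar>?i p * q p\<bar> + Mc * \<bar>?i p * Y p\<bar>)"
   proof (rule AE_I2)
    fix p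
    have "\<bar>Y p\<bar> * \<bar>indicator V p * c0 p - c p\<bar> <= \<bar>Y p\<bar> * (c0 p + Mc)"
     using c0[of p] Mc[of p] by (intro mult_left_mono) (auto simp: indicator_def)
    also have "... <= \<bar>q p\<bar> + Mc * \<bar>Y p\<bar>" using c0Y[of p] by (simp add: algebra_simps)
    also have "... <= \<bar>\<bar>q p\<bar> + Mc * \<bar>Y p\<bar>\<bar>" by (rule abs_ge_self)
    finally show "norm (?e p) <= norm (\<bar>?i p * q p\<bar> + Mc * \<bar>?i p * Y p\<bar>)"
     by (cases "p : cylinder T") (simp_all add: abs_mult)
   qed
  qed measurable
 qed
 have e: "(LBINT p. ?e p) <= \<delta>'"
 proof -
  have "(\<integral>p. \<bar>indicator V p * c0 p - c p\<bar> \<partial>m) = (LBINT p. ?e p)"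
   unfolding m_def by (subst integral_density) auto
  then show ?thesis using c(4) by simp
 qed
 obtain L D where LD: "!!eps. 0 < eps ==> \<exists>xi. test_function s T c eta X L D B eps xi" using ex[OF c(1,2)] by blast
 have c3: "c (t, x) = 0" if "t <= tau" for t x using c(3)[of "(t, x)"] that by (simp add: V_def)
 obtain eps1 where e1: "0 < eps1" "!!xi. test_function s T c eta X L D B eps1 xi ==>
   (LBINT p. ?i p * (Y p * (eta p - c p * xi (fst p) (snd p)) + q p * xi (fst p) (snd p))) <= a"
  using key[OF c(1,2) c3, of L D] by blast
 obtain xi where tf: "test_function s T c eta X L D B eps1 xi" using LD[OF e1(1)] by blast
 interpret tf: test_function s T c eta X L D B eps1 xi by (rule tf)
 let ?x = "%p. xi (fst p) (snd p)"
 have xb: "0 <= ?x p" "?x p <= X" if "p : cylinder T" for p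
  using that tf.nonneg[of "fst p" "snd p"] tf.abs_le[of "fst p" "snd p"] by (auto simp: cylinder_iff)
 obtain Ce where Ce: "!!p. \<bar>eta p\<bar> <= Ce" using tf.eta_bdd by blast
 have ieta: "Leb1 (%p. ?i p * (Y p * eta p))"
  using integrable_bounded_mult[OF Yi, of eta Ce] Ce by (simp add: mult.assoc)
 have imain: "Leb1 (%p. ?i p * (Y p * (eta p - c p * ?x p) + q p * ?x p))"
 proof -
  have "Leb1 (%p. (?i p * Y p) * (eta p - c p * ?x p))"
  proof (rule integrable_bounded_mult[OF Yi])
   fix p assume "?i p * Y p \<noteq> 0"
   then have p: "p : cylinder T" by (auto simp: indicator_def split: if_splits)
   have "\<bar>c p * ?x p\<bar> <= Mc * X" unfolding abs_mult using Mc[of p] xb[OF p] by (intro mult_mono) auto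
   then show "\<bar>eta p - c p * ?x p\<bar> <= Ce + Mc * X" using Ce[of p] by linarith
  qed measurable
  moreover have "Leb1 (%p. (?i p * q p) * ?x p)"
   by (rule integrable_bounded_mult[OF qi, where C = X]) (use xb in "auto simp: indicator_def split: if_splits")
  ultimately have "Leb1 (%p. (?i p * Y p) * (eta p - c p * ?x p) + (?i p * q p) * ?x p)" by (rule Bochner_Integration.integrable_add)
  then show ?thesis by (simp add: algebra_simps)
 qed
 let ?l = "%p. ?i p * (indicator {..tau} (fst p) * max 0 (- q p))"
 have il: "integrable lborel ?l"
  by (rule Bochner_Integration.integrable_bound[OF qi]) (auto simp: indicator_def)
 have "(LBINT p. ?i p * (Y p * eta p)) <= (LBINT p. ?i p * (Y p * (eta p - c p * ?x p) + q p * ?x p) + (X * ?e p + X * ?l p))"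
 proof (rule Bochner_Integration.integral_mono[OF ieta])
  show "Leb1 (%p. ?i p * (Y p * (eta p - c p * ?x p) + q p * ?x p) + (X * ?e p + X * ?l p))"
   using imain ei il by (intro Bochner_Integration.integrable_add integrable_mult_right)
  fix p
  show "?i p * (Y p * eta p) <= ?i p * (Y p * (eta p - c p * ?x p) + q p * ?x p) + (X * ?e p + X * ?l p)"
  proof (cases "p : cylinder T")
   case True
   note x = xb[OF True]
   have bound: "?x p * r <= X * r'" if "r <= r'" "0 <= r'" for r r'
   proof -
    have "?x p * r <= ?x p * r'" using that x by (intro mult_left_mono)
    also have "... <= X * r'" using that x by (intro mult_right_mono)
    finally show ?thesis .
   qed
   have "?x p * (c p * Y p - q p) <= X * (?e p + ?l p)"
   proof (rule bound)
    show "0 <= ?e p + ?l p" by (intro add_nonneg_nonneg mult_nonneg_nonneg) auto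
    \<comment> \<open>Up to \<open>tau\<close> the coefficient is 0 and only the negative part of
      \<open>q\<close> can hurt. Later, \<open>c0 Y <= q\<close> holds: with equality if
      \<open>q Y > 0\<close>, and otherwise because then \<open>q >= 0\<close>, as a negative
      \<open>q\<close> would make \<open>Y\<close> negative by \<open>sgn\<close>.\<close>
    show "c p * Y p - q p <= ?e p + ?l p"
    proof (cases "fst p <= tau")
     case l: True
     then have "c p * Y p = 0" using c(3)[of p] by (simp add: V_def mem_Times_iff)
     moreover have "?l p = max 0 (- q p)" using True l by simp
     moreover have "0 <= ?e p" by simp
     ultimately show ?thesis using max.cobounded2[of "- q p" 0] by linarith
    next
     case l: False
     then have pV: "p : V" by (simp add: V_def mem_Times_iff)
     have "c0 p * Y p - q p <= 0"
     proof (cases "0 < q p * Y p")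
      case True
      then show ?thesis by (auto simp: c0_def)
     next
      case False
      then have "~ q p < 0" using sgn[OF True] mult_neg_neg[of "q p" "Y p"] by auto
      then show ?thesis using False by (simp add: c0_def)
     qed
     moreover have "(c p - c0 p) * Y p <= \<bar>Y p\<bar> * \<bar>c0 p - c p\<bar>"
      using abs_ge_self[of "(c p - c0 p) * Y p"] by (simp add: abs_mult abs_minus_commute mult.commute)
     ultimately have "c p * Y p - q p <= \<bar>Y p\<bar> * \<bar>c0 p - c p\<bar>" by (simp add: algebra_simps)
     then show ?thesis using True l pV by simp
    qed
   qed
   then show ?thesis using True by (simp add: algebra_simps)
  qed simp
 qed
 also have "... = (LBINT p. ?i p * (Y p * (eta p - c p * ?x p) + q p * ?x p)) + (X * (LBINT p. ?e p) + X * (LBINT p. ?l p))"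
  using imain ei il by (subst Bochner_Integration.integral_add) (simp_all add: Bochner_Integration.integral_add)
 also have "... <= a + (\<delta> + X * (LBINT p. ?l p))"
  using e1(2)[OF tf] mult_left_mono[OF e X] d'(2) by linarith
 finally show "(LBINT p. ?i p * (Y p * eta p)) <= a + X * (LBINT p. ?l p) + \<delta>" by simp
qed

text \<open>The indicator of \<open>Z > 0\<close> is approximated by admissible test functions in
  \<open>L^1\<close> with respect to \<open>|Z| dx\<close>, which shows that the positive part of
  \<open>Z\<close> has integral 0 over \<open>V\<close>.\<close>

lemma nonpos_of_tests:
 fixes Z :: "real \<times> 'a::euclidean_space => real"
 assumes V: "open V" and [measurable]: "Z : borel_funs" and Zi: "Leb1 (%p. indicator V p * Z p)"
  and test: "!!eta. c11 eta ==> (!!p. 0 <= eta p) ==> (!!p. p \<notin> V ==> eta p = 0) ==> (LBINT p. indicator V p * (Z p * eta p)) <= 0"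
 shows "AE p in lborel. p : V --> Z p <= 0"
proof -
 let ?i = "%p. indicator V p :: real"
 have [measurable]: "V : sets borel" using V by simp
 define m where "m = density lborel (%p. ennreal \<bar>?i p * Z p\<bar>)"
 have im: "(%p. ennreal \<bar>?i p * Z p\<bar>) : borel_measurable lborel" by measurable
 have fin: "finite_measure m"
 proof
  have "emeasure m (space m) = (NN p. ennreal \<bar>?i p * Z p\<bar>)"
   unfolding m_def by (subst emeasure_density[OF im]) auto
  also have "... < \<infinity>" using Zi unfolding integrable_iff_bounded by simp
  finally show "emeasure m (space m) \<noteq> \<infinity>" by simp
 qed
 have ms: "sets m = sets borel" by (simp add: m_def)
 define f where "f p = (if 0 < Z p then 1 else 0 :: real)" for p
 have fb[measurable]: "f : borel_funs" unfolding f_def[abs_def] by measurable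
 have f0: "0 <= f p" "f p <= 1" for p by (auto simp: f_def)
 have fi: "integrable m f"
  by (rule finite_measure.integrable_const_bound[OF fin, of _ 1]) (use f0 ms in "auto cong: measurable_cong_sets")
 have ifi: "Leb1 (%p. ?i p * Z p * f p)" by (rule integrable_bounded_mult[OF Zi, where C = 1]) (use f0 in auto)
 have "(LBINT p. ?i p * Z p * f p) <= 0"
 proof (rule field_le_epsilon)
  fix \<delta> :: real assume d: "0 < \<delta>"
  obtain eta where eta: "c11 eta" "!!p. 0 <= eta p" "!!p. p \<notin> V ==> eta p = 0" "(\<integral>p. \<bar>?i p * f p - eta p\<bar> \<partial>m) <= \<delta>"
   using c11_dense[OF fin ms V fb f0(1) fi d] by blast
  have [measurable]: "eta : borel_funs" by (rule c11_borel[OF eta(1)])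
  obtain Me where Me: "!!p. \<bar>eta p\<bar> <= Me" using eta(1) c11_boundD(1) unfolding c11_def by blast
  let ?e = "%p. \<bar>?i p * Z p\<bar> * \<bar>?i p * f p - eta p\<bar>"
  have "\<bar>?i p * Z p\<bar> \<noteq> 0 ==> \<bar>\<bar>?i p * f p - eta p\<bar>\<bar> <= 1 + Me" for p using f0[of p] Me[of p] by (auto simp: indicator_def)
  then have ei: "integrable lborel ?e" by (intro integrable_bounded_mult[OF integrable_abs[OF Zi]]) auto
  have e: "(LBINT p. ?e p) <= \<delta>"
  proof -
   have "(\<integral>p. \<bar>?i p * f p - eta p\<bar> \<partial>m) = (LBINT p. ?e p)" unfolding m_def by (subst integral_density) auto
   then show ?thesis using eta(4) by simp
  qed
  have ie: "Leb1 (%p. ?i p * Z p * eta p)" by (rule integrable_bounded_mult[OF Zi, where C = Me]) (use Me in auto)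
  have "(LBINT p. ?i p * Z p * f p) <= (LBINT p. ?i p * Z p * eta p + ?e p)"
  proof (rule Bochner_Integration.integral_mono[OF ifi Bochner_Integration.integrable_add[OF ie ei]])
   fix p
   have "Z p * (f p - eta p) <= \<bar>Z p\<bar> * \<bar>f p - eta p\<bar>" using abs_ge_self[of "Z p * (f p - eta p)"] by (simp add: abs_mult)
   then show "?i p * Z p * f p <= ?i p * Z p * eta p + ?e p" by (simp add: indicator_def right_diff_distrib)
  qed
  also have "... = (LBINT p. ?i p * Z p * eta p) + (LBINT p. ?e p)" using ie ei by (rule Bochner_Integration.integral_add)
  also have "... <= 0 + \<delta>" using test[OF eta(1-3)] e by (intro add_mono) (simp_all add: mult.assoc)
  finally show "(LBINT p. ?i p * Z p * f p) <= 0 + \<delta>" .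
 qed
 moreover have nn: "0 <= ?i p * Z p * f p" for p by (auto simp: f_def indicator_def)
 moreover have "0 <= (LBINT p. ?i p * Z p * f p)" by (intro Bochner_Integration.integral_nonneg nn)
 ultimately have "(LBINT p. ?i p * Z p * f p) = 0" by linarith
 then have "AE p in lborel. ?i p * Z p * f p = 0"
  using integral_nonneg_eq_0_iff_AE[OF ifi] nn by simp
 then show ?thesis
 proof eventually_elim
  case (elim p)
  then show ?case by (auto simp: f_def split: if_splits)
 qed
qed

text \<open>The weak formulation in the form in which it is used: for a Borel, everywhere
  nonnegative representative, tested with dual solutions, and with the dual equation already
  inserted. The right-hand side is the error of replacing the fractional Laplacian of
  \<open>xi\<close> by the jump operator.\<close>

definition tested_solution :: "real => real => (real => real) => real => 'a::euclidean_space => (real \<times> 'a => real) => bool" where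
 "tested_solution s \<beta> g k z V \<longleftrightarrow> V : borel_funs & (\<forall>p. 0 <= V p) \<and>
  (\<forall>T>0. Leb1 (%p. indicator (cylinder T) p * V p) \<and>
   Leb1 (%p. indicator (cylinder T) p * (fst p powr \<beta> * g (V p)))) \<and>
  (\<forall>T c eta X L D B eps xi. test_function s T c eta X L D B eps xi -->
   \<bar>(LBINT p. indicator (cylinder T) p * (V p * (eta p - c p * xi (fst p) (snd p)) + fst p powr \<beta> * g (V p) * xi (fst p) (snd p)))
     - k * xi 0 z\<bar> <= D * m2 TYPE('a) s eps * (LBINT p. indicator (cylinder T) p * V p))"

lemma tested_solutionD:
 fixes V :: "real \<times> 'a::euclidean_space => real"
 assumes "tested_solution s \<beta> g k z V"
 shows "V : borel_funs" "0 <= V p"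
  "0 < T ==> Leb1 (%p. indicator (cylinder T) p * V p)"
  "0 < T ==> Leb1 (%p. indicator (cylinder T) p * (fst p powr \<beta> * g (V p)))"
  "test_function s T c eta X L D B eps xi ==>
   \<bar>(LBINT p. indicator (cylinder T) p * (V p * (eta p - c p * xi (fst p) (snd p)) + fst p powr \<beta> * g (V p) * xi (fst p) (snd p)))
     - k * xi 0 z\<bar> <= D * m2 TYPE('a) s eps * (LBINT p. indicator (cylinder T) p * V p)"
 using assms unfolding tested_solution_def by blast+

lemma (in test_function) full_lap_borel: "(%p. indicator (cylinder T) p * full_lap s (xi (fst p)) (snd p)) : borel_funs"
proof (rule borel_measurable_LIMSEQ_real)
 let ?e = "%n. inverse (real (Suc n))"
 obtain C where C: "!!t x. \<bar>xi t x\<bar> <= C" using bdd by blast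
 have lim: "filterlim ?e (at_right 0) sequentially"
  by (rule tendsto_imp_filterlim_at_right[OF LIMSEQ_inverse_real_of_nat]) simp
 show "(%p. indicator (cylinder T) p * frac_lap_trunc s (?e n) (xi (fst p)) (snd p)) : borel_funs" for n
 proof -
  have "continuous_on UNIV (%(t, x). jump (jump_kernel s (?e n)) (xi t) x)"
   by (rule symmetric_jumps.jump_continuous[OF symmetric_jumps_jump_kernel[OF s] cont C]) simp
  then have [measurable]: "(%p. jump (jump_kernel s (?e n)) (xi (fst p)) (snd p)) : borel_funs"
   by (simp add: case_prod_unfold borel_measurable_continuous_onI)
  show ?thesis unfolding frac_lap_trunc_eq_jump[OF s xi_slice_borel] by measurable
 qed
 fix p
 show "(%n. indicator (cylinder T) p * frac_lap_trunc s (?e n) (xi (fst p)) (snd p)) \<longlonglongrightarrow> indicator (cylinder T) p * full_lap s (xi (fst p)) (snd p)"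
 proof (cases "p : cylinder T")
  case True
  then have "has_frac_lap s (xi (fst p)) (snd p) (full_lap s (xi (fst p)) (snd p))"
   by (intro c11_has_frac_lap(1)[OF s reg]) (auto simp: cylinder_iff)
  from filterlim_compose[OF this[unfolded has_frac_lap_def] lim] show ?thesis using True by simp
 qed simp
qed

lemma (in test_function) tested_integrable:
 assumes V: "Leb1 (%p. indicator (cylinder T) p * V p)" and h: "Leb1 (%p. indicator (cylinder T) p * h p)"
 shows "Leb1 (%p. indicator (cylinder T) p * (V p * (eta p - c p * xi (fst p) (snd p)) + h p * xi (fst p) (snd p)))"
proof -
 let ?i = "%p. indicator (cylinder T) p :: real" and ?x = "%p. xi (fst p) (snd p)"
 have xX: "\<bar>?x p\<bar> <= X" if "p : cylinder T" for p using abs_le[of "fst p" "snd p"] that by (auto simp: cylinder_iff)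
 obtain Cc Ce where C: "!!p. \<bar>c p\<bar> <= Cc" "!!p. \<bar>eta p\<bar> <= Ce" using c_bdd eta_bdd by blast
 have "Leb1 (%p. (?i p * V p) * (eta p - c p * ?x p))"
 proof (rule integrable_bounded_mult[OF V])
  fix p assume "?i p * V p \<noteq> 0"
  then have "p : cylinder T" by (auto simp: indicator_def split: if_splits)
  then have "\<bar>c p * ?x p\<bar> <= Cc * X" unfolding abs_mult using C(1)[of p] xX[of p] by (intro mult_mono) auto
  then show "\<bar>eta p - c p * ?x p\<bar> <= Ce + Cc * X" using C(2)[of p] by linarith
 qed measurable
 moreover have "Leb1 (%p. (?i p * h p) * ?x p)"
  by (rule integrable_bounded_mult[OF h, where C = X]) (use xX in "auto simp: indicator_def split: if_splits")
 ultimately have "Leb1 (%p. (?i p * V p) * (eta p - c p * ?x p) + (?i p * h p) * ?x p)"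
  by (rule Bochner_Integration.integrable_add)
 then show ?thesis by (simp add: algebra_simps)
qed

lemma integral_point_mass:
 assumes [measurable]: "f : borel_funs" and f: "!!x. 0 <= f x"
 shows "(\<integral>x. f x \<partial>scale_measure (of_nat k) (return borel (z::'a::euclidean_space))) = real k * f z"
proof -
 have m: "f : borel_measurable (scale_measure (of_nat k) (return borel z))"
  using assms(1) by (subst measurable_cong_sets[of _ borel _ borel]) auto
 have "(\<integral>x. f x \<partial>scale_measure (of_nat k) (return borel z)) = enn2real (\<integral>\<^sup>+x. ennreal (f x) \<partial>scale_measure (of_nat k) (return borel z))"
  by (rule integral_eq_nn_integral[OF m]) (use f in auto)
 also have "(\<integral>\<^sup>+x. ennreal (f x) \<partial>scale_measure (of_nat k) (return borel z)) = of_nat k * ennreal (f z)"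
  by (subst nn_integral_scale_measure) (auto simp: nn_integral_return)
 also have "... = ennreal (real k * f z)" using f by (simp add: ennreal_mult ennreal_of_nat_eq_real_of_nat)
 finally show ?thesis using f by simp
qed

text \<open>A weak solution is only Lebesgue measurable on each cylinder and nonnegative almost
  everywhere, so a Borel representative is selected first. Then
  \<open>- deriv xi + frac_lap xi\<close> equals \<open>eta - c xi\<close> up to the sum of the
  fractional Laplacian and the jump operator applied to \<open>xi\<close>, which
  \<open>jump_kernel_error\<close> bounds.\<close>

lemma weak_solution_tested:
 fixes v :: "real => 'a::euclidean_space => real"
 assumes s: "0 < s" "s < 1" and g: "continuous_on {0..} g"
  and w: "weak_solution s \<beta> g (scale_measure (of_nat k) (return borel z)) v"
 shows "\<exists>V. tested_solution s \<beta> g (real k) z V & (AE p in lborel. 0 < fst p --> v (fst p) (snd p) = V p)"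
proof -
 let ?v = "%p. v (fst p) (snd p)"
 let ?i = "%T p. indicator (cylinder T) p :: real"
 have nn: "AE p in lebesgue_on half_space. 0 <= ?v p" using w by (simp add: weak_solution_def case_prod_unfold)
 have i1: "integrable lebesgue (%p. ?i T p * ?v p)" and i2: "integrable lebesgue (%p. ?i T p * (fst p powr \<beta> * g (?v p)))" if "0 < T" for T
  using w that by (simp_all add: weak_solution_def set_integrable_def case_prod_unfold)
 have eq: "(LINT p:cylinder T|lebesgue. (- deriv (%tau. xi tau (snd p)) (fst p) + frac_lap s (xi (fst p)) (snd p)) * ?v p
   + fst p powr \<beta> * g (?v p) * xi (fst p) (snd p)) = (\<integral>x. xi 0 x \<partial>scale_measure (of_nat k) (return borel z))"
  if "0 < T" "xi : test_space s T" for T xi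
  using w that by (simp add: weak_solution_def case_prod_unfold)
 have hs: "half_space : sets (borel :: (real \<times> 'a) measure)" unfolding half_space_def by (intro borel_open open_Times) auto
 have hm: "(%p. indicator half_space p * ?v p) : borel_measurable lebesgue"
 proof (rule borel_measurable_LIMSEQ_real)
  show "(%p. ?i (real (Suc n)) p * ?v p) : borel_measurable lebesgue" for n
   using i1[of "real (Suc n)"] by (intro borel_measurable_integrable) auto
  fix p :: "real \<times> 'a"
  obtain n where n: "fst p < real n" using reals_Archimedean2 by blast
  have "?i (real (Suc m)) p * ?v p = indicator half_space p * ?v p" if "n <= m" for m
  proof -
   have "fst p < real (Suc m)" using n that by linarith
   then show ?thesis by (auto simp: indicator_def cylinder_def half_space_def mem_Times_iff)
  qed
  then have "eventually (%m. ?i (real (Suc m)) p * ?v p = indicator half_space p * ?v p) sequentially"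
   unfolding eventually_sequentially by blast
  then show "(%n. ?i (real (Suc n)) p * ?v p) \<longlonglongrightarrow> indicator half_space p * ?v p" by (rule tendsto_eventually)
 qed
 obtain V0 where V0: "V0 : borel_measurable lborel" "AE p in lborel. indicator half_space p * ?v p = V0 p"
  using completion_ex_borel_measurable_real[OF hm] by blast
 have nn': "AE p in lborel. p : half_space --> 0 <= ?v p"
  using nn hs by (subst (asm) AE_restrict_space_iff) (auto simp: AE_completion_iff)
 define V where "V p = max 0 (V0 p)" for p
 have Vb[measurable]: "V : borel_funs" unfolding V_def[abs_def] using V0(1) by simp
 have Vnn: "0 <= V p" for p by (simp add: V_def)
 have ae: "AE p in lborel. 0 < fst p --> ?v p = V p"
  using V0(2) nn'
 proof eventually_elim
  case (elim p)
  then show ?case by (auto simp: V_def half_space_def mem_Times_iff)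
 qed
 have aeL: "AE p in lebesgue. 0 < fst p --> ?v p = V p" by (rule AE_completion[OF ae])
 have gV[measurable]: "(%p. g (V p)) : borel_funs"
 proof -
  have "continuous_on UNIV (%r. g (max 0 r))" by (rule continuous_on_compose2[OF g]) (auto intro!: continuous_intros)
  then have "(%r. g (max 0 r)) : borel_funs" by (rule borel_measurable_continuous_onI)
  from measurable_compose[OF Vb this] show ?thesis using Vnn by (simp add: max_absorb2)
 qed
 let ?h = "%p. fst p powr \<beta> * g (V p)"
 have toL: "Leb1 f" if "integrable lebesgue f'" "f : borel_funs" "AE p in lebesgue. f' p = f p" for f f' :: "real \<times> 'a => real"
 proof -
  have m: "f : borel_measurable lborel" using that(2) by simp
  have "integrable lebesgue f" by (rule integrable_cong_AE_imp[OF that(1) measurable_completion[OF m] that(3)])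
  then show ?thesis by (subst (asm) integrable_completion[OF m])
 qed
 have j1: "Leb1 (%p. ?i T p * V p)" if "0 < T" for T
 proof (rule toL[OF i1[OF that]])
  show "AE p in lebesgue. ?i T p * ?v p = ?i T p * V p"
   using aeL by eventually_elim (auto simp: indicator_def cylinder_iff)
 qed measurable
 have j2: "Leb1 (%p. ?i T p * ?h p)" if "0 < T" for T
 proof (rule toL[OF i2[OF that]])
  show "AE p in lebesgue. ?i T p * (fst p powr \<beta> * g (?v p)) = ?i T p * ?h p"
   using aeL by eventually_elim (auto simp: indicator_def cylinder_iff)
 qed measurable
 have "tested_solution s \<beta> g (real k) z V"
  unfolding tested_solution_def
 proof (intro conjI allI impI Vb Vnn j1 j2)
  fix T c eta X L D B eps and xi :: "real => 'a => real"
  assume tf: "test_function s T c eta X L D B eps xi"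
  interpret tf: test_function s T c eta X L D B eps xi by (rule tf)
  note [measurable] = tf.xi_borel tf.c_borel tf.eta_borel tf.jump_xi_borel tf.full_lap_borel
  let ?x = "%p. xi (fst p) (snd p)" and ?J = "%p. jump (jump_kernel s eps) (xi (fst p)) (snd p)"
  let ?L = "%p. full_lap s (xi (fst p)) (snd p)"
  define A where "A p = ?i T p * (?J p - c p * ?x p + eta p) + ?i T p * ?L p" for p
  have [measurable]: "A : borel_funs" unfolding A_def[abs_def] by measurable
  define G where "G p = ?i T p * (V p * (eta p - c p * ?x p) + ?h p * ?x p)" for p
  define e where "e p = (?i T p * V p) * (?i T p * ?J p + ?i T p * ?L p)" for p
  have [measurable]: "G : borel_funs" "e : borel_funs" unfolding G_def[abs_def] e_def[abs_def] by measurable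
  have Gi: "Leb1 G" unfolding G_def[abs_def] by (rule tf.tested_integrable[OF j1[OF tf.T] j2[OF tf.T]])
  let ?\<delta> = "D * m2 TYPE('a) s eps"
  have err: "\<bar>?i T p * ?J p + ?i T p * ?L p\<bar> <= ?\<delta>" if "p : cylinder T" for p
   using jump_kernel_error[OF s tf.reg[of "fst p"] tf.eps, of "snd p"] that by (simp add: cylinder_iff add.commute)
  have ei: "Leb1 e" unfolding e_def[abs_def]
  proof (rule integrable_bounded_mult[OF j1[OF tf.T]])
   fix p assume "?i T p * V p \<noteq> 0"
   then show "\<bar>?i T p * ?J p + ?i T p * ?L p\<bar> <= ?\<delta>" by (intro err) (auto simp: indicator_def split: if_splits)
  qed measurable
  have FGe: "A p * V p + ?i T p * ?h p * ?x p = G p + e p" for p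
   by (cases "p : cylinder T") (simp_all add: A_def G_def e_def algebra_simps)
  have "real k * xi 0 z = (\<integral>x. xi 0 x \<partial>scale_measure (of_nat k) (return borel z))"
   using tf.nonneg[of 0] tf.T by (subst integral_point_mass) auto
  also have "... = (LINT p:cylinder T|lebesgue. (- deriv (%tau. xi tau (snd p)) (fst p) + frac_lap s (xi (fst p)) (snd p)) * ?v p
   + fst p powr \<beta> * g (?v p) * ?x p)" by (rule eq[OF tf.T tf.in_test_space, symmetric])
  also have "... = (\<integral>p. A p * (?i T p * ?v p) + (?i T p * (fst p powr \<beta> * g (?v p))) * ?x p \<partial>lebesgue)"
   unfolding set_lebesgue_integral_def
  proof (rule Bochner_Integration.integral_cong[OF refl])
   fix p :: "real \<times> 'a"
   show "?i T p *\<^sub>R ((- deriv (%tau. xi tau (snd p)) (fst p) + frac_lap s (xi (fst p)) (snd p)) * ?v p + fst p powr \<beta> * g (?v p) * ?x p)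
    = A p * (?i T p * ?v p) + (?i T p * (fst p powr \<beta> * g (?v p))) * ?x p"
   proof (cases "p : cylinder T")
    case True
    then have t: "0 < fst p" "fst p < T" by (auto simp: cylinder_iff)
    have dd: "deriv (%tau. xi tau (snd p)) (fst p) = - ?J p + c p * ?x p - eta p"
     using DERIV_imp_deriv[OF tf.deriv[OF t, of "snd p"]] by simp
    have ff: "frac_lap s (xi (fst p)) (snd p) = ?L p" using c11_has_frac_lap(2)[OF s tf.reg[of "fst p"]] t by simp
    show ?thesis unfolding dd ff using True by (simp add: A_def algebra_simps)
   qed (simp add: A_def)
  qed
  also have "... = (\<integral>p. A p * V p + ?i T p * ?h p * ?x p \<partial>lebesgue)"
  proof (rule integral_cong_AE)
   have m: "A : borel_measurable lebesgue" "?x : borel_measurable lebesgue" by (auto intro!: measurable_completion)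
   show "(%p. A p * (?i T p * ?v p) + (?i T p * (fst p powr \<beta> * g (?v p))) * ?x p) : borel_measurable lebesgue"
    by (rule borel_measurable_add[OF borel_measurable_times[OF m(1) borel_measurable_integrable[OF i1[OF tf.T]]]
      borel_measurable_times[OF borel_measurable_integrable[OF i2[OF tf.T]] m(2)]])
   show "(%p. A p * V p + ?i T p * ?h p * ?x p) : borel_measurable lebesgue" by (rule measurable_completion) measurable
   show "AE p in lebesgue. A p * (?i T p * ?v p) + (?i T p * (fst p powr \<beta> * g (?v p))) * ?x p = A p * V p + ?i T p * ?h p * ?x p"
    using aeL
   proof eventually_elim
    case (elim p)
    show ?case
    proof (cases "p : cylinder T")
     case True
     then show ?thesis using elim by (simp add: cylinder_iff)
    next
     case False
     then show ?thesis by (simp add: A_def)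
    qed
   qed
  qed
  also have "... = (\<integral>p. G p + e p \<partial>lebesgue)" by (simp only: FGe)
  also have "... = (LBINT p. G p + e p)" by (rule integral_completion) measurable
  also have "... = (LBINT p. G p) + (LBINT p. e p)" by (rule Bochner_Integration.integral_add[OF Gi ei])
  finally have id: "real k * xi 0 z = (LBINT p. G p) + (LBINT p. e p)" .
  have "\<bar>(LBINT p. e p)\<bar> <= (LBINT p. \<bar>e p\<bar>)" by (rule integral_abs_bound)
  also have "... <= (LBINT p. ?\<delta> * (?i T p * V p))"
  proof (rule Bochner_Integration.integral_mono[OF integrable_abs[OF ei] integrable_mult_right[OF j1[OF tf.T]]])
   fix p
   show "\<bar>e p\<bar> <= ?\<delta> * (?i T p * V p)"
   proof (cases "p : cylinder T")
    case True
    then have "\<bar>e p\<bar> = V p * \<bar>?i T p * ?J p + ?i T p * ?L p\<bar>" unfolding e_def abs_mult using Vnn[of p] by simp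
    also have "... <= V p * ?\<delta>" by (intro mult_left_mono err True Vnn)
    finally show ?thesis using True by (simp add: mult.commute)
   qed (simp add: e_def)
  qed
  finally show "\<bar>(LBINT p. ?i T p * (V p * (eta p - c p * ?x p) + ?h p * ?x p)) - real k * xi 0 z\<bar>
   <= ?\<delta> * (LBINT p. ?i T p * V p)"
   using id by (simp add: G_def)
 qed
 then show ?thesis using ae by blast
qed

lemma lborel_time_shift:
 fixes f :: "real \<times> 'a::euclidean_space => real"
 assumes [measurable]: "f : borel_funs"
 shows "(LBINT p. f (fst p - a, snd p)) = (LBINT p. f p)"
  and "Leb1 f ==> Leb1 (%p. f (fst p - a, snd p))"
proof -
 have eq: "(- a, 0) + p = (fst p - a, snd p)" for p :: "real \<times> 'a" by (simp add: prod_eq_iff)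
 show "(LBINT p. f (fst p - a, snd p)) = (LBINT p. f p)"
  using lborel_integral_shift[OF assms, of "(- a, 0)"] by (simp only: eq)
 assume "Leb1 f"
 then have "integrable (distr lborel borel ((+) (- a, 0))) f" by (simp add: lborel_distr_plus)
 then have "Leb1 (%p. f ((- a, 0) + p))" by (subst (asm) integrable_distr_eq) auto
 then show "Leb1 (%p. f (fst p - a, snd p))" by (simp only: eq)
qed

context approximant
begin

text \<open>\<open>late_w\<close> and \<open>late_absorb\<close> transport the approximant to the
  time of \<open>u\<close> and set it to 0 up to \<open>t0\<close>. The switching on at
  \<open>t0\<close> appears in the duality formula as the datum \<open>w 0\<close> tested with
  \<open>xi t0\<close>.\<close>

definition late :: "real \<times> 'a => real" where "late p = indicator {0<..<T - t0} (fst p - t0)"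
definition late_w :: "real \<times> 'a => real" where "late_w p = late p * w (fst p - t0) (snd p)"
definition late_absorb :: "real \<times> 'a => real" where "late_absorb p = late p * absorb (fst p - t0) (snd p)"

lemma w_joint_borel [measurable]: "(%p. w (fst p) (snd p)) : borel_funs"
 and absorb_joint_borel [measurable]: "(%p. absorb (fst p) (snd p)) : borel_funs"
 using jump_solution_borel(2)[OF sol] absorb_measurable by (simp_all add: case_prod_unfold)

lemma late_cylinder: "late p \<noteq> 0 ==> p : cylinder T & t0 < fst p"
 using t0 by (auto simp: late_def cylinder_iff indicator_def split: if_splits)

lemma late_integrable:
 assumes "t0 < T"
 shows "late_w : borel_funs" "Leb1 late_w" "late_absorb : borel_funs" "Leb1 late_absorb"
proof -
 let ?j = "%p::real \<times> 'a. indicator {0<..<T - t0} (fst p) :: real"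
 have i: "Leb1 (%p. ?j p * w (fst p) (snd p))"
  using integrable_space_time[of "%t x. w t x" 0 "T - t0" k] mass t0 by (simp add: case_prod_unfold)
 show "Leb1 late_w"
  using lborel_time_shift(2)[OF _ i, of t0] by (simp add: late_w_def[abs_def] late_def)
 then show "late_w : borel_funs" using borel_measurable_integrable by fastforce
 have i: "Leb1 (%p. ?j p * absorb (fst p) (snd p))"
  using total_absorption(1)[of "T - t0"] assms t0 by (simp add: case_prod_unfold)
 show "Leb1 late_absorb"
  using lborel_time_shift(2)[OF _ i, of t0] by (simp add: late_absorb_def[abs_def] late_def)
 then show "late_absorb : borel_funs" using borel_measurable_integrable by fastforce
qed

text \<open>\<open>w\<close> and \<open>\<xi>\<close> solve equations with different jump kernels. By symmetry the difference of the kernels can be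
  moved to \<open>w\<close>, whose regularity is known before \<open>\<xi>\<close> is chosen.\<close>

lemma shifted_duality:
 assumes tf: "test_function s T c eta X L D' B' eps' xi" and tT: "t0 < T" and small: "D * m2 TYPE('a) s eps' <= th"
 shows "\<bar>(LBINT p. indicator (cylinder T) p * (late_w p * (eta p - c p * xi (fst p) (snd p)) + late_absorb p * xi (fst p) (snd p)))
  - (LBINT x. w 0 x * xi t0 x)\<bar> <= 2 * th * B' * T"
proof -
 interpret tf: test_function s T c eta X L D' B' eps' xi by (rule tf)
 let ?kappa = "jump_kernel s eps :: 'a measure" and ?kappa' = "jump_kernel s eps' :: 'a measure"
 define t1 where "t1 = T - t0"
 have t1: "0 <= t1" "t1 <= T" "t1 = T - t0" using tT t0 by (auto simp: t1_def)
 define sh where "sh p = (t0 + fst p, snd p)" for p :: "real \<times> 'a"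
 have shb: "sh : borel \<rightarrow>\<^sub>M borel"
  unfolding sh_def[abs_def] by (intro borel_measurable_continuous_onI) (auto intro!: continuous_intros)
 define d where "d p = - jump ?kappa' (xi (fst p)) (snd p) + c p * xi (fst p) (snd p) - eta p" for p
 note [measurable] = tf.xi_borel tf.c_borel tf.eta_borel tf.jump_xi_borel
 have db: "d : borel_funs" unfolding d_def[abs_def] by measurable
 define \<zeta> where "\<zeta> t x = xi (t0 + t) x" for t x
 have \<zeta>_eq: "\<zeta> t = xi (t0 + t)" for t by (simp add: \<zeta>_def fun_eq_iff)
 obtain Cx where Cx: "!!t x. \<bar>xi t x\<bar> <= Cx" using tf.bdd by blast
 obtain Cd where Cd: "!!t x. 0 < t ==> t < T ==> \<bar>- jump ?kappa' (xi t) x + c (t, x) * xi t x - eta (t, x)\<bar> <= Cd"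
  using tf.derivative_bounded by blast
 have zc: "continuous_on UNIV (%(t, x). \<zeta> t x)"
 proof -
  have "continuous_on UNIV (%p. xi (fst p) (snd p))" using tf.cont by (simp add: case_prod_unfold)
  then have "continuous_on UNIV (%p. xi (fst (sh p)) (snd (sh p)))"
   by (rule continuous_on_compose2) (auto simp: sh_def[abs_def] intro!: continuous_intros)
  then show ?thesis by (simp add: sh_def \<zeta>_def case_prod_unfold)
 qed
 have zd: "((%tau. \<zeta> tau x) has_real_derivative d (sh (t, x))) (at t)" if "0 < t" "t < t1" for t x
 proof -
  have "((%tau. xi tau x) has_real_derivative d (t0 + t, x)) (at (t0 + t))"
   unfolding d_def fst_conv snd_conv by (rule tf.deriv) (use that t0 t1 in auto)
  moreover have "((%tau. t0 + tau) has_real_derivative 1) (at t)" by (auto intro!: derivative_eq_intros)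
  ultimately have "((%tau. xi (t0 + tau) x) has_real_derivative d (t0 + t, x) * 1) (at t)" by (rule DERIV_chain2)
  then show ?thesis by (simp add: \<zeta>_def sh_def)
 qed
 have dsb: "(%(t, x). d (sh (t, x))) : borel_funs"
  using measurable_compose[OF shb db] by (simp add: case_prod_unfold)
 have dbd: "\<bar>d (sh (t, x))\<bar> <= Cd" if "0 < t" "t < t1" for t x
  using Cd[of "t0 + t" x] that t0 t1 by (simp add: d_def sh_def)
 have zb: "\<bar>\<zeta> t x\<bar> <= Cx" for t x using Cx by (simp add: \<zeta>_def)
 note dual = duality[OF t1(1,2) zc zb dsb dbd zd]
 let ?j = "%t. indicator {0<..<t1} t :: real"
 define H where "H p = ?j (fst p) * (w (fst p) (snd p) * (d (sh p) + jump ?kappa (\<zeta> (fst p)) (snd p)) - \<zeta> (fst p) (snd p) * absorb (fst p) (snd p))" for p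
 have Hi: "Leb1 H" using dual(1) by (simp add: H_def[abs_def] case_prod_unfold)
 have Hint: "(LBINT p. H p) = - (LBINT x. w 0 x * xi t0 x)"
 proof -
  have "\<zeta> t1 x = 0" for x using tf.final by (simp add: \<zeta>_def t1_def)
  then show ?thesis using dual(2) by (simp add: H_def case_prod_unfold \<zeta>_eq)
 qed
 \<comment> \<open>The error caused by the two different kernels, with the jump operators still
   acting on the test function.\<close>
 define e where "e p = (?j (fst p) * w (fst p) (snd p)) * (jump ?kappa' (\<zeta> (fst p)) (snd p) - jump ?kappa (\<zeta> (fst p)) (snd p))" for p
 have jc: "(%p. jump kappa (\<zeta> (fst p)) (snd p)) : borel_funs" if "symmetric_jumps kappa" for kappa
  using borel_measurable_continuous_onI[OF symmetric_jumps.jump_continuous[OF that zc zb]] by (simp add: case_prod_unfold)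
 note [measurable] = jc[OF sj] jc[OF tf.sj]
 have zsb[measurable]: "\<zeta> t : borel_funs" for t unfolding \<zeta>_def[abs_def] by (rule tf.xi_slice_borel)
 have wi: "Leb1 (%p. ?j (fst p) * w (fst p) (snd p))"
  using integrable_space_time[of "%t x. w t x" 0 t1 k] mass t1 by (simp add: case_prod_unfold)
 have jb: "\<bar>jump kappa (\<zeta> t) x\<bar> <= 2 * Cx * measure kappa UNIV" if "symmetric_jumps kappa" for kappa t x
  by (rule symmetric_jumps.jump_bound[OF that]) (use zb in auto)
 have ei: "Leb1 e" unfolding e_def[abs_def]
 proof (rule integrable_bounded_mult[OF wi])
  show "\<bar>jump ?kappa' (\<zeta> (fst p)) (snd p) - jump ?kappa (\<zeta> (fst p)) (snd p)\<bar> <= 2 * Cx * measure ?kappa' UNIV + 2 * Cx * measure ?kappa UNIV" for p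
   using jb[OF sj, of "fst p" "snd p"] jb[OF tf.sj, of "fst p" "snd p"] by linarith
 qed measurable
 define A where "A p = - H p - e p" for p
 have Ab[measurable]: "A : borel_funs"
  unfolding A_def[abs_def] using borel_measurable_integrable[OF Hi] borel_measurable_integrable[OF ei] by simp
 have "(LBINT p. indicator (cylinder T) p * (late_w p * (eta p - c p * xi (fst p) (snd p)) + late_absorb p * xi (fst p) (snd p)))
  = (LBINT p. A (fst p - t0, snd p))"
 proof (rule Bochner_Integration.integral_cong[OF refl])
  fix p
  show "indicator (cylinder T) p * (late_w p * (eta p - c p * xi (fst p) (snd p)) + late_absorb p * xi (fst p) (snd p)) = A (fst p - t0, snd p)"
  proof (cases "fst p - t0 : {0<..<t1}")
   case True
   then have "late p = 1" "p : cylinder T" using t0 by (auto simp: late_def t1_def cylinder_iff)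
   then show ?thesis using True by (simp add: A_def H_def e_def d_def sh_def \<zeta>_eq late_w_def late_absorb_def algebra_simps)
  next
   case False
   then have "late p = 0" by (simp add: late_def t1_def)
   then show ?thesis using False by (simp add: A_def H_def e_def late_w_def late_absorb_def)
  qed
 qed
 also have "... = (LBINT p. A p)" by (rule lborel_time_shift(1)[OF Ab])
 also have "... = (LBINT x. w 0 x * xi t0 x) - (LBINT p. e p)"
  unfolding A_def using Hi ei Hint by (subst Bochner_Integration.integral_diff) auto
 finally have main: "(LBINT p. indicator (cylinder T) p * (late_w p * (eta p - c p * xi (fst p) (snd p)) + late_absorb p * xi (fst p) (snd p)))
  = (LBINT x. w 0 x * xi t0 x) - (LBINT p. e p)" .
 have ei': "integrable (lborel \<Otimes>\<^sub>M lborel) e" using ei by (simp add: lborel_prod)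
 have inner: "\<bar>(LBINT x. e (t, x))\<bar> <= 2 * th * B' * ?j t" for t
 proof (cases "t : {0<..<t1}")
  case True
  then have t: "0 <= t" "t <= T" "0 <= t0 + t" "t0 + t <= T" using t1 t0 by auto
  have wt: "Leb1 (w t)" by (rule w_integrable[OF t(1,2)])
  have wM: "\<bar>w t x\<bar> <= M" for x using c11_boundD(1)[OF reg[OF t(1,2)]] .
  note d1 = symmetric_jumps.jump_dual[OF sj w_borel zsb wt wM zb] and d2 = symmetric_jumps.jump_dual[OF tf.sj w_borel zsb wt wM zb]
  \<comment> \<open>Moved to \<open>w t\<close>, each operator is within \<open>th\<close> of the
    negative fractional Laplacian of \<open>w t\<close>: the kernel of \<open>w\<close> by
    \<open>defect\<close>, that of \<open>xi\<close> by \<open>small\<close>. Hence the bound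
    \<open>2 th\<close>, against which only the mass \<open>B'\<close> of \<open>xi\<close>
    counts.\<close>
  let ?g = "%x. jump ?kappa' (w t) x - jump ?kappa (w t) x"
  have g: "\<bar>?g x\<bar> <= 2 * th" for x
   using jump_kernel_error[OF s reg[OF t(1,2)] eps, of x] jump_kernel_error[OF s reg[OF t(1,2)] tf.eps, of x] small defect by linarith
  have "(LBINT x. e (t, x)) = (LBINT x. w t x * jump ?kappa' (\<zeta> t) x - w t x * jump ?kappa (\<zeta> t) x)"
   using True by (simp add: e_def right_diff_distrib)
  also have "... = (LBINT x. w t x * jump ?kappa' (\<zeta> t) x) - (LBINT x. w t x * jump ?kappa (\<zeta> t) x)"
   by (rule Bochner_Integration.integral_diff[OF d2(2) d1(2)])
  also have "... = (LBINT x. \<zeta> t x * jump ?kappa' (w t) x) - (LBINT x. \<zeta> t x * jump ?kappa (w t) x)"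
   using d1(3) d2(3) by simp
  also have "... = (LBINT x. ?g x * \<zeta> t x)"
   by (subst Bochner_Integration.integral_diff[OF d2(1) d1(1), symmetric]) (simp add: algebra_simps)
  finally have eq: "(LBINT x. e (t, x)) = (LBINT x. ?g x * \<zeta> t x)" .
  have "(NN x. ennreal \<bar>?g x * \<zeta> t x\<bar>) <= ennreal (2 * th) * ennreal B'"
   by (rule nn_integral_abs_mult_le[OF zsb _ g]) (use tf.mass[OF t(3,4)] in \<open>simp add: \<zeta>_def\<close>)
  also have "... = ennreal (2 * th * B')" using th tf.B by (intro ennreal_mult[symmetric]) auto
  finally have "(LBINT x. \<bar>?g x * \<zeta> t x\<bar>) <= 2 * th * B'" using th tf.B by (intro integral_real_bounded) auto
  then have "\<bar>(LBINT x. ?g x * \<zeta> t x)\<bar> <= 2 * th * B'" by (rule order_trans[OF integral_abs_bound])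
  then show ?thesis using True unfolding eq by simp
 qed (simp add: e_def)
 have "(LBINT p. e p) = (LBINT t. (LBINT x. e (t, x)))"
  using lborel_pair.integral_fst'[OF ei'] by (simp add: lborel_prod)
 also have "\<bar>...\<bar> <= (LBINT t. \<bar>(LBINT x. e (t, x))\<bar>)" by (rule integral_abs_bound)
 also have "... <= (LBINT t. 2 * th * B' * ?j t)"
  by (rule Bochner_Integration.integral_mono[OF integrable_abs[OF lborel_pair.integrable_fst'[OF ei']] _ inner])
   (use t1 in "auto simp: integrable_indicator_iff")
 also have "... = 2 * th * B' * t1" using t1 by simp
 also have "... <= 2 * th * B' * T" using t1 th tf.B by (intro mult_left_mono) auto
 finally have "\<bar>(LBINT p. e p)\<bar> <= 2 * th * B' * T" .
 then show ?thesis unfolding main by simp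
qed

end

lemma small_product:
 assumes "m <= a / (\<bar>D\<bar> * I + 1)" "0 <= D" "0 <= I" "0 <= (a::real)"
 shows "D * m * I <= a"
proof -
 define P where "P = D * I"
 have P: "0 <= P" using assms by (simp add: P_def)
 have "D * m * I = P * m" by (simp add: P_def)
 also have "... <= P * (a / (P + 1))" using assms P by (intro mult_left_mono) (auto simp: P_def)
 also have "... = P / (P + 1) * a" by simp
 also have "... <= 1 * a" using P assms by (intro mult_right_mono) auto
 finally show ?thesis by simp
qed

section \<open>Comparison almost everywhere on windows away from the initial time\<close>

definition window :: "real => (real \<times> 'a::euclidean_space) set" where
 "window N = {1 / N<..<N} \<times> ball 0 N"

lemma window_open: "open (window N)"
 unfolding window_def by (intro open_Times) auto

lemma window_subset_cylinder: "1 < N ==> window N \<subseteq> cylinder N"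
proof -
 assume "1 < N"
 then have h: "0 < 1 / N" by simp
 show ?thesis by (auto simp: window_def cylinder_def intro: less_trans[OF h])
qed

lemma window_cover: assumes "0 < fst p" shows "\<exists>n. p : window (real n + 2)"
proof -
 obtain n where n: "max (fst p) (max (1 / fst p) (norm (snd p))) < real n" using reals_Archimedean2 by blast
 then have "1 / fst p < real n + 2" by simp
 then have "1 / (real n + 2) < fst p" using assms by (simp add: field_simps)
 then show ?thesis using n by (intro exI[of _ n]) (auto simp: window_def mem_Times_iff)
qed

lemma integrable_window:
 fixes V :: "real \<times> 'a::euclidean_space => real"
 assumes N: "1 < N" and i: "Leb1 (%p. indicator (cylinder N) p * V p)"
 shows "Leb1 (%p. indicator (window N) p * V p)"
proof -
 have [measurable]: "window N : sets (borel :: (real \<times> 'a) measure)" by (intro borel_open window_open)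
 have "Leb1 (%p. (indicator (cylinder N) p * V p) * indicator (window N) p)"
  by (rule integrable_bounded_mult[OF i, where C = 1]) auto
 moreover have "(%p. (indicator (cylinder N) p * V p) * indicator (window N) p) = (%p. indicator (window N) p * V p)"
  using window_subset_cylinder[OF N] by (auto simp: fun_eq_iff indicator_def)
 ultimately show ?thesis by simp
qed

text \<open>Here \<open>duality_bound\<close> is used with \<open>tau = 0\<close>: the initial terms
  are evaluated at the same point, so \<open>(k - k') xi 0 z <= 0\<close> and no continuity of
  \<open>xi\<close> in time is involved. Monotonicity of \<open>g\<close> yields the sign
  condition.\<close>

lemma tested_solution_mono:
 fixes V V' :: "real \<times> 'a::euclidean_space => real"
 assumes s: "0 < s" "s < 1" and g: "mono_on {0..} g" and V: "tested_solution s \<beta> g k z V" and V': "tested_solution s \<beta> g k' z V'"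
  and k: "k <= k'" and N: "1 < N"
 shows "AE p in lborel. p : window N --> V p <= V' p"
proof -
 have N0: "0 < N" using N by simp
 note [measurable] = tested_solutionD(1)[OF V] tested_solutionD(1)[OF V']
 let ?i = "%p. indicator (cylinder N) p :: real"
 let ?h = "%V p. fst p powr \<beta> * g (V p)"
 note nn = tested_solutionD(2)[OF V] tested_solutionD(2)[OF V']
 note i = tested_solutionD(3)[OF V N0] tested_solutionD(3)[OF V' N0] tested_solutionD(4)[OF V N0] tested_solutionD(4)[OF V' N0]
 define q where "q p = ?i p * ?h V p - ?i p * ?h V' p" for p
 have qb: "q : borel_funs"
  unfolding q_def[abs_def] using borel_measurable_integrable[OF i(3)] borel_measurable_integrable[OF i(4)] by simp
 define IV where "IV = (LBINT p. ?i p * V p) + (LBINT p. ?i p * V' p)"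
 have I0: "0 <= (LBINT p. ?i p * V p)" "0 <= (LBINT p. ?i p * V' p)"
  using nn by (simp_all add: Bochner_Integration.integral_nonneg)
 then have IV: "0 <= IV" "(LBINT p. ?i p * V p) <= IV" "(LBINT p. ?i p * V' p) <= IV"
  unfolding IV_def by linarith+
 have "AE p in lborel. p : window N --> V p - V' p <= 0"
 proof (rule nonpos_of_tests[OF window_open])
  show "Leb1 (%p. indicator (window N) p * (V p - V' p))"
   using Bochner_Integration.integrable_diff[OF integrable_window[OF N i(1)] integrable_window[OF N i(2)]] by (simp add: right_diff_distrib)
  fix eta :: "real \<times> 'a => real" assume eta: "c11 eta" "!!p. 0 <= eta p" "!!p. p \<notin> window N ==> eta p = 0"
  have far: "eta (t, x) = 0" if "N <= norm x" for t x using eta(3) that by (auto simp: window_def)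
  obtain X B where X: "0 <= X" "0 <= B" and ex: "\<forall>c. c11 c --> (\<forall>p. 0 <= c p) --> (\<exists>L D. \<forall>eps>0. \<exists>xi. test_function s N c eta X L D B eps xi)"
   using test_function_exists[OF s N0 eta(1,2) far] by blast
  show "(LBINT p. indicator (window N) p * ((V p - V' p) * eta p)) <= 0"
  proof (rule field_le_epsilon)
   fix a :: real assume a: "0 < a"
   have "(LBINT p. indicator (window N) p * ((V p - V' p) * eta p)) = (LBINT p. ?i p * ((V p - V' p) * eta p))"
    using window_subset_cylinder[OF N] eta(3) by (intro Bochner_Integration.integral_cong) (auto simp: indicator_def)
   also have "... <= a + X * (LBINT p. ?i p * (indicator {..0} (fst p) * max 0 (- q p)))"
   proof (rule duality_bound[OF N0 X(1) _ qb, where B = B])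
    show "(%p. V p - V' p) : borel_funs" by measurable
    show "Leb1 (%p. ?i p * (V p - V' p))" using Bochner_Integration.integrable_diff[OF i(1,2)] by (simp add: right_diff_distrib)
    have "(%p. ?i p * q p) = (%p. ?i p * ?h V p - ?i p * ?h V' p)" by (auto simp: q_def fun_eq_iff indicator_def)
    then show "Leb1 (%p. ?i p * q p)" using Bochner_Integration.integrable_diff[OF i(3,4)] by simp
    show "V p - V' p < 0" if "p : cylinder N" "q p < 0" for p
    proof (rule ccontr)
     assume "~ V p - V' p < 0"
     then have "g (V' p) <= g (V p)" using g nn by (auto simp: mono_on_def)
     then have "?h V' p <= ?h V p" by (intro mult_left_mono) auto
     then show False using that by (simp add: q_def)
    qed
    show "\<exists>L D. \<forall>eps>0. \<exists>xi. test_function s N c eta X L D B eps xi" if "c11 c" "!!p. 0 <= c p" for c using ex that by blast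
    fix c :: "real \<times> 'a => real" and L D
    have "0 < a / 2 / (\<bar>D\<bar> * IV + 1)" using a IV by (intro divide_pos_pos add_nonneg_pos mult_nonneg_nonneg) auto
    then obtain e1 where e1: "0 < e1" "!!eps. eps <= e1 ==> m2 TYPE('a) s eps <= a / 2 / (\<bar>D\<bar> * IV + 1)"
     using m2_small[OF s] by blast
    show "\<exists>eps1>0. \<forall>eps xi. 0 < eps --> eps <= eps1 --> test_function s N c eta X L D B eps xi -->
     (LBINT p. ?i p * ((V p - V' p) * (eta p - c p * xi (fst p) (snd p)) + q p * xi (fst p) (snd p))) <= a"
    proof (rule exI[of _ e1], rule conjI[OF e1(1)], intro allI impI)
     fix eps xi assume e: "0 < eps" "eps <= e1" and tf: "test_function s N c eta X L D B eps xi"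
     interpret tf: test_function s N c eta X L D B eps xi by (rule tf)
     have D: "0 <= D" using c11_bound_nonneg(3)[OF tf.reg[of 0]] N0 by simp
     let ?F = "%V p. ?i p * (V p * (eta p - c p * xi (fst p) (snd p)) + ?h V p * xi (fst p) (snd p))"
     have Dm: "D * m2 TYPE('a) s eps * I <= a / 2" if "0 <= I" "I <= IV" for I
      by (rule order_trans[OF mult_left_mono[OF that(2)] small_product]) (use e1(2)[OF e(2)] D m2_nonneg[OF s, of eps, where 'a = 'a] IV(1) a in auto)
     have b: "\<bar>(LBINT p. ?F V p) - k * xi 0 z\<bar> <= a / 2"
      by (rule order_trans[OF tested_solutionD(5)[OF V tf] Dm[OF I0(1) IV(2)]])
     have b': "\<bar>(LBINT p. ?F V' p) - k' * xi 0 z\<bar> <= a / 2"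
      by (rule order_trans[OF tested_solutionD(5)[OF V' tf] Dm[OF I0(2) IV(3)]])
     have "(LBINT p. ?i p * ((V p - V' p) * (eta p - c p * xi (fst p) (snd p)) + q p * xi (fst p) (snd p))) = (LBINT p. ?F V p - ?F V' p)"
      by (intro Bochner_Integration.integral_cong refl) (auto simp: q_def indicator_def algebra_simps)
     also have "... = (LBINT p. ?F V p) - (LBINT p. ?F V' p)"
      by (rule Bochner_Integration.integral_diff) (rule tf.tested_integrable[OF i(1,3)], rule tf.tested_integrable[OF i(2,4)])
     also have "... <= a"
     proof -
      have "k * xi 0 z <= k' * xi 0 z" using mult_right_mono[OF k tf.nonneg[of 0 z]] N0 by simp
      then show ?thesis using b b' by linarith
     qed
     finally show "(LBINT p. ?i p * ((V p - V' p) * (eta p - c p * xi (fst p) (snd p)) + q p * xi (fst p) (snd p))) <= a" .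
    qed
   qed
   \<comment> \<open>The cylinder contains only positive times, so there is no early loss.\<close>
   also have "(LBINT p. ?i p * (indicator {..0} (fst p) * max 0 (- q p))) = (\<integral>p. 0 \<partial>(lborel :: (real \<times> 'a) measure))"
    by (rule Bochner_Integration.integral_cong[OF refl]) (auto simp: indicator_def cylinder_iff)
   finally show "(LBINT p. indicator (window N) p * ((V p - V' p) * eta p)) <= 0 + a" by simp
  qed
 qed measurable
 then show ?thesis by simp
qed

context singular_solution
begin

text \<open>The order of choices carries the proof. From \<open>eta\<close> alone come
  \<open>X\<close> and \<open>B\<close>, hence \<open>tau\<close>, \<open>rho1\<close> and
  \<open>t1\<close>; these determine the radius of the data and \<open>th\<close>; then the
  approximant with \<open>t0 < t1\<close> is selected. Only after it come the coefficient
  \<open>c\<close>, depending on \<open>w\<close>, and last the truncation length for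
  \<open>xi\<close>.\<close>

lemma tested_solution_le:
 assumes V: "tested_solution s \<beta> g k z V" and k: "0 < k" and N: "1 < N"
 shows "AE p in lborel. p : window N --> V p <= u (fst p) (snd p)"
proof -
 have N0: "0 < N" using N by simp
 note [measurable] = tested_solutionD(1)[OF V]
 let ?i = "%p. indicator (cylinder N) p :: real"
 let ?h = "%p. fst p powr \<beta> * g (V p)"
 note nn = tested_solutionD(2)[OF V]
 have h0: "0 <= ?h p" for p using g(2)[OF nn] by simp
 note i = tested_solutionD(3,4)[OF V N0]
 define IV where "IV = (LBINT p. ?i p * V p)"
 have IV: "0 <= IV" unfolding IV_def using nn by (intro Bochner_Integration.integral_nonneg) simp
 \<comment> \<open>Only local integrability of \<open>u\<close> at positive times is available, so
   \<open>u\<close> is replaced by its restriction to a compact set containing the window.\<close>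
 define U where "U p = indicator ({1 / N..N} \<times> cball 0 N) p * u (fst p) (snd p)" for p
 have Ui: "Leb1 U"
 proof -
  have h: "0 < 1 / N" using N0 by simp
  have sub: "{1 / N..N} \<times> cball 0 N \<subseteq> (half_space :: (real \<times> 'a) set)"
   by (auto simp: half_space_def intro: less_le_trans[OF h])
  have "continuous_on half_space (%p. u (fst p) (snd p))" using u unfolding classical_solution_def case_prod_unfold by blast
  then have c: "continuous_on ({1 / N..N} \<times> cball 0 N) (%p. u (fst p) (snd p))" using sub by (rule continuous_on_subset)
  have "Leb1 (%p. indicator ({1 / N..N} \<times> cball 0 N) p *\<^sub>R u (fst p) (snd p))"
   by (rule borel_integrable_compact[OF _ c]) (intro compact_Times compact_Icc compact_cball)
  then show ?thesis by (simp add: U_def[abs_def])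
 qed
 have [measurable]: "U : borel_funs" using borel_measurable_integrable[OF Ui] by simp
 have Uu: "U p = u (fst p) (snd p)" if "p : window N" for p using that by (auto simp: U_def window_def indicator_def)
 have iU: "Leb1 (%p. ?i p * U p)"
  using integrable_bounded_mult[OF Ui, of ?i 1] by (simp add: mult.commute)
 have "AE p in lborel. p : window N --> V p - U p <= 0"
 proof (rule nonpos_of_tests[OF window_open])
  show "Leb1 (%p. indicator (window N) p * (V p - U p))"
   using Bochner_Integration.integrable_diff[OF integrable_window[OF N i(1)] integrable_window[OF N iU]] by (simp add: right_diff_distrib)
  fix eta :: "real \<times> 'a => real" assume eta: "c11 eta" "!!p. 0 <= eta p" "!!p. p \<notin> window N ==> eta p = 0"
  have [measurable]: "eta : borel_funs" by (rule c11_borel[OF eta(1)])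
  obtain Me where Me: "!!p. \<bar>eta p\<bar> <= Me" using eta(1) c11_boundD(1) unfolding c11_def by blast
  have far: "eta (t, x) = 0" if "N <= norm x" for t x using eta(3) that by (auto simp: window_def)
  obtain X B where X: "0 <= X" "0 <= B" and ex: "\<forall>c. c11 c --> (\<forall>p. 0 <= c p) --> (\<exists>L D. \<forall>eps>0. \<exists>xi. test_function s N c eta X L D B eps xi)"
   using test_function_exists[OF s N0 eta(1,2) far] by blast
  have ieta: "Leb1 (%p. ?i p * eta p)"
  proof -
   have "Leb1 (%p :: real \<times> 'a. indicator (window N) p * (1::real))"
   proof -
    have "emeasure lborel (window N :: (real \<times> 'a) set) < \<infinity>"
     unfolding window_def by (intro emeasure_bounded_finite bounded_Times bounded_ball) (rule bounded_subset[OF bounded_closed_interval[of "1 / N" N]], auto)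
    moreover have "window N : sets (borel :: (real \<times> 'a) measure)" by (intro borel_open window_open)
    ultimately show ?thesis by (simp add: integrable_indicator_iff)
   qed
   from integrable_bounded_mult[OF this, of eta Me] Me have "Leb1 (%p. indicator (window N) p * eta p)" by simp
   moreover have "(%p. indicator (window N) p * eta p) = (%p. ?i p * eta p)"
    using window_subset_cylinder[OF N] eta(3) by (auto simp: indicator_def fun_eq_iff)
   ultimately show ?thesis by simp
  qed
  define I where "I = (LBINT p. ?i p * eta p)"
  have I: "0 <= I" unfolding I_def using eta(2) by (intro Bochner_Integration.integral_nonneg) simp
  show "(LBINT p. indicator (window N) p * ((V p - U p) * eta p)) <= 0"
  proof (rule field_le_epsilon)
   fix a :: real assume a: "0 < a"
   \<comment> \<open>The errors add up to \<open>(k + 2) \<delta>\<close> from the duality,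
     \<open>X \<delta>\<close> from the early absorption and \<open>\<delta>\<close> from the
     passage from \<open>w\<close> to \<open>u\<close>.\<close>
   define \<delta> where "\<delta> = a / (k + X + 4)"
   have d: "0 < \<delta>" using a k X by (auto simp: \<delta>_def intro!: divide_pos_pos)
   have da: "(k + 2) * \<delta> + X * \<delta> + \<delta> <= a"
   proof -
    have "(k + X + 4) * \<delta> = a" using k X by (simp add: \<delta>_def)
    then show ?thesis using d by (simp add: algebra_simps)
   qed
   obtain tau' r where tr: "0 < tau'" "tau' <= 1" "0 < r" "keeps_mass k 1 \<delta> tau' r"
    by (rule uniform_local_mass[OF k zero_less_one d])
   \<comment> \<open>Below \<open>1 / N\<close> the function \<open>eta\<close> vanishes, which
     makes the dual flow free up to \<open>tau\<close>. The factor 2 leaves room to control the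
     absorption up to the time \<open>2 tau\<close>, beyond \<open>tau\<close>.\<close>
   define tau where "tau = min (1 / N) (min N tau') / 2"
   have tau: "0 < tau" "2 * tau <= tau'" "2 * tau <= N" "2 * tau <= 1 / N" using N0 tr by (auto simp: tau_def)
   have tau': "tau <= 1 / N" "tau <= N" using tau by linarith+
   have X1: "0 < X + 1" using X by simp
   obtain rho1 t1 where rt: "0 < rho1" "0 < t1" "t1 <= tau" and flow: "\<forall>Lip\<ge>0. \<exists>eps1>0. \<forall>eps \<Phi> x y t. 0 < eps --> eps <= eps1 -->
    jump_solution (jump_kernel s eps) (%_ _ _. 0) tau \<Phi> --> (\<forall>t x. 0 <= t --> t <= tau --> \<bar>\<Phi> t x\<bar> <= X + 1) -->
    (\<forall>t x y. 0 <= t --> t <= tau --> \<bar>\<Phi> t x - \<Phi> t y\<bar> <= Lip * norm (x - y)) -->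
    0 <= t --> t <= t1 --> norm (x - y) <= rho1 --> \<bar>\<Phi> (tau - t) x - \<Phi> tau (y::'a)\<bar> <= \<delta>"
    using flow_equicontinuity[OF s tau(1) X1 d, where 'a = 'a] by blast
   \<comment> \<open>\<open>r\<close> lets the approximant keep its mass, and
     \<open>2 r2 <= rho1\<close> puts its data where \<open>xi\<close> at time \<open>t0\<close> is
     close to \<open>xi 0 z\<close>.\<close>
   define r2 where "r2 = min r (rho1 / 2)"
   have r2: "0 < r2" "r2 <= r" "2 * r2 <= rho1" using tr rt by (auto simp: r2_def)
   \<comment> \<open>Collects the factors of \<open>th\<close> in the two errors it has to control:
     the different kernels in \<open>shifted_duality\<close>, and the gap between \<open>w\<close>
     and \<open>u\<close> integrated against \<open>eta\<close>.\<close>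
   define Q where "Q = 2 * B * N + (1 + 2 * N) * I"
   have Q: "0 <= 2 * B * N" "0 <= (1 + 2 * N) * I" using X N0 I by auto
   define th where "th = \<delta> / (Q + 1)"
   have th: "0 < th" using d Q by (auto simp: th_def Q_def intro!: divide_pos_pos)
   have thQ: "th * Q <= \<delta>"
   proof -
    have "th * Q <= th * (Q + 1)" using th by (intro mult_left_mono) auto
    also have "... = \<delta>" using Q by (simp add: th_def Q_def)
    finally show ?thesis .
   qed
   have th1: "2 * th * B * N <= \<delta>" and th2: "(th + 2 * th * N) * I <= \<delta>"
   proof -
    have eq: "th * Q = 2 * th * B * N + (th + 2 * th * N) * I" by (simp add: Q_def algebra_simps)
    have "0 <= 2 * th * B * N" "0 <= (th + 2 * th * N) * I" using th X N0 I by auto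
    then show "2 * th * B * N <= \<delta>" "(th + 2 * th * N) * I <= \<delta>" using thQ eq by linarith+
   qed
   obtain t0 eps0 M Bw D R G w where A: "0 < t0" "t0 < t1" "approximant s \<beta> g z t0 N th k eps0 M Bw D R G w"
    "!!x. 2 * r2 <= norm (x - z) ==> w 0 x = 0" "(LBINT x. w 0 x) = k"
    "!!sig x. 0 <= sig ==> sig < N ==> w sig x - th - 2 * th * sig <= u (t0 + sig) x"
    using approximant_below[OF k r2(1) th rt(2) N0] by blast
   interpret ap: approximant s \<beta> g z t0 N th k eps0 M Bw D R G w by (rule A(3))
   have t0: "t0 < tau" "t0 < N" "t0 <= 1" using A(2) rt(3) tau tau' tr(2) by linarith+
   note L = ap.late_integrable[OF t0(2)]
   note [measurable] = L(1) L(3)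
   have iW: "?i p * ap.late_w p = ap.late_w p" "?i p * ap.late_absorb p = ap.late_absorb p" for p
    using ap.late_cylinder[of p] by (auto simp: ap.late_w_def ap.late_absorb_def indicator_def)
   define q where "q p = ?i p * ?h p - ap.late_absorb p" for p
   have qb: "q : borel_funs"
    unfolding q_def[abs_def] using borel_measurable_integrable[OF i(2)] by simp
   have iq: "?i p * q p = q p" for p using iW(2)[of p] by (cases "p : cylinder N") (simp_all add: q_def)
   \<comment> \<open>Of the bound, \<open>k \<delta>\<close> comes from comparing the datum of mass
     \<open>k\<close>, tested with \<open>xi t0\<close>, with \<open>k xi 0 z\<close>; one
     \<open>\<delta>\<close> is the error of \<open>tested_solution\<close> and one that of
     \<open>shifted_duality\<close>.\<close>
   have main: "(LBINT p. ?i p * ((V p - ap.late_w p) * eta p))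
    <= (k + 2) * \<delta> + X * (LBINT p. ?i p * (indicator {..tau} (fst p) * max 0 (- q p)))"
   proof (rule duality_bound[OF N0 X(1) _ qb, where B = B])
    show "(%p. V p - ap.late_w p) : borel_funs" by measurable
    show "Leb1 (%p. ?i p * (V p - ap.late_w p))"
     using Bochner_Integration.integrable_diff[OF i(1) L(2)] by (simp add: right_diff_distrib iW)
    show "Leb1 (%p. ?i p * q p)"
     unfolding iq unfolding q_def[abs_def] by (rule Bochner_Integration.integrable_diff[OF i(2) L(4)])
    show "\<exists>L D. \<forall>eps>0. \<exists>xi. test_function s N c eta X L D B eps xi" if "c11 c" "!!p. 0 <= c p" for c using ex that by blast
    show "V p - ap.late_w p < 0" if p: "p : cylinder N" "q p < 0" for p
    proof (rule ccontr)
     assume n: "~ V p - ap.late_w p < 0"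
     have hF: "?h p < ap.late_absorb p" using p by (simp add: q_def)
     then have l: "fst p - t0 : {0<..<N - t0}" using h0[of p] by (cases "fst p - t0 : {0<..<N - t0}") (auto simp: ap.late_absorb_def ap.late_def)
     let ?w = "w (fst p - t0) (snd p)"
     have sg: "0 <= fst p - t0" "fst p - t0 <= N" using l A(1) by auto
     have w0: "0 <= ?w" by (rule ap.nonneg[OF sg])
     have "ap.late_w p = ?w" using l by (simp add: ap.late_w_def ap.late_def)
     then have "g ?w <= g (V p)" using g(1) n w0 by (auto simp: mono_on_def)
     then have "G ?w <= g (V p)" using ap.G_le[OF w0] by linarith
     then have "fst p powr \<beta> * G ?w <= ?h p" by (intro mult_left_mono) auto
     moreover have "ap.late_absorb p = fst p powr \<beta> * G ?w"
      using l ap.weight_eq[OF sg] by (simp add: ap.late_absorb_def ap.late_def)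
     ultimately show False using hF by linarith
    qed
    fix c :: "real \<times> 'a => real" and Lc Dc
    assume c: "c11 c" "!!p. 0 <= c p" "!!t x. t <= tau ==> c (t, x) = 0"
    have D: "0 <= D" using c11_bound_nonneg(3)[OF ap.reg[of 0]] N0 by simp
    \<comment> \<open>Three demands on the truncation length of \<open>xi\<close>: equicontinuity of
      its free flow for the Lipschitz constant \<open>Lc\<close>, a small error against
      \<open>V\<close>, and an error at most \<open>th\<close> on \<open>w\<close>.\<close>
    obtain e1 where e1: "0 < e1" and flow1: "!!eps \<Phi> x y t. 0 < eps ==> eps <= e1 ==>
    jump_solution (jump_kernel s eps) (%_ _ _. 0) tau \<Phi> ==> (\<forall>t x. 0 <= t --> t <= tau --> \<bar>\<Phi> t x\<bar> <= X + 1) ==>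
    (\<forall>t x y. 0 <= t --> t <= tau --> \<bar>\<Phi> t x - \<Phi> t y\<bar> <= \<bar>Lc\<bar> * norm (x - y)) ==>
    0 <= t ==> t <= t1 ==> norm (x - y) <= rho1 ==> \<bar>\<Phi> (tau - t) x - \<Phi> tau (y::'a)\<bar> <= \<delta>"
     using flow[rule_format, of "\<bar>Lc\<bar>"] by auto
    have "0 < \<delta> / (\<bar>Dc\<bar> * IV + 1)" using d IV by (intro divide_pos_pos add_nonneg_pos mult_nonneg_nonneg) auto
    then obtain e2 where e2: "0 < e2" "!!eps. eps <= e2 ==> m2 TYPE('a) s eps <= \<delta> / (\<bar>Dc\<bar> * IV + 1)"
     using m2_small[OF s] by blast
    have "0 < th / (\<bar>D\<bar> * 1 + 1)" using th by (intro divide_pos_pos add_nonneg_pos) auto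
    then obtain e3 where e3: "0 < e3" "!!eps. eps <= e3 ==> m2 TYPE('a) s eps <= th / (\<bar>D\<bar> * 1 + 1)"
     using m2_small[OF s] by blast
    have em: "0 < min e1 (min e2 e3)" using e1 e2 e3 by simp
    show "\<exists>eps1>0. \<forall>eps xi. 0 < eps --> eps <= eps1 --> test_function s N c eta X Lc Dc B eps xi -->
     (LBINT p. ?i p * ((V p - ap.late_w p) * (eta p - c p * xi (fst p) (snd p)) + q p * xi (fst p) (snd p))) <= (k + 2) * \<delta>"
    proof (rule exI[of _ "min e1 (min e2 e3)"], rule conjI[OF em], intro allI impI)
     fix eps xi assume e: "0 < eps" "eps <= min e1 (min e2 e3)" and tf: "test_function s N c eta X Lc Dc B eps xi"
     interpret tf: test_function s N c eta X Lc Dc B eps xi by (rule tf)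
     have Dc: "0 <= Dc" using c11_bound_nonneg(3)[OF tf.reg[of 0]] N0 by simp
     have m0: "0 <= m2 TYPE('a) s eps" by (rule m2_nonneg[OF s])
     let ?x = "%p. xi (fst p) (snd p)"
     let ?F = "%p. ?i p * (V p * (eta p - c p * ?x p) + ?h p * ?x p)"
     let ?W = "%p. ?i p * (ap.late_w p * (eta p - c p * ?x p) + ap.late_absorb p * ?x p)"
     have "\<bar>(LBINT p. ?F p) - k * xi 0 z\<bar> <= Dc * m2 TYPE('a) s eps * IV"
      unfolding IV_def by (rule tested_solutionD(5)[OF V tf])
     also have "... <= \<delta>" by (rule small_product) (use e e2(2)[of eps] Dc m0 IV d in auto)
     finally have b: "(LBINT p. ?F p) <= k * xi 0 z + \<delta>" by linarith
     have "D * m2 TYPE('a) s eps * 1 <= th" by (rule small_product) (use e e3(2)[of eps] D m0 th in auto)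
     then have "D * m2 TYPE('a) s eps <= th" by simp
     from ap.shifted_duality[OF tf t0(2) this] th1
     have b': "(LBINT x. w 0 x * xi t0 x) - \<delta> <= (LBINT p. ?W p)" by linarith
     have van: "c (t, x) = 0 & eta (t, x) = 0" if "t < tau" for t x
     proof -
      have "(t, x) \<notin> window N" using that tau' by (auto simp: window_def)
      then show ?thesis using c(3)[of t x] eta(3) that by simp
     qed
     \<comment> \<open>Reversed in time, \<open>xi\<close> solves the free equation on
       \<open>{0..tau}\<close>, and times 0 and \<open>t0\<close> become \<open>tau\<close> and
       \<open>tau - t0\<close>. This is where the point mass and the spread datum at the later time
       \<open>t0\<close> are reconciled.\<close>
     have close: "xi 0 z - \<delta> <= xi t0 x" if "norm (x - z) <= rho1" for x
     proof -
      have "\<bar>xi (tau - (tau - t0)) x - xi (tau - tau) z\<bar> <= \<delta>"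
      proof (rule flow1[of eps "%sig. xi (tau - sig)"])
       show "jump_solution (jump_kernel s eps) (%_ _ _. 0) tau (%sig. xi (tau - sig))" by (rule tf.flow[OF tau(1) tau'(2) van])
       show "\<forall>t x. 0 <= t --> t <= tau --> \<bar>xi (tau - t) x\<bar> <= X + 1"
       proof (intro allI impI)
        fix t x assume "0 <= t" "t <= tau"
        then show "\<bar>xi (tau - t) x\<bar> <= X + 1" using tf.abs_le[of "tau - t" x] tau'(2) by simp
       qed
       show "\<forall>t x y. 0 <= t --> t <= tau --> \<bar>xi (tau - t) x - xi (tau - t) y\<bar> <= \<bar>Lc\<bar> * norm (x - y)"
       proof (intro allI impI)
        fix t x y assume "0 <= t" "t <= tau"
        then have "\<bar>xi (tau - t) x - xi (tau - t) y\<bar> <= Lc * norm (x - y)"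
         using tau'(2) by (intro c11_bound_lipschitz[OF tf.reg]) auto
        also have "... <= \<bar>Lc\<bar> * norm (x - y)" by (intro mult_right_mono) auto
        finally show "\<bar>xi (tau - t) x - xi (tau - t) y\<bar> <= \<bar>Lc\<bar> * norm (x - y)" .
       qed
      qed (use e A(1,2) that in auto)
      then show ?thesis by (simp add: abs_le_iff)
     qed
     have w0i: "Leb1 (w 0)" by (rule ap.w_integrable) (use N0 in auto)
     have w0n: "0 <= w 0 x" for x using ap.nonneg[of 0 x] N0 by simp
     have "k * (xi 0 z - \<delta>) = (LBINT x. w 0 x * (xi 0 z - \<delta>))" using A(5) by simp
     also have "... <= (LBINT x. w 0 x * xi t0 x)"
     proof (rule Bochner_Integration.integral_mono)
      show "Leb1 (%x. w 0 x * (xi 0 z - \<delta>))" using w0i by simp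
      show "Leb1 (%x. w 0 x * xi t0 x)"
       by (rule integrable_bounded_mult[OF w0i, where C = X]) (use tf.abs_le[of t0] A(1) t0 in auto)
      show "w 0 x * (xi 0 z - \<delta>) <= w 0 x * xi t0 x" for x
      proof (cases "2 * r2 <= norm (x - z)")
       case False
       then show ?thesis using close[of x] r2(3) w0n by (intro mult_left_mono) auto
      qed (simp add: A(4))
     qed
     finally have b'': "k * xi 0 z - k * \<delta> <= (LBINT x. w 0 x * xi t0 x)" by (simp add: right_diff_distrib)
     have "(LBINT p. ?i p * ((V p - ap.late_w p) * (eta p - c p * ?x p) + q p * ?x p)) = (LBINT p. ?F p - ?W p)"
      by (intro Bochner_Integration.integral_cong refl) (auto simp: q_def indicator_def algebra_simps)
     also have "... = (LBINT p. ?F p) - (LBINT p. ?W p)"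
     proof (rule Bochner_Integration.integral_diff)
      show "integrable lborel ?F" by (rule tf.tested_integrable[OF i])
      show "integrable lborel ?W" by (rule tf.tested_integrable; unfold iW; fact L)
     qed
     also have "... <= (k + 2) * \<delta>" using b b' b'' by (simp add: algebra_simps)
     finally show "(LBINT p. ?i p * ((V p - ap.late_w p) * (eta p - c p * ?x p) + q p * ?x p)) <= (k + 2) * \<delta>" .
    qed
   qed
   have early: "(LBINT p. ?i p * (indicator {..tau} (fst p) * max 0 (- q p))) <= \<delta>"
   proof -
    \<comment> \<open>The absorption is counted up to the time \<open>2 tau\<close> instead of
      \<open>tau\<close>, so that the closed condition \<open>fst p <= tau\<close> lies inside the
      open time interval.\<close>
    define sig where "sig = 2 * tau - t0"
    have sg: "0 <= sig" "sig <= N" "sig <= tau'" using t0 tau A(1) by (auto simp: sig_def)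
    define f where "f p = indicator {0<..<sig} (fst p) * (time_weight \<beta> t0 N (fst p) * G (w (fst p) (snd p)))" for p
    have fi: "Leb1 f" using ap.total_absorption(1)[OF sg(1,2)] by (simp add: f_def[abs_def] case_prod_unfold)
    have fb: "f : borel_funs" using borel_measurable_integrable[OF fi] by simp
    have f0: "0 <= f p" for p using ap.absorb_nonneg[of "fst p" "snd p"] by (simp add: f_def)
    have "(LBINT p. ?i p * (indicator {..tau} (fst p) * max 0 (- q p))) <= (LBINT p. f (fst p - t0, snd p))"
    proof (rule integral_mono'[OF lborel_time_shift(2)[OF fb fi]])
     show "0 <= f (fst p - t0, snd p)" for p by (rule f0)
     show "?i p * (indicator {..tau} (fst p) * max 0 (- q p)) <= f (fst p - t0, snd p)" for p
     proof (cases "p : cylinder N & fst p <= tau & 0 < - q p")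
      case True
      then have "- q p = ap.late_absorb p - ?h p" by (simp add: q_def)
      then have le: "- q p <= ap.late_absorb p" using h0[of p] by linarith
      then have "ap.late p \<noteq> 0" using True by (auto simp: ap.late_absorb_def)
      then have l: "fst p - t0 : {0<..<N - t0}" by (auto simp: ap.late_def indicator_def split: if_splits)
      then have "fst p - t0 : {0<..<sig}" using True tau by (auto simp: sig_def)
      then have "ap.late_absorb p = f (fst p - t0, snd p)" using l by (simp add: ap.late_absorb_def ap.late_def f_def)
      then show ?thesis using le True by simp
     next
      case False
      then have z0: "?i p * (indicator {..tau} (fst p) * max 0 (- q p)) = 0" by (auto simp: indicator_def max_def)
      show ?thesis unfolding z0 by (rule f0)
     qed
    qed
    also have "... = (LBINT p. f p)" by (rule lborel_time_shift(1)[OF fb])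
    also have "... = k - (LBINT x. w sig x)"
     using ap.total_absorption(2)[OF sg(1,2)] A(5) by (simp add: f_def case_prod_unfold)
    also have "... <= \<delta>"
    proof -
     have w0: "w 0 x = 0" if "2 * r <= norm (x - z)" for x using A(4)[of x] that r2(2) by simp
     \<comment> \<open>The mass kept near \<open>z\<close> already exceeds
       \<open>k - \<delta>\<close>, so the absorption over the whole space is at most
       \<open>\<delta>\<close>.\<close>
     have "k - \<delta> <= (LBINT x. w sig x * bump_at z 1 x)" by (rule keeps_massD[OF tr(4) A(3) t0(3) w0 A(5) sg])
     also have "... <= (LBINT x. w sig x)"
      by (rule integral_mono'[OF ap.w_integrable[OF sg(1,2)]])
       (use ap.nonneg[OF sg(1,2)] bump_at_bounds[of z 1] in "auto intro!: mult_left_le")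
     finally show ?thesis by linarith
    qed
    finally show ?thesis .
   qed
   have j1: "Leb1 (%p. ?i p * ((V p - ap.late_w p) * eta p))"
   proof -
    have "Leb1 (%p. (?i p * V p - ap.late_w p) * eta p)"
     by (rule integrable_bounded_mult[OF Bochner_Integration.integrable_diff[OF i(1) L(2)], where C = Me]) (use Me in auto)
    moreover have eq: "(?i p * V p - ap.late_w p) * eta p = ?i p * ((V p - ap.late_w p) * eta p)" for p
     using iW(1)[of p] by (cases "p : cylinder N") simp_all
    ultimately show ?thesis unfolding eq by simp
   qed
   have j2: "Leb1 (%p. ?i p * ((ap.late_w p - U p) * eta p))"
   proof -
    have "Leb1 (%p. (ap.late_w p - ?i p * U p) * eta p)"
     by (rule integrable_bounded_mult[OF Bochner_Integration.integrable_diff[OF L(2) iU], where C = Me]) (use Me in auto)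
    moreover have eq: "(ap.late_w p - ?i p * U p) * eta p = ?i p * ((ap.late_w p - U p) * eta p)" for p
     using iW(1)[of p] by (cases "p : cylinder N") simp_all
    ultimately show ?thesis unfolding eq by simp
   qed
   have "(LBINT p. indicator (window N) p * ((V p - U p) * eta p)) = (LBINT p. ?i p * ((V p - ap.late_w p) * eta p) + ?i p * ((ap.late_w p - U p) * eta p))"
    using window_subset_cylinder[OF N] eta(3) by (intro Bochner_Integration.integral_cong refl) (auto simp: indicator_def algebra_simps)
   also have "... = (LBINT p. ?i p * ((V p - ap.late_w p) * eta p)) + (LBINT p. ?i p * ((ap.late_w p - U p) * eta p))"
    by (rule Bochner_Integration.integral_add[OF j1 j2])
   finally have split: "(LBINT p. indicator (window N) p * ((V p - U p) * eta p))
    = (LBINT p. ?i p * ((V p - ap.late_w p) * eta p)) + (LBINT p. ?i p * ((ap.late_w p - U p) * eta p))" .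
   have "(LBINT p. ?i p * ((ap.late_w p - U p) * eta p)) <= (LBINT p. (th + 2 * th * N) * (?i p * eta p))"
   proof (rule Bochner_Integration.integral_mono[OF j2 integrable_mult_right[OF ieta]])
    fix p
    have c0: "0 <= th + 2 * th * N" using th N0 by simp
    show "?i p * ((ap.late_w p - U p) * eta p) <= (th + 2 * th * N) * (?i p * eta p)"
    proof (cases "p : window N")
     case True
     then have p: "p : cylinder N" using window_subset_cylinder[OF N] by blast
     have "ap.late_w p - U p <= th + 2 * th * N"
     proof (cases "fst p - t0 : {0<..<N - t0}")
      case l: True
      have "2 * th * (fst p - t0) <= 2 * th * N" using l A(1) th by (intro mult_left_mono) auto
      then show ?thesis using A(6)[of "fst p - t0" "snd p"] l A(1) Uu[OF True] by (simp add: ap.late_w_def ap.late_def)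
     next
      case False
      then have "ap.late_w p = 0" by (simp add: ap.late_w_def ap.late_def)
      moreover have "0 <= U p" using unn[of "fst p" "snd p"] p Uu[OF True] by (simp add: cylinder_iff)
      ultimately show ?thesis using c0 by linarith
     qed
     from mult_right_mono[OF this eta(2)[of p]] show ?thesis using p by simp
    qed (simp add: eta(3))
   qed
   also have "... = (th + 2 * th * N) * I" by (simp add: I_def)
   finally have "(LBINT p. ?i p * ((ap.late_w p - U p) * eta p)) <= (th + 2 * th * N) * I" .
   then show "(LBINT p. indicator (window N) p * ((V p - U p) * eta p)) <= 0 + a"
    unfolding split using main mult_left_mono[OF early X(1)] th2 da by linarith
  qed
 qed measurable
 then show ?thesis
 proof eventually_elim
  case (elim p)
  then show ?case using Uu[of p] by auto
 qed
qed

end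

theorem theoremC:
  fixes f :: "real \<Rightarrow> 'a::euclidean_space \<Rightarrow> real \<Rightarrow> real"
    and g :: "real \<Rightarrow> real"
    and u :: "real \<Rightarrow> 'a \<Rightarrow> real"
    and s \<beta> :: real
    and S :: "'a set" and \<nu> :: "'a measure" and z :: 'a
  assumes s: "0 < s" "s < 1"
    and \<beta>: "-1 < \<beta>"
    and f_caratheodory: "caratheodory f"
    and f_sign: "\<And>t x r. t > 0 \<Longrightarrow> f t x r * r \<ge> 0"
    and f_zero: "\<And>t x. t > 0 \<Longrightarrow> f t x 0 = 0"
    and f_bounds: "\<And>t x r. t > 0 \<Longrightarrow> r \<ge> 0 \<Longrightarrow> 0 \<le> f t x r \<and> f t x r \<le> t powr \<beta> * g r"
    and g_cont: "continuous_on {0..} g"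
    and g_mono: "mono_on {0..} g"
    and g_subcritical_nonpos: "\<beta> \<le> 0 \<Longrightarrow>
      set_integrable lebesgue {1..} (\<lambda>\<sigma>. g \<sigma> * \<sigma> powr (-1 - (1 + 2 * s * (1 + \<beta>) / real DIM('a))))"
    and g_subcritical_pos: "\<beta> > 0 \<Longrightarrow>
      set_integrable lebesgue {1..} (\<lambda>\<sigma>. g \<sigma> * \<sigma> powr (-2 - 2 * s / real DIM('a)))"
    and u_sol: "classical_solution s f u"
    and u_nonneg: "\<And>t x. t > 0 \<Longrightarrow> u t x \<ge> 0"
    and u_trace: "initial_trace f u S \<nu>"
    and z: "z \<in> S"
  shows "(\<forall>\<rho>>0. filterlim (\<lambda>t. LINT x:ball z \<rho>|lebesgue. u t x) at_top (at_right 0)) \<and>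
    (\<forall>v :: nat \<Rightarrow> real \<Rightarrow> 'a \<Rightarrow> real.
       (\<forall>k\<ge>1. weak_solution s \<beta> g (scale_measure (of_nat k) (return borel z)) (v k)) \<longrightarrow>
       (AE (t, x) in lebesgue_on half_space.
          convergent (\<lambda>k. v k t x) \<and> lim (\<lambda>k. v k t x) \<le> u t x))"
proof -
  have g0: "0 \<le> g r" if "0 \<le> r" for r using f_bounds[of 1 r 0] that by simp
  have zs: "z \<in> singular_set u" using u_trace z by (simp add: initial_trace_def)
  \<comment> \<open>Both cases of the integral condition are one condition with
    \<open>min \<beta> 0\<close> in the exponent.\<close>
  have g_int: "set_integrable lebesgue {1..} (\<lambda>\<sigma>. g \<sigma> * \<sigma> powr (- 2 - 2 * s * (1 + min \<beta> 0) / real DIM('a)))"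
  proof (cases "\<beta> \<le> 0")
    case True
    have "- 1 - (1 + 2 * s * (1 + \<beta>) / real DIM('a)) = - 2 - 2 * s * (1 + min \<beta> 0) / real DIM('a)" using True by simp
    then show ?thesis using g_subcritical_nonpos[OF True] by (simp only:)
  next
    case False
    have "- 2 - 2 * s / real DIM('a) = - 2 - 2 * s * (1 + min \<beta> 0) / real DIM('a)" using False by simp
    then show ?thesis using g_subcritical_pos False by (simp only: not_le)
  qed
  interpret singular_solution f g u s \<beta> z
    by unfold_locales (use s \<beta> f_bounds g_mono g0 g_int u_sol u_nonneg zs in auto)
  have lim: "AE (t, x) in lebesgue_on half_space. convergent (\<lambda>k. v k t x) \<and> lim (\<lambda>k. v k t x) \<le> u t x"
    if v: "\<forall>k\<ge>1. weak_solution s \<beta> g (scale_measure (of_nat k) (return borel z)) (v k)" for v :: "nat \<Rightarrow> real \<Rightarrow> 'a \<Rightarrow> real"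
  proof -
    have "\<exists>V. 1 \<le> k \<longrightarrow> tested_solution s \<beta> g (real k) z V \<and> (AE p in lborel. 0 < fst p \<longrightarrow> v k (fst p) (snd p) = V p)" for k
    proof (cases "1 \<le> k")
      case True
      then show ?thesis using weak_solution_tested[OF s g_cont, of \<beta> k z "v k"] v by blast
    qed simp
    then obtain V where V: "\<And>k. 1 \<le> k \<Longrightarrow> tested_solution s \<beta> g (real k) z (V k)"
      and vV: "\<And>k. 1 \<le> k \<Longrightarrow> AE p in lborel. 0 < fst p \<longrightarrow> v k (fst p) (snd p) = V k p" by metis
    have N: "1 < real n + 2" for n by simp
    \<comment> \<open>The exceptional sets depend on the index and on the window, but both are
      countable. Indices start at \<open>Suc j\<close>, since the hypothesis on \<open>v\<close>
      begins with \<open>k = 1\<close>; the limit does not see the shift.\<close>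
    have "AE p in lborel. \<forall>j n. p \<in> window (real n + 2) \<longrightarrow> V (Suc j) p \<le> V (Suc (Suc j)) p"
      unfolding AE_all_countable by (intro allI tested_solution_mono[OF s g(1) V V _ N]) auto
    moreover have "AE p in lborel. \<forall>j n. p \<in> window (real n + 2) \<longrightarrow> V (Suc j) p \<le> u (fst p) (snd p)"
      unfolding AE_all_countable by (intro allI tested_solution_le[OF V _ N]) auto
    moreover have "AE p in lborel. \<forall>j. 0 < fst p \<longrightarrow> v (Suc j) (fst p) (snd p) = V (Suc j) p"
      unfolding AE_all_countable by (intro allI vV) simp
    ultimately have "AE p in lborel. p \<in> half_space \<longrightarrow>
      convergent (\<lambda>k. v k (fst p) (snd p)) \<and> lim (\<lambda>k. v k (fst p) (snd p)) \<le> u (fst p) (snd p)"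
    proof eventually_elim
      case (elim p)
      show ?case
      proof
        assume "p \<in> half_space"
        then have p: "0 < fst p" by (auto simp: half_space_def)
        obtain n where n: "p \<in> window (real n + 2)" using window_cover[OF p] by blast
        let ?X = "\<lambda>j. v (Suc j) (fst p) (snd p)"
        have X: "?X j = V (Suc j) p" for j using elim(3) p by blast
        have up: "?X j \<le> u (fst p) (snd p)" for j using elim(2) n unfolding X by blast
        have "incseq ?X" unfolding X using elim(1) n by (intro incseq_SucI) blast
        then obtain L where L: "?X \<longlonglongrightarrow> L" using incseq_convergent[of ?X "u (fst p) (snd p)"] up by blast
        have "L \<le> u (fst p) (snd p)" by (rule LIMSEQ_le_const2[OF L]) (use up in blast)
        moreover have L': "(\<lambda>k. v k (fst p) (snd p)) \<longlonglongrightarrow> L" using L by (rule LIMSEQ_imp_Suc)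
        ultimately show "convergent (\<lambda>k. v k (fst p) (snd p)) \<and> lim (\<lambda>k. v k (fst p) (snd p)) \<le> u (fst p) (snd p)"
          using limI[OF L'] convergentI[OF L'] by simp
      qed
    qed
    then have "AE p in lebesgue. p \<in> half_space \<longrightarrow>
      convergent (\<lambda>k. v k (fst p) (snd p)) \<and> lim (\<lambda>k. v k (fst p) (snd p)) \<le> u (fst p) (snd p)" by (rule AE_completion)
    moreover have "(half_space :: (real \<times> 'a) set) \<in> sets borel" unfolding half_space_def by (intro borel_open open_Times) auto
    ultimately show ?thesis unfolding case_prod_unfold by (subst AE_restrict_space_iff) auto
  qed
  show ?thesis using local_mass_blow_up lim by blast
qed

end
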